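(* Let $K$ and $L$ be simplicial sets, $f:L\to K$ a map of simplicial sets, and $\mathcal{M}$ a model category. (1) The category $Fun^{b}(\mathbf{K},\mathcal{M})$ of bounded diagrams indexed by $K$ can be given a model category structure in which the weak equivalences (respectively fibrations) are the objectwise weak equivalences (respectively objectwise fibrations). With these model structures on $Fun^{b}(\mathbf{K},\mathcal{M})$ and $Fun^{b}(\mathbf{L},\mathcal{M})$: (2) The functor $colim_{\mathbf{K}}:Fun^{b}(\mathbf{K},\mathcal{M})\to\mathcal{M}$ is homotopy meaningful on cofibrant objects. Moreover it converts (acyclic) cofibrations in $Fun^{b}(\mathbf{K},\mathcal{M})$ into (acyclic) cofibrations in $\mathcal{M}$. In particular, if $F:\mathbf{K}\to\mathcal{M}$ is a cofibrant object in $Fun^{b}(\mathbf{K},\mathcal{M})$, then $colim_{\mathbf{K}}F$ is cofibrant in $\mathcal{M}$. (3) The left Kan extension functor $f^{k}:Fun^{b}(\mathbf{L},\mathcal{M})\to Fun^{b}(\mathbf{K},\mathcal{M})$ is homotopy meaningful on cofibrant objects. Moreover it converts (acyclic) cofibrations in $Fun^{b}(\mathbf{L},\mathcal{M})$ into (acyclic) cofibrations in $Fun^{b}(\mathbf{K},\mathcal{M})$. In particular, if $F:\mathbf{L}\to\mathcal{M}$ is a cofibrant object in $Fun^{b}(\mathbf{L},\mathcal{M})$, then $f^{k}F$ is cofibrant in $Fun^{b}(\mathbf{K},\mathcal{M})$.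
   Context: Model category: a category with weak equivalences, fibrations and cofibrations satisfying Quillen's axioms MC1--MC5, with all small limits and colimits (factorizations are not required to be functorial). "Acyclic" means in addition a weak equivalence. Simplex category: for a simplicial set $K$, $\mathbf{K}$ is the category whose objects are maps $\sigma:\Delta[n]\to K$ (simplices of $K$) and whose morphisms from $\sigma:\Delta[n]\to K$ to $\tau:\Delta[m]\to K$ are maps $\Delta[n]\to\Delta[m]$ over $K$. For $\sigma\in K_n$ the codegeneracy $\Delta[n+1]\to\Delta[n]$ gives a morphism $s_i:s_i\sigma\to\sigma$ in $\mathbf{K}$. A map $f:L\to K$ induces a functor $f:\mathbf{L}\to\mathbf{K}$. Bounded diagram: a functor $F:\mathbf{K}\to\mathcal{C}$ is bounded if $F(s_i):F(s_i\sigma)\to F(\sigma)$ is an isomorphism for every degeneracy morphism $s_i:s_i\sigma\to\sigma$. $Fun^{b}(\mathbf{K},\mathcal{C})$ is the full subcategory of $Fun(\mathbf{K},\mathcal{C})$ on bounded diagrams. $f^{k}:Fun(\mathbf{L},\mathcal{M})\to Fun(\mathbf{K},\mathcal{M})$ is the left Kan extension along $f:\mathbf{L}\to\mathbf{K}$ (left adjoint to precomposition with $f$); it carries bounded diagrams to bounded diagrams, and in (3) $f^k$ denotes the restriction to bounded diagrams. A functor from a model category to a category with weak equivalences is homotopy meaningful on cofibrant objects if it sends weak equivalences between cofibrant objects to weak equivalences. *)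

theory Defs
  imports Main "HOL-Library.FuncSet"
begin

section \<open>Categories\<close>

record ('o, 'a) cat =
  Obj :: "'o set"
  Arr :: "'a set"
  Dom :: "'a \<Rightarrow> 'o"
  Cod :: "'a \<Rightarrow> 'o"
  Ide :: "'o \<Rightarrow> 'a"
  Comp :: "'a \<Rightarrow> 'a \<Rightarrow> 'a" (infixl "\<cdot>\<index>" 70)

definition Hom :: "('o, 'a, 'z) cat_scheme \<Rightarrow> 'o \<Rightarrow> 'o \<Rightarrow> 'a set" where
  "Hom C x y = {f \<in> Arr C. Dom C f = x \<and> Cod C f = y}"

locale category =
  fixes C :: "('o, 'a, 'z) cat_scheme" (structure)
  assumes Dom_Obj: "f \<in> Arr C \<Longrightarrow> Dom C f \<in> Obj C"
    and Cod_Obj: "f \<in> Arr C \<Longrightarrow> Cod C f \<in> Obj C"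
    and Ide_Hom: "x \<in> Obj C \<Longrightarrow> Ide C x \<in> Hom C x x"
    and Comp_Hom: "f \<in> Hom C x y \<Longrightarrow> g \<in> Hom C y z \<Longrightarrow> g \<cdot> f \<in> Hom C x z"
    and Comp_Ide_right: "f \<in> Hom C x y \<Longrightarrow> f \<cdot> Ide C x = f"
    and Comp_Ide_left: "f \<in> Hom C x y \<Longrightarrow> Ide C y \<cdot> f = f"
    and Comp_assoc: "f \<in> Hom C w x \<Longrightarrow> g \<in> Hom C x y \<Longrightarrow> h \<in> Hom C y z \<Longrightarrow>
      h \<cdot> (g \<cdot> f) = (h \<cdot> g) \<cdot> f"

definition full_subcategory :: "('o, 'a) cat \<Rightarrow> ('o \<Rightarrow> bool) \<Rightarrow> ('o, 'a) cat" where
  "full_subcategory C P =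
     C\<lparr>Obj := {x \<in> Obj C. P x}, Arr := {f \<in> Arr C. P (Dom C f) \<and> P (Cod C f)}\<rparr>"

definition is_iso :: "('o, 'a, 'z) cat_scheme \<Rightarrow> 'a \<Rightarrow> bool" where
  "is_iso C f \<longleftrightarrow> f \<in> Arr C \<and>
     (\<exists>g \<in> Hom C (Cod C f) (Dom C f).
        g \<cdot>\<^bsub>C\<^esub> f = Ide C (Dom C f) \<and> f \<cdot>\<^bsub>C\<^esub> g = Ide C (Cod C f))"

definition initial_object :: "('o, 'a, 'z) cat_scheme \<Rightarrow> 'o \<Rightarrow> bool" where
  "initial_object C x \<longleftrightarrow> x \<in> Obj C \<and> (\<forall>y \<in> Obj C. \<exists>!f. f \<in> Hom C x y)"

record ('o, 'a, 'p, 'b) func =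
  on_obj :: "'o \<Rightarrow> 'p"
  on_arr :: "'a \<Rightarrow> 'b"

definition is_functor ::
  "('o, 'a, 'y) cat_scheme \<Rightarrow> ('p, 'b, 'z) cat_scheme \<Rightarrow> ('o, 'a, 'p, 'b) func \<Rightarrow> bool" where
  "is_functor A B F \<longleftrightarrow> category A \<and> category B \<and>
     (\<forall>x \<in> Obj A. on_obj F x \<in> Obj B) \<and>
     (\<forall>x \<in> Obj A. \<forall>y \<in> Obj A. \<forall>f \<in> Hom A x y. on_arr F f \<in> Hom B (on_obj F x) (on_obj F y)) \<and>
     (\<forall>x \<in> Obj A. on_arr F (Ide A x) = Ide B (on_obj F x)) \<and>
     (\<forall>f \<in> Arr A. \<forall>g \<in> Arr A. Dom A g = Cod A f \<longrightarrow>
        on_arr F (g \<cdot>\<^bsub>A\<^esub> f) = on_arr F g \<cdot>\<^bsub>B\<^esub> on_arr F f)"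

record ('f, 'o, 'b) nat_trans =
  Src :: 'f
  Tgt :: 'f
  component :: "'o \<Rightarrow> 'b"

definition is_natural ::
  "('o, 'a, 'y) cat_scheme \<Rightarrow> ('p, 'b, 'z) cat_scheme \<Rightarrow>
   ('o, 'a, 'p, 'b) func \<Rightarrow> ('o, 'a, 'p, 'b) func \<Rightarrow> ('o \<Rightarrow> 'b) \<Rightarrow> bool" where
  "is_natural A B F G t \<longleftrightarrow>
     (\<forall>x \<in> Obj A. t x \<in> Hom B (on_obj F x) (on_obj G x)) \<and>
     (\<forall>f \<in> Arr A. t (Cod A f) \<cdot>\<^bsub>B\<^esub> on_arr F f = on_arr G f \<cdot>\<^bsub>B\<^esub> t (Dom A f))"

text \<open>Functors and transformations that are objects or arrows of a functor category are required
  to be extensional, so that HOL equality is the mathematical equality.\<close>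

definition fun_cat ::
  "('o, 'a, 'y) cat_scheme \<Rightarrow> ('p, 'b, 'z) cat_scheme \<Rightarrow>
   (('o, 'a, 'p, 'b) func, (('o, 'a, 'p, 'b) func, 'o, 'b) nat_trans) cat" where
  "fun_cat A B = (let Fs = {F. is_functor A B F \<and> on_obj F \<in> extensional (Obj A)
                                 \<and> on_arr F \<in> extensional (Arr A)} in
     \<lparr>Obj = Fs,
      Arr = {t. Src t \<in> Fs \<and> Tgt t \<in> Fs \<and> is_natural A B (Src t) (Tgt t) (component t)
                \<and> component t \<in> extensional (Obj A)},
      Dom = Src,
      Cod = Tgt,
      Ide = (\<lambda>F. \<lparr>Src = F, Tgt = F, component = (\<lambda>x \<in> Obj A. Ide B (on_obj F x))\<rparr>),
      Comp = (\<lambda>t s. \<lparr>Src = Src s, Tgt = Tgt t,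
                component = (\<lambda>x \<in> Obj A. component t x \<cdot>\<^bsub>B\<^esub> component s x)\<rparr>)\<rparr>)"

definition precomposition ::
  "('o, 'a, 'z) cat_scheme \<Rightarrow> ('o, 'a, 'p, 'b) func \<Rightarrow>
   (('p, 'b, 'q, 'c) func, (('p, 'b, 'q, 'c) func, 'p, 'c) nat_trans,
    ('o, 'a, 'q, 'c) func, (('o, 'a, 'q, 'c) func, 'o, 'c) nat_trans) func" where
  "precomposition A P = (let pull = (\<lambda>F. \<lparr>on_obj = (\<lambda>x \<in> Obj A. on_obj F (on_obj P x)),
                                          on_arr = (\<lambda>f \<in> Arr A. on_arr F (on_arr P f))\<rparr>) in
     \<lparr>on_obj = pull,
      on_arr = (\<lambda>t. \<lparr>Src = pull (Src t), Tgt = pull (Tgt t),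
                      component = (\<lambda>x \<in> Obj A. component t (on_obj P x))\<rparr>)\<rparr>)"

text \<open>\<open>F : A \<rightarrow> B\<close> is left adjoint to \<open>R : B \<rightarrow> A\<close>: there is a natural unit with universal components.\<close>

definition is_left_adjoint ::
  "('o, 'a, 'y) cat_scheme \<Rightarrow> ('p, 'b, 'z) cat_scheme \<Rightarrow>
   ('o, 'a, 'p, 'b) func \<Rightarrow> ('p, 'b, 'o, 'a) func \<Rightarrow> bool" where
  "is_left_adjoint A B F R \<longleftrightarrow> is_functor A B F \<and> is_functor B A R \<and>
     (\<exists>\<eta>. (\<forall>x \<in> Obj A. \<eta> x \<in> Hom A x (on_obj R (on_obj F x))) \<and>
          (\<forall>f \<in> Arr A. \<eta> (Cod A f) \<cdot>\<^bsub>A\<^esub> f = on_arr R (on_arr F f) \<cdot>\<^bsub>A\<^esub> \<eta> (Dom A f)) \<and>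
          (\<forall>x \<in> Obj A. \<forall>y \<in> Obj B. \<forall>g \<in> Hom A x (on_obj R y).
             \<exists>!h. h \<in> Hom B (on_obj F x) y \<and> on_arr R h \<cdot>\<^bsub>A\<^esub> \<eta> x = g))"


section \<open>Limits and colimits\<close>

definition is_cocone ::
  "('j, 'k, 'y) cat_scheme \<Rightarrow> ('o, 'a, 'z) cat_scheme \<Rightarrow> ('j, 'k, 'o, 'a) func \<Rightarrow>
   'o \<Rightarrow> ('j \<Rightarrow> 'a) \<Rightarrow> bool" where
  "is_cocone J C F c \<iota> \<longleftrightarrow> c \<in> Obj C \<and> (\<forall>x \<in> Obj J. \<iota> x \<in> Hom C (on_obj F x) c) \<and>
     (\<forall>f \<in> Arr J. \<iota> (Cod J f) \<cdot>\<^bsub>C\<^esub> on_arr F f = \<iota> (Dom J f))"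

definition is_colimit ::
  "('j, 'k, 'y) cat_scheme \<Rightarrow> ('o, 'a, 'z) cat_scheme \<Rightarrow> ('j, 'k, 'o, 'a) func \<Rightarrow>
   'o \<Rightarrow> ('j \<Rightarrow> 'a) \<Rightarrow> bool" where
  "is_colimit J C F c \<iota> \<longleftrightarrow> is_cocone J C F c \<iota> \<and>
     (\<forall>d \<kappa>. is_cocone J C F d \<kappa> \<longrightarrow>
        (\<exists>!h. h \<in> Hom C c d \<and> (\<forall>x \<in> Obj J. h \<cdot>\<^bsub>C\<^esub> \<iota> x = \<kappa> x)))"

definition is_cone ::
  "('j, 'k, 'y) cat_scheme \<Rightarrow> ('o, 'a, 'z) cat_scheme \<Rightarrow> ('j, 'k, 'o, 'a) func \<Rightarrow>
   'o \<Rightarrow> ('j \<Rightarrow> 'a) \<Rightarrow> bool" where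
  "is_cone J C F c \<pi> \<longleftrightarrow> c \<in> Obj C \<and> (\<forall>x \<in> Obj J. \<pi> x \<in> Hom C c (on_obj F x)) \<and>
     (\<forall>f \<in> Arr J. on_arr F f \<cdot>\<^bsub>C\<^esub> \<pi> (Dom J f) = \<pi> (Cod J f))"

definition is_limit ::
  "('j, 'k, 'y) cat_scheme \<Rightarrow> ('o, 'a, 'z) cat_scheme \<Rightarrow> ('j, 'k, 'o, 'a) func \<Rightarrow>
   'o \<Rightarrow> ('j \<Rightarrow> 'a) \<Rightarrow> bool" where
  "is_limit J C F c \<pi> \<longleftrightarrow> is_cone J C F c \<pi> \<and>
     (\<forall>d \<kappa>. is_cone J C F d \<kappa> \<longrightarrow>
        (\<exists>!h. h \<in> Hom C d c \<and> (\<forall>x \<in> Obj J. \<pi> x \<cdot>\<^bsub>C\<^esub> h = \<kappa> x)))"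

text \<open>HOL has no set-theoretic universe, so smallness is relative to a type \<open>'u\<close> (later assumed
  infinite) that plays the role of the universe of small sets: a small index category is one whose
  objects and arrows are elements of \<open>'u\<close>, that is, up to isomorphism, one with at most as many
  arrows as \<open>'u\<close> has elements. The simplices of a simplicial set are elements of \<open>'u\<close> too.\<close>

definition has_small_limits :: "('o, 'a, 'z) cat_scheme \<Rightarrow> 'u itself \<Rightarrow> bool" where
  "has_small_limits C U \<longleftrightarrow>
     (\<forall>(J :: ('u, 'u) cat) F. is_functor J C F \<longrightarrow> (\<exists>c \<pi>. is_limit J C F c \<pi>))"

definition has_small_colimits :: "('o, 'a, 'z) cat_scheme \<Rightarrow> 'u itself \<Rightarrow> bool" where
  "has_small_colimits C U \<longleftrightarrow>
     (\<forall>(J :: ('u, 'u) cat) F. is_functor J C F \<longrightarrow> (\<exists>c \<iota>. is_colimit J C F c \<iota>))"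

text \<open>\<open>Q\<close> is a colimit functor on a full subcategory \<open>D\<close> of \<open>Fun(J, C)\<close>: it sends each diagram to
  the vertex of a colimiting cocone, and each transformation to the arrow it induces.\<close>

definition is_colimit_functor ::
  "('j, 'k, 'y) cat_scheme \<Rightarrow> ('o, 'a, 'z) cat_scheme \<Rightarrow>
   (('j, 'k, 'o, 'a) func, (('j, 'k, 'o, 'a) func, 'j, 'a) nat_trans) cat \<Rightarrow>
   (('j, 'k, 'o, 'a) func, (('j, 'k, 'o, 'a) func, 'j, 'a) nat_trans, 'o, 'a) func \<Rightarrow> bool" where
  "is_colimit_functor J C D Q \<longleftrightarrow> is_functor D C Q \<and>
     (\<exists>\<iota>. (\<forall>F \<in> Obj D. is_colimit J C F (on_obj Q F) (\<iota> F)) \<and>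
          (\<forall>t \<in> Arr D. \<forall>x \<in> Obj J.
             on_arr Q t \<cdot>\<^bsub>C\<^esub> \<iota> (Src t) x = \<iota> (Tgt t) x \<cdot>\<^bsub>C\<^esub> component t x))"


section \<open>Model categories\<close>

record ('o, 'a) model_cat = "('o, 'a) cat" +
  Weq :: "'a set"
  Fib :: "'a set"
  Cof :: "'a set"

definition is_retract :: "('o, 'a, 'z) cat_scheme \<Rightarrow> 'a \<Rightarrow> 'a \<Rightarrow> bool" where
  "is_retract C f g \<longleftrightarrow> f \<in> Arr C \<and> g \<in> Arr C \<and>
     (\<exists>i \<in> Hom C (Dom C f) (Dom C g). \<exists>r \<in> Hom C (Dom C g) (Dom C f).
      \<exists>j \<in> Hom C (Cod C f) (Cod C g). \<exists>s \<in> Hom C (Cod C g) (Cod C f).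
        r \<cdot>\<^bsub>C\<^esub> i = Ide C (Dom C f) \<and> s \<cdot>\<^bsub>C\<^esub> j = Ide C (Cod C f) \<and>
        g \<cdot>\<^bsub>C\<^esub> i = j \<cdot>\<^bsub>C\<^esub> f \<and> f \<cdot>\<^bsub>C\<^esub> r = s \<cdot>\<^bsub>C\<^esub> g)"

definition has_lifting :: "('o, 'a, 'z) cat_scheme \<Rightarrow> 'a \<Rightarrow> 'a \<Rightarrow> bool" where
  "has_lifting C i p \<longleftrightarrow>
     (\<forall>u \<in> Hom C (Dom C i) (Dom C p). \<forall>v \<in> Hom C (Cod C i) (Cod C p).
        p \<cdot>\<^bsub>C\<^esub> u = v \<cdot>\<^bsub>C\<^esub> i \<longrightarrow>
        (\<exists>h \<in> Hom C (Cod C i) (Dom C p). h \<cdot>\<^bsub>C\<^esub> i = u \<and> p \<cdot>\<^bsub>C\<^esub> h = v))"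

text \<open>That the three classes contain the identities and are closed under composition, which some
  authors list separately, follows from MC2--MC5 by the retract argument.\<close>

locale model_category = category M
  for M :: "('o, 'a, 'z) model_cat_scheme" (structure) +
  fixes U :: "'u itself"
  assumes Weq_Arr: "Weq M \<subseteq> Arr M"
    and Fib_Arr: "Fib M \<subseteq> Arr M"
    and Cof_Arr: "Cof M \<subseteq> Arr M"
    and MC1: "has_small_limits M U" "has_small_colimits M U"
    and MC2: "f \<in> Hom M x y \<Longrightarrow> g \<in> Hom M y z \<Longrightarrow>
        (f \<in> Weq M \<and> g \<in> Weq M \<longrightarrow> g \<cdot> f \<in> Weq M) \<and>
        (f \<in> Weq M \<and> g \<cdot> f \<in> Weq M \<longrightarrow> g \<in> Weq M) \<and>
        (g \<in> Weq M \<and> g \<cdot> f \<in> Weq M \<longrightarrow> f \<in> Weq M)"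
    and MC3: "is_retract M f g \<Longrightarrow>
        (g \<in> Weq M \<longrightarrow> f \<in> Weq M) \<and> (g \<in> Fib M \<longrightarrow> f \<in> Fib M) \<and> (g \<in> Cof M \<longrightarrow> f \<in> Cof M)"
    and MC4: "i \<in> Cof M \<Longrightarrow> p \<in> Fib M \<Longrightarrow> i \<in> Weq M \<or> p \<in> Weq M \<Longrightarrow> has_lifting M i p"
    and MC5_acyclic_fib: "f \<in> Hom M x y \<Longrightarrow>
        \<exists>z. \<exists>i \<in> Hom M x z. \<exists>p \<in> Hom M z y. i \<in> Cof M \<and> p \<in> Fib M \<inter> Weq M \<and> f = p \<cdot> i"
    and MC5_acyclic_cof: "f \<in> Hom M x y \<Longrightarrow>
        \<exists>z. \<exists>i \<in> Hom M x z. \<exists>p \<in> Hom M z y. i \<in> Cof M \<inter> Weq M \<and> p \<in> Fib M \<and> f = p \<cdot> i"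

definition cofibrant :: "('o, 'a, 'z) model_cat_scheme \<Rightarrow> 'o \<Rightarrow> bool" where
  "cofibrant M X \<longleftrightarrow> X \<in> Obj M \<and> (\<exists>I i. initial_object M I \<and> i \<in> Hom M I X \<and> i \<in> Cof M)"

definition homotopy_meaningful_on_cofibrant ::
  "('o, 'a, 'y) model_cat_scheme \<Rightarrow> ('p, 'b, 'z) model_cat_scheme \<Rightarrow>
   ('o, 'a, 'p, 'b) func \<Rightarrow> bool" where
  "homotopy_meaningful_on_cofibrant M N F \<longleftrightarrow>
     (\<forall>w \<in> Weq M. cofibrant M (Dom M w) \<and> cofibrant M (Cod M w) \<longrightarrow> on_arr F w \<in> Weq N)"

definition preserves_cofibrations ::
  "('o, 'a, 'y) model_cat_scheme \<Rightarrow> ('p, 'b, 'z) model_cat_scheme \<Rightarrow>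
   ('o, 'a, 'p, 'b) func \<Rightarrow> bool" where
  "preserves_cofibrations M N F \<longleftrightarrow> (\<forall>i \<in> Cof M. on_arr F i \<in> Cof N)"

definition preserves_acyclic_cofibrations ::
  "('o, 'a, 'y) model_cat_scheme \<Rightarrow> ('p, 'b, 'z) model_cat_scheme \<Rightarrow>
   ('o, 'a, 'p, 'b) func \<Rightarrow> bool" where
  "preserves_acyclic_cofibrations M N F \<longleftrightarrow>
     (\<forall>i \<in> Cof M \<inter> Weq M. on_arr F i \<in> Cof N \<inter> Weq N)"

definition preserves_cofibrant_objects ::
  "('o, 'a, 'y) model_cat_scheme \<Rightarrow> ('p, 'b, 'z) model_cat_scheme \<Rightarrow>
   ('o, 'a, 'p, 'b) func \<Rightarrow> bool" where
  "preserves_cofibrant_objects M N F \<longleftrightarrow> (\<forall>X. cofibrant M X \<longrightarrow> cofibrant N (on_obj F X))"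


section \<open>Simplicial sets\<close>

text \<open>An arrow \<open>(m, n, \<theta>)\<close> of the category \<open>\<Delta>\<close> is a weakly monotone map
  \<open>\<theta> : {0, \<dots>, m} \<rightarrow> {0, \<dots>, n}\<close>.\<close>

type_synonym ord_map = "nat \<times> nat \<times> (nat \<Rightarrow> nat)"

definition Delta :: "(nat, ord_map) cat" where
  "Delta =
     \<lparr>Obj = UNIV,
      Arr = {(m, n, \<theta>). \<theta> \<in> {..m} \<rightarrow>\<^sub>E {..n} \<and> mono_on {..m} \<theta>},
      Dom = (\<lambda>(m, n, \<theta>). m),
      Cod = (\<lambda>(m, n, \<theta>). n),
      Ide = (\<lambda>n. (n, n, \<lambda>j \<in> {..n}. j)),
      Comp = (\<lambda>(m', n', \<psi>) (m, n, \<theta>). (m, n', compose {..m} \<psi> \<theta>))\<rparr>"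

record 'u sset =
  Simp :: "nat \<Rightarrow> 'u set"
  act :: "ord_map \<Rightarrow> 'u \<Rightarrow> 'u"

locale simplicial_set =
  fixes K :: "'u sset"
  assumes act_closed: "\<alpha> \<in> Hom Delta m n \<Longrightarrow> x \<in> Simp K n \<Longrightarrow> act K \<alpha> x \<in> Simp K m"
    and act_Ide: "x \<in> Simp K n \<Longrightarrow> act K (Ide Delta n) x = x"
    and act_Comp: "\<alpha> \<in> Hom Delta m n \<Longrightarrow> \<beta> \<in> Hom Delta n p \<Longrightarrow> x \<in> Simp K p \<Longrightarrow>
      act K (\<beta> \<cdot>\<^bsub>Delta\<^esub> \<alpha>) x = act K \<alpha> (act K \<beta> x)"

definition simplicial_maps :: "'u sset \<Rightarrow> 'v sset \<Rightarrow> (nat \<Rightarrow> 'u \<Rightarrow> 'v) set" where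
  "simplicial_maps A B = {f. (\<forall>n. f n \<in> Simp A n \<rightarrow>\<^sub>E Simp B n) \<and>
     (\<forall>m n. \<forall>\<alpha> \<in> Hom Delta m n. \<forall>x \<in> Simp A n. f m (act A \<alpha> x) = act B \<alpha> (f n x))}"

definition sset_comp ::
  "'u sset \<Rightarrow> (nat \<Rightarrow> 'v \<Rightarrow> 'w) \<Rightarrow> (nat \<Rightarrow> 'u \<Rightarrow> 'v) \<Rightarrow> (nat \<Rightarrow> 'u \<Rightarrow> 'w)" where
  "sset_comp A g f = (\<lambda>n. compose (Simp A n) (g n) (f n))"

definition std_simplex :: "nat \<Rightarrow> ord_map sset" where
  "std_simplex n = \<lparr>Simp = (\<lambda>m. Hom Delta m n), act = (\<lambda>\<alpha> \<theta>. \<theta> \<cdot>\<^bsub>Delta\<^esub> \<alpha>)\<rparr>"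

text \<open>The map \<open>\<Delta>[m] \<rightarrow> \<Delta>[n]\<close> induced by \<open>\<alpha> : [m] \<rightarrow> [n]\<close>.\<close>

definition std_map :: "ord_map \<Rightarrow> nat \<Rightarrow> ord_map \<Rightarrow> ord_map" where
  "std_map \<alpha> = (\<lambda>p. \<lambda>\<theta> \<in> Hom Delta p (Dom Delta \<alpha>). \<alpha> \<cdot>\<^bsub>Delta\<^esub> \<theta>)"

text \<open>An object \<open>(n, \<sigma>)\<close> of the simplex category of \<open>K\<close> is a map \<open>\<sigma> : \<Delta>[n] \<rightarrow> K\<close>; an arrow
  \<open>(x, y, \<phi>)\<close> carries its source and target.\<close>

type_synonym 'u simplex = "nat \<times> (nat \<Rightarrow> ord_map \<Rightarrow> 'u)"
type_synonym 'u simplex_arr = "'u simplex \<times> 'u simplex \<times> (nat \<Rightarrow> ord_map \<Rightarrow> ord_map)"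

definition simplices :: "'u sset \<Rightarrow> 'u simplex set" where
  "simplices K = {(n, \<sigma>). \<sigma> \<in> simplicial_maps (std_simplex n) K}"

definition simplex_cat :: "'u sset \<Rightarrow> ('u simplex, 'u simplex_arr) cat" where
  "simplex_cat K =
     \<lparr>Obj = simplices K,
      Arr = {((n, \<sigma>), (m, \<tau>), \<phi>). (n, \<sigma>) \<in> simplices K \<and> (m, \<tau>) \<in> simplices K \<and>
               \<phi> \<in> simplicial_maps (std_simplex n) (std_simplex m) \<and>
               sset_comp (std_simplex n) \<tau> \<phi> = \<sigma>},
      Dom = (\<lambda>(x, y, \<phi>). x),
      Cod = (\<lambda>(x, y, \<phi>). y),
      Ide = (\<lambda>(n, \<sigma>). ((n, \<sigma>), (n, \<sigma>), std_map (Ide Delta n))),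
      Comp = (\<lambda>(y', z, \<psi>) (x, y, \<phi>). (x, z, sset_comp (std_simplex (fst x)) \<psi> \<phi>))\<rparr>"

definition simplex_functor ::
  "'u sset \<Rightarrow> (nat \<Rightarrow> 'u \<Rightarrow> 'v) \<Rightarrow>
   ('u simplex, 'u simplex_arr, 'v simplex, 'v simplex_arr) func" where
  "simplex_functor L f = (let push = (\<lambda>(n, \<sigma>). (n, sset_comp (std_simplex n) f \<sigma>)) in
     \<lparr>on_obj = push, on_arr = (\<lambda>(x, y, \<phi>). (push x, push y, \<phi>))\<rparr>)"

text \<open>The codegeneracy \<open>[n+1] \<rightarrow> [n]\<close> taking the value \<open>i\<close> twice, for \<open>i \<le> n\<close>, and the degeneracy
  morphism \<open>s\<^sub>i : s\<^sub>i \<sigma> \<rightarrow> \<sigma>\<close> it induces for \<open>\<sigma> : \<Delta>[n] \<rightarrow> K\<close>.\<close>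

definition codegeneracy :: "nat \<Rightarrow> nat \<Rightarrow> ord_map" where
  "codegeneracy n i = (n + 1, n, \<lambda>j \<in> {..n + 1}. if j \<le> i then j else j - 1)"

definition degeneracy_arr :: "'u simplex \<Rightarrow> nat \<Rightarrow> 'u simplex_arr" where
  "degeneracy_arr x i = (case x of (n, \<sigma>) \<Rightarrow>
     let s = std_map (codegeneracy n i)
     in ((n + 1, sset_comp (std_simplex (n + 1)) \<sigma> s), (n, \<sigma>), s))"


section \<open>Bounded diagrams\<close>

definition bounded ::
  "'u sset \<Rightarrow> ('o, 'a, 'z) cat_scheme \<Rightarrow>
   ('u simplex, 'u simplex_arr, 'o, 'a) func \<Rightarrow> bool" where
  "bounded K C F \<longleftrightarrow>
     (\<forall>(n, \<sigma>) \<in> simplices K. \<forall>i \<le> n. is_iso C (on_arr F (degeneracy_arr (n, \<sigma>) i)))"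

type_synonym ('u, 'o, 'a) diagram = "('u simplex, 'u simplex_arr, 'o, 'a) func"
type_synonym ('u, 'o, 'a) diagram_map = "(('u, 'o, 'a) diagram, 'u simplex, 'a) nat_trans"

definition bounded_cat ::
  "'u sset \<Rightarrow> ('o, 'a, 'z) cat_scheme \<Rightarrow>
   (('u, 'o, 'a) diagram, ('u, 'o, 'a) diagram_map) cat" where
  "bounded_cat K C = full_subcategory (fun_cat (simplex_cat K) C) (bounded K C)"

text \<open>The category of bounded diagrams with the objectwise weak equivalences and objectwise
  fibrations and with a given class \<open>Cs\<close> of cofibrations. In a model category the cofibrations
  are determined by the other two classes.\<close>

definition bounded_model ::
  "'u sset \<Rightarrow> ('o, 'a, 'z) model_cat_scheme \<Rightarrow> ('u, 'o, 'a) diagram_map set \<Rightarrow>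
   (('u, 'o, 'a) diagram, ('u, 'o, 'a) diagram_map) model_cat" where
  "bounded_model K M Cs = cat.extend (bounded_cat K M) (model_cat.fields
     {t \<in> Arr (bounded_cat K M). \<forall>x \<in> simplices K. component t x \<in> Weq M}
     {t \<in> Arr (bounded_cat K M). \<forall>x \<in> simplices K. component t x \<in> Fib M}
     Cs)"

text \<open>The left Kan extension functor \<open>f\<^sup>k\<close> along \<open>f : L \<rightarrow> K\<close>, on all diagrams.\<close>

definition is_left_Kan_extension_functor ::
  "'u sset \<Rightarrow> 'v sset \<Rightarrow> (nat \<Rightarrow> 'u \<Rightarrow> 'v) \<Rightarrow> ('o, 'a, 'z) cat_scheme \<Rightarrow>
   (('u, 'o, 'a) diagram, ('u, 'o, 'a) diagram_map,
    ('v, 'o, 'a) diagram, ('v, 'o, 'a) diagram_map) func \<Rightarrow> bool" where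
  "is_left_Kan_extension_functor L K f C E \<longleftrightarrow>
     is_left_adjoint (fun_cat (simplex_cat L) C) (fun_cat (simplex_cat K) C) E
       (precomposition (simplex_cat L) (simplex_functor L f))"

end

theory Submission
  imports Defs "HOL-Library.Countable"
begin

text \<open>A bounded diagram cannot distinguish two sections of the same degeneracy, because the
  degeneracy becomes invertible. This replaces the localization of the simplex category at the
  degeneracies: arrows are compared through their images under all bounded diagrams, a functor
  \<open>Z\<close> inverts the degeneracy \<open>s\<close> with section \<open>d\<close> as soon as \<open>Z (d s) = id\<close>, and colimits give
  such identities by uniqueness. An arrow out of a nondegenerate simplex is injective, so it raises
  the dimension unless it is an identity. Hence a map of bounded diagrams can be factored by
  attaching, dimension by dimension, the two halves of a factorization in \<open>M\<close> at the nondegenerate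
  simplices: attaching cells at \<open>x\<close> does not change the values at the other nondegenerate simplices
  of dimension at most that of \<open>x\<close>. Cofibrations are the maps with the left lifting property
  against the objectwise acyclic fibrations, and the retract argument yields the model axioms.

  Colimits and left Kan extensions are left adjoint to the constant diagram functor and to
  restriction along \<open>f\<close>, which visibly preserve objectwise (acyclic) fibrations, so the last two
  parts follow from Ken Brown's lemma. That \<open>f\<^sup>k F\<close> is bounded is a prism argument.\<close>

unbundle cardinal_syntax

text \<open>Factorizations in \<open>M\<close> are chosen and not functorial, so factoring every
  component of a map does not yield a diagram. A choice is therefore made at nondegenerate simplices
  only, and the rest of the diagram is generated from it: attaching the free bounded diagram on a
  cell at \<open>x\<close> means gluing one copy for every arrow from \<open>x\<close> to
  \<open>y\<close>, up to the identifications that boundedness forces. These may be tested on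
  bounded diagrams with values in \<open>M\<close> itself. They are strong enough to make the new
  diagram bounded, because no bounded diagram separates \<open>d s u\<close> from \<open>u\<close>,
  and weak enough that maps into bounded diagrams respect them. A lift is then chosen once for each
  nondegenerate simplex, at its identity cell, and spreads by naturality. For the second half of MC5
  the left factor must also be an objectwise weak equivalence. This is read off at each object from
  lifting properties in \<open>M\<close>, since these characterise acyclic cofibrations. A countable
  sequence of stages suffices: at a nondegenerate simplex it is constant up to isomorphism once its
  own dimension has been passed.\<close>

lemma in_Hom: "f \<in> Hom C x y \<longleftrightarrow> f \<in> Arr C \<and> Dom C f = x \<and> Cod C f = y"
  by (auto simp: Hom_def)

section \<open>Arrow calculus in a category\<close>

context category
begin

lemma Comp_simps [simp]:
  assumes "f \<in> Arr C" "g \<in> Arr C" "Dom C g = Cod C f"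
  shows "g \<cdot> f \<in> Arr C" "Dom C (g \<cdot> f) = Dom C f" "Cod C (g \<cdot> f) = Cod C g"
  using Comp_Hom[of f "Dom C f" "Cod C f" g "Cod C g"] assms by (auto simp: in_Hom)

lemma assoc:
  assumes "f \<in> Arr C" "g \<in> Arr C" "h \<in> Arr C" "Dom C g = Cod C f" "Dom C h = Cod C g"
  shows "(h \<cdot> g) \<cdot> f = h \<cdot> (g \<cdot> f)"
  using Comp_assoc[of f "Dom C f" "Cod C f" g "Cod C g" h "Cod C h"] assms by (auto simp: in_Hom)

lemma Ide_simps [simp]:
  assumes "x \<in> Obj C"
  shows "Ide C x \<in> Arr C" "Dom C (Ide C x) = x" "Cod C (Ide C x) = x"
  using Ide_Hom[OF assms] by (auto simp: in_Hom)

lemma Comp_Ide [simp]: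
  assumes "f \<in> Arr C"
  shows "Dom C f = x \<Longrightarrow> f \<cdot> Ide C x = f" "Cod C f = y \<Longrightarrow> Ide C y \<cdot> f = f"
  using Comp_Ide_right[of f "Dom C f" "Cod C f"] Comp_Ide_left[of f "Dom C f" "Cod C f"] assms
  by (auto simp: in_Hom)

lemma Dom_Cod_Obj [simp]: "f \<in> Arr C \<Longrightarrow> Dom C f \<in> Obj C" "f \<in> Arr C \<Longrightarrow> Cod C f \<in> Obj C"
  by (simp_all add: Dom_Obj Cod_Obj)

lemma Hom_Obj: "f \<in> Hom C x y \<Longrightarrow> x \<in> Obj C" "f \<in> Hom C x y \<Longrightarrow> y \<in> Obj C"
  by (auto simp: in_Hom)

lemma reassoc:
  assumes "g \<cdot> f = k" "x \<in> Arr C" "f \<in> Arr C" "g \<in> Arr C" "Dom C f = Cod C x" "Dom C g = Cod C f"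
  shows "g \<cdot> (f \<cdot> x) = k \<cdot> x"
  using assoc[of x f g] assms by simp

lemma Ide_eqI: "x \<in> Obj C \<Longrightarrow> Ide C x = Ide C y \<Longrightarrow> y \<in> Obj C \<Longrightarrow> x = y"
  by (metis Ide_simps(2))

lemma iso_cancel_right:
  assumes "is_iso C k" "f \<in> Arr C" "g \<in> Arr C" "Dom C f = Cod C k" "Dom C g = Cod C k"
    and eq: "f \<cdot> k = g \<cdot> k"
  shows "f = g"
proof -
  obtain l where l: "l \<in> Hom C (Cod C k) (Dom C k)" "k \<cdot> l = Ide C (Cod C k)" and k: "k \<in> Arr C"
    using assms(1) by (auto simp: is_iso_def)
  have "(f \<cdot> k) \<cdot> l = f" "(g \<cdot> k) \<cdot> l = g"
    using l k assms(2-5) by (simp_all add: in_Hom assoc)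
  then show ?thesis using eq by metis
qed

lemma iso_cancel_left:
  assumes "is_iso C k" "f \<in> Arr C" "g \<in> Arr C" "Cod C f = Dom C k" "Cod C g = Dom C k"
    and eq: "k \<cdot> f = k \<cdot> g"
  shows "f = g"
proof -
  obtain l where l: "l \<in> Hom C (Cod C k) (Dom C k)" "l \<cdot> k = Ide C (Dom C k)" and k: "k \<in> Arr C"
    using assms(1) by (auto simp: is_iso_def)
  have "l \<cdot> (k \<cdot> f) = f" "l \<cdot> (k \<cdot> g) = g"
    using l k assms(2-5) by (simp_all add: in_Hom assoc[symmetric])
  then show ?thesis using eq by metis
qed

end

lemma functor_D:
  assumes "is_functor A B F"
  shows "category A" "category B"
    "x \<in> Obj A \<Longrightarrow> on_obj F x \<in> Obj B"
    "f \<in> Arr A \<Longrightarrow> on_arr F f \<in> Arr B"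
    "f \<in> Arr A \<Longrightarrow> Dom B (on_arr F f) = on_obj F (Dom A f)"
    "f \<in> Arr A \<Longrightarrow> Cod B (on_arr F f) = on_obj F (Cod A f)"
    "x \<in> Obj A \<Longrightarrow> on_arr F (Ide A x) = Ide B (on_obj F x)"
    "f \<in> Arr A \<Longrightarrow> g \<in> Arr A \<Longrightarrow> Dom A g = Cod A f \<Longrightarrow>
        on_arr F (g \<cdot>\<^bsub>A\<^esub> f) = on_arr F g \<cdot>\<^bsub>B\<^esub> on_arr F f"
    "f \<in> Hom A x y \<Longrightarrow> on_arr F f \<in> Hom B (on_obj F x) (on_obj F y)"
proof -
  note F = assms[unfolded is_functor_def]
  show A: "category A" and "category B"
    using F by blast+
  show H: "on_arr F f \<in> Hom B (on_obj F x) (on_obj F y)" if "f \<in> Hom A x y" for f x y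
    using F that category.Hom_Obj[OF A that] by blast
  show "x \<in> Obj A \<Longrightarrow> on_obj F x \<in> Obj B" "x \<in> Obj A \<Longrightarrow> on_arr F (Ide A x) = Ide B (on_obj F x)"
    "f \<in> Arr A \<Longrightarrow> g \<in> Arr A \<Longrightarrow> Dom A g = Cod A f \<Longrightarrow>
        on_arr F (g \<cdot>\<^bsub>A\<^esub> f) = on_arr F g \<cdot>\<^bsub>B\<^esub> on_arr F f"
    using F by blast+
  show "f \<in> Arr A \<Longrightarrow> on_arr F f \<in> Arr B"
    "f \<in> Arr A \<Longrightarrow> Dom B (on_arr F f) = on_obj F (Dom A f)"
    "f \<in> Arr A \<Longrightarrow> Cod B (on_arr F f) = on_obj F (Cod A f)"
    using H[of f "Dom A f" "Cod A f"] by (auto simp: in_Hom)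
qed

lemma functorI:
  assumes "category A" "category B"
    "\<And>x. x \<in> Obj A \<Longrightarrow> on_obj F x \<in> Obj B"
    "\<And>f x y. f \<in> Hom A x y \<Longrightarrow> on_arr F f \<in> Hom B (on_obj F x) (on_obj F y)"
    "\<And>x. x \<in> Obj A \<Longrightarrow> on_arr F (Ide A x) = Ide B (on_obj F x)"
    "\<And>f g x y z. f \<in> Hom A x y \<Longrightarrow> g \<in> Hom A y z \<Longrightarrow>
        on_arr F (g \<cdot>\<^bsub>A\<^esub> f) = on_arr F g \<cdot>\<^bsub>B\<^esub> on_arr F f"
  shows "is_functor A B F"
  unfolding is_functor_def using assms by (auto simp: in_Hom)


section \<open>Colimits of presentations\<close>

text \<open>The relation \<open>(i, f, j, g)\<close> asks that the legs at \<open>i\<close> and \<open>j\<close> agree after composition with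
  \<open>f\<close> and \<open>g\<close> respectively.\<close>

definition presentation ::
  "('o, 'a, 'z) cat_scheme \<Rightarrow> 'i set \<Rightarrow> ('i \<Rightarrow> 'o) \<Rightarrow> ('i \<times> 'a \<times> 'i \<times> 'a) set \<Rightarrow> bool" where
  "presentation C I X R \<longleftrightarrow> (\<forall>i \<in> I. X i \<in> Obj C) \<and>
     (\<forall>(i, f, j, g) \<in> R. i \<in> I \<and> j \<in> I \<and> f \<in> Hom C (Dom C f) (X i) \<and> g \<in> Hom C (Dom C f) (X j))"

definition pcocone ::
  "('o, 'a, 'z) cat_scheme \<Rightarrow> 'i set \<Rightarrow> ('i \<Rightarrow> 'o) \<Rightarrow> ('i \<times> 'a \<times> 'i \<times> 'a) set \<Rightarrow>
   'o \<Rightarrow> ('i \<Rightarrow> 'a) \<Rightarrow> bool" where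
  "pcocone C I X R c \<kappa> \<longleftrightarrow> c \<in> Obj C \<and> (\<forall>i \<in> I. \<kappa> i \<in> Hom C (X i) c) \<and>
     (\<forall>(i, f, j, g) \<in> R. \<kappa> i \<cdot>\<^bsub>C\<^esub> f = \<kappa> j \<cdot>\<^bsub>C\<^esub> g)"

text \<open>This is the coequalizer of two maps between coproducts, without mention of the
  coproducts. Binary coproducts, sequential colimits, the gluing of cells and colimits over comma
  categories all arise below as generators and relations, so that one existence proof serves them
  all.\<close>

definition pcolimit ::
  "('o, 'a, 'z) cat_scheme \<Rightarrow> 'i set \<Rightarrow> ('i \<Rightarrow> 'o) \<Rightarrow> ('i \<times> 'a \<times> 'i \<times> 'a) set \<Rightarrow>
   'o \<Rightarrow> ('i \<Rightarrow> 'a) \<Rightarrow> bool" where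
  "pcolimit C I X R c \<kappa> \<longleftrightarrow> pcocone C I X R c \<kappa> \<and>
     (\<forall>d \<kappa>'. pcocone C I X R d \<kappa>' \<longrightarrow> (\<exists>!h. h \<in> Hom C c d \<and> (\<forall>i \<in> I. h \<cdot>\<^bsub>C\<^esub> \<kappa> i = \<kappa>' i)))"

lemma pcoconeI:
  assumes "c \<in> Obj C" "\<And>i. i \<in> I \<Longrightarrow> \<kappa> i \<in> Hom C (X i) c"
    "\<And>i f j g. (i, f, j, g) \<in> R \<Longrightarrow> \<kappa> i \<cdot>\<^bsub>C\<^esub> f = \<kappa> j \<cdot>\<^bsub>C\<^esub> g"
  shows "pcocone C I X R c \<kappa>"
  using assms unfolding pcocone_def by blast

lemma pcoconeD:
  assumes "pcocone C I X R c \<kappa>"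
  shows "c \<in> Obj C" "i \<in> I \<Longrightarrow> \<kappa> i \<in> Hom C (X i) c"
    "(i, f, j, g) \<in> R \<Longrightarrow> \<kappa> i \<cdot>\<^bsub>C\<^esub> f = \<kappa> j \<cdot>\<^bsub>C\<^esub> g"
  using assms unfolding pcocone_def by blast+

lemma pcolimitD:
  assumes "pcolimit C I X R c \<kappa>"
  shows "pcocone C I X R c \<kappa>" "c \<in> Obj C" "i \<in> I \<Longrightarrow> \<kappa> i \<in> Hom C (X i) c"
    "(i, f, j, g) \<in> R \<Longrightarrow> \<kappa> i \<cdot>\<^bsub>C\<^esub> f = \<kappa> j \<cdot>\<^bsub>C\<^esub> g"
  using assms pcoconeD unfolding pcolimit_def by fast+

lemma pcolimit_induced:
  assumes "pcolimit C I X R c \<kappa>" "pcocone C I X R d \<kappa>'"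
  shows "\<exists>h. h \<in> Hom C c d \<and> (\<forall>i \<in> I. h \<cdot>\<^bsub>C\<^esub> \<kappa> i = \<kappa>' i)"
  using assms unfolding pcolimit_def by (elim conjE allE impE) (assumption, erule ex1_implies_ex)

lemma (in category) pcocone_Comp:
  assumes "presentation C I X R" "pcocone C I X R c \<kappa>" "h \<in> Hom C c d"
  shows "pcocone C I X R d (\<lambda>i. h \<cdot> \<kappa> i)"
proof (rule pcoconeI)
  show "d \<in> Obj C" using assms(3) by (auto simp: in_Hom)
  show "h \<cdot> \<kappa> i \<in> Hom C (X i) d" if "i \<in> I" for i
    using pcoconeD(2)[OF assms(2) that] assms(3) by (simp add: in_Hom)
  fix i f j g assume r: "(i, f, j, g) \<in> R"
  then have *: "i \<in> I" "j \<in> I" "f \<in> Hom C (Dom C f) (X i)" "g \<in> Hom C (Dom C f) (X j)"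
    using assms(1) by (fastforce simp: presentation_def)+
  have "\<kappa> i \<cdot> f = \<kappa> j \<cdot> g" using pcoconeD(3)[OF assms(2) r] .
  then show "(h \<cdot> \<kappa> i) \<cdot> f = (h \<cdot> \<kappa> j) \<cdot> g"
    using *(3,4) pcoconeD(2)[OF assms(2) *(1)] pcoconeD(2)[OF assms(2) *(2)] assms(3)
    by (simp add: in_Hom assoc)
qed

text \<open>The uniqueness half of the universal property. Functoriality, naturality and boundedness
  of what is built from colimits are equations between maps out of a colimit, and are verified
  through it leg by leg.\<close>

lemma (in category) pcolimit_eqI:
  assumes "presentation C I X R" "pcolimit C I X R c \<kappa>" "g \<in> Hom C c d" "h \<in> Hom C c d"
    and "\<And>i. i \<in> I \<Longrightarrow> g \<cdot> \<kappa> i = h \<cdot> \<kappa> i"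
  shows "g = h"
  using assms(2-) pcocone_Comp[OF assms(1) pcolimitD(1)[OF assms(2)] assms(4)]
  unfolding pcolimit_def by blast

text \<open>Smallness is a bound on the set of arrows, whereas \<open>has_small_colimits\<close>
  speaks of index categories inside \<open>'u\<close>. An injection of the arrows into
  \<open>'u\<close> transports the index category there. Each object is represented by its identity
  arrow, so the bound on arrows covers the objects too.\<close>

lemma small_colimit:
  fixes J :: "('j, 'k, 'y) cat_scheme" and C :: "('o, 'a, 'z) cat_scheme"
  assumes D: "is_functor J C D" and C: "has_small_colimits C TYPE('u)"
    and small: "|Arr J| \<le>o |UNIV :: 'u set|"
  shows "\<exists>c \<iota>. is_colimit J C D c \<iota>"
proof -
  note F = functor_D[OF D]
  interpret J: category J by fact
  interpret C: category C by fact
  obtain e :: "'k \<Rightarrow> 'u" where e: "inj_on e (Arr J)"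
    using small card_of_ordLeq[of "Arr J" "UNIV :: 'u set"] by auto
  define e' where "e' = the_inv_into (Arr J) e"
  have e' [simp]: "e' (e f) = f" if "f \<in> Arr J" for f
    using the_inv_into_f_f[OF e that] by (simp add: e'_def)
  define J' :: "('u, 'u) cat" where
    "J' = \<lparr>Obj = (\<lambda>x. e (Ide J x)) ` Obj J, Arr = e ` Arr J,
           Dom = (\<lambda>a. e (Ide J (Dom J (e' a)))), Cod = (\<lambda>a. e (Ide J (Cod J (e' a)))),
           Ide = (\<lambda>a. a), Comp = (\<lambda>b a. e (e' b \<cdot>\<^bsub>J\<^esub> e' a))\<rparr>"
  define D' where
    "D' = \<lparr>on_obj = (\<lambda>a. on_obj D (Dom J (e' a))), on_arr = (\<lambda>a. on_arr D (e' a))\<rparr>"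
  have e_eq: "e f = e g \<longleftrightarrow> f = g" if "f \<in> Arr J" "g \<in> Arr J" for f g
    using e that by (auto dest: inj_onD)
  have ide_eq: "Ide J x = Ide J y \<longleftrightarrow> x = y" if "x \<in> Obj J" "y \<in> Obj J" for x y
    using J.Ide_eqI that by auto
  have catJ': "category J'"
    by unfold_locales (auto simp: J'_def in_Hom e_eq ide_eq J.assoc)
  have "is_functor J' C D'"
    by (rule functorI[OF catJ' F(2)]) (auto simp: J'_def D'_def in_Hom e_eq ide_eq F)
  then obtain c \<iota> where col: "is_colimit J' C D' c \<iota>"
    using C unfolding has_small_colimits_def by blast
  have cocone: "is_cocone J' C D' d \<kappa> \<longleftrightarrow> is_cocone J C D d (\<lambda>x. \<kappa> (e (Ide J x)))" for d \<kappa>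
    by (simp add: is_cocone_def J'_def D'_def)
  have "is_colimit J C D c (\<lambda>x. \<iota> (e (Ide J x)))"
    unfolding is_colimit_def
  proof (intro conjI allI impI)
    show "is_cocone J C D c (\<lambda>x. \<iota> (e (Ide J x)))"
      using col cocone by (auto simp: is_colimit_def)
    fix d \<kappa> assume \<kappa>: "is_cocone J C D d \<kappa>"
    define \<kappa>' where "\<kappa>' = (\<lambda>a. \<kappa> (Dom J (e' a)))"
    have "is_cocone J' C D' d \<kappa>'"
      unfolding cocone using \<kappa> by (simp add: is_cocone_def \<kappa>'_def)
    then have "\<exists>!h. h \<in> Hom C c d \<and> (\<forall>x \<in> Obj J'. h \<cdot>\<^bsub>C\<^esub> \<iota> x = \<kappa>' x)"
      using col by (auto simp: is_colimit_def)
    then show "\<exists>!h. h \<in> Hom C c d \<and> (\<forall>x \<in> Obj J. h \<cdot>\<^bsub>C\<^esub> \<iota> (e (Ide J x)) = \<kappa> x)"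
      by (simp add: \<kappa>'_def J'_def)
  qed
  then show ?thesis by blast
qed

section \<open>Cardinal bounds relative to the universe of small sets\<close>

lemma card_of_ordLeq_Times:
  assumes "infinite (UNIV :: 'u set)" "|A| \<le>o |UNIV :: 'u set|" "|B| \<le>o |UNIV :: 'u set|"
  shows "|A \<times> B| \<le>o |UNIV :: 'u set|"
  using card_of_Times_ordLeq_infinite_Field[of "|UNIV :: 'u set|" A B] assms
  by (simp add: Field_card_of card_of_Card_order card_of_card_order_on)

lemma card_of_ordLeq_Un:
  assumes "infinite (UNIV :: 'u set)" "|A| \<le>o |UNIV :: 'u set|" "|B| \<le>o |UNIV :: 'u set|"
  shows "|A \<union> B| \<le>o |UNIV :: 'u set|"
  using card_of_Un_ordLeq_infinite_Field[of "|UNIV :: 'u set|" A B] assms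
  by (simp add: Field_card_of card_of_Card_order card_of_card_order_on)

lemma card_of_ordLeq_image: "|A| \<le>o |UNIV :: 'u set| \<Longrightarrow> |f ` A| \<le>o |UNIV :: 'u set|"
  using card_of_image ordLeq_transitive by blast

lemma card_of_ordLeq_subset: "A \<subseteq> B \<Longrightarrow> |B| \<le>o |UNIV :: 'u set| \<Longrightarrow> |A| \<le>o |UNIV :: 'u set|"
  using card_of_mono1 ordLeq_transitive by blast

lemma card_of_ordLeq_countable:
  assumes "infinite (UNIV :: 'u set)"
  shows "|A :: 'b :: countable set| \<le>o |UNIV :: 'u set|"
proof -
  have "|A| \<le>o |UNIV :: nat set|"
    by (rule card_of_ordLeqI[of to_nat]) (auto intro: inj_on_subset[OF inj_to_nat])
  also have "|UNIV :: nat set| \<le>o |UNIV :: 'u set|"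
    using assms infinite_iff_card_of_nat by blast
  finally show ?thesis .
qed

text \<open>Generators and relations together become the objects of an index category, in which each
  relation has one arrow to each of the two generators it compares. Cocones over this diagram are
  the same as \<open>pcocone\<close>s, because the leg at a relation is forced by the leg at a
  generator.\<close>

lemma (in category) pcolimit_exists:
  fixes I :: "'i set"
  assumes P: "presentation C I X R"
    and C: "has_small_colimits C TYPE('u)" and inf: "infinite (UNIV :: 'u set)"
    and I: "|I| \<le>o |UNIV :: 'u set|" and R: "|R| \<le>o |UNIV :: 'u set|"
  obtains c \<kappa> where "pcolimit C I X R c \<kappa>"
proof -
  have PI: "X i \<in> Obj C" if "i \<in> I" for i using that P by (auto simp: presentation_def)
  have PR: "i \<in> I" "j \<in> I" "f \<in> Hom C (Dom C f) (X i)" "g \<in> Hom C (Dom C f) (X j)"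
    if "(i, f, j, g) \<in> R" for i f j g
    using that P by (fastforce simp: presentation_def)+
  \<comment> \<open>An arrow is its source with a label: 0 is the identity, while 1 and 2 lead from
    a relation to its two generators. Two non-identity arrows never compose, so a composite of
    \<open>b\<close> with \<open>a\<close> is \<open>a\<close> if \<open>b\<close> is an identity
    and \<open>b\<close> otherwise.\<close>
  define J :: "('i + 'i \<times> 'a \<times> 'i \<times> 'a, ('i + 'i \<times> 'a \<times> 'i \<times> 'a) \<times> nat) cat" where
    "J = \<lparr>Obj = Inl ` I \<union> Inr ` R, Arr = (Inl ` I \<union> Inr ` R) \<times> {0} \<union> Inr ` R \<times> {1, 2},
          Dom = fst,
          Cod = (\<lambda>(x, k). case x of Inl i \<Rightarrow> x | Inr (i, f, j, g) \<Rightarrow>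
                   if k = 0 then x else if k = 1 then Inl i else Inl j),
          Ide = (\<lambda>x. (x, 0)), Comp = (\<lambda>b a. if snd b = 0 then a else b)\<rparr>"
  define D :: "('i + 'i \<times> 'a \<times> 'i \<times> 'a, ('i + 'i \<times> 'a \<times> 'i \<times> 'a) \<times> nat, 'o, 'a) func" where
    "D = \<lparr>on_obj = (\<lambda>x. case x of Inl i \<Rightarrow> X i | Inr (i, f, j, g) \<Rightarrow> Dom C f),
          on_arr = (\<lambda>(x, k). case x of Inl i \<Rightarrow> Ide C (X i) | Inr (i, f, j, g) \<Rightarrow>
                      if k = 0 then Ide C (Dom C f) else if k = 1 then f else g)\<rparr>"
  have RD: "i \<in> I" "j \<in> I" "f \<in> Arr C" "g \<in> Arr C" "Cod C f = X i" "Cod C g = X j"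
    "Dom C g = Dom C f" "Dom C f \<in> Obj C"
    if "(i, f, j, g) \<in> R" for i f j g
    using PR[OF that] by (auto simp: in_Hom)
  have ObjJ: thesis if "x \<in> Obj J" "\<And>i. x = Inl i \<Longrightarrow> i \<in> I \<Longrightarrow> thesis"
    "\<And>i f j g. x = Inr (i, f, j, g) \<Longrightarrow> (i, f, j, g) \<in> R \<Longrightarrow> thesis" for x thesis
    using that by (auto simp: J_def)
  have ArrJ: thesis if "a \<in> Arr J" "\<And>i. a = (Inl i, 0) \<Longrightarrow> i \<in> I \<Longrightarrow> thesis"
    "\<And>i f j g. a = (Inr (i, f, j, g), 0) \<Longrightarrow> (i, f, j, g) \<in> R \<Longrightarrow> thesis"
    "\<And>i f j g. a = (Inr (i, f, j, g), 1) \<Longrightarrow> (i, f, j, g) \<in> R \<Longrightarrow> thesis"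
    "\<And>i f j g. a = (Inr (i, f, j, g), 2) \<Longrightarrow> (i, f, j, g) \<in> R \<Longrightarrow> thesis" for a thesis
    using that by (force simp: J_def)
  have catJ: "category J"
  proof
    fix a assume "a \<in> Arr J"
    then show "Dom J a \<in> Obj J"
      by (rule ArrJ) (simp_all add: J_def)
    show "Cod J a \<in> Obj J"
      using \<open>a \<in> Arr J\<close> by (rule ArrJ) (simp_all add: J_def RD(1,2))
  next
    fix x y z w a b c assume a: "a \<in> Hom J w x" and b: "b \<in> Hom J x y"
    from a have Aa: "a \<in> Arr J" and "w = Dom J a" "x = Cod J a" by (auto simp: in_Hom)
    moreover from b have Ab: "b \<in> Arr J" and "x = Dom J b" "y = Cod J b" by (auto simp: in_Hom)
    ultimately have eq: "w = Dom J a" "Cod J a = Dom J b" "y = Cod J b" by simp_all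
    show "b \<cdot>\<^bsub>J\<^esub> a \<in> Hom J w y"
      by (rule ArrJ[OF Aa]; rule ArrJ[OF Ab]; use eq in \<open>simp add: J_def in_Hom\<close>)
  qed (auto simp: J_def in_Hom split: sum.splits)
  have D: "is_functor J C D"
  proof (rule functorI[OF catJ category_axioms])
    fix x assume "x \<in> Obj J" then show "on_obj D x \<in> Obj C"
      by (rule ObjJ) (simp_all add: D_def PI RD(8))
  next
    fix a x y assume a: "a \<in> Hom J x y"
    then have "a \<in> Arr J" "x = Dom J a" "y = Cod J a" by (auto simp: in_Hom)
    then have Aa: "a \<in> Arr J" and eq: "x = Dom J a" "y = Cod J a" by simp_all
    show "on_arr D a \<in> Hom C (on_obj D x) (on_obj D y)"
      by (rule ArrJ[OF Aa]; simp add: eq J_def D_def in_Hom PI RD)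
  next
    fix x assume "x \<in> Obj J" then show "on_arr D (Ide J x) = Ide C (on_obj D x)"
      by (rule ObjJ) (simp_all add: D_def J_def)
  next
    fix a b x y z assume a: "a \<in> Hom J x y" and b: "b \<in> Hom J y z"
    from a b have Aa: "a \<in> Arr J" and Ab: "b \<in> Arr J" and eq: "Cod J a = Dom J b"
      by (auto simp: in_Hom)
    show "on_arr D (b \<cdot>\<^bsub>J\<^esub> a) = on_arr D b \<cdot> on_arr D a"
      by (rule ArrJ[OF Aa]; rule ArrJ[OF Ab]; use eq in \<open>simp add: J_def D_def PI RD\<close>)
  qed
  have "|Arr J| \<le>o |UNIV :: 'u set|"
    unfolding J_def cat.simps
    by (intro card_of_ordLeq_Un card_of_ordLeq_Times inf card_of_ordLeq_image I R
        card_of_ordLeq_countable[OF inf])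
  then obtain c \<iota> where col: "is_colimit J C D c \<iota>"
    using small_colimit[OF D C] by blast
  have cocone: "is_cocone J C D d \<kappa> \<longleftrightarrow> pcocone C I X R d (\<lambda>i. \<kappa> (Inl i)) \<and>
      (\<forall>(i, f, j, g) \<in> R. \<kappa> (Inr (i, f, j, g)) = \<kappa> (Inl i) \<cdot> f)" for d \<kappa>
  proof
    assume k: "is_cocone J C D d \<kappa>"
    then have k1: "\<kappa> x \<in> Hom C (on_obj D x) d" if "x \<in> Obj J" for x
      using that by (auto simp: is_cocone_def)
    have k2: "\<kappa> (Cod J a) \<cdot> on_arr D a = \<kappa> (Dom J a)" if "a \<in> Arr J" for a
      using k that by (auto simp: is_cocone_def)
    have r: "\<kappa> (Inr (i, f, j, g)) = \<kappa> (Inl i) \<cdot> f" "\<kappa> (Inr (i, f, j, g)) = \<kappa> (Inl j) \<cdot> g"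
      if "(i, f, j, g) \<in> R" for i f j g
      using k2[of "(Inr (i, f, j, g), 1)"] k2[of "(Inr (i, f, j, g), 2)"] that
      by (auto simp: J_def D_def)
    show "pcocone C I X R d (\<lambda>i. \<kappa> (Inl i)) \<and>
      (\<forall>(i, f, j, g) \<in> R. \<kappa> (Inr (i, f, j, g)) = \<kappa> (Inl i) \<cdot> f)"
    proof
      show "pcocone C I X R d (\<lambda>i. \<kappa> (Inl i))"
      proof (rule pcoconeI)
        show "d \<in> Obj C" using k by (auto simp: is_cocone_def)
        show "\<kappa> (Inl i) \<in> Hom C (X i) d" if "i \<in> I" for i
          using k1[of "Inl i"] that by (simp add: J_def D_def)
        show "\<kappa> (Inl i) \<cdot> f = \<kappa> (Inl j) \<cdot> g" if "(i, f, j, g) \<in> R" for i f j g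
          using r[OF that] by simp
      qed
      show "\<forall>(i, f, j, g) \<in> R. \<kappa> (Inr (i, f, j, g)) = \<kappa> (Inl i) \<cdot> f"
        using r(1) by blast
    qed
  next
    assume k: "pcocone C I X R d (\<lambda>i. \<kappa> (Inl i)) \<and>
      (\<forall>(i, f, j, g) \<in> R. \<kappa> (Inr (i, f, j, g)) = \<kappa> (Inl i) \<cdot> f)"
    have k1: "\<kappa> (Inl i) \<in> Arr C" "Dom C (\<kappa> (Inl i)) = X i" "Cod C (\<kappa> (Inl i)) = d"
      if "i \<in> I" for i
      using pcoconeD(2)[OF conjunct1[OF k] that] by (auto simp: in_Hom)
    have k2: "\<kappa> (Inr (i, f, j, g)) = \<kappa> (Inl i) \<cdot> f" "\<kappa> (Inl i) \<cdot> f = \<kappa> (Inl j) \<cdot> g"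
      if "(i, f, j, g) \<in> R" for i f j g
      using that conjunct2[OF k] pcoconeD(3)[OF conjunct1[OF k] that] by auto
    show "is_cocone J C D d \<kappa>"
      unfolding is_cocone_def
    proof (intro conjI ballI)
      show "d \<in> Obj C" using pcoconeD(1)[OF conjunct1[OF k]] by simp
      show "\<kappa> x \<in> Hom C (on_obj D x) d" if "x \<in> Obj J" for x
        using that by (rule ObjJ) (simp_all add: D_def in_Hom k1 k2(1) RD)
      show "\<kappa> (Cod J a) \<cdot> on_arr D a = \<kappa> (Dom J a)" if "a \<in> Arr J" for a
        using that
      proof (rule ArrJ)
        fix i f j g assume a: "a = (Inr (i, f, j, g), 2)" and r: "(i, f, j, g) \<in> R"
        then show ?thesis using k2[OF r] by (simp add: J_def D_def)
      qed (simp_all add: J_def D_def k1 k2(1) RD)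
    qed
  qed
  have "pcolimit C I X R c (\<lambda>i. \<iota> (Inl i))"
    unfolding pcolimit_def
  proof (intro conjI allI impI)
    show cc: "pcocone C I X R c (\<lambda>i. \<iota> (Inl i))"
      using col cocone by (auto simp: is_colimit_def)
    fix d \<kappa> assume \<kappa>: "pcocone C I X R d \<kappa>"
    define \<kappa>' :: "'i + 'i \<times> 'a \<times> 'i \<times> 'a \<Rightarrow> 'a"
      where "\<kappa>' = (\<lambda>x. case x of Inl i \<Rightarrow> \<kappa> i | Inr (i, f, j, g) \<Rightarrow> \<kappa> i \<cdot> f)"
    have "is_cocone J C D d \<kappa>'"
      unfolding cocone using \<kappa> by (auto simp: \<kappa>'_def)
    then have ex: "\<exists>!h. h \<in> Hom C c d \<and> (\<forall>x \<in> Obj J. h \<cdot> \<iota> x = \<kappa>' x)"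
      using col by (auto simp: is_colimit_def)
    have \<iota>: "\<iota> (Inr (i, f, j, g)) = \<iota> (Inl i) \<cdot> f" if "(i, f, j, g) \<in> R" for i f j g
      using col cocone that by (auto simp: is_colimit_def)
    \<comment> \<open>A map that is correct on the generators is correct on the relations, since the
      legs there factor through a generator. So both uniqueness statements range over the same
      \<open>h\<close>.\<close>
    have "(\<forall>x \<in> Obj J. h \<cdot> \<iota> x = \<kappa>' x) \<longleftrightarrow> (\<forall>i \<in> I. h \<cdot> \<iota> (Inl i) = \<kappa> i)"
      if h: "h \<in> Hom C c d" for h
    proof -
      have "h \<cdot> \<iota> (Inr (i, f, j, g)) = \<kappa> i \<cdot> f"
        if r: "(i, f, j, g) \<in> R" and hi: "h \<cdot> \<iota> (Inl i) = \<kappa> i" for i f j g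
      proof -
        have "\<iota> (Inl i) \<in> Hom C (X i) c" using pcoconeD(2)[OF cc] PR(1)[OF r] by auto
        then have "(h \<cdot> \<iota> (Inl i)) \<cdot> f = h \<cdot> (\<iota> (Inl i) \<cdot> f)"
          using h RD[OF r] by (intro assoc) (auto simp: in_Hom)
        then show ?thesis using \<iota>[OF r] hi by simp
      qed
      then show ?thesis
        by (auto simp: J_def \<kappa>'_def Ball_def PR(1))
    qed
    then show "\<exists>!h. h \<in> Hom C c d \<and> (\<forall>i\<in>I. h \<cdot> \<iota> (Inl i) = \<kappa> i)" using ex by metis
  qed
  then show ?thesis using that by blast
qed

text \<open>Colimits that depend on \<open>y\<close> form a functor as soon as generators move along
  \<phi>, values move along \<xi> and cocones pull back. The index set may vary with
  \<open>y\<close>. This covers pointwise colimits of diagrams, where it is fixed, the attaching of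
  cells, where it consists of arrows into \<open>y\<close>, and Kan extensions, where it is a comma
  category.\<close>

lemma pcolimit_functor:
  fixes A :: "('o, 'a, 'y) cat_scheme" and M :: "('p, 'b, 'z) cat_scheme"
    and I :: "'o \<Rightarrow> 'i set"
  assumes "category A" and "category M"
    and pres: "\<And>y. y \<in> Obj A \<Longrightarrow> presentation M (I y) (X y) (R y)"
    and col: "\<And>y. y \<in> Obj A \<Longrightarrow> \<exists>c \<kappa>. pcolimit M (I y) (X y) (R y) c \<kappa>"
    and \<phi>: "\<And>v x y i. v \<in> Hom A x y \<Longrightarrow> i \<in> I x \<Longrightarrow> \<phi> v i \<in> I y"
    and \<xi>: "\<And>v x y i. v \<in> Hom A x y \<Longrightarrow> i \<in> I x \<Longrightarrow> \<xi> v i \<in> Hom M (X x i) (X y (\<phi> v i))"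
    and pull: "\<And>v x y d \<kappa>. v \<in> Hom A x y \<Longrightarrow> pcocone M (I y) (X y) (R y) d \<kappa> \<Longrightarrow>
        pcocone M (I x) (X x) (R x) d (\<lambda>i. \<kappa> (\<phi> v i) \<cdot>\<^bsub>M\<^esub> \<xi> v i)"
    and \<phi>_Ide: "\<And>x i. x \<in> Obj A \<Longrightarrow> i \<in> I x \<Longrightarrow> \<phi> (Ide A x) i = i"
    and \<xi>_Ide: "\<And>x i. x \<in> Obj A \<Longrightarrow> i \<in> I x \<Longrightarrow> \<xi> (Ide A x) i = Ide M (X x i)"
    and \<phi>_Comp: "\<And>v w x y z i. v \<in> Hom A x y \<Longrightarrow> w \<in> Hom A y z \<Longrightarrow> i \<in> I x \<Longrightarrow>
        \<phi> (w \<cdot>\<^bsub>A\<^esub> v) i = \<phi> w (\<phi> v i)"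
    and \<xi>_Comp: "\<And>v w x y z i. v \<in> Hom A x y \<Longrightarrow> w \<in> Hom A y z \<Longrightarrow> i \<in> I x \<Longrightarrow>
        \<xi> (w \<cdot>\<^bsub>A\<^esub> v) i = \<xi> w (\<phi> v i) \<cdot>\<^bsub>M\<^esub> \<xi> v i"
  shows "\<exists>Z \<kappa>. is_functor A M Z \<and> on_obj Z \<in> extensional (Obj A) \<and> on_arr Z \<in> extensional (Arr A) \<and>
    (\<forall>y \<in> Obj A. pcolimit M (I y) (X y) (R y) (on_obj Z y) (\<kappa> y)) \<and>
    (\<forall>x y v i. v \<in> Hom A x y \<longrightarrow> i \<in> I x \<longrightarrow>
        on_arr Z v \<cdot>\<^bsub>M\<^esub> \<kappa> x i = \<kappa> y (\<phi> v i) \<cdot>\<^bsub>M\<^esub> \<xi> v i)"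
proof -
  interpret A: category A by fact
  interpret M: category M by fact
  obtain c \<kappa> where c: "\<And>y. y \<in> Obj A \<Longrightarrow> pcolimit M (I y) (X y) (R y) (c y) (\<kappa> y)"
    using col by metis
  have \<kappa>: "\<kappa> y i \<in> Hom M (X y i) (c y)" if "y \<in> Obj A" "i \<in> I y" for y i
    using pcolimitD(3)[OF c that(2)] that(1) by blast
  have "\<exists>h. h \<in> Hom M (c (Dom A v)) (c (Cod A v)) \<and>
      (\<forall>i \<in> I (Dom A v). h \<cdot>\<^bsub>M\<^esub> \<kappa> (Dom A v) i = \<kappa> (Cod A v) (\<phi> v i) \<cdot>\<^bsub>M\<^esub> \<xi> v i)"
    if v: "v \<in> Arr A" for v
  proof -
    have v': "v \<in> Hom A (Dom A v) (Cod A v)" using v by (simp add: in_Hom)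
    have "pcocone M (I (Dom A v)) (X (Dom A v)) (R (Dom A v)) (c (Cod A v))
        (\<lambda>i. \<kappa> (Cod A v) (\<phi> v i) \<cdot>\<^bsub>M\<^esub> \<xi> v i)"
      using pull[OF v' pcolimitD(1)[OF c[OF A.Dom_Cod_Obj(2)[OF v]]]] .
    then show ?thesis by (rule pcolimit_induced[OF c[OF A.Dom_Cod_Obj(1)[OF v]]])
  qed
  then obtain h where h: "\<And>v. v \<in> Arr A \<Longrightarrow> h v \<in> Hom M (c (Dom A v)) (c (Cod A v))"
    "\<And>v i. v \<in> Arr A \<Longrightarrow> i \<in> I (Dom A v) \<Longrightarrow>
      h v \<cdot>\<^bsub>M\<^esub> \<kappa> (Dom A v) i = \<kappa> (Cod A v) (\<phi> v i) \<cdot>\<^bsub>M\<^esub> \<xi> v i"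
    by metis
  define Z where "Z = \<lparr>on_obj = restrict c (Obj A), on_arr = restrict h (Arr A)\<rparr>"
  have hH: "h v \<in> Hom M (c x) (c y)" if "v \<in> Hom A x y" for v x y
    using h(1)[of v] that by (auto simp: in_Hom)
  have hk: "h v \<cdot>\<^bsub>M\<^esub> \<kappa> x i = \<kappa> y (\<phi> v i) \<cdot>\<^bsub>M\<^esub> \<xi> v i" if "v \<in> Hom A x y" "i \<in> I x" for v x y i
    using h(2)[of v] that by (auto simp: in_Hom)
  have F: "is_functor A M Z"
  proof (rule functorI)
    show "category A" "category M" by fact+
    show "on_obj Z x \<in> Obj M" if "x \<in> Obj A" for x
      using pcolimitD(2)[OF c[OF that]] that by (simp add: Z_def)
    show "on_arr Z v \<in> Hom M (on_obj Z x) (on_obj Z y)" if "v \<in> Hom A x y" for v x y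
      using hH[OF that] A.Hom_Obj[OF that] that by (simp add: Z_def in_Hom)
    show "on_arr Z (Ide A x) = Ide M (on_obj Z x)" if x: "x \<in> Obj A" for x
    proof -
      have c0: "c x \<in> Obj M" using pcolimitD(2)[OF c[OF x]] .
      have "h (Ide A x) = Ide M (c x)"
      proof (rule M.pcolimit_eqI[OF pres[OF x] c[OF x]])
        show "h (Ide A x) \<in> Hom M (c x) (c x)" using hH[OF A.Ide_Hom[OF x]] .
        show "Ide M (c x) \<in> Hom M (c x) (c x)" using c0 by (rule M.Ide_Hom)
        fix i assume i: "i \<in> I x"
        show "h (Ide A x) \<cdot>\<^bsub>M\<^esub> \<kappa> x i = Ide M (c x) \<cdot>\<^bsub>M\<^esub> \<kappa> x i"
          using hk[OF A.Ide_Hom[OF x] i] \<kappa>[OF x i] by (simp add: \<phi>_Ide \<xi>_Ide x i in_Hom)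
      qed
      then show ?thesis using x by (simp add: Z_def)
    qed
    show "on_arr Z (w \<cdot>\<^bsub>A\<^esub> v) = on_arr Z w \<cdot>\<^bsub>M\<^esub> on_arr Z v"
      if v: "v \<in> Hom A x y" and w: "w \<in> Hom A y z" for v w x y z
    proof -
      note O = A.Hom_Obj[OF v] A.Hom_Obj[OF w]
      note wv = A.Comp_Hom[OF v w]
      have "h (w \<cdot>\<^bsub>A\<^esub> v) = h w \<cdot>\<^bsub>M\<^esub> h v"
      proof (rule M.pcolimit_eqI[OF pres[OF O(1)] c[OF O(1)]])
        show "h (w \<cdot>\<^bsub>A\<^esub> v) \<in> Hom M (c x) (c z)" using hH[OF wv] .
        show "h w \<cdot>\<^bsub>M\<^esub> h v \<in> Hom M (c x) (c z)" using M.Comp_Hom[OF hH[OF v] hH[OF w]] .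
        fix i assume i: "i \<in> I x"
        note i' = \<phi>[OF v i] and i'' = \<phi>[OF w \<phi>[OF v i]]
        have "(h w \<cdot>\<^bsub>M\<^esub> h v) \<cdot>\<^bsub>M\<^esub> \<kappa> x i = h w \<cdot>\<^bsub>M\<^esub> (\<kappa> y (\<phi> v i) \<cdot>\<^bsub>M\<^esub> \<xi> v i)"
          using hk[OF v i] M.Comp_assoc[OF \<kappa>[OF O(1) i] hH[OF v] hH[OF w]] by simp
        also have "\<dots> = (h w \<cdot>\<^bsub>M\<^esub> \<kappa> y (\<phi> v i)) \<cdot>\<^bsub>M\<^esub> \<xi> v i"
          by (rule M.Comp_assoc[OF \<xi>[OF v i] \<kappa>[OF O(2) i'] hH[OF w]])
        also have "\<dots> = (\<kappa> z (\<phi> w (\<phi> v i)) \<cdot>\<^bsub>M\<^esub> \<xi> w (\<phi> v i)) \<cdot>\<^bsub>M\<^esub> \<xi> v i"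
          using hk[OF w i'] by simp
        also have "\<dots> = \<kappa> z (\<phi> w (\<phi> v i)) \<cdot>\<^bsub>M\<^esub> (\<xi> w (\<phi> v i) \<cdot>\<^bsub>M\<^esub> \<xi> v i)"
          by (rule M.Comp_assoc[OF \<xi>[OF v i] \<xi>[OF w i'] \<kappa>[OF O(4) i''], symmetric])
        also have "\<dots> = h (w \<cdot>\<^bsub>A\<^esub> v) \<cdot>\<^bsub>M\<^esub> \<kappa> x i"
          using hk[OF wv i] \<phi>_Comp[OF v w i] \<xi>_Comp[OF v w i] by simp
        finally show "h (w \<cdot>\<^bsub>A\<^esub> v) \<cdot>\<^bsub>M\<^esub> \<kappa> x i = (h w \<cdot>\<^bsub>M\<^esub> h v) \<cdot>\<^bsub>M\<^esub> \<kappa> x i" by simp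
      qed
      then show ?thesis using v w wv by (simp add: Z_def in_Hom)
    qed
  qed
  have "pcolimit M (I y) (X y) (R y) (on_obj Z y) (\<kappa> y)" if "y \<in> Obj A" for y
    using c[OF that] that by (simp add: Z_def)
  moreover have "on_arr Z v \<cdot>\<^bsub>M\<^esub> \<kappa> x i = \<kappa> y (\<phi> v i) \<cdot>\<^bsub>M\<^esub> \<xi> v i" if "v \<in> Hom A x y" "i \<in> I x" for v x y i
    using hk[OF that] that by (simp add: Z_def in_Hom)
  moreover have "on_obj Z \<in> extensional (Obj A)" "on_arr Z \<in> extensional (Arr A)"
    by (simp_all add: Z_def)
  ultimately show ?thesis using F by blast
qed


section \<open>Diagrams inverting a class of split epimorphisms\<close>

lemma Obj_fun_cat: "F \<in> Obj (fun_cat A M) \<longleftrightarrow>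
    is_functor A M F \<and> on_obj F \<in> extensional (Obj A) \<and> on_arr F \<in> extensional (Arr A)"
  by (simp add: fun_cat_def)

lemma Arr_fun_cat: "t \<in> Arr (fun_cat A M) \<longleftrightarrow> Src t \<in> Obj (fun_cat A M) \<and> Tgt t \<in> Obj (fun_cat A M) \<and>
    is_natural A M (Src t) (Tgt t) (component t) \<and> component t \<in> extensional (Obj A)"
  by (simp add: fun_cat_def)

lemma fun_cat_simps:
  "Dom (fun_cat A M) = Src" "Cod (fun_cat A M) = Tgt"
  "Ide (fun_cat A M) F = \<lparr>Src = F, Tgt = F, component = (\<lambda>x \<in> Obj A. Ide M (on_obj F x))\<rparr>"
  "t \<cdot>\<^bsub>fun_cat A M\<^esub> s = \<lparr>Src = Src s, Tgt = Tgt t,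
                component = (\<lambda>x \<in> Obj A. component t x \<cdot>\<^bsub>M\<^esub> component s x)\<rparr>"
  by (simp_all add: fun_cat_def)

text \<open>Restriction to the objects makes the components extensional, as the arrows of
  \<open>fun_cat\<close> have to be, so an arbitrary family of components may be passed in.\<close>

definition mk_nat ::
  "('o, 'a, 'y) cat_scheme \<Rightarrow> ('o, 'a, 'p, 'b) func \<Rightarrow> ('o, 'a, 'p, 'b) func \<Rightarrow> ('o \<Rightarrow> 'b) \<Rightarrow>
   (('o, 'a, 'p, 'b) func, 'o, 'b) nat_trans" where
  "mk_nat A F G t = \<lparr>Src = F, Tgt = G, component = restrict t (Obj A)\<rparr>"

lemma mk_nat_simps [simp]:
  "Src (mk_nat A F G t) = F" "Tgt (mk_nat A F G t) = G"
  "x \<in> Obj A \<Longrightarrow> component (mk_nat A F G t) x = t x"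
  by (simp_all add: mk_nat_def)

lemma Hom_fun_catD:
  assumes "t \<in> Hom (fun_cat A M) F G"
  shows "Src t = F" "Tgt t = G" "F \<in> Obj (fun_cat A M)" "G \<in> Obj (fun_cat A M)"
    "x \<in> Obj A \<Longrightarrow> component t x \<in> Hom M (on_obj F x) (on_obj G x)"
    "v \<in> Hom A x y \<Longrightarrow> component t y \<cdot>\<^bsub>M\<^esub> on_arr F v = on_arr G v \<cdot>\<^bsub>M\<^esub> component t x"
  using assms unfolding in_Hom Arr_fun_cat fun_cat_simps is_natural_def by auto

lemma Hom_fun_catI:
  assumes "F \<in> Obj (fun_cat A M)" "G \<in> Obj (fun_cat A M)"
    "\<And>x. x \<in> Obj A \<Longrightarrow> t x \<in> Hom M (on_obj F x) (on_obj G x)"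
    "\<And>v x y. v \<in> Hom A x y \<Longrightarrow> t y \<cdot>\<^bsub>M\<^esub> on_arr F v = on_arr G v \<cdot>\<^bsub>M\<^esub> t x"
  shows "mk_nat A F G t \<in> Hom (fun_cat A M) F G"
proof -
  have "category A" using assms(1) by (simp add: Obj_fun_cat is_functor_def)
  then show ?thesis using assms(1-3) assms(4)[of v "Dom A v" "Cod A v" for v]
    by (simp add: in_Hom Arr_fun_cat fun_cat_simps is_natural_def mk_nat_def category.Dom_Cod_Obj)
qed

lemma fun_cat_eqI:
  assumes "t \<in> Hom (fun_cat A M) F G" "t' \<in> Hom (fun_cat A M) F G"
    "\<And>x. x \<in> Obj A \<Longrightarrow> component t x = component t' x"
  shows "t = t'"
proof (rule nat_trans.equality)
  show "component t = component t'"
    using assms by (intro extensionalityI[of _ "Obj A"]) (auto simp: in_Hom Arr_fun_cat)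
qed (use Hom_fun_catD(1,2)[OF assms(1)] Hom_fun_catD(1,2)[OF assms(2)] in simp_all)

lemma category_fun_cat:
  assumes "category A" "category M" shows "category (fun_cat A M)"
proof -
  interpret M: category M by fact
  let ?C = "fun_cat A M"
  have obj: "is_functor A M F" if "F \<in> Obj ?C" for F using that by (simp add: Obj_fun_cat)
  show ?thesis
  proof
    show "Dom ?C t \<in> Obj ?C" "Cod ?C t \<in> Obj ?C" if "t \<in> Arr ?C" for t
      using that by (auto simp: Arr_fun_cat fun_cat_simps)
    show ide: "Ide ?C F \<in> Hom ?C F F" if F: "F \<in> Obj ?C" for F
    proof -
      note FD = functor_D[OF obj[OF F]]
      have "mk_nat A F F (\<lambda>x. Ide M (on_obj F x)) \<in> Hom ?C F F"
        by (rule Hom_fun_catI[OF F F]) (auto simp: FD in_Hom)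
      then show ?thesis by (simp add: fun_cat_simps mk_nat_def)
    qed
    show cmp: "t \<cdot>\<^bsub>?C\<^esub> s \<in> Hom ?C F H" if s: "s \<in> Hom ?C F G" and t: "t \<in> Hom ?C G H" for s t F G H
    proof -
      note sD = Hom_fun_catD[OF s] and tD = Hom_fun_catD[OF t]
      note FD = functor_D[OF obj[OF sD(3)]] and GD = functor_D[OF obj[OF sD(4)]]
        and HD = functor_D[OF obj[OF tD(4)]]
      have "mk_nat A F H (\<lambda>x. component t x \<cdot>\<^bsub>M\<^esub> component s x) \<in> Hom ?C F H"
      proof (rule Hom_fun_catI[OF sD(3) tD(4)])
        show "component t x \<cdot>\<^bsub>M\<^esub> component s x \<in> Hom M (on_obj F x) (on_obj H x)" if "x \<in> Obj A" for x
          using M.Comp_Hom[OF sD(5)[OF that] tD(5)[OF that]] .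
        show "(component t y \<cdot>\<^bsub>M\<^esub> component s y) \<cdot>\<^bsub>M\<^esub> on_arr F v =
            on_arr H v \<cdot>\<^bsub>M\<^esub> (component t x \<cdot>\<^bsub>M\<^esub> component s x)" if v: "v \<in> Hom A x y" for v x y
        proof -
          note xy = category.Hom_Obj[OF assms(1) v]
          have "(component t y \<cdot>\<^bsub>M\<^esub> component s y) \<cdot>\<^bsub>M\<^esub> on_arr F v
            = component t y \<cdot>\<^bsub>M\<^esub> (component s y \<cdot>\<^bsub>M\<^esub> on_arr F v)"
            by (rule M.Comp_assoc[OF FD(9)[OF v] sD(5)[OF xy(2)] tD(5)[OF xy(2)], symmetric])
          also have "\<dots> = (component t y \<cdot>\<^bsub>M\<^esub> on_arr G v) \<cdot>\<^bsub>M\<^esub> component s x"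
            unfolding sD(6)[OF v]
            by (rule M.Comp_assoc[OF sD(5)[OF xy(1)] GD(9)[OF v] tD(5)[OF xy(2)]])
          also have "\<dots> = on_arr H v \<cdot>\<^bsub>M\<^esub> (component t x \<cdot>\<^bsub>M\<^esub> component s x)"
            unfolding tD(6)[OF v]
            by (rule M.Comp_assoc[OF sD(5)[OF xy(1)] tD(5)[OF xy(1)] HD(9)[OF v], symmetric])
          finally show ?thesis .
        qed
      qed
      then show ?thesis using sD(1) tD(2) by (simp add: fun_cat_simps mk_nat_def)
    qed
    show "t \<cdot>\<^bsub>?C\<^esub> Ide ?C F = t" if t: "t \<in> Hom ?C F G" for t F G
      by (rule fun_cat_eqI[OF cmp[OF ide[OF Hom_fun_catD(3)[OF t]] t] t])
        (use Hom_fun_catD(5)[OF t] in \<open>simp add: fun_cat_simps in_Hom\<close>)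
    show "Ide ?C G \<cdot>\<^bsub>?C\<^esub> t = t" if t: "t \<in> Hom ?C F G" for t F G
      by (rule fun_cat_eqI[OF cmp[OF t ide[OF Hom_fun_catD(4)[OF t]]] t])
        (use Hom_fun_catD(5)[OF t] in \<open>simp add: fun_cat_simps in_Hom\<close>)
    show "u \<cdot>\<^bsub>?C\<^esub> (t \<cdot>\<^bsub>?C\<^esub> s) = (u \<cdot>\<^bsub>?C\<^esub> t) \<cdot>\<^bsub>?C\<^esub> s"
      if s: "s \<in> Hom ?C F G" and t: "t \<in> Hom ?C G H" and u: "u \<in> Hom ?C H K" for s t u F G H K
      by (rule fun_cat_eqI[OF cmp[OF cmp[OF s t] u] cmp[OF s cmp[OF t u]]])
        (simp add: fun_cat_simps
          M.Comp_assoc[OF Hom_fun_catD(5)[OF s] Hom_fun_catD(5)[OF t] Hom_fun_catD(5)[OF u]])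
  qed
qed

lemma full_subcategory_simps [simp]:
  "Obj (full_subcategory C P) = {x \<in> Obj C. P x}"
  "Arr (full_subcategory C P) = {f \<in> Arr C. P (Dom C f) \<and> P (Cod C f)}"
  "Dom (full_subcategory C P) = Dom C" "Cod (full_subcategory C P) = Cod C"
  "Ide (full_subcategory C P) = Ide C" "g \<cdot>\<^bsub>full_subcategory C P\<^esub> f = g \<cdot>\<^bsub>C\<^esub> f"
  by (simp_all add: full_subcategory_def)

lemma Hom_full_subcategory [simp]:
  "P x \<Longrightarrow> P y \<Longrightarrow> Hom (full_subcategory C P) x y = Hom C x y"
  by (auto simp: Hom_def)

lemma in_Hom_full_subcategory:
  "f \<in> Hom (full_subcategory C P) x y \<longleftrightarrow> f \<in> Hom C x y \<and> P x \<and> P y"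
  by (auto simp: Hom_def)

lemma category_full_subcategory:
  assumes "category C" shows "category (full_subcategory C P)"
proof -
  interpret category C by fact
  show ?thesis by unfold_locales (auto simp: in_Hom assoc)
qed

text \<open>Bounded diagrams are the case of a simplex category with its degeneracies as
  \<open>S\<close>. Working with a general pair keeps the combinatorics of simplices apart from the
  homotopy theory.\<close>

definition inv_cat ::
  "('o, 'a, 'y) cat_scheme \<Rightarrow> 'a set \<Rightarrow> ('p, 'b, 'z) cat_scheme \<Rightarrow>
   (('o, 'a, 'p, 'b) func, (('o, 'a, 'p, 'b) func, 'o, 'b) nat_trans) cat" where
  "inv_cat A S M = full_subcategory (fun_cat A M) (\<lambda>F. \<forall>s \<in> S. is_iso M (on_arr F s))"

text \<open>The section \<open>d\<close> of an arrow \<open>s\<close> plays the role of a coface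
  undoing a codegeneracy. It stands in for a formal inverse: inverting \<open>s\<close> will mean
  that \<open>d s\<close> acts as the identity.\<close>

locale inverting = A: category A + M: category M
  for A :: "('o, 'a, 'y) cat_scheme" and M :: "('p, 'b, 'z) cat_scheme" +
  fixes S :: "'a set"
  assumes S_Arr: "S \<subseteq> Arr A"
    and S_split: "s \<in> S \<Longrightarrow> \<exists>d \<in> Hom A (Cod A s) (Dom A s). s \<cdot>\<^bsub>A\<^esub> d = Ide A (Cod A s)"
begin

abbreviation B where "B \<equiv> inv_cat A S M"

lemma Obj_B: "F \<in> Obj B \<longleftrightarrow> F \<in> Obj (fun_cat A M) \<and> (\<forall>s \<in> S. is_iso M (on_arr F s))"
  by (simp add: inv_cat_def)

lemma in_Hom_B: "t \<in> Hom B F G \<longleftrightarrow> t \<in> Hom (fun_cat A M) F G \<and> F \<in> Obj B \<and> G \<in> Obj B"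
  using Hom_fun_catD(3,4)[of t A M F G] by (auto simp: inv_cat_def in_Hom_full_subcategory)

lemma category_B: "category B"
  unfolding inv_cat_def
  by (intro category_full_subcategory category_fun_cat A.category_axioms M.category_axioms)

lemma B_simps:
  "Dom B = Src" "Cod B = Tgt" "x \<in> Obj A \<Longrightarrow> component (Ide B F) x = Ide M (on_obj F x)"
  "x \<in> Obj A \<Longrightarrow> component (t \<cdot>\<^bsub>B\<^esub> s) x = component t x \<cdot>\<^bsub>M\<^esub> component s x"
  by (simp_all add: inv_cat_def fun_cat_simps)

lemma B_functor: "F \<in> Obj B \<Longrightarrow> is_functor A M F"
  by (simp add: Obj_B Obj_fun_cat)

lemmas BD = functor_D[OF B_functor]

lemma Hom_BD:
  assumes "t \<in> Hom B F G"
  shows "Src t = F" "Tgt t = G" "F \<in> Obj B" "G \<in> Obj B"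
    "x \<in> Obj A \<Longrightarrow> component t x \<in> Hom M (on_obj F x) (on_obj G x)"
    "v \<in> Hom A x y \<Longrightarrow> component t y \<cdot>\<^bsub>M\<^esub> on_arr F v = on_arr G v \<cdot>\<^bsub>M\<^esub> component t x"
proof -
  from assms have t: "t \<in> Hom (fun_cat A M) F G" and "F \<in> Obj B" "G \<in> Obj B"
    by (simp_all add: in_Hom_B)
  then show "F \<in> Obj B" "G \<in> Obj B" by simp_all
  show "Src t = F" "Tgt t = G"
    "x \<in> Obj A \<Longrightarrow> component t x \<in> Hom M (on_obj F x) (on_obj G x)"
    "v \<in> Hom A x y \<Longrightarrow> component t y \<cdot>\<^bsub>M\<^esub> on_arr F v = on_arr G v \<cdot>\<^bsub>M\<^esub> component t x"
    using Hom_fun_catD[OF t] by simp_all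
qed

lemma Hom_BI:
  assumes "F \<in> Obj B" "G \<in> Obj B"
    "\<And>x. x \<in> Obj A \<Longrightarrow> t x \<in> Hom M (on_obj F x) (on_obj G x)"
    "\<And>v x y. v \<in> Hom A x y \<Longrightarrow> t y \<cdot>\<^bsub>M\<^esub> on_arr F v = on_arr G v \<cdot>\<^bsub>M\<^esub> t x"
  shows "mk_nat A F G t \<in> Hom B F G"
  using assms Hom_fun_catI[of F A M G t] by (simp add: in_Hom_B Obj_B)

lemma B_eqI:
  assumes "t \<in> Hom B F G" "t' \<in> Hom B F G"
    "\<And>x. x \<in> Obj A \<Longrightarrow> component t x = component t' x"
  shows "t = t'"
  by (rule fun_cat_eqI[of t A M F G]) (use assms in \<open>simp_all add: in_Hom_B\<close>)

text \<open>Since \<open>s d\<close> is an identity, \<open>Z d\<close> is always a right inverse of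
  \<open>Z s\<close>, and it is a two-sided inverse once \<open>Z (d s)\<close> is an identity.
  Invertibility thus becomes an equation, which can be verified on the legs of a colimit or the
  projections of a limit.\<close>

lemma Obj_BI:
  assumes Z: "is_functor A M Z" "on_obj Z \<in> extensional (Obj A)" "on_arr Z \<in> extensional (Arr A)"
    and ds: "\<And>s. s \<in> S \<Longrightarrow> \<exists>d \<in> Hom A (Cod A s) (Dom A s). s \<cdot>\<^bsub>A\<^esub> d = Ide A (Cod A s) \<and>
      on_arr Z (d \<cdot>\<^bsub>A\<^esub> s) = Ide M (on_obj Z (Dom A s))"
  shows "Z \<in> Obj B"
proof -
  have "is_iso M (on_arr Z s)" if s: "s \<in> S" for s
  proof -
    note D = functor_D[OF Z(1)]
    obtain d where d: "d \<in> Hom A (Cod A s) (Dom A s)" "s \<cdot>\<^bsub>A\<^esub> d = Ide A (Cod A s)"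
      and id: "on_arr Z (d \<cdot>\<^bsub>A\<^esub> s) = Ide M (on_obj Z (Dom A s))"
      using ds[OF s] by blast
    have sA: "s \<in> Arr A" using s S_Arr by blast
    have "on_arr Z d \<cdot>\<^bsub>M\<^esub> on_arr Z s = Ide M (on_obj Z (Dom A s))"
      using id D(8)[of s d] sA d by (simp add: in_Hom)
    moreover have "on_arr Z s \<cdot>\<^bsub>M\<^esub> on_arr Z d = Ide M (on_obj Z (Cod A s))"
      using D(8)[of d s] D(7)[of "Cod A s"] sA d by (simp add: in_Hom)
    ultimately show ?thesis unfolding is_iso_def
      using D(4,5,6)[OF sA] D(9)[OF d(1)] by auto
  qed
  then show ?thesis using Z by (simp add: Obj_B Obj_fun_cat)
qed

lemma Obj_BI_all_sections:
  assumes "is_functor A M Z" "on_obj Z \<in> extensional (Obj A)" "on_arr Z \<in> extensional (Arr A)"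
    and "\<And>s d. s \<in> S \<Longrightarrow> d \<in> Hom A (Cod A s) (Dom A s) \<Longrightarrow> s \<cdot>\<^bsub>A\<^esub> d = Ide A (Cod A s) \<Longrightarrow>
      on_arr Z (d \<cdot>\<^bsub>A\<^esub> s) = Ide M (on_obj Z (Dom A s))"
  shows "Z \<in> Obj B"
  using assms S_split by (intro Obj_BI) blast+

text \<open>Composing \<open>d s\<close> with \<open>s\<close> on the left gives back
  \<open>s\<close>, because \<open>s d\<close> is an identity. The invertible \<open>F s\<close> is
  then cancelled.\<close>

lemma section_inverse:
  assumes F: "F \<in> Obj B" and s: "s \<in> S" and d: "d \<in> Hom A (Cod A s) (Dom A s)"
    and sd: "s \<cdot>\<^bsub>A\<^esub> d = Ide A (Cod A s)"
  shows "on_arr F (d \<cdot>\<^bsub>A\<^esub> s) = Ide M (on_obj F (Dom A s))"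
proof -
  note D = BD[OF F]
  have sA: "s \<in> Arr A" using s S_Arr by blast
  have iso: "is_iso M (on_arr F s)" using F s by (auto simp: Obj_B)
  have sds: "s \<cdot>\<^bsub>A\<^esub> (d \<cdot>\<^bsub>A\<^esub> s) = s"
    using A.reassoc[OF sd, of s] sA d by (simp add: in_Hom)
  have "on_arr F (s \<cdot>\<^bsub>A\<^esub> (d \<cdot>\<^bsub>A\<^esub> s)) = on_arr F s \<cdot>\<^bsub>M\<^esub> on_arr F (d \<cdot>\<^bsub>A\<^esub> s)"
    by (rule D(8)) (use sA d in \<open>simp_all add: in_Hom\<close>)
  then have eq: "on_arr F s \<cdot>\<^bsub>M\<^esub> on_arr F (d \<cdot>\<^bsub>A\<^esub> s) = on_arr F s"
    using arg_cong[OF sds, of "on_arr F"] by (rule trans[OF sym])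
  have "on_arr F s \<cdot>\<^bsub>M\<^esub> on_arr F (d \<cdot>\<^bsub>A\<^esub> s) = on_arr F s \<cdot>\<^bsub>M\<^esub> Ide M (on_obj F (Dom A s))"
    unfolding eq by (rule M.Comp_Ide(1)[OF D(4,5)[OF sA], symmetric])
  then show ?thesis
    by (rule M.iso_cancel_left[OF iso, rotated 4]) (use sA d in \<open>simp_all add: in_Hom D(3-6)\<close>)
qed

text \<open>Both arrows become right inverses of the same isomorphism \<open>F s\<close>. The prism
  argument draws its identifications from this.\<close>

lemma sections_eq:
  assumes F: "F \<in> Obj B" and s: "s \<in> S" and d: "d \<in> Hom A (Cod A s) (Dom A s)"
    and sd: "s \<cdot>\<^bsub>A\<^esub> d = Ide A (Cod A s)" and d': "d' \<in> Hom A (Cod A s) (Dom A s)"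
    and sd': "s \<cdot>\<^bsub>A\<^esub> d' = Ide A (Cod A s)"
  shows "on_arr F d = on_arr F d'"
proof -
  note D = BD[OF F]
  have sA: "s \<in> Arr A" using s S_Arr by blast
  have iso: "is_iso M (on_arr F s)" using F s by (auto simp: Obj_B)
  have "on_arr F s \<cdot>\<^bsub>M\<^esub> on_arr F d = on_arr F s \<cdot>\<^bsub>M\<^esub> on_arr F d'"
    using D(8)[of d s, symmetric] D(8)[of d' s, symmetric] sA d d' by (simp add: in_Hom sd sd')
  then show ?thesis
    by (rule M.iso_cancel_left[OF iso, rotated 4]) (use sA d d' in \<open>simp_all add: in_Hom D(3-6)\<close>)
qed

end

section \<open>Limits and colimits of inverting diagrams\<close>

locale small_inverting = inverting A M S
  for A :: "('o, 'a, 'y) cat_scheme" and M :: "('p, 'b, 'z) cat_scheme" and S +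
  fixes U :: "'u itself"
  assumes infinite: "infinite (UNIV :: 'u set)"
    and small_A: "|Arr A| \<le>o |UNIV :: 'u set|"
    and limits: "has_small_limits M U"
    and colimits: "has_small_colimits M U"
begin

lemma M_pcolimit:
  assumes "presentation M I X R" "|I| \<le>o |UNIV :: 'u set|" "|R| \<le>o |UNIV :: 'u set|"
  shows "\<exists>c \<kappa>. pcolimit M I X R c \<kappa>"
proof -
  have "has_small_colimits M TYPE('u)" using colimits by (simp add: has_small_colimits_def)
  from M.pcolimit_exists[OF assms(1) this infinite assms(2,3)] show ?thesis by blast
qed

text \<open>A relation between transformations is evaluated at one object, which turns a
  presentation of diagrams into a presentation in \<open>M\<close>.\<close>

definition at :: "('i \<times> (('o, 'a, 'p, 'b) func, 'o, 'b) nat_trans \<times> 'i \<times>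
    (('o, 'a, 'p, 'b) func, 'o, 'b) nat_trans) set \<Rightarrow> 'o \<Rightarrow> ('i \<times> 'b \<times> 'i \<times> 'b) set" where
  "at R y = (\<lambda>(i, f, j, g). (i, component f y, j, component g y)) ` R"

lemma in_at: "(i, f, j, g) \<in> R \<Longrightarrow> (i, component f y, j, component g y) \<in> at R y"
  by (force simp: at_def)

lemma atE:
  assumes "(i, f', j, g') \<in> at R y"
  obtains f g where "(i, f, j, g) \<in> R" "f' = component f y" "g' = component g y"
  using assms by (auto simp: at_def)

lemma presentationD:
  assumes "presentation C I X R"
  shows "i \<in> I \<Longrightarrow> X i \<in> Obj C"
    "(i, f, j, g) \<in> R \<Longrightarrow> i \<in> I" "(i, f, j, g) \<in> R \<Longrightarrow> j \<in> I"
    "(i, f, j, g) \<in> R \<Longrightarrow> f \<in> Hom C (Dom C f) (X i)" "(i, f, j, g) \<in> R \<Longrightarrow> g \<in> Hom C (Dom C f) (X j)"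
  using assms unfolding presentation_def by fast+

lemma presentation_at:
  assumes P: "presentation B I X R" and y: "y \<in> Obj A"
  shows "presentation M I (\<lambda>i. on_obj (X i) y) (at R y)"
  unfolding presentation_def
proof (intro conjI ballI, goal_cases)
  case (1 i)
  then show ?case using BD(3)[OF presentationD(1)[OF P 1] y] by simp
next
  case (2 r)
  obtain i f' j g' where r: "r = (i, f', j, g')" by (cases r)
  obtain f g where fg: "(i, f, j, g) \<in> R" "f' = component f y" "g' = component g y"
    using 2 r atE by metis
  have f: "component f y \<in> Hom M (on_obj (Dom B f) y) (on_obj (X i) y)"
    and g: "component g y \<in> Hom M (on_obj (Dom B f) y) (on_obj (X j) y)"
    using Hom_BD(5)[OF presentationD(4)[OF P fg(1)] y] Hom_BD(5)[OF presentationD(5)[OF P fg(1)] y] .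
  then show ?case using presentationD(2,3)[OF P fg(1)] by (simp add: r fg(2,3) in_Hom)
qed

text \<open>The colimit is formed object by object. It inverts \<open>S\<close> because
  \<open>Z (d s)\<close> and the identity agree on every leg, each \<open>X i\<close> having
  identified them already. The second conclusion, that evaluation preserves the colimit, is what
  later allows a sequence of diagrams to be compared with its colimit inside
  \<open>M\<close>.\<close>

lemma B_pcolimit:
  assumes P: "presentation B I X R" and I: "|I| \<le>o |UNIV :: 'u set|" and R: "|R| \<le>o |UNIV :: 'u set|"
  obtains Z \<kappa> where "pcolimit B I X R Z \<kappa>"
    "\<And>y. y \<in> Obj A \<Longrightarrow>
      pcolimit M I (\<lambda>i. on_obj (X i) y) (at R y) (on_obj Z y) (\<lambda>i. component (\<kappa> i) y)"
proof -
  note PD = presentationD[OF P]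
  have pres: "presentation M I (\<lambda>i. on_obj (X i) y) (at R y)" if "y \<in> Obj A" for y
    using presentation_at[OF P that] .
  have col: "\<exists>c \<kappa>. pcolimit M I (\<lambda>i. on_obj (X i) y) (at R y) c \<kappa>" if "y \<in> Obj A" for y
    using M_pcolimit[OF pres[OF that] I] card_of_ordLeq_image[OF R] unfolding at_def by blast
  have XD: "is_functor A M (X i)" if "i \<in> I" for i
    using B_functor[OF PD(1)[OF that]] .
  have pull: "pcocone M I (\<lambda>i. on_obj (X i) x) (at R x) d (\<lambda>i. \<kappa> i \<cdot>\<^bsub>M\<^esub> on_arr (X i) v)"
    if v: "v \<in> Hom A x y" and k: "pcocone M I (\<lambda>i. on_obj (X i) y) (at R y) d \<kappa>" for v x y d \<kappa>
  proof (rule pcoconeI)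
    note xy = A.Hom_Obj[OF v]
    show "d \<in> Obj M" using pcoconeD(1)[OF k] .
    show "\<kappa> i \<cdot>\<^bsub>M\<^esub> on_arr (X i) v \<in> Hom M (on_obj (X i) x) d" if "i \<in> I" for i
      using M.Comp_Hom[OF functor_D(9)[OF XD[OF that] v] pcoconeD(2)[OF k that]] .
    fix i f' j g' assume "(i, f', j, g') \<in> at R x"
    then obtain f g where r: "(i, f, j, g) \<in> R" and e: "f' = component f x" "g' = component g x"
      by (rule atE)
    \<comment> \<open>Naturality of \<open>f\<close> moves \<open>v\<close> to the other side, so
      the relation at \<open>x\<close> follows from the one at \<open>y\<close> by precomposing with
      the value at \<open>v\<close> of the common source.\<close>
    have swap: "(\<kappa> i \<cdot>\<^bsub>M\<^esub> on_arr (X i) v) \<cdot>\<^bsub>M\<^esub> component f x = (\<kappa> i \<cdot>\<^bsub>M\<^esub> component f y) \<cdot>\<^bsub>M\<^esub> on_arr (Dom B f) v"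
      if h: "i \<in> I" "f \<in> Hom B (Dom B f) (X i)" for i f
    proof -
      note fD = Hom_BD[OF h(2)]
      have swap: "(\<kappa> i \<cdot>\<^bsub>M\<^esub> on_arr (X i) v) \<cdot>\<^bsub>M\<^esub> component f x = \<kappa> i \<cdot>\<^bsub>M\<^esub> (on_arr (X i) v \<cdot>\<^bsub>M\<^esub> component f x)"
        by (rule M.Comp_assoc[OF fD(5)[OF xy(1)] functor_D(9)[OF XD[OF h(1)] v] pcoconeD(2)[OF k h(1)], symmetric])
      also have "\<dots> = \<kappa> i \<cdot>\<^bsub>M\<^esub> (component f y \<cdot>\<^bsub>M\<^esub> on_arr (Dom B f) v)"
        by (simp only: fD(6)[OF v])
      also have "\<dots> = (\<kappa> i \<cdot>\<^bsub>M\<^esub> component f y) \<cdot>\<^bsub>M\<^esub> on_arr (Dom B f) v"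
        by (rule M.Comp_assoc[OF BD(9)[OF fD(3) v] fD(5)[OF xy(2)] pcoconeD(2)[OF k h(1)]])
      finally show ?thesis .
    qed
    have g: "Dom B g = Dom B f" "g \<in> Hom B (Dom B g) (X j)" using PD(5)[OF r] by (simp_all add: in_Hom)
    have "\<kappa> i \<cdot>\<^bsub>M\<^esub> component f y = \<kappa> j \<cdot>\<^bsub>M\<^esub> component g y"
      using pcoconeD(3)[OF k in_at[OF r]] .
    then show "(\<kappa> i \<cdot>\<^bsub>M\<^esub> on_arr (X i) v) \<cdot>\<^bsub>M\<^esub> f' = (\<kappa> j \<cdot>\<^bsub>M\<^esub> on_arr (X j) v) \<cdot>\<^bsub>M\<^esub> g'"
      using swap[OF PD(2)[OF r] PD(4)[OF r]] swap[OF PD(3)[OF r] g(2)] g(1) by (simp add: e)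
  qed
  have "\<exists>Z \<kappa>. is_functor A M Z \<and> on_obj Z \<in> extensional (Obj A) \<and> on_arr Z \<in> extensional (Arr A) \<and>
    (\<forall>y \<in> Obj A. pcolimit M I (\<lambda>i. on_obj (X i) y) (at R y) (on_obj Z y) (\<kappa> y)) \<and>
    (\<forall>x y v i. v \<in> Hom A x y \<longrightarrow> i \<in> I \<longrightarrow>
        on_arr Z v \<cdot>\<^bsub>M\<^esub> \<kappa> x i = \<kappa> y i \<cdot>\<^bsub>M\<^esub> on_arr (X i) v)"
    by (rule pcolimit_functor[OF A.category_axioms M.category_axioms, where \<phi> = "\<lambda>_ i. i"])
       (use pres col pull functor_D(7,9)[OF XD] functor_D(8)[OF XD] in \<open>simp_all add: in_Hom\<close>)
  then obtain Z \<kappa> where Z: "is_functor A M Z" "on_obj Z \<in> extensional (Obj A)" "on_arr Z \<in> extensional (Arr A)"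
    and k: "\<And>y. y \<in> Obj A \<Longrightarrow> pcolimit M I (\<lambda>i. on_obj (X i) y) (at R y) (on_obj Z y) (\<kappa> y)"
    and nat: "\<And>v x y i. v \<in> Hom A x y \<Longrightarrow> i \<in> I \<Longrightarrow>
        on_arr Z v \<cdot>\<^bsub>M\<^esub> \<kappa> x i = \<kappa> y i \<cdot>\<^bsub>M\<^esub> on_arr (X i) v"
    by blast
  note ZD = functor_D[OF Z(1)]
  have ZB: "Z \<in> Obj B"
  proof (rule Obj_BI_all_sections[OF Z])
    fix s d assume s: "s \<in> S" and d: "d \<in> Hom A (Cod A s) (Dom A s)" "s \<cdot>\<^bsub>A\<^esub> d = Ide A (Cod A s)"
    have sA: "s \<in> Arr A" using s S_Arr by blast
    then have ds: "d \<cdot>\<^bsub>A\<^esub> s \<in> Hom A (Dom A s) (Dom A s)" and y: "Dom A s \<in> Obj A"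
      using d by (auto simp: in_Hom)
    show "on_arr Z (d \<cdot>\<^bsub>A\<^esub> s) = Ide M (on_obj Z (Dom A s))"
    proof (rule M.pcolimit_eqI[OF pres[OF y] k[OF y] ZD(9)[OF ds]])
      show "Ide M (on_obj Z (Dom A s)) \<in> Hom M (on_obj Z (Dom A s)) (on_obj Z (Dom A s))"
        using M.Ide_Hom[OF ZD(3)[OF y]] .
      fix i assume i: "i \<in> I"
      show "on_arr Z (d \<cdot>\<^bsub>A\<^esub> s) \<cdot>\<^bsub>M\<^esub> \<kappa> (Dom A s) i = Ide M (on_obj Z (Dom A s)) \<cdot>\<^bsub>M\<^esub> \<kappa> (Dom A s) i"
        using nat[OF ds i] section_inverse[OF PD(1)[OF i] s d] pcolimitD(3)[OF k[OF y] i]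
        by (simp add: in_Hom)
    qed
  qed
  define \<kappa>' where "\<kappa>' i = mk_nat A (X i) Z (\<lambda>y. \<kappa> y i)" for i
  have \<kappa>': "\<kappa>' i \<in> Hom B (X i) Z" if i: "i \<in> I" for i
    unfolding \<kappa>'_def using pcolimitD(3)[OF k i] nat[OF _ i, symmetric]
    by (rule Hom_BI[OF PD(1)[OF i] ZB])
  have comp: "component (\<kappa>' i) y = \<kappa> y i" if "y \<in> Obj A" for y i
    using that by (simp add: \<kappa>'_def)
  have pk: "pcolimit M I (\<lambda>i. on_obj (X i) y) (at R y) (on_obj Z y) (\<lambda>i. component (\<kappa>' i) y)"
    if "y \<in> Obj A" for y
    using k[OF that] that by (simp add: comp)
  have "pcolimit B I X R Z \<kappa>'"
    unfolding pcolimit_def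
  proof (intro conjI allI impI)
    show "pcocone B I X R Z \<kappa>'"
    proof (rule pcoconeI)
      fix i f j g assume r: "(i, f, j, g) \<in> R"
      note f = category.Comp_Hom[OF category_B PD(4)[OF r] \<kappa>'[OF PD(2)[OF r]]]
        and g = category.Comp_Hom[OF category_B PD(5)[OF r] \<kappa>'[OF PD(3)[OF r]]]
      show "\<kappa>' i \<cdot>\<^bsub>B\<^esub> f = \<kappa>' j \<cdot>\<^bsub>B\<^esub> g"
        by (rule B_eqI[OF f g]) (use pcolimitD(4)[OF k in_at[OF r]] in \<open>simp add: B_simps comp\<close>)
    qed (use ZB \<kappa>' in simp_all)
    fix D l assume l: "pcocone B I X R D l"
    note lH = pcoconeD(2)[OF l]
    have D: "D \<in> Obj B" using pcoconeD(1)[OF l] .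
    have l': "pcocone M I (\<lambda>i. on_obj (X i) y) (at R y) (on_obj D y) (\<lambda>i. component (l i) y)"
      if y: "y \<in> Obj A" for y
    proof (rule pcoconeI)
      show "on_obj D y \<in> Obj M" using BD(3)[OF D y] .
      show "component (l i) y \<in> Hom M (on_obj (X i) y) (on_obj D y)" if "i \<in> I" for i
        using Hom_BD(5)[OF lH[OF that] y] .
      fix i f' j g' assume "(i, f', j, g') \<in> at R y"
      then obtain f g where r: "(i, f, j, g) \<in> R" and e: "f' = component f y" "g' = component g y"
        by (rule atE)
      show "component (l i) y \<cdot>\<^bsub>M\<^esub> f' = component (l j) y \<cdot>\<^bsub>M\<^esub> g'"
        using arg_cong[OF pcoconeD(3)[OF l r], of "\<lambda>t. component t y"] y by (simp add: B_simps e)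
    qed
    have "\<exists>h. h \<in> Hom M (on_obj Z y) (on_obj D y) \<and> (\<forall>i \<in> I. h \<cdot>\<^bsub>M\<^esub> \<kappa> y i = component (l i) y)"
      if "y \<in> Obj A" for y
      using pcolimit_induced[OF k[OF that] l'[OF that]] .
    then obtain h where h: "\<And>y. y \<in> Obj A \<Longrightarrow> h y \<in> Hom M (on_obj Z y) (on_obj D y)"
      "\<And>y i. y \<in> Obj A \<Longrightarrow> i \<in> I \<Longrightarrow> h y \<cdot>\<^bsub>M\<^esub> \<kappa> y i = component (l i) y"
      by metis
    have H: "mk_nat A Z D h \<in> Hom B Z D"
    proof (rule Hom_BI[OF ZB D h(1)])
      fix v x y assume v: "v \<in> Hom A x y"
      note xy = A.Hom_Obj[OF v]
      show "h y \<cdot>\<^bsub>M\<^esub> on_arr Z v = on_arr D v \<cdot>\<^bsub>M\<^esub> h x"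
      proof (rule M.pcolimit_eqI[OF pres[OF xy(1)] k[OF xy(1)]])
        show "h y \<cdot>\<^bsub>M\<^esub> on_arr Z v \<in> Hom M (on_obj Z x) (on_obj D y)"
          using M.Comp_Hom[OF ZD(9)[OF v] h(1)[OF xy(2)]] .
        show "on_arr D v \<cdot>\<^bsub>M\<^esub> h x \<in> Hom M (on_obj Z x) (on_obj D y)"
          using M.Comp_Hom[OF h(1)[OF xy(1)] BD(9)[OF D v]] .
        fix i assume i: "i \<in> I"
        note kx = pcolimitD(3)[OF k[OF xy(1)] i] and ky = pcolimitD(3)[OF k[OF xy(2)] i]
        have "(h y \<cdot>\<^bsub>M\<^esub> on_arr Z v) \<cdot>\<^bsub>M\<^esub> \<kappa> x i = h y \<cdot>\<^bsub>M\<^esub> (\<kappa> y i \<cdot>\<^bsub>M\<^esub> on_arr (X i) v)"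
          unfolding nat[OF v i, symmetric]
          by (rule M.Comp_assoc[OF kx ZD(9)[OF v] h(1)[OF xy(2)], symmetric])
        also have "\<dots> = component (l i) y \<cdot>\<^bsub>M\<^esub> on_arr (X i) v"
          unfolding h(2)[OF xy(2) i, symmetric]
          by (rule M.Comp_assoc[OF functor_D(9)[OF XD[OF i] v] ky h(1)[OF xy(2)]])
        also have "\<dots> = on_arr D v \<cdot>\<^bsub>M\<^esub> component (l i) x" by (rule Hom_BD(6)[OF lH[OF i] v])
        also have "\<dots> = (on_arr D v \<cdot>\<^bsub>M\<^esub> h x) \<cdot>\<^bsub>M\<^esub> \<kappa> x i"
          unfolding h(2)[OF xy(1) i, symmetric]
          by (rule M.Comp_assoc[OF kx h(1)[OF xy(1)] BD(9)[OF D v]])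
        finally show "(h y \<cdot>\<^bsub>M\<^esub> on_arr Z v) \<cdot>\<^bsub>M\<^esub> \<kappa> x i = (on_arr D v \<cdot>\<^bsub>M\<^esub> h x) \<cdot>\<^bsub>M\<^esub> \<kappa> x i" .
      qed
    qed
    show "\<exists>!h. h \<in> Hom B Z D \<and> (\<forall>i\<in>I. h \<cdot>\<^bsub>B\<^esub> \<kappa>' i = l i)"
    proof (rule ex1I[of _ "mk_nat A Z D h"], intro conjI ballI H)
      fix i assume i: "i \<in> I"
      show "mk_nat A Z D h \<cdot>\<^bsub>B\<^esub> \<kappa>' i = l i"
        by (rule B_eqI[OF category.Comp_Hom[OF category_B \<kappa>'[OF i] H] lH[OF i]])
           (simp add: B_simps comp h(2) i)
    next
      fix g assume g: "g \<in> Hom B Z D \<and> (\<forall>i\<in>I. g \<cdot>\<^bsub>B\<^esub> \<kappa>' i = l i)"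
      then have gH: "g \<in> Hom B Z D" by blast
      show "g = mk_nat A Z D h"
      proof (rule B_eqI[OF gH H])
        fix y assume y: "y \<in> Obj A"
        show "component g y = component (mk_nat A Z D h) y"
        proof (rule M.pcolimit_eqI[OF pres[OF y] k[OF y] Hom_BD(5)[OF gH y] Hom_BD(5)[OF H y]])
          fix i assume i: "i \<in> I"
          then have "g \<cdot>\<^bsub>B\<^esub> \<kappa>' i = l i" using g by blast
          from arg_cong[OF this, of "\<lambda>t. component t y"]
          show "component g y \<cdot>\<^bsub>M\<^esub> \<kappa> y i = component (mk_nat A Z D h) y \<cdot>\<^bsub>M\<^esub> \<kappa> y i"
            using y h(2)[OF y i] by (simp add: B_simps comp)
        qed
      qed
    qed
  qed
  then show thesis using pk by (rule that)
qed

lemma B_colimits: "has_small_colimits B U"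
  unfolding has_small_colimits_def
proof (intro allI impI)
  fix J :: "('u, 'u) cat" and F assume F: "is_functor J B F"
  note FD = functor_D[OF F]
  interpret J: category J by (rule FD(1))
  interpret B: category B by (rule category_B)
  \<comment> \<open>One relation for each arrow \<open>a\<close> of \<open>J\<close>: the leg at the
    target after \<open>F a\<close> equals the leg at the source. The identity on the second side
    only fills the format of a relation.\<close>
  define R where "R = (\<lambda>a. (Cod J a, on_arr F a, Dom J a, Ide B (on_obj F (Dom J a)))) ` Arr J"
  have P: "presentation B (Obj J) (on_obj F) R"
    by (auto simp: presentation_def R_def in_Hom FD)
  have cc: "is_cocone J B F d \<kappa> \<longleftrightarrow> pcocone B (Obj J) (on_obj F) R d \<kappa>" for d \<kappa>
  proof -
    have "\<kappa> (Dom J a) \<cdot>\<^bsub>B\<^esub> Ide B (on_obj F (Dom J a)) = \<kappa> (Dom J a)"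
      if "\<forall>x \<in> Obj J. \<kappa> x \<in> Hom B (on_obj F x) d" "a \<in> Arr J" for a
      using that by (simp add: in_Hom)
    then show ?thesis unfolding is_cocone_def pcocone_def R_def by auto
  qed
  have "|Obj J| \<le>o |UNIV :: 'u set|" "|R| \<le>o |UNIV :: 'u set|"
    unfolding R_def by (intro card_of_mono1 subset_UNIV, intro card_of_ordLeq_image card_of_mono1 subset_UNIV)
  then obtain c \<kappa> where "pcolimit B (Obj J) (on_obj F) R c \<kappa>"
    using B_pcolimit[OF P] by metis
  then show "\<exists>c \<iota>. is_colimit J B F c \<iota>"
    unfolding is_colimit_def pcolimit_def cc by blast
qed

lemma limit_eqI:
  assumes L: "is_limit J M D c \<pi>" and J: "is_functor J M D"
    and g: "g \<in> Hom M d c" and h: "h \<in> Hom M d c"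
    and eq: "\<And>j. j \<in> Obj J \<Longrightarrow> \<pi> j \<cdot>\<^bsub>M\<^esub> g = \<pi> j \<cdot>\<^bsub>M\<^esub> h"
  shows "g = h"
proof -
  note JD = functor_D[OF J]
  have cone: "is_cone J M D c \<pi>" using L by (simp add: is_limit_def)
  then have \<pi>: "\<pi> j \<in> Hom M c (on_obj D j)" if "j \<in> Obj J" for j
    using that by (auto simp: is_cone_def)
  have "is_cone J M D d (\<lambda>j. \<pi> j \<cdot>\<^bsub>M\<^esub> h)"
    unfolding is_cone_def
  proof (intro conjI ballI)
    show "d \<in> Obj M" using M.Hom_Obj(1)[OF h] .
    show "\<pi> j \<cdot>\<^bsub>M\<^esub> h \<in> Hom M d (on_obj D j)" if "j \<in> Obj J" for j
      using M.Comp_Hom[OF h \<pi>[OF that]] .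
    fix a assume a: "a \<in> Arr J"
    then have a': "a \<in> Hom J (Dom J a) (Cod J a)" and o: "Dom J a \<in> Obj J"
      using category.Dom_Obj[OF JD(1)] by (simp_all add: in_Hom)
    have "on_arr D a \<cdot>\<^bsub>M\<^esub> \<pi> (Dom J a) = \<pi> (Cod J a)"
      using cone a by (auto simp: is_cone_def)
    then show "on_arr D a \<cdot>\<^bsub>M\<^esub> (\<pi> (Dom J a) \<cdot>\<^bsub>M\<^esub> h) = \<pi> (Cod J a) \<cdot>\<^bsub>M\<^esub> h"
      using M.Comp_assoc[OF h \<pi>[OF o] JD(9)[OF a']] by simp
  qed
  then have "\<exists>!k. k \<in> Hom M d c \<and> (\<forall>j \<in> Obj J. \<pi> j \<cdot>\<^bsub>M\<^esub> k = \<pi> j \<cdot>\<^bsub>M\<^esub> h)"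
    using L unfolding is_limit_def by blast
  then show ?thesis using g h eq by blast
qed

text \<open>The pointwise limit inverts \<open>S\<close> for the reason dual to that for colimits:
  \<open>Z (d s)\<close> and the identity have the same composites with all projections.\<close>

lemma B_limits: "has_small_limits B U"
  unfolding has_small_limits_def
proof (intro allI impI)
  fix J :: "('u, 'u) cat" and F assume F: "is_functor J B F"
  note FD = functor_D[OF F]
  interpret J: category J by (rule FD(1))
  interpret B: category B by (rule category_B)
  define F' where "F' y = \<lparr>on_obj = (\<lambda>j. on_obj (on_obj F j) y), on_arr = (\<lambda>a. component (on_arr F a) y)\<rparr>" for y
  have F': "is_functor J M (F' y)" if y: "y \<in> Obj A" for y
  proof (rule functorI[OF FD(1) M.category_axioms])
    show "on_obj (F' y) j \<in> Obj M" if "j \<in> Obj J" for j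
      using BD(3)[OF FD(3)[OF that] y] by (simp add: F'_def)
    show "on_arr (F' y) a \<in> Hom M (on_obj (F' y) j) (on_obj (F' y) k)" if "a \<in> Hom J j k" for a j k
      using Hom_BD(5)[OF FD(9)[OF that] y] by (simp add: F'_def)
    show "on_arr (F' y) (Ide J j) = Ide M (on_obj (F' y) j)" if "j \<in> Obj J" for j
      using FD(7)[OF that] y by (simp add: F'_def B_simps)
    show "on_arr (F' y) (b \<cdot>\<^bsub>J\<^esub> a) = on_arr (F' y) b \<cdot>\<^bsub>M\<^esub> on_arr (F' y) a"
      if "a \<in> Hom J j k" "b \<in> Hom J k l" for a b j k l
      using FD(8)[of a b] that y by (simp add: F'_def B_simps in_Hom)
  qed
  have "\<exists>c \<pi>. is_limit J M (F' y) c \<pi>" if "y \<in> Obj A" for y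
    using limits F'[OF that] unfolding has_small_limits_def by blast
  then obtain c \<pi> where L: "\<And>y. y \<in> Obj A \<Longrightarrow> is_limit J M (F' y) (c y) (\<pi> y)" by metis
  have cone: "is_cone J M (F' y) (c y) (\<pi> y)" if "y \<in> Obj A" for y
    using L[OF that] by (simp add: is_limit_def)
  have c: "c y \<in> Obj M" if "y \<in> Obj A" for y
    using cone[OF that] by (simp add: is_cone_def)
  have \<pi>: "\<pi> y j \<in> Hom M (c y) (on_obj (on_obj F j) y)" if "y \<in> Obj A" "j \<in> Obj J" for y j
    using cone[OF that(1)] that(2) by (simp add: is_cone_def F'_def)
  have \<pi>_a: "component (on_arr F a) y \<cdot>\<^bsub>M\<^esub> \<pi> y (Dom J a) = \<pi> y (Cod J a)"
    if "y \<in> Obj A" "a \<in> Arr J" for y a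
    using cone[OF that(1)] that(2) by (simp add: is_cone_def F'_def)
  have aH: "on_arr F a \<in> Hom B (on_obj F (Dom J a)) (on_obj F (Cod J a))" if "a \<in> Arr J" for a
    using FD(9)[of a] that by (simp add: in_Hom)
  have induced: "\<exists>h. h \<in> Hom M d (c y) \<and> (\<forall>j \<in> Obj J. \<pi> y j \<cdot>\<^bsub>M\<^esub> h = \<kappa> j)"
    if "is_cone J M (F' y) d \<kappa>" "y \<in> Obj A" for y d \<kappa>
    using L[OF that(2)] that(1) unfolding is_limit_def by blast
  have "\<exists>h. h \<in> Hom M (c x) (c y) \<and>
      (\<forall>j \<in> Obj J. \<pi> y j \<cdot>\<^bsub>M\<^esub> h = on_arr (on_obj F j) v \<cdot>\<^bsub>M\<^esub> \<pi> x j)"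
    if v: "v \<in> Hom A x y" for v x y
  proof (rule induced)
    note xy = A.Hom_Obj[OF v]
    show "y \<in> Obj A" using xy(2) .
    show "is_cone J M (F' y) (c x) (\<lambda>j. on_arr (on_obj F j) v \<cdot>\<^bsub>M\<^esub> \<pi> x j)"
      unfolding is_cone_def
    proof (intro conjI ballI)
      show "c x \<in> Obj M" using c[OF xy(1)] .
      show "on_arr (on_obj F j) v \<cdot>\<^bsub>M\<^esub> \<pi> x j \<in> Hom M (c x) (on_obj (F' y) j)" if "j \<in> Obj J" for j
        using M.Comp_Hom[OF \<pi>[OF xy(1) that] BD(9)[OF FD(3)[OF that] v]] by (simp add: F'_def)
      fix a assume a: "a \<in> Arr J"
      note dc = J.Dom_Obj[OF a] J.Cod_Obj[OF a]
      let ?f = "on_arr F a"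
      have "component ?f y \<cdot>\<^bsub>M\<^esub> (on_arr (on_obj F (Dom J a)) v \<cdot>\<^bsub>M\<^esub> \<pi> x (Dom J a))
        = (component ?f y \<cdot>\<^bsub>M\<^esub> on_arr (on_obj F (Dom J a)) v) \<cdot>\<^bsub>M\<^esub> \<pi> x (Dom J a)"
        by (rule M.Comp_assoc[OF \<pi>[OF xy(1) dc(1)] BD(9)[OF FD(3)[OF dc(1)] v] Hom_BD(5)[OF aH[OF a] xy(2)]])
      also have "\<dots> = (on_arr (on_obj F (Cod J a)) v \<cdot>\<^bsub>M\<^esub> component ?f x) \<cdot>\<^bsub>M\<^esub> \<pi> x (Dom J a)"
        by (simp only: Hom_BD(6)[OF aH[OF a] v])
      also have "\<dots> = on_arr (on_obj F (Cod J a)) v \<cdot>\<^bsub>M\<^esub> (component ?f x \<cdot>\<^bsub>M\<^esub> \<pi> x (Dom J a))"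
        by (rule M.Comp_assoc[OF \<pi>[OF xy(1) dc(1)] Hom_BD(5)[OF aH[OF a] xy(1)] BD(9)[OF FD(3)[OF dc(2)] v], symmetric])
      also have "\<dots> = on_arr (on_obj F (Cod J a)) v \<cdot>\<^bsub>M\<^esub> \<pi> x (Cod J a)"
        by (simp only: \<pi>_a[OF xy(1) a])
      finally show "on_arr (F' y) a \<cdot>\<^bsub>M\<^esub> (on_arr (on_obj F (Dom J a)) v \<cdot>\<^bsub>M\<^esub> \<pi> x (Dom J a)) =
          on_arr (on_obj F (Cod J a)) v \<cdot>\<^bsub>M\<^esub> \<pi> x (Cod J a)" by (simp add: F'_def)
    qed
  qed
  then have "\<exists>h. h \<in> Hom M (c (Dom A v)) (c (Cod A v)) \<and> (\<forall>j \<in> Obj J.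
      \<pi> (Cod A v) j \<cdot>\<^bsub>M\<^esub> h = on_arr (on_obj F j) v \<cdot>\<^bsub>M\<^esub> \<pi> (Dom A v) j)" if "v \<in> Arr A" for v
    using that by (simp add: in_Hom)
  then obtain h where h: "\<And>v. v \<in> Arr A \<Longrightarrow> h v \<in> Hom M (c (Dom A v)) (c (Cod A v))"
      "\<And>v j. v \<in> Arr A \<Longrightarrow> j \<in> Obj J \<Longrightarrow>
      \<pi> (Cod A v) j \<cdot>\<^bsub>M\<^esub> h v = on_arr (on_obj F j) v \<cdot>\<^bsub>M\<^esub> \<pi> (Dom A v) j"
    by metis
  have hH: "h v \<in> Hom M (c x) (c y)" if "v \<in> Hom A x y" for v x y
    using h(1)[of v] that by (auto simp: in_Hom)
  have hk: "\<pi> y j \<cdot>\<^bsub>M\<^esub> h v = on_arr (on_obj F j) v \<cdot>\<^bsub>M\<^esub> \<pi> x j" if "v \<in> Hom A x y" "j \<in> Obj J" for v x y j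
    using h(2)[of v] that by (auto simp: in_Hom)
  note eqI = limit_eqI[OF L F']
  define Z where "Z = \<lparr>on_obj = restrict c (Obj A), on_arr = restrict h (Arr A)\<rparr>"
  have Zo: "on_obj Z y = c y" if "y \<in> Obj A" for y using that by (simp add: Z_def)
  have Za: "on_arr Z v = h v" if "v \<in> Arr A" for v using that by (simp add: Z_def)
  have Z: "is_functor A M Z"
  proof (rule functorI[OF A.category_axioms M.category_axioms])
    show "on_obj Z x \<in> Obj M" if "x \<in> Obj A" for x using c that by (simp add: Zo)
    show "on_arr Z v \<in> Hom M (on_obj Z x) (on_obj Z y)" if v: "v \<in> Hom A x y" for v x y
    proof -
      have "v \<in> Arr A" using v by (simp add: in_Hom)
      then show ?thesis using hH[OF v] A.Hom_Obj[OF v] by (simp add: Zo Za)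
    qed
    show "on_arr Z (Ide A x) = Ide M (on_obj Z x)" if x: "x \<in> Obj A" for x
    proof -
      have "h (Ide A x) = Ide M (c x)"
      proof (rule eqI[OF x x hH[OF A.Ide_Hom[OF x]] M.Ide_Hom[OF c[OF x]]])
        fix j assume j: "j \<in> Obj J"
        show "\<pi> x j \<cdot>\<^bsub>M\<^esub> h (Ide A x) = \<pi> x j \<cdot>\<^bsub>M\<^esub> Ide M (c x)"
          unfolding hk[OF A.Ide_Hom[OF x] j] using \<pi>[OF x j] BD(7)[OF FD(3)[OF j] x]
          by (simp add: in_Hom)
      qed
      then show ?thesis using x by (simp add: Zo Za)
    qed
    show "on_arr Z (w \<cdot>\<^bsub>A\<^esub> v) = on_arr Z w \<cdot>\<^bsub>M\<^esub> on_arr Z v"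
      if v: "v \<in> Hom A x y" and w: "w \<in> Hom A y z" for v w x y z
    proof -
      note O = A.Hom_Obj[OF v] A.Hom_Obj[OF w]
      note wv = A.Comp_Hom[OF v w]
      have "h (w \<cdot>\<^bsub>A\<^esub> v) = h w \<cdot>\<^bsub>M\<^esub> h v"
      proof (rule eqI[OF O(4) O(4) hH[OF wv] M.Comp_Hom[OF hH[OF v] hH[OF w]]])
        fix j assume j: "j \<in> Obj J"
        note Fj = BD[OF FD(3)[OF j]]
        have "\<pi> z j \<cdot>\<^bsub>M\<^esub> (h w \<cdot>\<^bsub>M\<^esub> h v) = (\<pi> z j \<cdot>\<^bsub>M\<^esub> h w) \<cdot>\<^bsub>M\<^esub> h v"
          by (rule M.Comp_assoc[OF hH[OF v] hH[OF w] \<pi>[OF O(4) j]])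
        also have "\<dots> = on_arr (on_obj F j) w \<cdot>\<^bsub>M\<^esub> (\<pi> y j \<cdot>\<^bsub>M\<^esub> h v)"
          unfolding hk[OF w j]
          by (rule M.Comp_assoc[OF hH[OF v] \<pi>[OF O(2) j] Fj(9)[OF w], symmetric])
        also have "\<dots> = (on_arr (on_obj F j) w \<cdot>\<^bsub>M\<^esub> on_arr (on_obj F j) v) \<cdot>\<^bsub>M\<^esub> \<pi> x j"
          unfolding hk[OF v j]
          by (rule M.Comp_assoc[OF \<pi>[OF O(1) j] Fj(9)[OF v] Fj(9)[OF w]])
        also have "\<dots> = \<pi> z j \<cdot>\<^bsub>M\<^esub> h (w \<cdot>\<^bsub>A\<^esub> v)"
          unfolding hk[OF wv j] using Fj(8)[of v w] v w by (simp add: in_Hom)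
        finally show "\<pi> z j \<cdot>\<^bsub>M\<^esub> h (w \<cdot>\<^bsub>A\<^esub> v) = \<pi> z j \<cdot>\<^bsub>M\<^esub> (h w \<cdot>\<^bsub>M\<^esub> h v)" by simp
      qed
      then show ?thesis using v w wv by (simp add: Za in_Hom)
    qed
  qed
  have ZB: "Z \<in> Obj B"
  proof (rule Obj_BI_all_sections[OF Z])
    show "on_obj Z \<in> extensional (Obj A)" "on_arr Z \<in> extensional (Arr A)" by (simp_all add: Z_def)
    fix s d assume s: "s \<in> S" and d: "d \<in> Hom A (Cod A s) (Dom A s)" "s \<cdot>\<^bsub>A\<^esub> d = Ide A (Cod A s)"
    have sA: "s \<in> Arr A" using s S_Arr by blast
    then have ds: "d \<cdot>\<^bsub>A\<^esub> s \<in> Hom A (Dom A s) (Dom A s)" and y: "Dom A s \<in> Obj A"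
      using d by (auto simp: in_Hom)
    have "h (d \<cdot>\<^bsub>A\<^esub> s) = Ide M (c (Dom A s))"
    proof (rule eqI[OF y y hH[OF ds] M.Ide_Hom[OF c[OF y]]])
      fix j assume j: "j \<in> Obj J"
      show "\<pi> (Dom A s) j \<cdot>\<^bsub>M\<^esub> h (d \<cdot>\<^bsub>A\<^esub> s) = \<pi> (Dom A s) j \<cdot>\<^bsub>M\<^esub> Ide M (c (Dom A s))"
        unfolding hk[OF ds j] section_inverse[OF FD(3)[OF j] s d] using \<pi>[OF y j] by (simp add: in_Hom)
    qed
    then show "on_arr Z (d \<cdot>\<^bsub>A\<^esub> s) = Ide M (on_obj Z (Dom A s))"
      using ds y by (simp add: Zo Za in_Hom)
  qed
  define \<pi>' where "\<pi>' j = mk_nat A Z (on_obj F j) (\<lambda>y. \<pi> y j)" for j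
  have \<pi>': "\<pi>' j \<in> Hom B Z (on_obj F j)" if j: "j \<in> Obj J" for j
    unfolding \<pi>'_def
  proof (rule Hom_BI[OF ZB FD(3)[OF j]])
    show "\<pi> x j \<in> Hom M (on_obj Z x) (on_obj (on_obj F j) x)" if "x \<in> Obj A" for x
      using \<pi>[OF that j] that by (simp add: Zo)
    show "\<pi> y j \<cdot>\<^bsub>M\<^esub> on_arr Z v = on_arr (on_obj F j) v \<cdot>\<^bsub>M\<^esub> \<pi> x j" if "v \<in> Hom A x y" for v x y
      using hk[OF that j] that by (simp add: Za in_Hom)
  qed
  have comp: "component (\<pi>' j) y = \<pi> y j" if "y \<in> Obj A" for y j
    using that by (simp add: \<pi>'_def)
  have "is_limit J B F Z \<pi>'"
    unfolding is_limit_def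
  proof (intro conjI allI impI)
    show "is_cone J B F Z \<pi>'"
      unfolding is_cone_def
    proof (intro conjI ballI ZB \<pi>')
      fix a assume a: "a \<in> Arr J"
      show "on_arr F a \<cdot>\<^bsub>B\<^esub> \<pi>' (Dom J a) = \<pi>' (Cod J a)"
        by (rule B_eqI[OF B.Comp_Hom[OF \<pi>'[OF J.Dom_Obj[OF a]] aH[OF a]] \<pi>'[OF J.Cod_Obj[OF a]]])
           (simp add: B_simps comp \<pi>_a a)
    qed
    fix D l assume l: "is_cone J B F D l"
    then have D: "D \<in> Obj B" and lH: "\<And>j. j \<in> Obj J \<Longrightarrow> l j \<in> Hom B D (on_obj F j)"
      and la: "\<And>a. a \<in> Arr J \<Longrightarrow> on_arr F a \<cdot>\<^bsub>B\<^esub> l (Dom J a) = l (Cod J a)"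
      by (auto simp: is_cone_def)
    have "\<exists>h. h \<in> Hom M (on_obj D y) (c y) \<and> (\<forall>j \<in> Obj J. \<pi> y j \<cdot>\<^bsub>M\<^esub> h = component (l j) y)"
      if y: "y \<in> Obj A" for y
    proof (rule induced[OF _ y])
      show "is_cone J M (F' y) (on_obj D y) (\<lambda>j. component (l j) y)"
        unfolding is_cone_def
      proof (intro conjI ballI)
        show "on_obj D y \<in> Obj M" using BD(3)[OF D y] .
        show "component (l j) y \<in> Hom M (on_obj D y) (on_obj (F' y) j)" if "j \<in> Obj J" for j
          using Hom_BD(5)[OF lH[OF that] y] by (simp add: F'_def)
        show "on_arr (F' y) a \<cdot>\<^bsub>M\<^esub> component (l (Dom J a)) y = component (l (Cod J a)) y"
          if "a \<in> Arr J" for a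
          using arg_cong[OF la[OF that], of "\<lambda>t. component t y"] y by (simp add: B_simps F'_def)
      qed
    qed
    then obtain h' where h': "\<And>y. y \<in> Obj A \<Longrightarrow> h' y \<in> Hom M (on_obj D y) (c y)"
      "\<And>y j. y \<in> Obj A \<Longrightarrow> j \<in> Obj J \<Longrightarrow> \<pi> y j \<cdot>\<^bsub>M\<^esub> h' y = component (l j) y"
      by metis
    have H: "mk_nat A D Z h' \<in> Hom B D Z"
    proof (rule Hom_BI[OF D ZB])
      show "h' x \<in> Hom M (on_obj D x) (on_obj Z x)" if "x \<in> Obj A" for x
        using h'(1)[OF that] that by (simp add: Zo)
      fix v x y assume v: "v \<in> Hom A x y"
      note xy = A.Hom_Obj[OF v]
      have "h' y \<cdot>\<^bsub>M\<^esub> on_arr D v = h v \<cdot>\<^bsub>M\<^esub> h' x"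
      proof (rule eqI[OF xy(2) xy(2) M.Comp_Hom[OF BD(9)[OF D v] h'(1)[OF xy(2)]]
            M.Comp_Hom[OF h'(1)[OF xy(1)] hH[OF v]]])
        fix j assume j: "j \<in> Obj J"
        note px = \<pi>[OF xy(1) j] and py = \<pi>[OF xy(2) j]
        have "\<pi> y j \<cdot>\<^bsub>M\<^esub> (h' y \<cdot>\<^bsub>M\<^esub> on_arr D v) = component (l j) y \<cdot>\<^bsub>M\<^esub> on_arr D v"
          unfolding h'(2)[OF xy(2) j, symmetric]
          by (rule M.Comp_assoc[OF BD(9)[OF D v] h'(1)[OF xy(2)] py])
        also have "\<dots> = on_arr (on_obj F j) v \<cdot>\<^bsub>M\<^esub> component (l j) x" by (rule Hom_BD(6)[OF lH[OF j] v])
        also have "\<dots> = (on_arr (on_obj F j) v \<cdot>\<^bsub>M\<^esub> \<pi> x j) \<cdot>\<^bsub>M\<^esub> h' x"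
          unfolding h'(2)[OF xy(1) j, symmetric]
          by (rule M.Comp_assoc[OF h'(1)[OF xy(1)] px BD(9)[OF FD(3)[OF j] v]])
        also have "\<dots> = \<pi> y j \<cdot>\<^bsub>M\<^esub> (h v \<cdot>\<^bsub>M\<^esub> h' x)"
          unfolding hk[OF v j, symmetric]
          by (rule M.Comp_assoc[OF h'(1)[OF xy(1)] hH[OF v] py, symmetric])
        finally show "\<pi> y j \<cdot>\<^bsub>M\<^esub> (h' y \<cdot>\<^bsub>M\<^esub> on_arr D v) = \<pi> y j \<cdot>\<^bsub>M\<^esub> (h v \<cdot>\<^bsub>M\<^esub> h' x)" .
      qed
      then show "h' y \<cdot>\<^bsub>M\<^esub> on_arr D v = on_arr Z v \<cdot>\<^bsub>M\<^esub> h' x"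
        using v by (simp add: Za in_Hom)
    qed
    show "\<exists>!h. h \<in> Hom B D Z \<and> (\<forall>j\<in>Obj J. \<pi>' j \<cdot>\<^bsub>B\<^esub> h = l j)"
    proof (rule ex1I[of _ "mk_nat A D Z h'"], intro conjI ballI H)
      fix j assume j: "j \<in> Obj J"
      show "\<pi>' j \<cdot>\<^bsub>B\<^esub> mk_nat A D Z h' = l j"
        by (rule B_eqI[OF B.Comp_Hom[OF H \<pi>'[OF j]] lH[OF j]])
           (simp add: B_simps comp h'(2) j)
    next
      fix g assume g: "g \<in> Hom B D Z \<and> (\<forall>j\<in>Obj J. \<pi>' j \<cdot>\<^bsub>B\<^esub> g = l j)"
      then have gH: "g \<in> Hom B D Z" by blast
      show "g = mk_nat A D Z h'"
      proof (rule B_eqI[OF gH H])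
        fix y assume y: "y \<in> Obj A"
        have "component g y = h' y"
        proof (rule eqI[OF y y _ h'(1)[OF y]])
          show "component g y \<in> Hom M (on_obj D y) (c y)" using Hom_BD(5)[OF gH y] y by (simp add: Zo)
          fix j assume j: "j \<in> Obj J"
          then have "\<pi>' j \<cdot>\<^bsub>B\<^esub> g = l j" using g by blast
          from arg_cong[OF this, of "\<lambda>t. component t y"]
          show "\<pi> y j \<cdot>\<^bsub>M\<^esub> component g y = \<pi> y j \<cdot>\<^bsub>M\<^esub> h' y"
            using y h'(2)[OF y j] by (simp add: B_simps comp)
        qed
        then show "component g y = component (mk_nat A D Z h') y" using y by simp
      qed
    qed
  qed
  then show "\<exists>c \<pi>. is_limit J B F c \<pi>" by blast
qed

end

section \<open>Lifting properties\<close>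

definition llp :: "('o, 'a, 'z) cat_scheme \<Rightarrow> 'a set \<Rightarrow> 'a set" where
  "llp C P = {i \<in> Arr C. \<forall>p \<in> P. has_lifting C i p}"

context category
begin

lemma has_liftingI:
  assumes "i \<in> Hom C a b" "p \<in> Hom C x y"
    "\<And>u v. u \<in> Hom C a x \<Longrightarrow> v \<in> Hom C b y \<Longrightarrow> p \<cdot> u = v \<cdot> i \<Longrightarrow>
       \<exists>h. h \<in> Hom C b x \<and> h \<cdot> i = u \<and> p \<cdot> h = v"
  shows "has_lifting C i p"
proof -
  have "Dom C i = a" "Cod C i = b" "Dom C p = x" "Cod C p = y" using assms(1,2) by (simp_all add: in_Hom)
  then show ?thesis unfolding has_lifting_def using assms(3) by blast
qed

lemma has_liftingE:
  assumes "has_lifting C i p" "i \<in> Hom C a b" "p \<in> Hom C x y"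
    "u \<in> Hom C a x" "v \<in> Hom C b y" "p \<cdot> u = v \<cdot> i"
  obtains h where "h \<in> Hom C b x" "h \<cdot> i = u" "p \<cdot> h = v"
proof -
  have "Dom C i = a" "Cod C i = b" "Dom C p = x" "Cod C p = y" using assms(2,3) by (simp_all add: in_Hom)
  then have "\<exists>h \<in> Hom C b x. h \<cdot> i = u \<and> p \<cdot> h = v"
    using assms(1)[unfolded has_lifting_def, rule_format, of u v] assms(4-) by simp
  then show thesis by (elim bexE conjE) (rule that)
qed

lemma is_isoI:
  assumes "f \<in> Hom C x y" "g \<in> Hom C y x" "g \<cdot> f = Ide C x" "f \<cdot> g = Ide C y"
  shows "is_iso C f"
  using assms by (auto simp: is_iso_def in_Hom)

lemma is_isoE:
  assumes "is_iso C f" "f \<in> Hom C x y"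
  obtains g where "g \<in> Hom C y x" "g \<cdot> f = Ide C x" "f \<cdot> g = Ide C y" "is_iso C g"
proof -
  obtain g where g: "g \<in> Hom C y x" "g \<cdot> f = Ide C x" "f \<cdot> g = Ide C y"
    using assms by (auto simp: is_iso_def in_Hom)
  then show thesis using that is_isoI[OF g(1) assms(2) g(3,2)] by blast
qed

text \<open>In the square with \<open>j\<close> on top and the identity at the bottom, a lift is a
  section \<open>h\<close> of \<open>q\<close> under \<open>x\<close>. The pair \<open>h\<close>,
  \<open>q\<close> then exhibits the composite as a retract of \<open>j\<close>, with identities on
  the sources.\<close>

lemma retract_argument:
  assumes j: "j \<in> Hom C x z" and q: "q \<in> Hom C z y" and "has_lifting C (q \<cdot> j) q"
  shows "is_retract C (q \<cdot> j) j"
proof -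
  have f: "q \<cdot> j \<in> Hom C x y" using Comp_Hom[OF j q] .
  note O = Hom_Obj[OF f]
  obtain h where h: "h \<in> Hom C y z" "h \<cdot> (q \<cdot> j) = j" "q \<cdot> h = Ide C y"
    by (rule has_liftingE[OF assms(3) f q j Ide_Hom[OF O(2)]])
       (use f Comp_Ide_left[OF f] in simp_all)
  show ?thesis
    unfolding is_retract_def
    apply (intro conjI)
    subgoal using f by (simp add: in_Hom)
    subgoal using j by (simp add: in_Hom)
    subgoal
      apply (rule bexI[of _ "Ide C x"], rule bexI[of _ "Ide C x"], rule bexI[of _ h], rule bexI[of _ q])
      using f j q h O by (simp_all add: in_Hom)
    done
qed

lemma retract_has_lifting:
  assumes "is_retract C f g" and L: "has_lifting C g p" and p: "p \<in> Arr C"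
  shows "has_lifting C f p"
proof -
  from assms(1) obtain i r j s where f: "f \<in> Arr C" and g: "g \<in> Arr C"
    and i: "i \<in> Hom C (Dom C f) (Dom C g)" and r: "r \<in> Hom C (Dom C g) (Dom C f)"
    and j: "j \<in> Hom C (Cod C f) (Cod C g)" and s: "s \<in> Hom C (Cod C g) (Cod C f)"
    and e: "r \<cdot> i = Ide C (Dom C f)" "s \<cdot> j = Ide C (Cod C f)" "g \<cdot> i = j \<cdot> f" "f \<cdot> r = s \<cdot> g"
    unfolding is_retract_def by blast
  note H = f g i[unfolded in_Hom] r[unfolded in_Hom] j[unfolded in_Hom] s[unfolded in_Hom] p
  show ?thesis
  proof (rule has_liftingI[of f _ _ p])
    show "f \<in> Hom C (Dom C f) (Cod C f)" "p \<in> Hom C (Dom C p) (Cod C p)" using f p by (auto simp: in_Hom)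
    fix u v assume u: "u \<in> Hom C (Dom C f) (Dom C p)" and v: "v \<in> Hom C (Cod C f) (Cod C p)"
      and sq: "p \<cdot> u = v \<cdot> f"
    have "p \<cdot> (u \<cdot> r) = (p \<cdot> u) \<cdot> r" using H u v by (simp add: in_Hom assoc)
    also have "\<dots> = v \<cdot> (f \<cdot> r)" using H u v sq by (simp add: in_Hom assoc)
    also have "\<dots> = (v \<cdot> s) \<cdot> g" using H u v e(4) by (simp add: in_Hom assoc)
    finally have sq': "p \<cdot> (u \<cdot> r) = (v \<cdot> s) \<cdot> g" .
    obtain h where h: "h \<in> Hom C (Cod C g) (Dom C p)" "h \<cdot> g = u \<cdot> r" "p \<cdot> h = v \<cdot> s"
      by (rule has_liftingE[OF L _ _ Comp_Hom[OF r u] Comp_Hom[OF s v] sq']) (use H in \<open>simp_all add: in_Hom\<close>)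
    have "(h \<cdot> j) \<cdot> f = h \<cdot> (g \<cdot> i)" using H h(1) e(3) by (simp add: in_Hom assoc)
    also have "\<dots> = (h \<cdot> g) \<cdot> i" using H h(1) by (simp add: in_Hom assoc)
    also have "\<dots> = u \<cdot> (r \<cdot> i)" unfolding h(2) using H u by (simp add: in_Hom assoc)
    also have "\<dots> = u" unfolding e(1) using u by (simp add: in_Hom)
    finally have 1: "(h \<cdot> j) \<cdot> f = u" .
    have "p \<cdot> (h \<cdot> j) = (p \<cdot> h) \<cdot> j" using H h(1) by (simp add: in_Hom assoc)
    also have "\<dots> = v \<cdot> (s \<cdot> j)" unfolding h(3) using H v by (simp add: in_Hom assoc)
    also have "\<dots> = v" unfolding e(2) using v by (simp add: in_Hom)
    finally have 2: "p \<cdot> (h \<cdot> j) = v" .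
    show "\<exists>h. h \<in> Hom C (Cod C f) (Dom C p) \<and> h \<cdot> f = u \<and> p \<cdot> h = v"
      using 1 2 Comp_Hom[OF j h(1)] by blast
  qed
qed

lemma has_lifting_Comp:
  assumes f: "f \<in> Hom C x y" and g: "g \<in> Hom C y z" and p: "p \<in> Arr C"
    and Lf: "has_lifting C f p" and Lg: "has_lifting C g p"
  shows "has_lifting C (g \<cdot> f) p"
proof (rule has_liftingI[OF Comp_Hom[OF f g], of p])
  show p': "p \<in> Hom C (Dom C p) (Cod C p)" using p by (simp add: in_Hom)
  fix u v assume u: "u \<in> Hom C x (Dom C p)" and v: "v \<in> Hom C z (Cod C p)" and sq: "p \<cdot> u = v \<cdot> (g \<cdot> f)"
  obtain h where h: "h \<in> Hom C y (Dom C p)" "h \<cdot> f = u" "p \<cdot> h = v \<cdot> g"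
    by (rule has_liftingE[OF Lf f p' u Comp_Hom[OF g v]])
       (use sq Comp_assoc[OF f g v] in simp_all)
  obtain h' where h': "h' \<in> Hom C z (Dom C p)" "h' \<cdot> g = h" "p \<cdot> h' = v"
    by (rule has_liftingE[OF Lg g p' h(1) v h(3)])
  show "\<exists>h. h \<in> Hom C z (Dom C p) \<and> h \<cdot> (g \<cdot> f) = u \<and> p \<cdot> h = v"
    using h' h(2) Comp_assoc[OF f g h'(1)] by (intro exI[of _ h']) simp
qed

text \<open>The isomorphism and its inverse form the retraction diagram. Hence the classes closed
  under retracts by MC3 are closed under composition with isomorphisms.\<close>

lemma iso_retract:
  assumes g: "is_iso C g" and f: "f \<in> Arr C"
  shows "Dom C f = Cod C g \<Longrightarrow> is_retract C (f \<cdot> g) f"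
    "Cod C f = Dom C g \<Longrightarrow> is_retract C (g \<cdot> f) f"
proof -
  have gA: "g \<in> Arr C" using g by (simp add: is_iso_def)
  obtain k where k: "k \<in> Hom C (Cod C g) (Dom C g)" "k \<cdot> g = Ide C (Dom C g)" "g \<cdot> k = Ide C (Cod C g)"
    using g by (auto simp: is_iso_def)
  show "is_retract C (f \<cdot> g) f" if d: "Dom C f = Cod C g"
    unfolding is_retract_def
    apply (intro conjI)
    subgoal using f gA d by simp
    subgoal using f by simp
    subgoal
      apply (rule bexI[of _ g], rule bexI[of _ k], rule bexI[of _ "Ide C (Cod C f)"],
          rule bexI[of _ "Ide C (Cod C f)"])
      using f gA d k by (simp_all add: in_Hom assoc)
    done
  show "is_retract C (g \<cdot> f) f" if d: "Cod C f = Dom C g"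
    unfolding is_retract_def
    apply (intro conjI)
    subgoal using f gA d by simp
    subgoal using f by simp
    subgoal
      apply (rule bexI[of _ "Ide C (Dom C f)"], rule bexI[of _ "Ide C (Dom C f)"],
          rule bexI[of _ k], rule bexI[of _ g])
      using f gA d k reassoc[OF k(2), of f] by (simp_all add: in_Hom)
    done
qed


subsection \<open>Sequential colimits\<close>

abbreviation seq_rel :: "(nat \<Rightarrow> 'o) \<Rightarrow> (nat \<Rightarrow> 'a) \<Rightarrow> (nat \<times> 'a \<times> nat \<times> 'a) set" where
  "seq_rel Z k \<equiv> range (\<lambda>n. (Suc n, k n, n, Ide C (Z n)))"

lemma seq_cocone_iff:
  assumes k: "\<And>n. k n \<in> Hom C (Z n) (Z (Suc n))"
  shows "pcocone C UNIV Z (seq_rel Z k) d b \<longleftrightarrow>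
    d \<in> Obj C \<and> (\<forall>n. b n \<in> Hom C (Z n) d) \<and> (\<forall>n. b (Suc n) \<cdot> k n = b n)"
proof -
  have "b n \<cdot> Ide C (Z n) = b n" if "\<forall>n. b n \<in> Hom C (Z n) d" for n
    using Comp_Ide_right[of "b n" "Z n" d] that by simp
  then show ?thesis unfolding pcocone_def by auto
qed

lemma seq_presentation:
  assumes k: "\<And>n. k n \<in> Hom C (Z n) (Z (Suc n))"
  shows "presentation C UNIV Z (seq_rel Z k)"
  using Hom_Obj(1)[OF k] k by (auto simp: presentation_def in_Hom)

text \<open>Lifts are found stage by stage, each extending the previous one. They form a cocone, and
  the map it induces lies over \<open>v\<close> because both maps have the same legs.\<close>

lemma seq_lifting:
  assumes k: "\<And>n. k n \<in> Hom C (Z n) (Z (Suc n))"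
    and lift: "\<And>n. has_lifting C (k n) p" and p: "p \<in> Arr C"
    and c: "pcolimit C UNIV Z (seq_rel Z k) c \<iota>"
  shows "has_lifting C (\<iota> 0) p"
proof -
  have \<iota>: "\<iota> n \<in> Hom C (Z n) c" for n using pcolimitD(3)[OF c] by simp
  have \<iota>k: "\<iota> (Suc n) \<cdot> k n = \<iota> n" for n
    using pcolimitD(1)[OF c] unfolding seq_cocone_iff[of k, OF k] by simp
  have p': "p \<in> Hom C (Dom C p) (Cod C p)" using p by (simp add: in_Hom)
  show ?thesis
  proof (rule has_liftingI[OF \<iota> p'])
    fix u v assume u: "u \<in> Hom C (Z 0) (Dom C p)" and v: "v \<in> Hom C c (Cod C p)" and sq: "p \<cdot> u = v \<cdot> \<iota> 0"
    \<comment> \<open>Dependent choice, since the lift at \<open>Suc n\<close> has to extend the one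
      already chosen at \<open>n\<close>. The clause for \<open>n = 0\<close> pins the start to
      \<open>u\<close>.\<close>
    have "\<exists>b. \<forall>n. (b n \<in> Hom C (Z n) (Dom C p) \<and> p \<cdot> b n = v \<cdot> \<iota> n \<and> (n = 0 \<longrightarrow> b n = u)) \<and> b (Suc n) \<cdot> k n = b n"
    proof (rule dependent_nat_choice)
      show "\<exists>b. b \<in> Hom C (Z 0) (Dom C p) \<and> p \<cdot> b = v \<cdot> \<iota> 0 \<and> (0 = (0::nat) \<longrightarrow> b = u)"
        using u sq by blast
      fix b n assume b: "b \<in> Hom C (Z n) (Dom C p) \<and> p \<cdot> b = v \<cdot> \<iota> n \<and> (n = 0 \<longrightarrow> b = u)"
      have "p \<cdot> b = (v \<cdot> \<iota> (Suc n)) \<cdot> k n"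
        by (simp add: Comp_assoc[OF k \<iota> v, symmetric] \<iota>k b)
      then obtain h where "h \<in> Hom C (Z (Suc n)) (Dom C p)" "h \<cdot> k n = b" "p \<cdot> h = v \<cdot> \<iota> (Suc n)"
        using has_liftingE[OF lift k p' _ Comp_Hom[OF \<iota> v]] b by blast
      then show "\<exists>h. (h \<in> Hom C (Z (Suc n)) (Dom C p) \<and> p \<cdot> h = v \<cdot> \<iota> (Suc n) \<and> (Suc n = 0 \<longrightarrow> h = u)) \<and> h \<cdot> k n = b"
        by blast
    qed
    then obtain b where b: "\<And>n. b n \<in> Hom C (Z n) (Dom C p)" "\<And>n. p \<cdot> b n = v \<cdot> \<iota> n"
      "b 0 = u" "\<And>n. b (Suc n) \<cdot> k n = b n" by blast
    have "pcocone C UNIV Z (seq_rel Z k) (Dom C p) b"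
      unfolding seq_cocone_iff[of k, OF k] using b p by simp
    then obtain h where h: "h \<in> Hom C c (Dom C p)" "\<And>n. h \<cdot> \<iota> n = b n"
      using pcolimit_induced[OF c] by blast
    have "p \<cdot> h = v"
    proof (rule pcolimit_eqI[OF seq_presentation[of k, OF k] c Comp_Hom[OF h(1) p'] v])
      fix n show "(p \<cdot> h) \<cdot> \<iota> n = v \<cdot> \<iota> n"
        by (simp add: Comp_assoc[OF \<iota> h(1) p', symmetric] h(2) b(2))
    qed
    then show "\<exists>h. h \<in> Hom C c (Dom C p) \<and> h \<cdot> \<iota> 0 = u \<and> p \<cdot> h = v"
      using h b(3) by blast
  qed
qed

text \<open>If the maps \<open>k m\<close> are isomorphisms for \<open>m \<ge> n\<close>, then \<open>Z n\<close> is itself a colimit.\<close>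

lemma seq_stable:
  assumes "\<And>m. k m \<in> Hom C (Z m) (Z (Suc m))" "\<And>m. m \<ge> n \<Longrightarrow> is_iso C (k m)"
  shows "\<exists>b. pcocone C UNIV Z (seq_rel Z k) (Z n) b \<and> b n = Ide C (Z n) \<and>
    (\<forall>d e. pcocone C UNIV Z (seq_rel Z k) d e \<longrightarrow> (\<forall>m. e n \<cdot> b m = e m))"
  using assms
proof (induction n arbitrary: Z k)
  case 0
  note k = 0(1) and iso = 0(2)
  \<comment> \<open>All maps of the sequence are invertible here, so the leg at \<open>Suc n\<close>
    is the leg at \<open>n\<close> after the inverse of \<open>k n\<close>, beginning with the
    identity of \<open>Z 0\<close>.\<close>
  have "\<exists>b. \<forall>n. (b n \<in> Hom C (Z n) (Z 0) \<and> (n = 0 \<longrightarrow> b n = Ide C (Z 0))) \<and> b (Suc n) \<cdot> k n = b n"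
  proof (rule dependent_nat_choice)
    show "\<exists>b. b \<in> Hom C (Z 0) (Z 0) \<and> (0 = (0::nat) \<longrightarrow> b = Ide C (Z 0))"
      using Ide_Hom[OF Hom_Obj(1)[OF k[of 0]]] by blast
    fix b n assume b: "b \<in> Hom C (Z n) (Z 0) \<and> (n = 0 \<longrightarrow> b = Ide C (Z 0))"
    obtain l where l: "l \<in> Hom C (Z (Suc n)) (Z n)" "l \<cdot> k n = Ide C (Z n)"
      using is_isoE[OF 0(2) k] by blast
    have "(b \<cdot> l) \<cdot> k n = b"
      using Comp_assoc[OF k l(1) conjunct1[OF b]] l(2) Comp_Ide_right[OF conjunct1[OF b]] by simp
    then show "\<exists>h. (h \<in> Hom C (Z (Suc n)) (Z 0) \<and> (Suc n = 0 \<longrightarrow> h = Ide C (Z 0))) \<and> h \<cdot> k n = b"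
      using Comp_Hom[OF l(1) conjunct1[OF b]] by blast
  qed
  then obtain b where b: "\<And>n. b n \<in> Hom C (Z n) (Z 0)" "b 0 = Ide C (Z 0)" "\<And>n. b (Suc n) \<cdot> k n = b n"
    by blast
  have "e 0 \<cdot> b m = e m" if e: "pcocone C UNIV Z (seq_rel Z k) d e" for d e m
  proof (induction m)
    have eH: "e n \<in> Hom C (Z n) d" and ek: "e (Suc n) \<cdot> k n = e n" for n
      using e unfolding seq_cocone_iff[of k, OF k] by simp_all
    case 0
    show ?case using b(2) Comp_Ide_right[OF eH] by simp
    case (Suc m)
    have "(e 0 \<cdot> b (Suc m)) \<cdot> k m = e 0 \<cdot> (b (Suc m) \<cdot> k m)"
      by (rule Comp_assoc[OF k b(1) eH, symmetric])
    also have "\<dots> = e (Suc m) \<cdot> k m" by (simp only: b(3) Suc ek)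
    finally show ?case
      by (rule iso_cancel_right[OF iso[OF le0], rotated 4])
         (use b(1) eH k Comp_Hom[OF b(1) eH] in \<open>simp_all add: in_Hom\<close>)
  qed
  moreover have "pcocone C UNIV Z (seq_rel Z k) (Z 0) b"
    unfolding seq_cocone_iff[of k, OF k] using b Hom_Obj(1)[OF k[of 0]] by blast
  ultimately show ?case using b(2) by blast
next
  case (Suc n)
  note k = Suc.prems(1)
  \<comment> \<open>Discarding the first term of the sequence lowers the bound by one. The leg at
    the discarded term is recovered as \<open>b 0\<close> after \<open>k 0\<close>.\<close>
  let ?Z = "\<lambda>m. Z (Suc m)" and ?k = "\<lambda>m. k (Suc m)"
  obtain b where b: "pcocone C UNIV ?Z (seq_rel ?Z ?k) (Z (Suc n)) b" "b n = Ide C (Z (Suc n))"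
    and e: "\<And>d e m. pcocone C UNIV ?Z (seq_rel ?Z ?k) d e \<Longrightarrow> e n \<cdot> b m = e m"
    using Suc.IH[of ?k ?Z] Suc.prems by auto
  have bH: "b m \<in> Hom C (Z (Suc m)) (Z (Suc n))" and bk: "b (Suc m) \<cdot> k (Suc m) = b m" for m
    using b(1) unfolding seq_cocone_iff[of ?k ?Z, OF k] by simp_all
  define b' where "b' m = (case m of 0 \<Rightarrow> b 0 \<cdot> k 0 | Suc m \<Rightarrow> b m)" for m
  have b'_simps: "b' 0 = b 0 \<cdot> k 0" "b' (Suc m) = b m" for m by (simp_all add: b'_def)
  have "b' m \<in> Hom C (Z m) (Z (Suc n))" for m
    using bH Comp_Hom[OF k bH] by (cases m) (simp_all add: b'_simps)
  moreover have "b' (Suc m) \<cdot> k m = b' m" for m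
    using bk by (cases m) (simp_all add: b'_simps)
  ultimately have 1: "pcocone C UNIV Z (seq_rel Z k) (Z (Suc n)) b'"
    unfolding seq_cocone_iff[of k, OF k] using Hom_Obj(1)[OF k] by blast
  have 2: "d (Suc n) \<cdot> b' m = d m" if d: "pcocone C UNIV Z (seq_rel Z k) c d" for c d m
  proof -
    have dH: "d m \<in> Hom C (Z m) c" and dk: "d (Suc m) \<cdot> k m = d m" and c: "c \<in> Obj C" for m
      using d unfolding seq_cocone_iff[of k, OF k] by simp_all
    have "pcocone C UNIV ?Z (seq_rel ?Z ?k) c (\<lambda>m. d (Suc m))"
      unfolding seq_cocone_iff[of ?k ?Z, OF k] using dH dk c by blast
    note * = e[OF this]
    show ?thesis
    proof (cases m)
      case 0
      then show ?thesis by (simp only: b'_simps Comp_assoc[OF k bH dH] * dk)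
    next
      case (Suc m')
      then show ?thesis using * by (simp add: b'_simps)
    qed
  qed
  show ?case using 1 2 b(2) by (intro exI[of _ b']) (simp add: b'_simps)
qed

text \<open>By \<open>seq_stable\<close>, \<open>Z n\<close> carries a cocone with the identity as
  its leg at \<open>n\<close>; the map it induces from the colimit is a left inverse of the leg. It
  is also a right inverse, because every cocone, the colimiting one included, factors through its
  own leg at \<open>n\<close>.\<close>

lemma seq_colimit_iso:
  assumes k: "\<And>m. k m \<in> Hom C (Z m) (Z (Suc m))" and iso: "\<And>m. m \<ge> n \<Longrightarrow> is_iso C (k m)"
    and c: "pcolimit C UNIV Z (seq_rel Z k) c \<iota>"
  shows "is_iso C (\<iota> n)"
proof -
  have \<iota>: "\<iota> n \<in> Hom C (Z n) c" for n using pcolimitD(3)[OF c] by simp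
  obtain b where b: "pcocone C UNIV Z (seq_rel Z k) (Z n) b" "b n = Ide C (Z n)"
    and e: "\<And>d e m. pcocone C UNIV Z (seq_rel Z k) d e \<Longrightarrow> e n \<cdot> b m = e m"
    using seq_stable[of k Z n, OF k iso] by blast
  obtain h where h: "h \<in> Hom C c (Z n)" "\<And>m. h \<cdot> \<iota> m = b m"
    using pcolimit_induced[OF c b(1)] by blast
  have "\<iota> n \<cdot> h = Ide C c"
  proof (rule pcolimit_eqI[OF seq_presentation[of k, OF k] c Comp_Hom[OF h(1) \<iota>] Ide_Hom[OF pcolimitD(2)[OF c]]])
    fix m
    have "(\<iota> n \<cdot> h) \<cdot> \<iota> m = \<iota> n \<cdot> (h \<cdot> \<iota> m)" by (rule Comp_assoc[OF \<iota> h(1) \<iota>, symmetric])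
    then show "(\<iota> n \<cdot> h) \<cdot> \<iota> m = Ide C c \<cdot> \<iota> m"
      by (simp only: h(2) e[OF pcolimitD(1)[OF c]] Comp_Ide_left[OF \<iota>])
  qed
  then show ?thesis using is_isoI[OF \<iota> h(1)] h(2) b(2) by simp
qed

end


section \<open>Model categories and left Quillen functors\<close>

context model_category
begin

lemma Fib_iso:
  assumes "is_iso M g" "f \<in> Fib M"
  shows "Dom M f = Cod M g \<Longrightarrow> f \<cdot> g \<in> Fib M" "Cod M f = Dom M g \<Longrightarrow> g \<cdot> f \<in> Fib M"
  using iso_retract[OF assms(1)] MC3 assms(2) Fib_Arr by blast+

lemma Weq_iso:
  assumes "is_iso M g" "f \<in> Weq M"
  shows "Dom M f = Cod M g \<Longrightarrow> f \<cdot> g \<in> Weq M" "Cod M f = Dom M g \<Longrightarrow> g \<cdot> f \<in> Weq M"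
  using iso_retract[OF assms(1)] MC3 assms(2) Weq_Arr by blast+

text \<open>One inclusion is MC4. For the other, the arrow is factored by MC5; it lifts against its
  right factor, so it is a retract of its left factor. Adjunctions can then be tested on lifting
  properties alone.\<close>

lemma Cof_eq_llp: "Cof M = llp M (Fib M \<inter> Weq M)"
proof (intro subset_antisym subsetI)
  show "i \<in> llp M (Fib M \<inter> Weq M)" if "i \<in> Cof M" for i
    using that MC4 Cof_Arr by (auto simp: llp_def)
  fix i assume i: "i \<in> llp M (Fib M \<inter> Weq M)"
  then have iA: "i \<in> Hom M (Dom M i) (Cod M i)" by (simp add: llp_def in_Hom)
  obtain z j q where j: "j \<in> Hom M (Dom M i) z" "j \<in> Cof M" and q: "q \<in> Hom M z (Cod M i)" "q \<in> Fib M \<inter> Weq M"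
    and e: "i = q \<cdot> j" using MC5_acyclic_fib[OF iA] by blast
  have "has_lifting M i q" using i q(2) by (simp add: llp_def)
  then have "is_retract M i j" using retract_argument[OF j(1) q(1)] by (simp add: e)
  then show "i \<in> Cof M" using MC3 j(2) by blast
qed

lemma acyclic_Cof_eq_llp: "Cof M \<inter> Weq M = llp M (Fib M)"
proof (intro subset_antisym subsetI)
  show "i \<in> llp M (Fib M)" if "i \<in> Cof M \<inter> Weq M" for i
    using that MC4 Cof_Arr by (auto simp: llp_def)
  fix i assume i: "i \<in> llp M (Fib M)"
  then have iA: "i \<in> Hom M (Dom M i) (Cod M i)" by (simp add: llp_def in_Hom)
  obtain z j q where j: "j \<in> Hom M (Dom M i) z" "j \<in> Cof M \<inter> Weq M" and q: "q \<in> Hom M z (Cod M i)" "q \<in> Fib M"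
    and e: "i = q \<cdot> j" using MC5_acyclic_cof[OF iA] by blast
  have "has_lifting M i q" using i q(2) by (simp add: llp_def)
  then have "is_retract M i j" using retract_argument[OF j(1) q(1)] by (simp add: e)
  then show "i \<in> Cof M \<inter> Weq M" using MC3 j(2) by blast
qed

text \<open>Two-out-of-three for \<open>w\<close> composed with an identity, where the composite is
  \<open>w\<close> again. Ken Brown's argument uses exactly these identities, at objects that
  already meet a weak equivalence.\<close>

lemma Ide_Weq:
  assumes "w \<in> Weq M" "w \<in> Hom M x y"
  shows "Ide M x \<in> Weq M" "Ide M y \<in> Weq M"
  using MC2[OF Ide_Hom[OF Hom_Obj(1)[OF assms(2)]] assms(2)]
    MC2[OF assms(2) Ide_Hom[OF Hom_Obj(2)[OF assms(2)]]] assms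
    Comp_Ide_left[OF assms(2)] Comp_Ide_right[OF assms(2)] by simp_all

text \<open>The leg is a pushout of the map from the initial object to the other summand. The lift
  is built directly: on the summand \<open>b\<close> it is prescribed, and on the other one it comes
  from cofibrancy.\<close>

lemma coproduct_leg_Cof:
  assumes c: "pcolimit M UNIV X {} P \<iota>" and X: "cofibrant M (X (\<not> b))"
  shows "\<iota> b \<in> Cof M"
proof -
  have \<iota>: "\<iota> b \<in> Hom M (X b) P" for b using pcolimitD(3)[OF c] by simp
  obtain I i where I: "initial_object M I" and i: "i \<in> Hom M I (X (\<not> b))" "i \<in> Cof M"
    using X by (auto simp: cofibrant_def)
  have "has_lifting M (\<iota> b) p" if p: "p \<in> Fib M \<inter> Weq M" for p
  proof -
    have p': "p \<in> Hom M (Dom M p) (Cod M p)" using p Fib_Arr by (auto simp: in_Hom)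
    note O = Hom_Obj[OF p']
    show ?thesis
    proof (rule has_liftingI[OF \<iota> p'])
      fix u v assume u: "u \<in> Hom M (X b) (Dom M p)" and v: "v \<in> Hom M P (Cod M p)" and sq: "p \<cdot> u = v \<cdot> \<iota> b"
      obtain e where e: "e \<in> Hom M I (Dom M p)" using I O by (auto simp: initial_object_def)
      have vi: "v \<cdot> \<iota> (\<not> b) \<in> Hom M (X (\<not> b)) (Cod M p)" using Comp_Hom[OF \<iota> v] .
      have "p \<cdot> e = (v \<cdot> \<iota> (\<not> b)) \<cdot> i"
        using I O Comp_Hom[OF e p'] Comp_Hom[OF i(1) vi] by (auto simp: initial_object_def)
      then obtain w where w: "w \<in> Hom M (X (\<not> b)) (Dom M p)" "p \<cdot> w = v \<cdot> \<iota> (\<not> b)"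
        using has_liftingE[OF MC4[OF i(2)] i(1) p' e vi] p by blast
      have "pcocone M UNIV X {} (Dom M p) (\<lambda>b'. if b' = b then u else w)"
        using O u w by (auto intro!: pcoconeI)
      then obtain h where h: "h \<in> Hom M P (Dom M p)" "\<And>b'. h \<cdot> \<iota> b' = (if b' = b then u else w)"
        using pcolimit_induced[OF c] by blast
      have "p \<cdot> h = v"
      proof (rule pcolimit_eqI[OF _ c Comp_Hom[OF h(1) p'] v])
        show "presentation M UNIV X {}" using Hom_Obj(1)[OF \<iota>] by (simp add: presentation_def)
        fix b' show "(p \<cdot> h) \<cdot> \<iota> b' = v \<cdot> \<iota> b'"
          using Comp_assoc[OF \<iota> h(1) p', of b'] h(2)[of b'] sq w(2) by (cases "b' = b") auto
      qed
      then show "\<exists>h. h \<in> Hom M P (Dom M p) \<and> h \<cdot> \<iota> b = u \<and> p \<cdot> h = v"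
        using h by auto
    qed
  qed
  then show ?thesis unfolding Cof_eq_llp using \<iota> by (auto simp: llp_def in_Hom)
qed

lemma Cof_Comp:
  assumes "f \<in> Cof M" "g \<in> Cof M" "f \<in> Hom M x y" "g \<in> Hom M y z"
  shows "g \<cdot> f \<in> Cof M"
  using assms has_lifting_Comp[OF assms(3,4)] Comp_Hom[OF assms(3,4)] Fib_Arr
  unfolding Cof_eq_llp by (auto simp: llp_def in_Hom)

end

section \<open>Adjunctions\<close>

lemma left_adjoint_exists:
  assumes R: "is_functor B A R"
    and univ: "\<And>x. x \<in> Obj A \<Longrightarrow> \<exists>c e. c \<in> Obj B \<and> e \<in> Hom A x (on_obj R c) \<and>
      (\<forall>y \<in> Obj B. \<forall>g \<in> Hom A x (on_obj R y). \<exists>!h. h \<in> Hom B c y \<and> on_arr R h \<cdot>\<^bsub>A\<^esub> e = g)"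
  shows "\<exists>F. is_left_adjoint A B F R"
proof -
  note RD = functor_D[OF R]
  interpret A: category A by (rule RD(2))
  interpret B: category B by (rule RD(1))
  obtain F \<eta> where F: "\<And>x. x \<in> Obj A \<Longrightarrow> F x \<in> Obj B"
    and \<eta>: "\<And>x. x \<in> Obj A \<Longrightarrow> \<eta> x \<in> Hom A x (on_obj R (F x))"
    and u: "\<And>x y g. x \<in> Obj A \<Longrightarrow> y \<in> Obj B \<Longrightarrow> g \<in> Hom A x (on_obj R y) \<Longrightarrow>
      \<exists>!h. h \<in> Hom B (F x) y \<and> on_arr R h \<cdot>\<^bsub>A\<^esub> \<eta> x = g"
    using univ by metis
  have eqI: "g = h" if "x \<in> Obj A" "g \<in> Hom B (F x) y" "h \<in> Hom B (F x) y"
    "on_arr R g \<cdot>\<^bsub>A\<^esub> \<eta> x = on_arr R h \<cdot>\<^bsub>A\<^esub> \<eta> x" for x y g h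
    using u[OF that(1) B.Hom_Obj(2)[OF that(3)] A.Comp_Hom[OF \<eta>[OF that(1)] RD(9)[OF that(3)]]] that by blast
  have "\<exists>h. h \<in> Hom B (F x) (F y) \<and> on_arr R h \<cdot>\<^bsub>A\<^esub> \<eta> x = \<eta> y \<cdot>\<^bsub>A\<^esub> f" if "f \<in> Hom A x y" for f x y
    using u[OF A.Hom_Obj(1)[OF that] F A.Comp_Hom[OF that \<eta>]] A.Hom_Obj[OF that] by blast
  then have "\<exists>h. h \<in> Hom B (F (Dom A f)) (F (Cod A f)) \<and> on_arr R h \<cdot>\<^bsub>A\<^esub> \<eta> (Dom A f) = \<eta> (Cod A f) \<cdot>\<^bsub>A\<^esub> f"
    if "f \<in> Arr A" for f using that by (simp add: in_Hom)
  then obtain h where h: "\<And>f. f \<in> Arr A \<Longrightarrow> h f \<in> Hom B (F (Dom A f)) (F (Cod A f))"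
    "\<And>f. f \<in> Arr A \<Longrightarrow> on_arr R (h f) \<cdot>\<^bsub>A\<^esub> \<eta> (Dom A f) = \<eta> (Cod A f) \<cdot>\<^bsub>A\<^esub> f" by metis
  have hH: "h f \<in> Hom B (F x) (F y)" and hn: "on_arr R (h f) \<cdot>\<^bsub>A\<^esub> \<eta> x = \<eta> y \<cdot>\<^bsub>A\<^esub> f"
    if "f \<in> Hom A x y" for f x y
    using h[of f] that by (auto simp: in_Hom)
  let ?F = "\<lparr>on_obj = F, on_arr = h\<rparr>"
  have "is_functor A B ?F"
  proof (rule functorI[OF RD(2,1)])
    show "on_arr ?F (Ide A x) = Ide B (on_obj ?F x)" if x: "x \<in> Obj A" for x
      using eqI[OF x hH[OF A.Ide_Hom[OF x]] B.Ide_Hom[OF F[OF x]]] hn[OF A.Ide_Hom[OF x]]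
        \<eta>[OF x] RD(7)[OF F[OF x]] by (simp add: in_Hom)
    show "on_arr ?F (g \<cdot>\<^bsub>A\<^esub> f) = on_arr ?F g \<cdot>\<^bsub>B\<^esub> on_arr ?F f"
      if f: "f \<in> Hom A x y" and g: "g \<in> Hom A y z" for f g x y z
    proof -
      note O = A.Hom_Obj[OF f] A.Hom_Obj[OF g]
      have "on_arr R (h g \<cdot>\<^bsub>B\<^esub> h f) \<cdot>\<^bsub>A\<^esub> \<eta> x = (on_arr R (h g) \<cdot>\<^bsub>A\<^esub> on_arr R (h f)) \<cdot>\<^bsub>A\<^esub> \<eta> x"
        using RD(8)[of "h f" "h g"] hH[OF f] hH[OF g] by (simp add: in_Hom)
      also have "\<dots> = on_arr R (h g) \<cdot>\<^bsub>A\<^esub> (\<eta> y \<cdot>\<^bsub>A\<^esub> f)"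
        unfolding hn[OF f, symmetric]
        by (rule A.Comp_assoc[OF \<eta>[OF O(1)] RD(9)[OF hH[OF f]] RD(9)[OF hH[OF g]], symmetric])
      also have "\<dots> = (\<eta> z \<cdot>\<^bsub>A\<^esub> g) \<cdot>\<^bsub>A\<^esub> f"
        unfolding hn[OF g, symmetric]
        by (rule A.Comp_assoc[OF f \<eta>[OF O(2)] RD(9)[OF hH[OF g]]])
      also have "\<dots> = \<eta> z \<cdot>\<^bsub>A\<^esub> (g \<cdot>\<^bsub>A\<^esub> f)"
        by (rule A.Comp_assoc[OF f g \<eta>[OF O(4)], symmetric])
      finally have "h (g \<cdot>\<^bsub>A\<^esub> f) = h g \<cdot>\<^bsub>B\<^esub> h f"
        using eqI[OF O(1) hH[OF A.Comp_Hom[OF f g]] B.Comp_Hom[OF hH[OF f] hH[OF g]]]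
          hn[OF A.Comp_Hom[OF f g]] by simp
      then show ?thesis by simp
    qed
  qed (use F hH in simp_all)
  then have "is_left_adjoint A B ?F R"
    unfolding is_left_adjoint_def using R \<eta> h(2) u by (intro conjI exI[of _ \<eta>]) simp_all
  then show ?thesis by blast
qed

locale left_adjoint =
  fixes A :: "('o, 'a, 'y) cat_scheme" and B :: "('p, 'b, 'z) cat_scheme"
    and F :: "('o, 'a, 'p, 'b) func" and R :: "('p, 'b, 'o, 'a) func" and \<eta> :: "'o \<Rightarrow> 'a"
  assumes F: "is_functor A B F" and R: "is_functor B A R"
    and \<eta>: "x \<in> Obj A \<Longrightarrow> \<eta> x \<in> Hom A x (on_obj R (on_obj F x))"
    and \<eta>_nat: "f \<in> Arr A \<Longrightarrow> \<eta> (Cod A f) \<cdot>\<^bsub>A\<^esub> f = on_arr R (on_arr F f) \<cdot>\<^bsub>A\<^esub> \<eta> (Dom A f)"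
    and universal: "x \<in> Obj A \<Longrightarrow> y \<in> Obj B \<Longrightarrow> g \<in> Hom A x (on_obj R y) \<Longrightarrow>
             \<exists>!h. h \<in> Hom B (on_obj F x) y \<and> on_arr R h \<cdot>\<^bsub>A\<^esub> \<eta> x = g"
begin

sublocale A: category A by (rule functor_D(1)[OF F])
sublocale B: category B by (rule functor_D(2)[OF F])

lemmas FD = functor_D[OF F] and RD = functor_D[OF R]

lemma transpose:
  assumes "x \<in> Obj A" "y \<in> Obj B" "g \<in> Hom A x (on_obj R y)"
  obtains h where "h \<in> Hom B (on_obj F x) y" "on_arr R h \<cdot>\<^bsub>A\<^esub> \<eta> x = g"
  using universal[OF assms] by blast

lemma transpose_eqI:
  assumes "x \<in> Obj A" "g \<in> Hom B (on_obj F x) y" "h \<in> Hom B (on_obj F x) y"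
    "on_arr R g \<cdot>\<^bsub>A\<^esub> \<eta> x = on_arr R h \<cdot>\<^bsub>A\<^esub> \<eta> x"
  shows "g = h"
  using universal[OF assms(1) B.Hom_Obj(2)[OF assms(3)] A.Comp_Hom[OF \<eta>[OF assms(1)] RD(9)[OF assms(3)]]]
    assms by blast

lemma transpose_Comp:
  assumes "x \<in> Obj A" "g \<in> Hom B (on_obj F x) y" "k \<in> Hom B y z"
  shows "on_arr R (k \<cdot>\<^bsub>B\<^esub> g) \<cdot>\<^bsub>A\<^esub> \<eta> x = on_arr R k \<cdot>\<^bsub>A\<^esub> (on_arr R g \<cdot>\<^bsub>A\<^esub> \<eta> x)"
  using RD(8)[of g k] A.Comp_assoc[OF \<eta>[OF assms(1)] RD(9)[OF assms(2)] RD(9)[OF assms(3)]] assms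
  by (simp add: in_Hom)

lemma transpose_F:
  assumes f: "f \<in> Hom A w x" and g: "g \<in> Hom B (on_obj F x) y"
  shows "on_arr R (g \<cdot>\<^bsub>B\<^esub> on_arr F f) \<cdot>\<^bsub>A\<^esub> \<eta> w = (on_arr R g \<cdot>\<^bsub>A\<^esub> \<eta> x) \<cdot>\<^bsub>A\<^esub> f"
proof -
  note O = A.Hom_Obj[OF f]
  have "on_arr R (g \<cdot>\<^bsub>B\<^esub> on_arr F f) \<cdot>\<^bsub>A\<^esub> \<eta> w = on_arr R g \<cdot>\<^bsub>A\<^esub> (on_arr R (on_arr F f) \<cdot>\<^bsub>A\<^esub> \<eta> w)"
    by (rule transpose_Comp[OF O(1) FD(9)[OF f] g])
  also have "\<dots> = on_arr R g \<cdot>\<^bsub>A\<^esub> (\<eta> x \<cdot>\<^bsub>A\<^esub> f)" using \<eta>_nat[of f] f by (simp add: in_Hom)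
  also have "\<dots> = (on_arr R g \<cdot>\<^bsub>A\<^esub> \<eta> x) \<cdot>\<^bsub>A\<^esub> f"
    by (rule A.Comp_assoc[OF f \<eta>[OF O(2)] RD(9)[OF g]])
  finally show ?thesis .
qed

text \<open>Transposition matches squares from \<open>F i\<close> to \<open>p\<close> with squares
  from \<open>i\<close> to \<open>R p\<close>, and a lift in one of them with a lift in the
  other.\<close>

lemma has_lifting_transpose:
  assumes i: "i \<in> Arr A" and p: "p \<in> Arr B" and L: "has_lifting A i (on_arr R p)"
  shows "has_lifting B (on_arr F i) p"
proof -
  have i': "i \<in> Hom A (Dom A i) (Cod A i)" and p': "p \<in> Hom B (Dom B p) (Cod B p)"
    using i p by (simp_all add: in_Hom)
  note O = A.Hom_Obj[OF i'] B.Hom_Obj[OF p']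
  show ?thesis
  proof (rule B.has_liftingI[OF FD(9)[OF i'] p'])
    fix u v assume u: "u \<in> Hom B (on_obj F (Dom A i)) (Dom B p)"
      and v: "v \<in> Hom B (on_obj F (Cod A i)) (Cod B p)" and sq: "p \<cdot>\<^bsub>B\<^esub> u = v \<cdot>\<^bsub>B\<^esub> on_arr F i"
    let ?u = "on_arr R u \<cdot>\<^bsub>A\<^esub> \<eta> (Dom A i)" and ?v = "on_arr R v \<cdot>\<^bsub>A\<^esub> \<eta> (Cod A i)"
    have "on_arr R p \<cdot>\<^bsub>A\<^esub> ?u = ?v \<cdot>\<^bsub>A\<^esub> i"
      using transpose_Comp[OF O(1) u p'] transpose_F[OF i' v] sq by simp
    then obtain h where h: "h \<in> Hom A (Cod A i) (on_obj R (Dom B p))" "h \<cdot>\<^bsub>A\<^esub> i = ?u" "on_arr R p \<cdot>\<^bsub>A\<^esub> h = ?v"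
      by (rule A.has_liftingE[OF L i' RD(9)[OF p'] A.Comp_Hom[OF \<eta>[OF O(1)] RD(9)[OF u]]
            A.Comp_Hom[OF \<eta>[OF O(2)] RD(9)[OF v]]])
    obtain g where g: "g \<in> Hom B (on_obj F (Cod A i)) (Dom B p)" "on_arr R g \<cdot>\<^bsub>A\<^esub> \<eta> (Cod A i) = h"
      by (rule transpose[OF O(2,3) h(1)])
    have "g \<cdot>\<^bsub>B\<^esub> on_arr F i = u"
      using transpose_eqI[OF O(1) B.Comp_Hom[OF FD(9)[OF i'] g(1)] u] transpose_F[OF i' g(1)] g(2) h(2) by simp
    moreover have "p \<cdot>\<^bsub>B\<^esub> g = v"
      using transpose_eqI[OF O(2) B.Comp_Hom[OF g(1) p'] v] transpose_Comp[OF O(2) g(1) p'] g(2) h(3) by simp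
    ultimately show "\<exists>h. h \<in> Hom B (on_obj F (Cod A i)) (Dom B p) \<and> h \<cdot>\<^bsub>B\<^esub> on_arr F i = u \<and> p \<cdot>\<^bsub>B\<^esub> h = v"
      using g(1) by blast
  qed
qed

lemma preserves_initial:
  assumes I: "initial_object A I" shows "initial_object B (on_obj F I)"
  unfolding initial_object_def
proof (intro conjI ballI)
  have I': "I \<in> Obj A" using I by (simp add: initial_object_def)
  show "on_obj F I \<in> Obj B" using FD(3)[OF I'] .
  fix y assume y: "y \<in> Obj B"
  have ex: "\<exists>!g. g \<in> Hom A I (on_obj R y)" using I RD(3)[OF y] by (simp add: initial_object_def)
  then obtain g where g: "g \<in> Hom A I (on_obj R y)" by blast
  obtain h where h: "h \<in> Hom B (on_obj F I) y" by (rule transpose[OF I' y g])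
  show "\<exists>!f. f \<in> Hom B (on_obj F I) y"
  proof (rule ex1I[of _ h], rule h)
    fix f assume f: "f \<in> Hom B (on_obj F I) y"
    show "f = h"
      using transpose_eqI[OF I' f h] ex A.Comp_Hom[OF \<eta>[OF I'] RD(9)[OF f]] A.Comp_Hom[OF \<eta>[OF I'] RD(9)[OF h]]
      by blast
  qed
qed

text \<open>A universal arrow, however constructed, has the value of the adjoint as its target up to
  isomorphism. This carries properties of a concrete Kan extension over to an arbitrary one.\<close>

lemma unique_up_to_iso:
  assumes x: "x \<in> Obj A" and c: "c \<in> Obj B" and e: "e \<in> Hom A x (on_obj R c)"
    and ue: "\<And>y g. y \<in> Obj B \<Longrightarrow> g \<in> Hom A x (on_obj R y) \<Longrightarrow> \<exists>!h. h \<in> Hom B c y \<and> on_arr R h \<cdot>\<^bsub>A\<^esub> e = g"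
  obtains k where "k \<in> Hom B c (on_obj F x)" "is_iso B k"
proof -
  have Fx: "on_obj F x \<in> Obj B" using FD(3)[OF x] .
  obtain k where k: "k \<in> Hom B c (on_obj F x)" "on_arr R k \<cdot>\<^bsub>A\<^esub> e = \<eta> x" using ue[OF Fx \<eta>[OF x]] by blast
  obtain l where l: "l \<in> Hom B (on_obj F x) c" "on_arr R l \<cdot>\<^bsub>A\<^esub> \<eta> x = e" by (rule transpose[OF x c e])
  have "on_arr R (k \<cdot>\<^bsub>B\<^esub> l) \<cdot>\<^bsub>A\<^esub> \<eta> x = \<eta> x" using transpose_Comp[OF x l(1) k(1)] l(2) k(2) by simp
  moreover have "on_arr R (Ide B (on_obj F x)) \<cdot>\<^bsub>A\<^esub> \<eta> x = \<eta> x"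
    using RD(7)[OF Fx] A.Comp_Ide_left[OF \<eta>[OF x]] by simp
  ultimately have 1: "k \<cdot>\<^bsub>B\<^esub> l = Ide B (on_obj F x)"
    using transpose_eqI[OF x B.Comp_Hom[OF l(1) k(1)] B.Ide_Hom[OF Fx]] by simp
  have "on_arr R (l \<cdot>\<^bsub>B\<^esub> k) \<cdot>\<^bsub>A\<^esub> e = on_arr R l \<cdot>\<^bsub>A\<^esub> (on_arr R k \<cdot>\<^bsub>A\<^esub> e)"
    using RD(8)[of k l] A.Comp_assoc[OF e RD(9)[OF k(1)] RD(9)[OF l(1)]] k l by (simp add: in_Hom)
  then have "on_arr R (l \<cdot>\<^bsub>B\<^esub> k) \<cdot>\<^bsub>A\<^esub> e = e" using k(2) l(2) by simp
  moreover have "on_arr R (Ide B c) \<cdot>\<^bsub>A\<^esub> e = e" using RD(7)[OF c] A.Comp_Ide_left[OF e] by simp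
  ultimately have 2: "l \<cdot>\<^bsub>B\<^esub> k = Ide B c"
    using ue[OF c e] B.Comp_Hom[OF k(1) l(1)] B.Ide_Hom[OF c] by blast
  show thesis using that[OF k(1)] B.is_isoI[OF k(1) l(1) 2 1] .
qed

end

lemma left_adjointE:
  assumes "is_left_adjoint A B F R" obtains \<eta> where "left_adjoint A B F R \<eta>"
  using assms unfolding is_left_adjoint_def left_adjoint_def by blast

text \<open>Both kinds of cofibrations are lifting classes, so the adjunction transports them once
  \<open>R\<close> respects the two kinds of fibrations. Weak equivalences between cofibrant objects
  are reached by Ken Brown's argument: \<open>w\<close> is an acyclic cofibration followed by a map
  that has an acyclic cofibration as a section.\<close>

lemma left_Quillen:
  fixes N :: "('o, 'a, 'y) model_cat_scheme" and M :: "('p, 'b, 'z) model_cat_scheme"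
  assumes N: "model_category N TYPE('u)" and M: "model_category M TYPE('u)" and inf: "infinite (UNIV :: 'u set)"
    and adj: "is_left_adjoint N M F R"
    and fib: "\<And>p. p \<in> Fib M \<Longrightarrow> on_arr R p \<in> Fib N"
    and afib: "\<And>p. p \<in> Fib M \<Longrightarrow> p \<in> Weq M \<Longrightarrow> on_arr R p \<in> Weq N"
  shows "homotopy_meaningful_on_cofibrant N M F \<and> preserves_cofibrations N M F \<and>
    preserves_acyclic_cofibrations N M F \<and> preserves_cofibrant_objects N M F"
proof -
  interpret N: model_category N "TYPE('u)" by fact
  interpret M: model_category M "TYPE('u)" by fact
  obtain \<eta> where "left_adjoint N M F R \<eta>" using left_adjointE[OF adj] .
  then interpret left_adjoint N M F R \<eta> .
  have cof: "on_arr F i \<in> Cof M" if i: "i \<in> Cof N" for i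
  proof -
    have iA: "i \<in> Arr N" using i N.Cof_Arr by blast
    have "has_lifting M (on_arr F i) p" if "p \<in> Fib M \<inter> Weq M" for p
      by (rule has_lifting_transpose[OF iA]) (use that i M.Fib_Arr N.MC4 fib afib in auto)
    then show ?thesis unfolding M.Cof_eq_llp using FD(4)[OF iA] by (simp add: llp_def)
  qed
  have acof: "on_arr F i \<in> Cof M \<inter> Weq M" if i: "i \<in> Cof N \<inter> Weq N" for i
  proof -
    have iA: "i \<in> Arr N" using i N.Cof_Arr by blast
    have "has_lifting M (on_arr F i) p" if "p \<in> Fib M" for p
      by (rule has_lifting_transpose[OF iA]) (use that i M.Fib_Arr N.MC4 fib afib in auto)
    then show ?thesis unfolding M.acyclic_Cof_eq_llp using FD(4)[OF iA] by (simp add: llp_def)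
  qed
  have "cofibrant M (on_obj F X)" if X: "cofibrant N X" for X
  proof -
    obtain I i where "initial_object N I" "i \<in> Hom N I X" "i \<in> Cof N" and "X \<in> Obj N"
      using X by (auto simp: cofibrant_def)
    then show ?thesis
      unfolding cofibrant_def using preserves_initial cof FD(3,9) by blast
  qed
  moreover have "on_arr F w \<in> Weq M" if w: "w \<in> Weq N" and X: "cofibrant N (Dom N w)" and Y: "cofibrant N (Cod N w)" for w
  proof -
    let ?X = "Dom N w" and ?Y = "Cod N w"
    have wH: "w \<in> Hom N ?X ?Y" using w N.Weq_Arr by (auto simp: in_Hom)
    note O = N.Hom_Obj[OF wH]
    \<comment> \<open>The coproduct of source and target, indexed by the booleans. Its legs are
      cofibrations because both summands are cofibrant.\<close>
    let ?Z = "\<lambda>b. if b then ?X else ?Y"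
    have "presentation N UNIV ?Z {}" using O by (simp add: presentation_def)
    then obtain P \<iota> where P: "pcolimit N UNIV ?Z {} P \<iota>"
      using N.pcolimit_exists[OF _ N.MC1(2) inf card_of_ordLeq_countable[OF inf] card_of_empty] by blast
    have \<iota>: "\<iota> True \<in> Hom N ?X P" "\<iota> False \<in> Hom N ?Y P"
      using pcolimitD(3)[OF P, of True] pcolimitD(3)[OF P, of False] by simp_all
    have \<iota>c: "\<iota> True \<in> Cof N" "\<iota> False \<in> Cof N"
      using N.coproduct_leg_Cof[OF P, of True] N.coproduct_leg_Cof[OF P, of False] X Y by simp_all
    \<comment> \<open>The map to the target that is \<open>w\<close> on one summand and the identity
      on the other. Factoring it compares both summands with the same object
      \<open>z\<close>.\<close>
    have "pcocone N UNIV ?Z {} ?Y (\<lambda>b. if b then w else Ide N ?Y)"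
      using O wH N.Ide_Hom[OF O(2)] by (auto intro!: pcoconeI)
    then obtain g where g: "g \<in> Hom N P ?Y" "g \<cdot>\<^bsub>N\<^esub> \<iota> True = w" "g \<cdot>\<^bsub>N\<^esub> \<iota> False = Ide N ?Y"
      using pcolimit_induced[OF P] by (metis (full_types) UNIV_I)
    obtain z j q where j: "j \<in> Hom N P z" "j \<in> Cof N" and q: "q \<in> Hom N z ?Y" "q \<in> Fib N \<inter> Weq N" and gq: "g = q \<cdot>\<^bsub>N\<^esub> j"
      using N.MC5_acyclic_fib[OF g(1)] by blast
    have idW: "Ide N ?Y \<in> Weq N" using N.Ide_Weq[OF w wH] by simp
    \<comment> \<open>To be applied to both legs: as \<open>q\<close> is a weak equivalence,
      \<open>j i\<close> is one whenever \<open>g i\<close> is, and it is a cofibration as a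
      composite of two.\<close>
    have key: "j \<cdot>\<^bsub>N\<^esub> i \<in> Cof N \<inter> Weq N \<and> j \<cdot>\<^bsub>N\<^esub> i \<in> Hom N x z \<and> q \<cdot>\<^bsub>N\<^esub> (j \<cdot>\<^bsub>N\<^esub> i) = g \<cdot>\<^bsub>N\<^esub> i"
      if i: "i \<in> Hom N x P" "i \<in> Cof N" and W: "g \<cdot>\<^bsub>N\<^esub> i \<in> Weq N" for i x
    proof -
      have "q \<cdot>\<^bsub>N\<^esub> (j \<cdot>\<^bsub>N\<^esub> i) = g \<cdot>\<^bsub>N\<^esub> i" using N.Comp_assoc[OF i(1) j(1) q(1)] gq by simp
      moreover from this have "j \<cdot>\<^bsub>N\<^esub> i \<in> Weq N" using N.MC2[OF N.Comp_Hom[OF i(1) j(1)] q(1)] q(2) W by simp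
      ultimately show ?thesis using N.Cof_Comp[OF i(2) j(2) i(1) j(1)] N.Comp_Hom[OF i(1) j(1)] by simp
    qed
    have jX: "j \<cdot>\<^bsub>N\<^esub> \<iota> True \<in> Cof N \<inter> Weq N" "j \<cdot>\<^bsub>N\<^esub> \<iota> True \<in> Hom N ?X z" "q \<cdot>\<^bsub>N\<^esub> (j \<cdot>\<^bsub>N\<^esub> \<iota> True) = w"
      using key[OF \<iota>(1) \<iota>c(1)] g(2) w by simp_all
    have jY: "j \<cdot>\<^bsub>N\<^esub> \<iota> False \<in> Cof N \<inter> Weq N" "j \<cdot>\<^bsub>N\<^esub> \<iota> False \<in> Hom N ?Y z" "q \<cdot>\<^bsub>N\<^esub> (j \<cdot>\<^bsub>N\<^esub> \<iota> False) = Ide N ?Y"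
      using key[OF \<iota>(2) \<iota>c(2)] g(3) idW by simp_all
    have FX: "on_arr F (j \<cdot>\<^bsub>N\<^esub> \<iota> True) \<in> Weq M" and FY: "on_arr F (j \<cdot>\<^bsub>N\<^esub> \<iota> False) \<in> Weq M"
      using acof jX(1) jY(1) by blast+
    \<comment> \<open>Nothing is known about \<open>F\<close> on acyclic fibrations. That
      \<open>F q\<close> is a weak equivalence comes from its section, the image of an acyclic
      cofibration.\<close>
    have "on_arr F q \<cdot>\<^bsub>M\<^esub> on_arr F (j \<cdot>\<^bsub>N\<^esub> \<iota> False) = Ide M (on_obj F ?Y)"
      using FD(8)[of "j \<cdot>\<^bsub>N\<^esub> \<iota> False" q] jY q(1) FD(7)[OF O(2)] by (simp add: in_Hom)
    then have "on_arr F q \<in> Weq M"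
      using M.MC2[OF FD(9)[OF jY(2)] FD(9)[OF q(1)]] FY M.Ide_Weq(1)[OF FY FD(9)[OF jY(2)]] by simp
    moreover have "on_arr F w = on_arr F q \<cdot>\<^bsub>M\<^esub> on_arr F (j \<cdot>\<^bsub>N\<^esub> \<iota> True)"
      using FD(8)[of "j \<cdot>\<^bsub>N\<^esub> \<iota> True" q] jX q(1) by (simp add: in_Hom)
    ultimately show ?thesis
      using M.MC2[OF FD(9)[OF jX(2)] FD(9)[OF q(1)]] FX by simp
  qed
  ultimately show ?thesis
    using cof acof
    by (simp add: homotopy_meaningful_on_cofibrant_def preserves_cofibrations_def
        preserves_acyclic_cofibrations_def preserves_cofibrant_objects_def)
qed

section \<open>The model structure on diagrams\<close>

text \<open>The two conditions on \<open>dim\<close> drive two inductions. Arrows of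
  \<open>S\<close> lower the dimension, so every object descends to a nondegenerate one. Arrows
  leaving a nondegenerate object raise it, so cells of dimension \<open>n\<close> leave untouched
  what has been arranged below \<open>n\<close>.\<close>

locale direct_inverting = small_inverting A M S U
  for A :: "('o, 'a, 'y) cat_scheme" and M :: "('p, 'b, 'z) cat_scheme" and S and U :: "'u itself" +
  fixes dim :: "'o \<Rightarrow> nat"
  assumes S_dim: "s \<in> S \<Longrightarrow> dim (Cod A s) < dim (Dom A s)"
    and nondegenerate_dim: "u \<in> Hom A x y \<Longrightarrow> \<forall>s \<in> S. Dom A s \<noteq> x \<Longrightarrow>
      dim x < dim y \<or> x = y \<and> u = Ide A x"
begin

definition nondegenerate :: "'o \<Rightarrow> bool" where
  "nondegenerate x \<longleftrightarrow> x \<in> Obj A \<and> (\<forall>s \<in> S. Dom A s \<noteq> x)"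

text \<open>A substitute for having the same image in the localization of \<open>A\<close> at \<open>S\<close>.\<close>

definition eqv :: "'a \<Rightarrow> 'a \<Rightarrow> bool" where
  "eqv u v \<longleftrightarrow> u \<in> Arr A \<and> v \<in> Arr A \<and> Dom A u = Dom A v \<and> Cod A u = Cod A v \<and>
     (\<forall>F \<in> Obj B. on_arr F u = on_arr F v)"

text \<open>Compatibility with composition on the left makes the arrows into \<open>y\<close> modulo
  \<open>eqv\<close> vary functorially with \<open>y\<close>.\<close>

lemma eqv_Comp:
  assumes "eqv u u'" "v \<in> Arr A" "Dom A v = Cod A u"
  shows "eqv (v \<cdot>\<^bsub>A\<^esub> u) (v \<cdot>\<^bsub>A\<^esub> u')"
  using assms BD(8) by (auto simp: eqv_def)

end

text \<open>The pair of classes is instantiated twice, by cofibrations with acyclic fibrations and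
  by acyclic cofibrations with fibrations. Both halves of MC5 for diagrams thereby come from one
  construction.\<close>

locale factorizing = direct_inverting A M S U dim
  for A :: "('o, 'a, 'y) cat_scheme" and M :: "('p, 'b, 'z) cat_scheme" and S and U :: "'u itself" and dim +
  fixes Lc Rc :: "'b set"
  assumes Rc_Arr: "Rc \<subseteq> Arr M"
    and factor: "f \<in> Hom M x y \<Longrightarrow>
      \<exists>z i p. i \<in> Hom M x z \<and> p \<in> Hom M z y \<and> i \<in> Lc \<and> p \<in> Rc \<and> p \<cdot>\<^bsub>M\<^esub> i = f"
    and lift: "i \<in> Lc \<Longrightarrow> p \<in> Rc \<Longrightarrow> has_lifting M i p"
    and Rc_iso: "is_iso M g \<Longrightarrow> f \<in> Rc \<Longrightarrow> Dom M f = Cod M g \<Longrightarrow> f \<cdot>\<^bsub>M\<^esub> g \<in> Rc"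
      "is_iso M g \<Longrightarrow> f \<in> Rc \<Longrightarrow> Cod M f = Dom M g \<Longrightarrow> g \<cdot>\<^bsub>M\<^esub> f \<in> Rc"
begin

definition objectwise :: "(('o, 'a, 'p, 'b) func, 'o, 'b) nat_trans set" where
  "objectwise = {t \<in> Arr B. \<forall>y \<in> Obj A. component t y \<in> Rc}"

text \<open>This measures the progress of the construction. Only nondegenerate objects are counted,
  because the components at the others follow from theirs along arrows of \<open>S\<close>.\<close>

definition good :: "nat \<Rightarrow> (('o, 'a, 'p, 'b) func, 'o, 'b) nat_trans \<Rightarrow> bool" where
  "good n p \<longleftrightarrow> (\<forall>y. nondegenerate y \<longrightarrow> dim y < n \<longrightarrow> component p y \<in> Rc)"

text \<open>One stage of the factorization: for every nondegenerate \<open>x\<close> of dimension \<open>n\<close> factor the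
  component at \<open>x\<close> as \<open>Z x \<rightarrow> w x \<rightarrow> G x\<close>, and push out the left factors along all the arrows
  that leave \<open>x\<close>, taken modulo \<open>eqv\<close>.\<close>

lemma step:
  assumes p: "p \<in> Hom B Z G" and good: "good n p"
  shows "\<exists>Z' k p'. k \<in> Hom B Z Z' \<and> p' \<in> Hom B Z' G \<and> p' \<cdot>\<^bsub>B\<^esub> k = p \<and> good (Suc n) p' \<and>
    (\<forall>q \<in> objectwise. has_lifting B k q) \<and>
    (\<forall>y \<in> Obj A. \<forall>q \<in> Rc. has_lifting M (component k y) q) \<and>
    (\<forall>y. nondegenerate y \<longrightarrow> dim y < n \<longrightarrow> is_iso M (component k y))"
proof -
  interpret B: category B by (rule category_B)
  note pD = Hom_BD[OF p]
  note ZB = pD(3) and GB = pD(4)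
  note ZD = BD[OF ZB] and GD = BD[OF GB]
  define N where "N x \<longleftrightarrow> nondegenerate x \<and> dim x = n" for x
  have N_Obj: "x \<in> Obj A" if "N x" for x using that by (simp add: N_def nondegenerate_def)
  have "\<exists>w i q. i \<in> Hom M (on_obj Z x) w \<and> q \<in> Hom M w (on_obj G x) \<and> i \<in> Lc \<and> q \<in> Rc \<and> q \<cdot>\<^bsub>M\<^esub> i = component p x"
    if "N x" for x
    using factor[OF pD(5)[OF N_Obj[OF that]]] .
  then obtain w i q where i: "\<And>x. N x \<Longrightarrow> i x \<in> Hom M (on_obj Z x) (w x)" and q: "\<And>x. N x \<Longrightarrow> q x \<in> Hom M (w x) (on_obj G x)"
    and iL: "\<And>x. N x \<Longrightarrow> i x \<in> Lc" and qR: "\<And>x. N x \<Longrightarrow> q x \<in> Rc"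
    and qi: "\<And>x. N x \<Longrightarrow> q x \<cdot>\<^bsub>M\<^esub> i x = component p x"
    by metis
  \<comment> \<open>A cell at \<open>y\<close> is an arrow into \<open>y\<close> from an object
    treated at this stage, and it contributes a copy of \<open>w\<close> at its source.\<close>
  define cells where "cells y = {u \<in> Arr A. Cod A u = y \<and> N (Dom A u)}" for y
  have cellD: "u \<in> Hom A (Dom A u) y" "N (Dom A u)" "y \<in> Obj A" if "u \<in> cells y" for u y
    using that by (auto simp: cells_def in_Hom)
  have cell_Comp: "v \<cdot>\<^bsub>A\<^esub> u \<in> cells y" "Dom A (v \<cdot>\<^bsub>A\<^esub> u) = Dom A u"
    if "v \<in> Hom A x y" "u \<in> cells x" for v u x y
    using that by (auto simp: cells_def in_Hom)
  have cell_eqv: "u' \<in> cells y" "Dom A u' = Dom A u" "on_arr Z u' = on_arr Z u"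
    if "u \<in> cells y" "eqv u u'" for u u' y
    using that ZB by (auto simp: cells_def eqv_def)
  have w: "w x \<in> Obj M" if "N x" for x using M.Hom_Obj(2)[OF i[OF that]] .
  define I where "I y = insert None (Some ` cells y)" for y
  define X where "X y j = (case j of None \<Rightarrow> on_obj Z y | Some u \<Rightarrow> w (Dom A u))" for y j
  \<comment> \<open>The first family glues the cell \<open>u\<close> to \<open>Z y\<close> along
    \<open>i\<close>, as in a pushout. The second identifies cells that no bounded diagram
    separates; the identities on both sides only fill the format of a relation.\<close>
  define R where "R y = (\<lambda>u. (Some u, i (Dom A u), None, on_arr Z u)) ` cells y \<union>
     (\<lambda>(u, u'). (Some u, Ide M (w (Dom A u)), Some u', Ide M (w (Dom A u)))) ` {(u, u'). u \<in> cells y \<and> eqv u u'}" for y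
  have X_simps: "X y None = on_obj Z y" "X y (Some u) = w (Dom A u)" for y u by (simp_all add: X_def)
  have pres: "presentation M (I y) (X y) (R y)" if y: "y \<in> Obj A" for y
    unfolding presentation_def
  proof (intro conjI ballI)
    show "X y j \<in> Obj M" if "j \<in> I y" for j
      using that ZD(3)[OF y] w cellD(2) by (auto simp: I_def X_simps)
    fix r assume "r \<in> R y"
    then consider u where "u \<in> cells y" "r = (Some u, i (Dom A u), None, on_arr Z u)"
      | u u' where "u \<in> cells y" "eqv u u'" "r = (Some u, Ide M (w (Dom A u)), Some u', Ide M (w (Dom A u)))"
      by (auto simp: R_def)
    then show "case r of (i, f, j, g) \<Rightarrow> i \<in> I y \<and> j \<in> I y \<and> f \<in> Hom M (Dom M f) (X y i) \<and> g \<in> Hom M (Dom M f) (X y j)"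
    proof cases
      case 1
      then show ?thesis using i[OF cellD(2)[OF 1(1)]] ZD(9)[OF cellD(1)[OF 1(1)]]
        by (simp add: I_def X_simps in_Hom)
    next
      case 2
      then show ?thesis using w[OF cellD(2)[OF 2(1)]] cell_eqv[OF 2(1,2)]
        by (simp add: I_def X_simps in_Hom)
    qed
  qed
  \<comment> \<open>The relations with their identities removed. An identity can be cancelled only
    if the leg has the right source, hence the case distinction on \<open>?H\<close>.\<close>
  have cocone: "pcocone M (I y) (X y) (R y) d \<kappa> \<longleftrightarrow> d \<in> Obj M \<and> \<kappa> None \<in> Hom M (on_obj Z y) d \<and>
      (\<forall>u \<in> cells y. \<kappa> (Some u) \<in> Hom M (w (Dom A u)) d) \<and>
      (\<forall>u \<in> cells y. \<kappa> (Some u) \<cdot>\<^bsub>M\<^esub> i (Dom A u) = \<kappa> None \<cdot>\<^bsub>M\<^esub> on_arr Z u) \<and>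
      (\<forall>u \<in> cells y. \<forall>u'. eqv u u' \<longrightarrow> \<kappa> (Some u) = \<kappa> (Some u'))" for y d \<kappa>
  proof -
    let ?H = "\<forall>u \<in> cells y. \<kappa> (Some u) \<in> Hom M (w (Dom A u)) d"
    have "\<kappa> (Some u) \<cdot>\<^bsub>M\<^esub> Ide M (w (Dom A u)) = \<kappa> (Some u) \<and>
      \<kappa> (Some u') \<cdot>\<^bsub>M\<^esub> Ide M (w (Dom A u)) = \<kappa> (Some u')"
      if ?H "u \<in> cells y" "eqv u u'" for u u'
      using that cell_eqv[OF that(2,3)] M.Comp_Ide_right[of "\<kappa> (Some u)"]
        M.Comp_Ide_right[of "\<kappa> (Some u')" "w (Dom A u')"] by auto
    then have 1: "(\<forall>u \<in> cells y. \<forall>u'. eqv u u' \<longrightarrow>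
           \<kappa> (Some u) \<cdot>\<^bsub>M\<^esub> Ide M (w (Dom A u)) = \<kappa> (Some u') \<cdot>\<^bsub>M\<^esub> Ide M (w (Dom A u))) \<longleftrightarrow>
        (\<forall>u \<in> cells y. \<forall>u'. eqv u u' \<longrightarrow> \<kappa> (Some u) = \<kappa> (Some u'))" if ?H
      using that by simp
    have 2: "(\<forall>(i, f, j, g) \<in> R y. \<kappa> i \<cdot>\<^bsub>M\<^esub> f = \<kappa> j \<cdot>\<^bsub>M\<^esub> g) \<longleftrightarrow>
        (\<forall>u \<in> cells y. \<kappa> (Some u) \<cdot>\<^bsub>M\<^esub> i (Dom A u) = \<kappa> None \<cdot>\<^bsub>M\<^esub> on_arr Z u) \<and>
        (\<forall>u \<in> cells y. \<forall>u'. eqv u u' \<longrightarrow>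
           \<kappa> (Some u) \<cdot>\<^bsub>M\<^esub> Ide M (w (Dom A u)) = \<kappa> (Some u') \<cdot>\<^bsub>M\<^esub> Ide M (w (Dom A u)))"
      unfolding R_def ball_Un ball_simps(9) by auto
    have 3: "(\<forall>j \<in> I y. \<kappa> j \<in> Hom M (X y j) d) \<longleftrightarrow> \<kappa> None \<in> Hom M (on_obj Z y) d \<and>
        (\<forall>u \<in> cells y. \<kappa> (Some u) \<in> Hom M (w (Dom A u)) d)"
      by (auto simp: I_def X_simps)
    show ?thesis
    proof (cases ?H)
      case True
      then show ?thesis unfolding pcocone_def 2 3 1[OF True] by simp
    next
      case False
      then show ?thesis unfolding pcocone_def 3 by (simp only: simp_thms)
    qed
  qed
  have small_cells: "|cells y| \<le>o |UNIV :: 'u set|" for y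
    by (rule card_of_ordLeq_subset[OF _ small_A]) (auto simp: cells_def)
  have col: "\<exists>c \<kappa>. pcolimit M (I y) (X y) (R y) c \<kappa>" if y: "y \<in> Obj A" for y
  proof (rule M_pcolimit[OF pres[OF y]])
    have "|{None :: 'a option}| \<le>o |UNIV :: 'u set|" using infinite
      by (intro card_of_singl_ordLeq) auto
    then have "|{None} \<union> Some ` cells y| \<le>o |UNIV :: 'u set|"
      by (intro card_of_ordLeq_Un infinite card_of_ordLeq_image small_cells)
    then show "|I y| \<le>o |UNIV :: 'u set|" by (simp add: I_def)
    have "|{(u, u'). u \<in> cells y \<and> eqv u u'}| \<le>o |UNIV :: 'u set|"
      by (rule card_of_ordLeq_subset[OF _ card_of_ordLeq_Times[OF infinite small_A small_A]])
         (auto simp: eqv_def)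
    then show "|R y| \<le>o |UNIV :: 'u set|" unfolding R_def
      by (intro card_of_ordLeq_Un infinite card_of_ordLeq_image small_cells)
  qed
  \<comment> \<open>An arrow \<open>v\<close> moves the cell \<open>u\<close> to \<open>v u\<close>.
    Both have the same source, so the attached object stays the same and the comparison map is an
    identity.\<close>
  define \<phi> where "\<phi> v j = map_option (\<lambda>u. v \<cdot>\<^bsub>A\<^esub> u) j" for v j
  define \<xi> where "\<xi> v j = (case j of None \<Rightarrow> on_arr Z v | Some u \<Rightarrow> Ide M (w (Dom A u)))" for v j
  have \<phi>\<xi>_simps: "\<phi> v None = None" "\<phi> v (Some u) = Some (v \<cdot>\<^bsub>A\<^esub> u)"
    "\<xi> v None = on_arr Z v" "\<xi> v (Some u) = Ide M (w (Dom A u))" for v u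
    by (simp_all add: \<phi>_def \<xi>_def)
  have IE: thesis if "j \<in> I y" "j = None \<Longrightarrow> thesis" "\<And>u. j = Some u \<Longrightarrow> u \<in> cells y \<Longrightarrow> thesis" for j y thesis
    using that by (auto simp: I_def)
  have "\<exists>Z' \<kappa>. is_functor A M Z' \<and> on_obj Z' \<in> extensional (Obj A) \<and> on_arr Z' \<in> extensional (Arr A) \<and>
    (\<forall>y \<in> Obj A. pcolimit M (I y) (X y) (R y) (on_obj Z' y) (\<kappa> y)) \<and>
    (\<forall>x y v i. v \<in> Hom A x y \<longrightarrow> i \<in> I x \<longrightarrow>
        on_arr Z' v \<cdot>\<^bsub>M\<^esub> \<kappa> x i = \<kappa> y (\<phi> v i) \<cdot>\<^bsub>M\<^esub> \<xi> v i)"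
  proof (rule pcolimit_functor[OF A.category_axioms M.category_axioms pres col])
    fix v x y j assume v: "v \<in> Hom A x y" and j: "j \<in> I x"
    show "\<phi> v j \<in> I y" using j cell_Comp(1)[OF v] by (auto simp: I_def \<phi>\<xi>_simps)
    show "\<xi> v j \<in> Hom M (X x j) (X y (\<phi> v j))" using j
    proof (rule IE)
      assume "j = None" then show ?thesis using ZD(9)[OF v] by (simp add: \<phi>\<xi>_simps X_simps)
    next
      fix u assume u: "j = Some u" "u \<in> cells x"
      then show ?thesis using M.Ide_Hom[OF w[OF cellD(2)[OF u(2)]]] cell_Comp(2)[OF v u(2)]
        by (simp add: \<phi>\<xi>_simps X_simps)
    qed
  next
    fix v x y d \<kappa> assume v: "v \<in> Hom A x y" and k: "pcocone M (I y) (X y) (R y) d \<kappa>"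
    note k = k[unfolded cocone]
    have ks: "\<kappa> (Some (v \<cdot>\<^bsub>A\<^esub> u)) \<cdot>\<^bsub>M\<^esub> Ide M (w (Dom A u)) = \<kappa> (Some (v \<cdot>\<^bsub>A\<^esub> u))"
      "\<kappa> (Some (v \<cdot>\<^bsub>A\<^esub> u)) \<in> Hom M (w (Dom A u)) d"
      if "u \<in> cells x" for u
      using k cell_Comp[OF v that] M.Comp_Ide_right[of "\<kappa> (Some (v \<cdot>\<^bsub>A\<^esub> u))" "w (Dom A u)" d] by metis+
    show "pcocone M (I x) (X x) (R x) d (\<lambda>j. \<kappa> (\<phi> v j) \<cdot>\<^bsub>M\<^esub> \<xi> v j)"
      unfolding cocone \<phi>\<xi>_simps
    proof (intro conjI ballI allI impI)
      show "d \<in> Obj M" "\<kappa> None \<cdot>\<^bsub>M\<^esub> on_arr Z v \<in> Hom M (on_obj Z x) d"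
        using k M.Comp_Hom[OF ZD(9)[OF v]] by blast+
      fix u assume u: "u \<in> cells x"
      show "\<kappa> (Some (v \<cdot>\<^bsub>A\<^esub> u)) \<cdot>\<^bsub>M\<^esub> Ide M (w (Dom A u)) \<in> Hom M (w (Dom A u)) d"
        using ks[OF u] by simp
      have "\<kappa> (Some (v \<cdot>\<^bsub>A\<^esub> u)) \<cdot>\<^bsub>M\<^esub> i (Dom A (v \<cdot>\<^bsub>A\<^esub> u)) = \<kappa> None \<cdot>\<^bsub>M\<^esub> on_arr Z (v \<cdot>\<^bsub>A\<^esub> u)"
        using k cell_Comp(1)[OF v u] by blast
      also have "\<dots> = \<kappa> None \<cdot>\<^bsub>M\<^esub> (on_arr Z v \<cdot>\<^bsub>M\<^esub> on_arr Z u)"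
        using ZD(8)[of u v] cellD(1)[OF u] v by (simp add: in_Hom)
      also have "\<dots> = (\<kappa> None \<cdot>\<^bsub>M\<^esub> on_arr Z v) \<cdot>\<^bsub>M\<^esub> on_arr Z u"
        using k by (intro M.Comp_assoc[OF ZD(9)[OF cellD(1)[OF u]] ZD(9)[OF v]]) blast
      finally show "(\<kappa> (Some (v \<cdot>\<^bsub>A\<^esub> u)) \<cdot>\<^bsub>M\<^esub> Ide M (w (Dom A u))) \<cdot>\<^bsub>M\<^esub> i (Dom A u) =
          (\<kappa> None \<cdot>\<^bsub>M\<^esub> on_arr Z v) \<cdot>\<^bsub>M\<^esub> on_arr Z u"
        by (simp only: ks(1)[OF u] cell_Comp(2)[OF v u])
      fix u' assume e: "eqv u u'"
      have vu: "eqv (v \<cdot>\<^bsub>A\<^esub> u) (v \<cdot>\<^bsub>A\<^esub> u')"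
        using eqv_Comp[OF e] v cellD(1)[OF u] by (simp add: in_Hom)
      have "\<kappa> (Some (v \<cdot>\<^bsub>A\<^esub> u)) = \<kappa> (Some (v \<cdot>\<^bsub>A\<^esub> u'))"
        using k cell_Comp(1)[OF v u] vu by blast
      then show "\<kappa> (Some (v \<cdot>\<^bsub>A\<^esub> u)) \<cdot>\<^bsub>M\<^esub> Ide M (w (Dom A u)) = \<kappa> (Some (v \<cdot>\<^bsub>A\<^esub> u')) \<cdot>\<^bsub>M\<^esub> Ide M (w (Dom A u'))"
        using ks(1)[OF u] ks(1)[OF cell_eqv(1)[OF u e]] by simp
    qed
  next
    fix x j assume x: "x \<in> Obj A" and j: "j \<in> I x"
    show "\<phi> (Ide A x) j = j" "\<xi> (Ide A x) j = Ide M (X x j)"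
      using j x by (auto elim!: IE simp: \<phi>\<xi>_simps X_simps ZD(7) cells_def)
  next
    fix v v' x y z j assume v: "v \<in> Hom A x y" and v': "v' \<in> Hom A y z" and j: "j \<in> I x"
    have "\<phi> (v' \<cdot>\<^bsub>A\<^esub> v) j = \<phi> v' (\<phi> v j) \<and> \<xi> (v' \<cdot>\<^bsub>A\<^esub> v) j = \<xi> v' (\<phi> v j) \<cdot>\<^bsub>M\<^esub> \<xi> v j"
      using j
    proof (rule IE)
      assume "j = None" then show ?thesis using ZD(8)[of v v'] v v' by (simp add: \<phi>\<xi>_simps in_Hom)
    next
      fix u assume u: "j = Some u" "u \<in> cells x"
      then show ?thesis
        using A.Comp_assoc[OF cellD(1)[OF u(2)] v v'] cell_Comp(2)[OF v u(2)] w[OF cellD(2)[OF u(2)]]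
        by (simp add: \<phi>\<xi>_simps)
    qed
    then show "\<phi> (v' \<cdot>\<^bsub>A\<^esub> v) j = \<phi> v' (\<phi> v j)" "\<xi> (v' \<cdot>\<^bsub>A\<^esub> v) j = \<xi> v' (\<phi> v j) \<cdot>\<^bsub>M\<^esub> \<xi> v j" by blast+
  qed
  then obtain Z' \<kappa> where Z': "is_functor A M Z'" "on_obj Z' \<in> extensional (Obj A)" "on_arr Z' \<in> extensional (Arr A)"
    and \<kappa>: "\<And>y. y \<in> Obj A \<Longrightarrow> pcolimit M (I y) (X y) (R y) (on_obj Z' y) (\<kappa> y)"
    and \<kappa>nat: "\<And>x y v j. v \<in> Hom A x y \<Longrightarrow> j \<in> I x \<Longrightarrow>
        on_arr Z' v \<cdot>\<^bsub>M\<^esub> \<kappa> x j = \<kappa> y (\<phi> v j) \<cdot>\<^bsub>M\<^esub> \<xi> v j" by blast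
  note Z'D = functor_D[OF Z'(1)]
  \<comment> \<open>The legs are split into the inclusion \<open>a\<close> of the old diagram and
    the cells \<open>b\<close>. The equation \<open>bi\<close> describes a cell on its
    boundary.\<close>
  define a where "a y = \<kappa> y None" for y
  define b where "b y u = \<kappa> y (Some u)" for y u
  have cc: "pcocone M (I y) (X y) (R y) (on_obj Z' y) (\<kappa> y)" if "y \<in> Obj A" for y
    using pcolimitD(1)[OF \<kappa>[OF that]] .
  have a: "a y \<in> Hom M (on_obj Z y) (on_obj Z' y)" if "y \<in> Obj A" for y
    using cc[OF that] by (simp add: cocone a_def)
  have b: "b y u \<in> Hom M (w (Dom A u)) (on_obj Z' y)" and bi: "b y u \<cdot>\<^bsub>M\<^esub> i (Dom A u) = a y \<cdot>\<^bsub>M\<^esub> on_arr Z u"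
    if "u \<in> cells y" for u y
    using cc[OF cellD(3)[OF that]] that by (simp_all add: cocone a_def b_def)
  have b_eqv: "b y u = b y u'" if "u \<in> cells y" "eqv u u'" for u u' y
    using cc[OF cellD(3)[OF that(1)]] that unfolding cocone b_def by blast
  have a_nat: "on_arr Z' v \<cdot>\<^bsub>M\<^esub> a x = a y \<cdot>\<^bsub>M\<^esub> on_arr Z v" if "v \<in> Hom A x y" for v x y
    using \<kappa>nat[OF that, of None] by (simp add: a_def \<phi>\<xi>_simps I_def)
  have b_nat: "on_arr Z' v \<cdot>\<^bsub>M\<^esub> b x u = b y (v \<cdot>\<^bsub>A\<^esub> u)" if "v \<in> Hom A x y" "u \<in> cells x" for v x y u
    using \<kappa>nat[OF that(1), of "Some u"] that(2) M.Comp_Ide_right[OF b[OF cell_Comp(1)[OF that]]] cell_Comp(2)[OF that]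
    by (simp add: b_def \<phi>\<xi>_simps I_def)
  have eqI: "g = h" if "y \<in> Obj A" "g \<in> Hom M (on_obj Z' y) d" "h \<in> Hom M (on_obj Z' y) d"
    "g \<cdot>\<^bsub>M\<^esub> a y = h \<cdot>\<^bsub>M\<^esub> a y" "\<And>u. u \<in> cells y \<Longrightarrow> g \<cdot>\<^bsub>M\<^esub> b y u = h \<cdot>\<^bsub>M\<^esub> b y u" for y g h d
    by (rule M.pcolimit_eqI[OF pres[OF that(1)] \<kappa>[OF that(1)] that(2,3)])
       (use that(4,5) in \<open>auto simp: I_def a_def b_def\<close>)
  have induced: "\<exists>h. h \<in> Hom M (on_obj Z' y) d \<and> h \<cdot>\<^bsub>M\<^esub> a y = \<alpha> \<and> (\<forall>u \<in> cells y. h \<cdot>\<^bsub>M\<^esub> b y u = \<beta> u)"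
    if y: "y \<in> Obj A" and \<alpha>: "\<alpha> \<in> Hom M (on_obj Z y) d"
      and \<beta>: "\<And>u. u \<in> cells y \<Longrightarrow> \<beta> u \<in> Hom M (w (Dom A u)) d"
      "\<And>u. u \<in> cells y \<Longrightarrow> \<beta> u \<cdot>\<^bsub>M\<^esub> i (Dom A u) = \<alpha> \<cdot>\<^bsub>M\<^esub> on_arr Z u"
      "\<And>u u'. u \<in> cells y \<Longrightarrow> eqv u u' \<Longrightarrow> \<beta> u = \<beta> u'" for y d \<alpha> \<beta>
  proof -
    have "pcocone M (I y) (X y) (R y) d (case_option \<alpha> \<beta>)"
      unfolding cocone using \<alpha> \<beta>(1,2) \<beta>(3) M.Hom_Obj(2)[OF \<alpha>] by simp
    from pcolimit_induced[OF \<kappa>[OF y] this] show ?thesis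
      by (auto simp: I_def a_def b_def)
  qed
  \<comment> \<open>On the old part \<open>d s\<close> acts as the identity because \<open>Z\<close>
    inverts \<open>s\<close>. The cell \<open>u\<close> is moved to \<open>d s u\<close>, which
    agrees with \<open>u\<close> under every bounded diagram; the second family of relations was
    imposed for this.\<close>
  have Z'B: "Z' \<in> Obj B"
  proof (rule Obj_BI_all_sections[OF Z'])
    fix s d assume s: "s \<in> S" and d: "d \<in> Hom A (Cod A s) (Dom A s)" "s \<cdot>\<^bsub>A\<^esub> d = Ide A (Cod A s)"
    have sA: "s \<in> Arr A" using s S_Arr by blast
    then have ds: "d \<cdot>\<^bsub>A\<^esub> s \<in> Hom A (Dom A s) (Dom A s)" and y: "Dom A s \<in> Obj A"
      using d by (auto simp: in_Hom)
    show "on_arr Z' (d \<cdot>\<^bsub>A\<^esub> s) = Ide M (on_obj Z' (Dom A s))"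
    proof (rule eqI[OF y Z'D(9)[OF ds] M.Ide_Hom[OF Z'D(3)[OF y]]])
      show "on_arr Z' (d \<cdot>\<^bsub>A\<^esub> s) \<cdot>\<^bsub>M\<^esub> a (Dom A s) = Ide M (on_obj Z' (Dom A s)) \<cdot>\<^bsub>M\<^esub> a (Dom A s)"
        unfolding a_nat[OF ds] section_inverse[OF ZB s d]
        using a[OF y] by (simp add: in_Hom)
      fix u assume u: "u \<in> cells (Dom A s)"
      have "on_arr F ((d \<cdot>\<^bsub>A\<^esub> s) \<cdot>\<^bsub>A\<^esub> u) = on_arr F u" if F: "F \<in> Obj B" for F
        using BD(8)[OF F, of u "d \<cdot>\<^bsub>A\<^esub> s"] section_inverse[OF F s d] BD(4,6)[OF F, of u] cellD(1)[OF u] ds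
        by (simp add: in_Hom)
      then have "eqv ((d \<cdot>\<^bsub>A\<^esub> s) \<cdot>\<^bsub>A\<^esub> u) u"
        unfolding eqv_def using cellD(1)[OF u] ds by (simp add: in_Hom)
      then show "on_arr Z' (d \<cdot>\<^bsub>A\<^esub> s) \<cdot>\<^bsub>M\<^esub> b (Dom A s) u = Ide M (on_obj Z' (Dom A s)) \<cdot>\<^bsub>M\<^esub> b (Dom A s) u"
        unfolding b_nat[OF ds u] using b_eqv[OF cell_Comp(1)[OF ds u]] M.Comp_Ide_left[OF b[OF u]] by simp
    qed
  qed
  define k where "k = mk_nat A Z Z' a"
  have k: "k \<in> Hom B Z Z'"
    unfolding k_def by (rule Hom_BI[OF ZB Z'B a]) (simp_all add: a_nat)
  have k_comp: "component k y = a y" if "y \<in> Obj A" for y using that by (simp add: k_def)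
  \<comment> \<open>The universal property of \<open>Z'\<close> among bounded diagrams: to extend
    \<open>t\<close>, one map \<open>h x\<close> per treated object is enough. On the cell
    \<open>u\<close> the extension is \<open>D u\<close> after \<open>h (Dom A u)\<close>, and this
    respects \<open>eqv\<close> because \<open>D\<close> is bounded.\<close>
  have map_out: "\<exists>H. H \<in> Hom B Z' D \<and> H \<cdot>\<^bsub>B\<^esub> k = t \<and>
      (\<forall>y \<in> Obj A. \<forall>u \<in> cells y. component H y \<cdot>\<^bsub>M\<^esub> b y u = on_arr D u \<cdot>\<^bsub>M\<^esub> h (Dom A u))"
    if t: "t \<in> Hom B Z D" and h: "\<And>x. N x \<Longrightarrow> h x \<in> Hom M (w x) (on_obj D x)"
      and hi: "\<And>x. N x \<Longrightarrow> h x \<cdot>\<^bsub>M\<^esub> i x = component t x" for t D h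
  proof -
    note tD = Hom_BD[OF t]
    note DD = BD[OF tD(4)]
    have hc: "on_arr D u \<cdot>\<^bsub>M\<^esub> h (Dom A u) \<in> Hom M (w (Dom A u)) (on_obj D y)" if "u \<in> cells y" for u y
      using M.Comp_Hom[OF h[OF cellD(2)[OF that]] DD(9)[OF cellD(1)[OF that]]] .
    have "\<exists>H. H \<in> Hom M (on_obj Z' y) (on_obj D y) \<and> H \<cdot>\<^bsub>M\<^esub> a y = component t y \<and>
      (\<forall>u \<in> cells y. H \<cdot>\<^bsub>M\<^esub> b y u = on_arr D u \<cdot>\<^bsub>M\<^esub> h (Dom A u))" if y: "y \<in> Obj A" for y
    proof (rule induced[OF y tD(5)[OF y] hc])
      fix u assume u: "u \<in> cells y"
      note u' = cellD[OF u]
      have "(on_arr D u \<cdot>\<^bsub>M\<^esub> h (Dom A u)) \<cdot>\<^bsub>M\<^esub> i (Dom A u) = on_arr D u \<cdot>\<^bsub>M\<^esub> component t (Dom A u)"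
        using M.Comp_assoc[OF i[OF u'(2)] h[OF u'(2)] DD(9)[OF u'(1)]] hi[OF u'(2)] by simp
      then show "(on_arr D u \<cdot>\<^bsub>M\<^esub> h (Dom A u)) \<cdot>\<^bsub>M\<^esub> i (Dom A u) = component t y \<cdot>\<^bsub>M\<^esub> on_arr Z u"
        using tD(6)[OF u'(1)] by simp
      fix u'' assume "eqv u u''"
      then show "on_arr D u \<cdot>\<^bsub>M\<^esub> h (Dom A u) = on_arr D u'' \<cdot>\<^bsub>M\<^esub> h (Dom A u'')"
        using tD(4) by (auto simp: eqv_def)
    qed
    then obtain H where H: "\<And>y. y \<in> Obj A \<Longrightarrow> H y \<in> Hom M (on_obj Z' y) (on_obj D y)"
      "\<And>y. y \<in> Obj A \<Longrightarrow> H y \<cdot>\<^bsub>M\<^esub> a y = component t y"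
      "\<And>y u. y \<in> Obj A \<Longrightarrow> u \<in> cells y \<Longrightarrow> H y \<cdot>\<^bsub>M\<^esub> b y u = on_arr D u \<cdot>\<^bsub>M\<^esub> h (Dom A u)"
      by metis
    have HB: "mk_nat A Z' D H \<in> Hom B Z' D"
    proof (rule Hom_BI[OF Z'B tD(4) H(1)])
      fix v x y assume v: "v \<in> Hom A x y"
      note xy = A.Hom_Obj[OF v]
      show "H y \<cdot>\<^bsub>M\<^esub> on_arr Z' v = on_arr D v \<cdot>\<^bsub>M\<^esub> H x"
      proof (rule eqI[OF xy(1) M.Comp_Hom[OF Z'D(9)[OF v] H(1)[OF xy(2)]] M.Comp_Hom[OF H(1)[OF xy(1)] DD(9)[OF v]]])
        have "(H y \<cdot>\<^bsub>M\<^esub> on_arr Z' v) \<cdot>\<^bsub>M\<^esub> a x = H y \<cdot>\<^bsub>M\<^esub> (a y \<cdot>\<^bsub>M\<^esub> on_arr Z v)"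
          unfolding a_nat[OF v, symmetric]
          by (rule M.Comp_assoc[OF a[OF xy(1)] Z'D(9)[OF v] H(1)[OF xy(2)], symmetric])
        also have "\<dots> = component t y \<cdot>\<^bsub>M\<^esub> on_arr Z v"
          unfolding H(2)[OF xy(2), symmetric]
          by (rule M.Comp_assoc[OF ZD(9)[OF v] a[OF xy(2)] H(1)[OF xy(2)]])
        also have "\<dots> = on_arr D v \<cdot>\<^bsub>M\<^esub> component t x" by (rule tD(6)[OF v])
        also have "\<dots> = (on_arr D v \<cdot>\<^bsub>M\<^esub> H x) \<cdot>\<^bsub>M\<^esub> a x"
          unfolding H(2)[OF xy(1), symmetric]
          by (rule M.Comp_assoc[OF a[OF xy(1)] H(1)[OF xy(1)] DD(9)[OF v]])
        finally show "(H y \<cdot>\<^bsub>M\<^esub> on_arr Z' v) \<cdot>\<^bsub>M\<^esub> a x = (on_arr D v \<cdot>\<^bsub>M\<^esub> H x) \<cdot>\<^bsub>M\<^esub> a x" .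
      next
        fix u assume u: "u \<in> cells x"
        note u' = cellD[OF u] and vu = cell_Comp[OF v u]
        have "(H y \<cdot>\<^bsub>M\<^esub> on_arr Z' v) \<cdot>\<^bsub>M\<^esub> b x u = H y \<cdot>\<^bsub>M\<^esub> b y (v \<cdot>\<^bsub>A\<^esub> u)"
          unfolding b_nat[OF v u, symmetric]
          by (rule M.Comp_assoc[OF b[OF u] Z'D(9)[OF v] H(1)[OF xy(2)], symmetric])
        also have "\<dots> = on_arr D (v \<cdot>\<^bsub>A\<^esub> u) \<cdot>\<^bsub>M\<^esub> h (Dom A u)"
          using H(3)[OF xy(2) vu(1)] vu(2) by simp
        also have "on_arr D (v \<cdot>\<^bsub>A\<^esub> u) = on_arr D v \<cdot>\<^bsub>M\<^esub> on_arr D u"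
          using DD(8)[of u v] u'(1) v by (simp add: in_Hom)
        also have "(on_arr D v \<cdot>\<^bsub>M\<^esub> on_arr D u) \<cdot>\<^bsub>M\<^esub> h (Dom A u) = on_arr D v \<cdot>\<^bsub>M\<^esub> (on_arr D u \<cdot>\<^bsub>M\<^esub> h (Dom A u))"
          by (rule M.Comp_assoc[OF h[OF u'(2)] DD(9)[OF u'(1)] DD(9)[OF v], symmetric])
        also have "\<dots> = (on_arr D v \<cdot>\<^bsub>M\<^esub> H x) \<cdot>\<^bsub>M\<^esub> b x u"
          unfolding H(3)[OF xy(1) u, symmetric]
          by (rule M.Comp_assoc[OF b[OF u] H(1)[OF xy(1)] DD(9)[OF v]])
        finally show "(H y \<cdot>\<^bsub>M\<^esub> on_arr Z' v) \<cdot>\<^bsub>M\<^esub> b x u = (on_arr D v \<cdot>\<^bsub>M\<^esub> H x) \<cdot>\<^bsub>M\<^esub> b x u" .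
      qed
    qed
    have "mk_nat A Z' D H \<cdot>\<^bsub>B\<^esub> k = t"
      by (rule B_eqI[OF B.Comp_Hom[OF k HB] t]) (simp add: B_simps k_comp H(2))
    then show ?thesis using HB H(3) by (intro exI[of _ "mk_nat A Z' D H"]) simp
  qed
  obtain p' where p': "p' \<in> Hom B Z' G" "p' \<cdot>\<^bsub>B\<^esub> k = p"
    and p'b: "\<And>y u. y \<in> Obj A \<Longrightarrow> u \<in> cells y \<Longrightarrow> component p' y \<cdot>\<^bsub>M\<^esub> b y u = on_arr G u \<cdot>\<^bsub>M\<^esub> q (Dom A u)"
    using map_out[OF p q qi] by blast
  \<comment> \<open>An arrow that leaves a nondegenerate object of dimension \<open>n\<close> cannot
    end at a lower dimension, so nothing is glued at \<open>y\<close>.\<close>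
  have k_iso: "is_iso M (component k y)" if y: "nondegenerate y" "dim y < n" for y
  proof -
    have yA: "y \<in> Obj A" using y by (simp add: nondegenerate_def)
    have "u \<notin> cells y" for u
      using nondegenerate_dim[of u "Dom A u" y] cellD[of u y] y(2)
      by (auto simp: N_def nondegenerate_def)
    then have no_cells: "cells y = {}" by blast
    obtain h where h: "h \<in> Hom M (on_obj Z' y) (on_obj Z y)" "h \<cdot>\<^bsub>M\<^esub> a y = Ide M (on_obj Z y)"
      using induced[OF yA M.Ide_Hom[OF ZD(3)[OF yA]], of undefined] no_cells by auto
    have "(a y \<cdot>\<^bsub>M\<^esub> h) \<cdot>\<^bsub>M\<^esub> a y = Ide M (on_obj Z' y) \<cdot>\<^bsub>M\<^esub> a y"
      using M.Comp_assoc[OF a[OF yA] h(1) a[OF yA]] h(2)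
        M.Comp_Ide_right[OF a[OF yA]] M.Comp_Ide_left[OF a[OF yA]] by simp
    then have "a y \<cdot>\<^bsub>M\<^esub> h = Ide M (on_obj Z' y)"
      using eqI[OF yA M.Comp_Hom[OF h(1) a[OF yA]] M.Ide_Hom[OF Z'D(3)[OF yA]]] no_cells by simp
    then show ?thesis using M.is_isoI[OF a[OF yA] h(1) h(2)] k_comp[OF yA] by simp
  qed
  \<comment> \<open>The identity is the only cell at \<open>y\<close>, so \<open>Z' y\<close> is
    \<open>w y\<close> up to isomorphism, and under it the component of \<open>p'\<close> becomes
    the right factor \<open>q y\<close>.\<close>
  have p'_n: "component p' y \<in> Rc" if y: "N y" for y
  proof -
    have yA: "y \<in> Obj A" using N_Obj[OF y] .
    let ?e = "Ide M (w y)"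
    have cell: "u = Ide A y" if "u \<in> cells y" for u
      using nondegenerate_dim[of u "Dom A u" y] cellD[OF that] y by (auto simp: N_def nondegenerate_def)
    have id_cell: "Ide A y \<in> cells y" using y yA by (simp add: cells_def)
    have "u' = u" if "u \<in> cells y" "eqv u u'" for u u'
      using cell[OF that(1)] cell[OF cell_eqv(1)[OF that]] by simp
    moreover have "?e \<cdot>\<^bsub>M\<^esub> i (Dom A u) = i y \<cdot>\<^bsub>M\<^esub> on_arr Z u" "Dom A u = y" if "u \<in> cells y" for u
      using cell[OF that] ZD(7)[OF yA] yA M.Comp_Ide_left[OF i[OF y]] M.Comp_Ide_right[OF i[OF y]] by simp_all
    \<comment> \<open>The inverse of the cell \<open>b y (Ide A y)\<close>: it is \<open>i y\<close>
      on the old part and the identity on the single cell.\<close>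
    ultimately obtain h where h: "h \<in> Hom M (on_obj Z' y) (w y)" "h \<cdot>\<^bsub>M\<^esub> a y = i y" "h \<cdot>\<^bsub>M\<^esub> b y (Ide A y) = ?e"
      using induced[OF yA i[OF y], of "\<lambda>_. ?e"] M.Ide_Hom[OF w[OF y]] id_cell by (metis (full_types))
    have b1: "b y (Ide A y) \<in> Hom M (w y) (on_obj Z' y)" "b y (Ide A y) \<cdot>\<^bsub>M\<^esub> i y = a y"
      using b[OF id_cell] bi[OF id_cell] yA ZD(7)[OF yA] M.Comp_Ide_right[OF a[OF yA]] by simp_all
    have bh: "b y (Ide A y) \<cdot>\<^bsub>M\<^esub> h = Ide M (on_obj Z' y)"
    proof (rule eqI[OF yA M.Comp_Hom[OF h(1) b1(1)] M.Ide_Hom[OF Z'D(3)[OF yA]]])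
      show "(b y (Ide A y) \<cdot>\<^bsub>M\<^esub> h) \<cdot>\<^bsub>M\<^esub> a y = Ide M (on_obj Z' y) \<cdot>\<^bsub>M\<^esub> a y"
        using M.Comp_assoc[OF a[OF yA] h(1) b1(1), symmetric] h(2) b1(2) M.Comp_Ide_left[OF a[OF yA]] by simp
      fix u assume "u \<in> cells y"
      then have "u = Ide A y" by (rule cell)
      then show "(b y (Ide A y) \<cdot>\<^bsub>M\<^esub> h) \<cdot>\<^bsub>M\<^esub> b y u = Ide M (on_obj Z' y) \<cdot>\<^bsub>M\<^esub> b y u"
        using M.Comp_assoc[OF b1(1) h(1) b1(1), symmetric] h(3) M.Comp_Ide_left[OF b1(1)] M.Comp_Ide_right[OF b1(1)] by simp
    qed
    have h_iso: "is_iso M h" using M.is_isoI[OF h(1) b1(1) bh h(3)] .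
    note p'y = Hom_BD(5)[OF p'(1) yA]
    have "component p' y \<cdot>\<^bsub>M\<^esub> b y (Ide A y) = q y"
      using p'b[OF yA id_cell] GD(7)[OF yA] yA M.Comp_Ide_left[OF q[OF y]] by simp
    then have "q y \<cdot>\<^bsub>M\<^esub> h = component p' y"
      using M.Comp_assoc[OF h(1) b1(1) p'y] bh M.Comp_Ide_right[OF p'y] by simp
    then show ?thesis using Rc_iso(1)[OF h_iso qR[OF y]] q[OF y] h(1) by (simp add: in_Hom)
  qed
  have "good (Suc n) p'"
    unfolding good_def
  proof (intro allI impI)
    fix y assume y: "nondegenerate y" "dim y < Suc n"
    have yA: "y \<in> Obj A" using y by (simp add: nondegenerate_def)
    show "component p' y \<in> Rc"
    proof (cases "dim y = n")
      case True then show ?thesis using p'_n y by (simp add: N_def)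
    next
      case False
      then have n: "dim y < n" using y by simp
      note ky = Hom_BD(5)[OF k yA] and p'y = Hom_BD(5)[OF p'(1) yA]
      \<comment> \<open>In lower dimensions the components of \<open>p\<close> and \<open>p'\<close>
        differ only by the isomorphism \<open>component k y\<close>.\<close>
      obtain l where l: "l \<in> Hom M (on_obj Z' y) (on_obj Z y)" "component k y \<cdot>\<^bsub>M\<^esub> l = Ide M (on_obj Z' y)" "is_iso M l"
        using M.is_isoE[OF k_iso[OF y(1) n] ky] by blast
      have "component p y = component p' y \<cdot>\<^bsub>M\<^esub> component k y"
        using p'(2) yA by (auto simp: B_simps(4)[symmetric])
      then have "component p y \<cdot>\<^bsub>M\<^esub> l = component p' y"
        using M.Comp_assoc[OF l(1) ky p'y] l(2) M.Comp_Ide_right[OF p'y] by simp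
      moreover have "component p y \<in> Rc" using good y(1) n by (simp add: good_def)
      ultimately show ?thesis using Rc_iso(1)[OF l(3)] l(1) pD(5)[OF yA] by (metis in_Hom)
    qed
  qed
  \<comment> \<open>A lift in \<open>M\<close> is chosen at the identity cell of each treated object
    only, and \<open>map_out\<close> extends it. On any other cell \<open>u\<close> it lies over
    \<open>v\<close> by naturality, since \<open>u\<close> is the image of the identity cell under
    the arrow \<open>u\<close>.\<close>
  moreover have "has_lifting B k r" if r: "r \<in> objectwise" for r
  proof -
    have rH: "r \<in> Hom B (Src r) (Tgt r)" and rR: "component r y \<in> Rc" if "y \<in> Obj A" for y
      using r that by (auto simp: objectwise_def in_Hom B_simps)
    have rH: "r \<in> Hom B (Src r) (Tgt r)" using r by (simp add: objectwise_def in_Hom B_simps)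
    note rD = Hom_BD[OF rH]
    show ?thesis
    proof (rule B.has_liftingI[OF k rH])
      fix t v assume t: "t \<in> Hom B Z (Src r)" and v: "v \<in> Hom B Z' (Tgt r)" and sq: "r \<cdot>\<^bsub>B\<^esub> t = v \<cdot>\<^bsub>B\<^esub> k"
      have sqy: "component r y \<cdot>\<^bsub>M\<^esub> component t y = component v y \<cdot>\<^bsub>M\<^esub> a y" if "y \<in> Obj A" for y
        using arg_cong[OF sq, of "\<lambda>t. component t y"] that by (simp add: B_simps k_comp)
      have "\<exists>h. h \<in> Hom M (w x) (on_obj (Src r) x) \<and> h \<cdot>\<^bsub>M\<^esub> i x = component t x \<and>
          component r x \<cdot>\<^bsub>M\<^esub> h = component v x \<cdot>\<^bsub>M\<^esub> b x (Ide A x)" if x: "N x" for x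
      proof -
        have xA: "x \<in> Obj A" using N_Obj[OF x] .
        have id_cell: "Ide A x \<in> cells x" using x xA by (simp add: cells_def)
        have b1: "b x (Ide A x) \<in> Hom M (w x) (on_obj Z' x)" "b x (Ide A x) \<cdot>\<^bsub>M\<^esub> i x = a x"
          using b[OF id_cell] bi[OF id_cell] xA ZD(7)[OF xA] M.Comp_Ide_right[OF a[OF xA]] by simp_all
        note vx = Hom_BD(5)[OF v xA]
        have sq': "component r x \<cdot>\<^bsub>M\<^esub> component t x = (component v x \<cdot>\<^bsub>M\<^esub> b x (Ide A x)) \<cdot>\<^bsub>M\<^esub> i x"
          using M.Comp_assoc[OF i[OF x] b1(1) vx, symmetric] b1(2) sqy[OF xA] by simp
        obtain h where "h \<in> Hom M (w x) (on_obj (Src r) x)" "h \<cdot>\<^bsub>M\<^esub> i x = component t x"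
          "component r x \<cdot>\<^bsub>M\<^esub> h = component v x \<cdot>\<^bsub>M\<^esub> b x (Ide A x)"
          by (rule M.has_liftingE[OF lift[OF iL[OF x] rR[OF xA]] i[OF x] rD(5)[OF xA] Hom_BD(5)[OF t xA]
                M.Comp_Hom[OF b1(1) vx] sq'])
        then show ?thesis by blast
      qed
      then obtain h where h: "\<And>x. N x \<Longrightarrow> h x \<in> Hom M (w x) (on_obj (Src r) x)"
        "\<And>x. N x \<Longrightarrow> h x \<cdot>\<^bsub>M\<^esub> i x = component t x"
        "\<And>x. N x \<Longrightarrow> component r x \<cdot>\<^bsub>M\<^esub> h x = component v x \<cdot>\<^bsub>M\<^esub> b x (Ide A x)"
        by metis
      obtain H where H: "H \<in> Hom B Z' (Src r)" "H \<cdot>\<^bsub>B\<^esub> k = t"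
        and Hb: "\<And>y u. y \<in> Obj A \<Longrightarrow> u \<in> cells y \<Longrightarrow> component H y \<cdot>\<^bsub>M\<^esub> b y u = on_arr (Src r) u \<cdot>\<^bsub>M\<^esub> h (Dom A u)"
        using map_out[OF t h(1,2)] by blast
      have "r \<cdot>\<^bsub>B\<^esub> H = v"
      proof (rule B_eqI[OF B.Comp_Hom[OF H(1) rH] v])
        fix y assume y: "y \<in> Obj A"
        note Hy = Hom_BD(5)[OF H(1) y] and ry = rD(5)[OF y] and vy = Hom_BD(5)[OF v y]
        have "component r y \<cdot>\<^bsub>M\<^esub> component H y = component v y"
        proof (rule eqI[OF y M.Comp_Hom[OF Hy ry] vy])
          have "component H y \<cdot>\<^bsub>M\<^esub> a y = component t y"
            using arg_cong[OF H(2), of "\<lambda>t. component t y"] y by (simp add: B_simps k_comp)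
          then show "(component r y \<cdot>\<^bsub>M\<^esub> component H y) \<cdot>\<^bsub>M\<^esub> a y = component v y \<cdot>\<^bsub>M\<^esub> a y"
            using M.Comp_assoc[OF a[OF y] Hy ry, symmetric] sqy[OF y] by simp
          fix u assume u: "u \<in> cells y"
          note u' = cellD[OF u]
          let ?x = "Dom A u"
          have xA: "?x \<in> Obj A" using N_Obj[OF u'(2)] .
          have id_cell: "Ide A ?x \<in> cells ?x" using u'(2) xA by (simp add: cells_def)
          have bx: "b ?x (Ide A ?x) \<in> Hom M (w ?x) (on_obj Z' ?x)" using b[OF id_cell] xA by simp
          have "(component r y \<cdot>\<^bsub>M\<^esub> component H y) \<cdot>\<^bsub>M\<^esub> b y u = component r y \<cdot>\<^bsub>M\<^esub> (on_arr (Src r) u \<cdot>\<^bsub>M\<^esub> h ?x)"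
            unfolding Hb[OF y u, symmetric] by (rule M.Comp_assoc[OF b[OF u] Hy ry, symmetric])
          also have "\<dots> = (component r y \<cdot>\<^bsub>M\<^esub> on_arr (Src r) u) \<cdot>\<^bsub>M\<^esub> h ?x"
            by (rule M.Comp_assoc[OF h(1)[OF u'(2)] BD(9)[OF rD(3) u'(1)] ry])
          also have "\<dots> = on_arr (Tgt r) u \<cdot>\<^bsub>M\<^esub> (component r ?x \<cdot>\<^bsub>M\<^esub> h ?x)"
            unfolding rD(6)[OF u'(1)]
            by (rule M.Comp_assoc[OF h(1)[OF u'(2)] rD(5)[OF xA] BD(9)[OF rD(4) u'(1)], symmetric])
          also have "\<dots> = (on_arr (Tgt r) u \<cdot>\<^bsub>M\<^esub> component v ?x) \<cdot>\<^bsub>M\<^esub> b ?x (Ide A ?x)"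
            unfolding h(3)[OF u'(2)]
            by (rule M.Comp_assoc[OF bx Hom_BD(5)[OF v xA] BD(9)[OF rD(4) u'(1)]])
          also have "\<dots> = component v y \<cdot>\<^bsub>M\<^esub> (on_arr Z' u \<cdot>\<^bsub>M\<^esub> b ?x (Ide A ?x))"
            unfolding Hom_BD(6)[OF v u'(1), symmetric]
            by (rule M.Comp_assoc[OF bx Z'D(9)[OF u'(1)] vy, symmetric])
          also have "\<dots> = component v y \<cdot>\<^bsub>M\<^esub> b y u"
            using b_nat[OF u'(1) id_cell] A.Comp_Ide_right[OF u'(1)] by simp
          finally show "(component r y \<cdot>\<^bsub>M\<^esub> component H y) \<cdot>\<^bsub>M\<^esub> b y u = component v y \<cdot>\<^bsub>M\<^esub> b y u" .
        qed
        then show "component (r \<cdot>\<^bsub>B\<^esub> H) y = component v y" using y by (simp add: B_simps)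
      qed
      then show "\<exists>H. H \<in> Hom B Z' (Src r) \<and> H \<cdot>\<^bsub>B\<^esub> k = t \<and> r \<cdot>\<^bsub>B\<^esub> H = v" using H by blast
    qed
  qed
  \<comment> \<open>At a fixed \<open>y\<close> the target \<open>r\<close> is a single arrow of
    \<open>M\<close>, with no diagram to be natural in, so a lift is chosen for each cell
    separately. What remains to be ensured is that equivalent cells receive the same lift.\<close>
  moreover have "has_lifting M (component k y) r" if y: "y \<in> Obj A" and r: "r \<in> Rc" for y r
  proof -
    have rH: "r \<in> Hom M (Dom M r) (Cod M r)" using r Rc_Arr by (auto simp: in_Hom)
    show ?thesis
      unfolding k_comp[OF y]
    proof (rule M.has_liftingI[OF a[OF y] rH])
      fix t v assume t: "t \<in> Hom M (on_obj Z y) (Dom M r)" and v: "v \<in> Hom M (on_obj Z' y) (Cod M r)"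
        and sq: "r \<cdot>\<^bsub>M\<^esub> t = v \<cdot>\<^bsub>M\<^esub> a y"
      define lifts where "lifts u h \<longleftrightarrow> h \<in> Hom M (w (Dom A u)) (Dom M r) \<and>
          h \<cdot>\<^bsub>M\<^esub> i (Dom A u) = t \<cdot>\<^bsub>M\<^esub> on_arr Z u \<and> r \<cdot>\<^bsub>M\<^esub> h = v \<cdot>\<^bsub>M\<^esub> b y u" for u h
      have ex: "\<exists>h. lifts u h" if u: "u \<in> cells y" for u
      proof -
        note u' = cellD[OF u]
        note Zu = ZD(9)[OF u'(1)]
        have "r \<cdot>\<^bsub>M\<^esub> (t \<cdot>\<^bsub>M\<^esub> on_arr Z u) = (v \<cdot>\<^bsub>M\<^esub> a y) \<cdot>\<^bsub>M\<^esub> on_arr Z u"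
          unfolding sq[symmetric] by (rule M.Comp_assoc[OF Zu t rH])
        also have "\<dots> = v \<cdot>\<^bsub>M\<^esub> (b y u \<cdot>\<^bsub>M\<^esub> i (Dom A u))"
          unfolding bi[OF u] by (rule M.Comp_assoc[OF Zu a[OF y] v, symmetric])
        also have "\<dots> = (v \<cdot>\<^bsub>M\<^esub> b y u) \<cdot>\<^bsub>M\<^esub> i (Dom A u)"
          by (rule M.Comp_assoc[OF i[OF u'(2)] b[OF u] v])
        finally obtain h where "h \<in> Hom M (w (Dom A u)) (Dom M r)"
          "h \<cdot>\<^bsub>M\<^esub> i (Dom A u) = t \<cdot>\<^bsub>M\<^esub> on_arr Z u" "r \<cdot>\<^bsub>M\<^esub> h = v \<cdot>\<^bsub>M\<^esub> b y u"
          by (rule M.has_liftingE[OF lift[OF iL[OF u'(2)] r] i[OF u'(2)] rH M.Comp_Hom[OF Zu t] M.Comp_Hom[OF b[OF u] v]])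
        then show ?thesis unfolding lifts_def by blast
      qed
      \<comment> \<open>Choosing from the predicate \<open>lifts u\<close> itself makes the choice
        constant on classes of \<open>eqv\<close>: equivalent cells pose the same lifting problem,
        so the predicates are equal.\<close>
      define h where "h u = (SOME h. lifts u h)" for u
      have h: "lifts u (h u)" if "u \<in> cells y" for u
        unfolding h_def using someI_ex[OF ex[OF that]] .
      have "h u = h u'" if "u \<in> cells y" "eqv u u'" for u u'
      proof -
        have "lifts u = lifts u'"
          using cell_eqv[OF that] b_eqv[OF that] by (simp add: lifts_def fun_eq_iff)
        then show ?thesis by (simp add: h_def)
      qed
      then obtain H where H: "H \<in> Hom M (on_obj Z' y) (Dom M r)" "H \<cdot>\<^bsub>M\<^esub> a y = t" "\<And>u. u \<in> cells y \<Longrightarrow> H \<cdot>\<^bsub>M\<^esub> b y u = h u"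
        using induced[OF y t, of h] h unfolding lifts_def by metis
      have "r \<cdot>\<^bsub>M\<^esub> H = v"
      proof (rule eqI[OF y M.Comp_Hom[OF H(1) rH] v])
        show "(r \<cdot>\<^bsub>M\<^esub> H) \<cdot>\<^bsub>M\<^esub> a y = v \<cdot>\<^bsub>M\<^esub> a y"
          using M.Comp_assoc[OF a[OF y] H(1) rH, symmetric] H(2) sq by simp
        show "(r \<cdot>\<^bsub>M\<^esub> H) \<cdot>\<^bsub>M\<^esub> b y u = v \<cdot>\<^bsub>M\<^esub> b y u" if "u \<in> cells y" for u
          using M.Comp_assoc[OF b[OF that] H(1) rH, symmetric] H(3)[OF that] h[OF that] by (simp add: lifts_def)
      qed
      then show "\<exists>H. H \<in> Hom M (on_obj Z' y) (Dom M r) \<and> H \<cdot>\<^bsub>M\<^esub> a y = t \<and> r \<cdot>\<^bsub>M\<^esub> H = v"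
        using H by blast
    qed
  qed
  ultimately show ?thesis using k p' k_iso by blast
qed

end

context factorizing
begin

lemma Rc_cancel_right:
  assumes g: "is_iso M g" "g \<in> Hom M x y" and f: "f \<in> Hom M y z" and fg: "f \<cdot>\<^bsub>M\<^esub> g \<in> Rc"
  shows "f \<in> Rc"
proof -
  obtain l where l: "l \<in> Hom M y x" "g \<cdot>\<^bsub>M\<^esub> l = Ide M y" "is_iso M l"
    using M.is_isoE[OF g] by blast
  have "(f \<cdot>\<^bsub>M\<^esub> g) \<cdot>\<^bsub>M\<^esub> l = f"
    using M.Comp_assoc[OF l(1) g(2) f, symmetric] l(2) M.Comp_Ide_right[OF f] by simp
  moreover have "(f \<cdot>\<^bsub>M\<^esub> g) \<cdot>\<^bsub>M\<^esub> l \<in> Rc"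
    by (rule Rc_iso(1)[OF l(3) fg]) (use M.Comp_Hom[OF g(2) f] l(1) in \<open>simp add: in_Hom\<close>)
  ultimately show ?thesis by simp
qed

lemma Rc_cancel_left:
  assumes g: "is_iso M g" "g \<in> Hom M y z" and f: "f \<in> Hom M x y" and gf: "g \<cdot>\<^bsub>M\<^esub> f \<in> Rc"
  shows "f \<in> Rc"
proof -
  obtain l where l: "l \<in> Hom M z y" "l \<cdot>\<^bsub>M\<^esub> g = Ide M y" "is_iso M l"
    using M.is_isoE[OF g] by blast
  have "l \<cdot>\<^bsub>M\<^esub> (g \<cdot>\<^bsub>M\<^esub> f) = f"
    using M.Comp_assoc[OF f g(2) l(1)] l(2) M.Comp_Ide_left[OF f] by simp
  moreover have "l \<cdot>\<^bsub>M\<^esub> (g \<cdot>\<^bsub>M\<^esub> f) \<in> Rc"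
    by (rule Rc_iso(2)[OF l(3) gf]) (use M.Comp_Hom[OF f g(2)] l(1) in \<open>simp add: in_Hom\<close>)
  ultimately show ?thesis by simp
qed

text \<open>Every object is connected to a nondegenerate one by arrows of \<open>S\<close>, which both diagrams invert.\<close>

lemma objectwiseI:
  assumes p: "p \<in> Hom B Z G" and nd: "\<And>y. nondegenerate y \<Longrightarrow> component p y \<in> Rc"
  shows "p \<in> objectwise"
proof -
  note pD = Hom_BD[OF p]
  have "component p y \<in> Rc" if "y \<in> Obj A" for y
    using that
  proof (induction "dim y" arbitrary: y rule: less_induct)
    case less
    show ?case
    proof (cases "nondegenerate y")
      case True then show ?thesis by (rule nd)
    next
      case False
      then obtain s where s: "s \<in> S" "Dom A s = y" using less.prems by (auto simp: nondegenerate_def)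
      have sA: "s \<in> Hom A y (Cod A s)" using s S_Arr by (auto simp: in_Hom)
      note O = A.Hom_Obj[OF sA]
      have IH: "component p (Cod A s) \<in> Rc" using less.hyps[OF _ O(2)] S_dim[OF s(1)] s(2) by simp
      \<comment> \<open>In the naturality square of \<open>p\<close> at \<open>s\<close> the values
        of both diagrams at \<open>s\<close> are invertible, so membership in \<open>Rc\<close>
        passes from the component at \<open>Cod A s\<close> to the one at \<open>y\<close>.\<close>
      have iso: "is_iso M (on_arr Z s)" "is_iso M (on_arr G s)" using pD(3,4) s(1) by (auto simp: Obj_B)
      have "component p (Cod A s) \<cdot>\<^bsub>M\<^esub> on_arr Z s \<in> Rc"
        by (rule Rc_iso(1)[OF iso(1) IH]) (use pD(5)[OF O(2)] BD(9)[OF pD(3) sA] in \<open>simp add: in_Hom\<close>)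
      then have "on_arr G s \<cdot>\<^bsub>M\<^esub> component p y \<in> Rc" by (simp only: pD(6)[OF sA])
      then show ?thesis by (rule Rc_cancel_left[OF iso(2) BD(9)[OF pD(4) sA] pD(5)[OF O(1)]])
    qed
  qed
  then show ?thesis using p by (simp add: objectwise_def in_Hom)
qed

text \<open>Lifting properties pass to the colimit of the stages, and the right factor survives it
  because at a nondegenerate \<open>y\<close> the colimit is reached after finitely many stages. The
  last conclusion concerns single components; it is what shows the left factor of the acyclic kind
  to be an objectwise weak equivalence.\<close>

lemma factorization:
  assumes t: "t \<in> Hom B F G"
  shows "\<exists>Z i p. i \<in> Hom B F Z \<and> p \<in> Hom B Z G \<and> p \<cdot>\<^bsub>B\<^esub> i = t \<and> p \<in> objectwise \<and>
    (\<forall>q \<in> objectwise. has_lifting B i q) \<and>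
    (\<forall>y \<in> Obj A. \<forall>q \<in> Rc. has_lifting M (component i y) q)"
proof -
  interpret B: category B by (rule category_B)
  define stage where "stage n zp zp' k \<longleftrightarrow> k \<in> Hom B (fst zp) (fst zp') \<and> snd zp' \<cdot>\<^bsub>B\<^esub> k = snd zp \<and>
    (\<forall>q \<in> objectwise. has_lifting B k q) \<and>
    (\<forall>y \<in> Obj A. \<forall>q \<in> Rc. has_lifting M (component k y) q) \<and>
    (\<forall>y. nondegenerate y \<longrightarrow> dim y < n \<longrightarrow> is_iso M (component k y))" for n zp zp' k
  \<comment> \<open>Dependent choice of the diagrams with their maps to \<open>G\<close>. The
    transitions are only asserted to exist and are selected afterwards.\<close>
  have "\<exists>zp. \<forall>n. (snd (zp n) \<in> Hom B (fst (zp n)) G \<and> good n (snd (zp n)) \<and> (n = 0 \<longrightarrow> zp n = (F, t))) \<and>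
     (\<exists>k. stage n (zp n) (zp (Suc n)) k)"
  proof (rule dependent_nat_choice)
    show "\<exists>zp. snd zp \<in> Hom B (fst zp) G \<and> good 0 (snd zp) \<and> (0 = (0 :: nat) \<longrightarrow> zp = (F, t))"
      using t by (intro exI[of _ "(F, t)"]) (simp add: good_def)
    fix zp n assume zp: "snd zp \<in> Hom B (fst zp) G \<and> good n (snd zp) \<and> (n = 0 \<longrightarrow> zp = (F, t))"
    obtain Z' k p' where "k \<in> Hom B (fst zp) Z'" "p' \<in> Hom B Z' G" "p' \<cdot>\<^bsub>B\<^esub> k = snd zp" "good (Suc n) p'"
      "\<forall>q \<in> objectwise. has_lifting B k q" "\<forall>y \<in> Obj A. \<forall>q \<in> Rc. has_lifting M (component k y) q"
      "\<forall>y. nondegenerate y \<longrightarrow> dim y < n \<longrightarrow> is_iso M (component k y)"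
      using step[OF conjunct1[OF zp] conjunct1[OF conjunct2[OF zp]]] by blast
    then show "\<exists>zp'. (snd zp' \<in> Hom B (fst zp') G \<and> good (Suc n) (snd zp') \<and> (Suc n = 0 \<longrightarrow> zp' = (F, t))) \<and>
        (\<exists>k. stage n zp zp' k)"
      by (intro exI[of _ "(Z', p')"] conjI exI[of _ k]) (simp_all add: stage_def)
  qed
  then obtain zp where zp: "\<And>n. snd (zp n) \<in> Hom B (fst (zp n)) G" "\<And>n. good n (snd (zp n))" "zp 0 = (F, t)"
    and ex: "\<And>n. \<exists>k. stage n (zp n) (zp (Suc n)) k" by blast
  from ex obtain k where st: "\<And>n. stage n (zp n) (zp (Suc n)) (k n)" by metis
  define Z where "Z n = fst (zp n)" for n
  define p where "p n = snd (zp n)" for n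
  have p: "p n \<in> Hom B (Z n) G" for n using zp(1) by (simp add: Z_def p_def)
  have Zp0: "Z 0 = F" "p 0 = t" using zp(3) by (simp_all add: Z_def p_def)
  have k: "k n \<in> Hom B (Z n) (Z (Suc n))" and pk: "p (Suc n) \<cdot>\<^bsub>B\<^esub> k n = p n"
    and k_lift: "\<And>q. q \<in> objectwise \<Longrightarrow> has_lifting B (k n) q"
    and k_lift': "\<And>y q. y \<in> Obj A \<Longrightarrow> q \<in> Rc \<Longrightarrow> has_lifting M (component (k n) y) q"
    and k_iso: "\<And>y. nondegenerate y \<Longrightarrow> dim y < n \<Longrightarrow> is_iso M (component (k n) y)" for n
    using st[of n] by (simp_all add: stage_def Z_def p_def)
  have pres: "presentation B UNIV Z (B.seq_rel Z k)" by (rule B.seq_presentation[of k Z, OF k])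
  have small: "|UNIV :: nat set| \<le>o |UNIV :: 'u set|" by (rule card_of_ordLeq_countable[OF infinite])
  obtain C \<kappa> where C: "pcolimit B UNIV Z (B.seq_rel Z k) C \<kappa>"
    and C_at: "\<And>y. y \<in> Obj A \<Longrightarrow> pcolimit M UNIV (\<lambda>n. on_obj (Z n) y) (at (B.seq_rel Z k) y) (on_obj C y) (\<lambda>n. component (\<kappa> n) y)"
    using B_pcolimit[OF pres small card_of_ordLeq_image[OF small]] by blast
  have C_y: "pcolimit M UNIV (\<lambda>n. on_obj (Z n) y) (M.seq_rel (\<lambda>n. on_obj (Z n) y) (\<lambda>n. component (k n) y)) (on_obj C y) (\<lambda>n. component (\<kappa> n) y)"
    if y: "y \<in> Obj A" for y
  proof -
    have "at (B.seq_rel Z k) y = M.seq_rel (\<lambda>n. on_obj (Z n) y) (\<lambda>n. component (k n) y)"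
      by (simp add: at_def image_image B_simps(3)[OF y])
    then show ?thesis using C_at[OF y] by simp
  qed
  have \<kappa>: "\<kappa> n \<in> Hom B (Z n) C" for n using pcolimitD(3)[OF C] by simp
  have ky: "component (k n) y \<in> Hom M (on_obj (Z n) y) (on_obj (Z (Suc n)) y)" if "y \<in> Obj A" for n y
    using Hom_BD(5)[OF k that] .
  have "pcocone B UNIV Z (B.seq_rel Z k) G p"
    unfolding B.seq_cocone_iff[of k Z, OF k] using p pk Hom_BD(4)[OF t] by blast
  from pcolimit_induced[OF C this] obtain P where P: "P \<in> Hom B C G" "\<And>n. P \<cdot>\<^bsub>B\<^esub> \<kappa> n = p n" by blast
  have "P \<in> objectwise"
  proof (rule objectwiseI[OF P(1)])
    fix y assume y: "nondegenerate y"
    then have yA: "y \<in> Obj A" by (simp add: nondegenerate_def)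
    \<comment> \<open>The first index above \<open>dim y\<close>: from there on the transitions are
      invertible at \<open>y\<close>, and \<open>good\<close> already puts the component of
      \<open>p ?n\<close> at \<open>y\<close> into \<open>Rc\<close>.\<close>
    let ?n = "Suc (dim y)"
    have "is_iso M (component (\<kappa> ?n) y)"
      by (rule M.seq_colimit_iso[of "\<lambda>n. component (k n) y" "\<lambda>n. on_obj (Z n) y" ?n, OF ky[OF yA] _ C_y[OF yA]]) (simp add: k_iso[OF y])
    moreover have "component P y \<cdot>\<^bsub>M\<^esub> component (\<kappa> ?n) y = component (p ?n) y"
      using P(2)[of ?n] yA by (metis B_simps(4))
    moreover have "component (p ?n) y \<in> Rc" using zp(2)[of ?n] y by (simp add: good_def p_def)
    ultimately show "component P y \<in> Rc"
      using Rc_cancel_right[OF _ Hom_BD(5)[OF \<kappa> yA] Hom_BD(5)[OF P(1) yA], of ?n] by simp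
  qed
  moreover have "has_lifting B (\<kappa> 0) q" if q: "q \<in> objectwise" for q
    by (rule B.seq_lifting[of k Z q, OF k k_lift[OF q] _ C]) (use q in \<open>simp add: objectwise_def\<close>)
  moreover have "has_lifting M (component (\<kappa> 0) y) q" if "y \<in> Obj A" "q \<in> Rc" for y q
    by (rule M.seq_lifting[of "\<lambda>n. component (k n) y" "\<lambda>n. on_obj (Z n) y" q, OF ky k_lift' _ C_y]) (use that Rc_Arr in auto)
  moreover have "\<kappa> 0 \<in> Hom B F C" using \<kappa>[of 0] Zp0 by simp
  moreover have "P \<cdot>\<^bsub>B\<^esub> \<kappa> 0 = t" using P(2)[of 0] Zp0 by simp
  ultimately show ?thesis using P(1) by blast
qed

end

section \<open>Model structures on a given category\<close>

lemma extend_simps [simp]: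
  "Obj (cat.extend C (model_cat.fields W Fi Co)) = Obj C" "Arr (cat.extend C (model_cat.fields W Fi Co)) = Arr C"
  "Dom (cat.extend C (model_cat.fields W Fi Co)) = Dom C" "Cod (cat.extend C (model_cat.fields W Fi Co)) = Cod C"
  "Ide (cat.extend C (model_cat.fields W Fi Co)) = Ide C"
  "Comp (cat.extend C (model_cat.fields W Fi Co)) = Comp C"
  "Weq (cat.extend C (model_cat.fields W Fi Co)) = W" "Fib (cat.extend C (model_cat.fields W Fi Co)) = Fi"
  "Cof (cat.extend C (model_cat.fields W Fi Co)) = Co"
  by (simp_all add: cat.defs model_cat.defs)

text \<open>None of these notions looks at the three added fields, so facts about the category of
  diagrams hold verbatim for the model category built on it.\<close>

lemma extend_defs:
  fixes C :: "('o, 'a) cat" and W Fi Co :: "'a set"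
  shows "Hom (cat.extend C (model_cat.fields W Fi Co)) = Hom C"
    "category (cat.extend C (model_cat.fields W Fi Co)) \<longleftrightarrow> category C"
    "has_lifting (cat.extend C (model_cat.fields W Fi Co)) = has_lifting C"
    "is_retract (cat.extend C (model_cat.fields W Fi Co)) = is_retract C"
    "has_small_limits (cat.extend C (model_cat.fields W Fi Co)) U = has_small_limits C U"
    "has_small_colimits (cat.extend C (model_cat.fields W Fi Co)) U = has_small_colimits C U"
    "is_functor J (cat.extend C (model_cat.fields W Fi Co)) F = is_functor J C F"
    "is_functor (cat.extend C (model_cat.fields W Fi Co)) J G = is_functor C J G"
proof -
  show Hom: "Hom (cat.extend C (model_cat.fields W Fi Co)) = Hom C"
    by (simp add: Hom_def fun_eq_iff)
  show cat: "category (cat.extend C (model_cat.fields W Fi Co)) \<longleftrightarrow> category C"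
    by (simp add: category_def Hom)
  show "has_lifting (cat.extend C (model_cat.fields W Fi Co)) = has_lifting C"
    "is_retract (cat.extend C (model_cat.fields W Fi Co)) = is_retract C"
    by (simp_all add: has_lifting_def is_retract_def Hom fun_eq_iff)
  \<comment> \<open>Stated for index categories of any type, since small limits and colimits range
    over those inside \<open>'u\<close> and not over the fixed \<open>J\<close>.\<close>
  have fctr: "is_functor J (cat.extend C (model_cat.fields W Fi Co)) F = is_functor J C F"
    for J :: "('j, 'k, 'y) cat_scheme" and F by (simp add: is_functor_def Hom cat)
  show "is_functor J (cat.extend C (model_cat.fields W Fi Co)) F = is_functor J C F"
    "is_functor (cat.extend C (model_cat.fields W Fi Co)) J G = is_functor C J G"
    by (simp_all add: is_functor_def Hom cat)
  show "has_small_limits (cat.extend C (model_cat.fields W Fi Co)) U = has_small_limits C U"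
    "has_small_colimits (cat.extend C (model_cat.fields W Fi Co)) U = has_small_colimits C U"
    by (simp_all add: has_small_limits_def has_small_colimits_def fctr is_limit_def is_colimit_def is_cone_def
        is_cocone_def Hom)
qed

text \<open>Evaluation at an object is a functor and preserves retracts. This gives MC3 for the
  classes that are defined objectwise.\<close>

lemma (in inverting) component_retract:
  assumes "is_retract B f g" and y: "y \<in> Obj A"
  shows "is_retract M (component f y) (component g y)"
proof -
  interpret B: category B by (rule category_B)
  from assms(1) obtain i r j s where f: "f \<in> Arr B" and g: "g \<in> Arr B"
    and i: "i \<in> Hom B (Dom B f) (Dom B g)" and r: "r \<in> Hom B (Dom B g) (Dom B f)"
    and j: "j \<in> Hom B (Cod B f) (Cod B g)" and s: "s \<in> Hom B (Cod B g) (Cod B f)"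
    and e: "r \<cdot>\<^bsub>B\<^esub> i = Ide B (Dom B f)" "s \<cdot>\<^bsub>B\<^esub> j = Ide B (Cod B f)"
      "g \<cdot>\<^bsub>B\<^esub> i = j \<cdot>\<^bsub>B\<^esub> f" "f \<cdot>\<^bsub>B\<^esub> r = s \<cdot>\<^bsub>B\<^esub> g"
    unfolding is_retract_def by blast
  have f': "f \<in> Hom B (Dom B f) (Cod B f)" and g': "g \<in> Hom B (Dom B g) (Cod B g)"
    using f g by (simp_all add: in_Hom)
  note c = Hom_BD(5)[OF _ y]
  note E = e[THEN arg_cong, of "\<lambda>t. component t y", unfolded B_simps(3)[OF y] B_simps(4)[OF y]]
  have d: "component f y \<in> Arr M" "Dom M (component f y) = on_obj (Dom B f) y" "Cod M (component f y) = on_obj (Cod B f) y"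
    "component g y \<in> Arr M" "Dom M (component g y) = on_obj (Dom B g) y" "Cod M (component g y) = on_obj (Cod B g) y"
    using c[OF f'] c[OF g'] by (simp_all add: in_Hom)
  show ?thesis
    unfolding is_retract_def d
    by (intro conjI d(1,4), rule bexI[OF _ c[OF i]], rule bexI[OF _ c[OF r]], rule bexI[OF _ c[OF j]],
        rule bexI[OF _ c[OF s]]) (intro conjI E)
qed

text \<open>As cofibrations are defined by lifting against acyclic fibrations, one half of MC4 holds
  by definition. The other half rests on the second factorization, whose left factors lift against
  all fibrations: an acyclic cofibration turns out to be a retract of such a factor.\<close>

lemma model_structure:
  fixes M :: "('p, 'b, 'z) model_cat_scheme" and U :: "'u itself"
  assumes M: "model_category M U" and D: "direct_inverting A M S U dim"
  defines "W \<equiv> {t \<in> Arr (inv_cat A S M). \<forall>x \<in> Obj A. component t x \<in> Weq M}"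
    and "Fi \<equiv> {t \<in> Arr (inv_cat A S M). \<forall>x \<in> Obj A. component t x \<in> Fib M}"
  shows "model_category (cat.extend (inv_cat A S M) (model_cat.fields W Fi (llp (inv_cat A S M) (Fi \<inter> W)))) U"
proof -
  interpret M: model_category M U by (rule M)
  interpret direct_inverting A M S U dim by (rule D)
  interpret B: category B by (rule category_B)
  let ?C = "llp B (Fi \<inter> W)"
  let ?N = "cat.extend B (model_cat.fields W Fi ?C)"
  interpret af: factorizing A M S U dim "Cof M" "Fib M \<inter> Weq M"
  proof
    show "\<exists>z i p. i \<in> Hom M x z \<and> p \<in> Hom M z y \<and> i \<in> Cof M \<and> p \<in> Fib M \<inter> Weq M \<and> p \<cdot>\<^bsub>M\<^esub> i = f"
      if "f \<in> Hom M x y" for f x y using M.MC5_acyclic_fib[OF that] by metis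
    show "has_lifting M i p" if "i \<in> Cof M" "p \<in> Fib M \<inter> Weq M" for i p
      using M.MC4 that by blast
  qed (use M.Fib_Arr M.Fib_iso M.Weq_iso in auto)
  interpret ac: factorizing A M S U dim "Cof M \<inter> Weq M" "Fib M"
  proof
    show "\<exists>z i p. i \<in> Hom M x z \<and> p \<in> Hom M z y \<and> i \<in> Cof M \<inter> Weq M \<and> p \<in> Fib M \<and> p \<cdot>\<^bsub>M\<^esub> i = f"
      if "f \<in> Hom M x y" for f x y using M.MC5_acyclic_cof[OF that] by metis
    show "has_lifting M i p" if "i \<in> Cof M \<inter> Weq M" "p \<in> Fib M" for i p
      using M.MC4 that by blast
  qed (use M.Fib_Arr M.Fib_iso in auto)
  have FW: "Fi \<inter> W = af.objectwise" and F: "Fi = ac.objectwise"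
    by (auto simp: W_def Fi_def af.objectwise_def ac.objectwise_def)
  have W_Arr: "W \<subseteq> Arr B" and Fi_Arr: "Fi \<subseteq> Arr B" by (auto simp: W_def Fi_def)
  have MC2: "(f \<in> W \<and> g \<in> W \<longrightarrow> g \<cdot>\<^bsub>B\<^esub> f \<in> W) \<and> (f \<in> W \<and> g \<cdot>\<^bsub>B\<^esub> f \<in> W \<longrightarrow> g \<in> W) \<and>
      (g \<in> W \<and> g \<cdot>\<^bsub>B\<^esub> f \<in> W \<longrightarrow> f \<in> W)"
    if f: "f \<in> Hom B x y" and g: "g \<in> Hom B y z" for f g x y z
  proof -
    have in_W: "t \<in> W \<longleftrightarrow> (\<forall>x \<in> Obj A. component t x \<in> Weq M)" if "t \<in> Hom B a b" for t a b
      using that by (simp add: W_def in_Hom)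
    have gf: "g \<cdot>\<^bsub>B\<^esub> f \<in> W \<longleftrightarrow> (\<forall>x \<in> Obj A. component g x \<cdot>\<^bsub>M\<^esub> component f x \<in> Weq M)"
      unfolding in_W[OF B.Comp_Hom[OF f g]] by (simp add: B_simps cong: ball_cong)
    show ?thesis
      unfolding in_W[OF f] in_W[OF g] gf
      using M.MC2[OF Hom_BD(5)[OF f] Hom_BD(5)[OF g]] by meson
  qed
  have retract_lift: "f \<in> llp B P" if "is_retract B f g" "g \<in> llp B P" "P \<subseteq> Arr B" for f g P
    using that B.retract_has_lifting[OF that(1)] by (auto simp: llp_def is_retract_def)
  have MC5: "\<exists>z. \<exists>i \<in> Hom B x z. \<exists>p \<in> Hom B z y. i \<in> llp B Fi \<inter> W \<and> p \<in> Fi \<and> f = p \<cdot>\<^bsub>B\<^esub> i"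
    if f: "f \<in> Hom B x y" for f x y
  proof -
    obtain z i p where i: "i \<in> Hom B x z" and p: "p \<in> Hom B z y" "p \<cdot>\<^bsub>B\<^esub> i = f" "p \<in> Fi"
      and l: "\<forall>q \<in> Fi. has_lifting B i q" "\<forall>y \<in> Obj A. \<forall>q \<in> Fib M. has_lifting M (component i y) q"
      using ac.factorization[OF f] unfolding F by blast
    \<comment> \<open>Each component lifts against every fibration of \<open>M\<close>, which makes
      it an acyclic cofibration there.\<close>
    have "component i y \<in> Weq M" if "y \<in> Obj A" for y
    proof -
      have "component i y \<in> llp M (Fib M)"
        using l(2) Hom_BD(5)[OF i that] that by (simp add: llp_def in_Hom)
      then show ?thesis unfolding M.acyclic_Cof_eq_llp[symmetric] by blast
    qed
    then have "i \<in> llp B Fi \<inter> W" using i l(1) by (simp add: llp_def W_def in_Hom)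
    then show ?thesis using i p by blast
  qed
  show ?thesis
  proof (intro model_category.intro model_category_axioms.intro, unfold extend_simps extend_defs)
    show "category B" by (rule category_B)
    show "W \<subseteq> Arr B" "Fi \<subseteq> Arr B" by fact+
    show "?C \<subseteq> Arr B" by (auto simp: llp_def)
    show "has_small_limits B U" by (rule B_limits)
    show "has_small_colimits B U" by (rule B_colimits)
    show "(f \<in> W \<and> g \<in> W \<longrightarrow> g \<cdot>\<^bsub>B\<^esub> f \<in> W) \<and> (f \<in> W \<and> g \<cdot>\<^bsub>B\<^esub> f \<in> W \<longrightarrow> g \<in> W) \<and>
      (g \<in> W \<and> g \<cdot>\<^bsub>B\<^esub> f \<in> W \<longrightarrow> f \<in> W)" if "f \<in> Hom B x y" "g \<in> Hom B y z" for f g x y z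
      using MC2[OF that] .
    show "(g \<in> W \<longrightarrow> f \<in> W) \<and> (g \<in> Fi \<longrightarrow> f \<in> Fi) \<and> (g \<in> ?C \<longrightarrow> f \<in> ?C)" if r: "is_retract B f g" for f g
      using M.MC3[OF component_retract[OF r]] retract_lift[OF r, of "Fi \<inter> W"] Fi_Arr r
      by (auto simp: W_def Fi_def is_retract_def)
    show "has_lifting B i p" if i: "i \<in> ?C" and p: "p \<in> Fi" and w: "i \<in> W \<or> p \<in> W" for i p
    proof (cases "p \<in> W")
      case True then show ?thesis using i p by (simp add: llp_def)
    next
      case False
      then have iW: "i \<in> W" using w by blast
      have iH: "i \<in> Hom B (Dom B i) (Cod B i)" using i by (simp add: llp_def in_Hom)
      obtain z j q where j: "j \<in> Hom B (Dom B i) z" "j \<in> llp B Fi" "j \<in> W"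
        and q: "q \<in> Hom B z (Cod B i)" "q \<in> Fi" and e: "i = q \<cdot>\<^bsub>B\<^esub> j"
        using MC5[OF iH] by blast
      \<comment> \<open>By two-out-of-three \<open>q\<close> is an acyclic fibration. So the
        cofibration \<open>i\<close> lifts against it, and the retract argument applies.\<close>
      have "q \<in> W" using MC2[OF j(1) q(1)] j(3) iW e by blast
      then have "has_lifting B (q \<cdot>\<^bsub>B\<^esub> j) q" using i q(2) e by (simp add: llp_def)
      then have "is_retract B i j" using B.retract_argument[OF j(1) q(1)] e by simp
      then have "i \<in> llp B Fi" using retract_lift j(2) Fi_Arr by blast
      then show ?thesis using p by (simp add: llp_def)
    qed
    show "\<exists>z. \<exists>i \<in> Hom B x z. \<exists>p \<in> Hom B z y. i \<in> ?C \<and> p \<in> Fi \<inter> W \<and> f = p \<cdot>\<^bsub>B\<^esub> i"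
      if f: "f \<in> Hom B x y" for f x y
    proof -
      obtain z i p where i: "i \<in> Hom B x z" and p: "p \<in> Hom B z y" "p \<cdot>\<^bsub>B\<^esub> i = f" "p \<in> Fi \<inter> W"
        and l: "\<forall>q \<in> Fi \<inter> W. has_lifting B i q"
        using af.factorization[OF f] unfolding FW by blast
      have "i \<in> ?C" using i l by (simp add: llp_def in_Hom)
      then show ?thesis using i p by blast
    qed
    show "\<exists>z. \<exists>i \<in> Hom B x z. \<exists>p \<in> Hom B z y. i \<in> ?C \<inter> W \<and> p \<in> Fi \<and> f = p \<cdot>\<^bsub>B\<^esub> i"
      if "f \<in> Hom B x y" for f x y
    proof -
      have "llp B Fi \<subseteq> ?C" by (auto simp: llp_def)
      then show ?thesis using MC5[OF that] by blast
    qed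
  qed
qed

section \<open>Colimits and Kan extensions as left adjoints\<close>

definition const_diagram :: "('o, 'a, 'y) cat_scheme \<Rightarrow> ('p, 'b, 'z) cat_scheme \<Rightarrow> 'p \<Rightarrow> ('o, 'a, 'p, 'b) func" where
  "const_diagram A M c = \<lparr>on_obj = (\<lambda>x \<in> Obj A. c), on_arr = (\<lambda>v \<in> Arr A. Ide M c)\<rparr>"

definition const_functor :: "('o, 'a, 'y) cat_scheme \<Rightarrow> ('p, 'b, 'z) cat_scheme \<Rightarrow>
    ('p, 'b, ('o, 'a, 'p, 'b) func, (('o, 'a, 'p, 'b) func, 'o, 'b) nat_trans) func" where
  "const_functor A M = \<lparr>on_obj = const_diagram A M,
     on_arr = (\<lambda>h. mk_nat A (const_diagram A M (Dom M h)) (const_diagram A M (Cod M h)) (\<lambda>_. h))\<rparr>"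

context inverting
begin

abbreviation const where "const \<equiv> const_diagram A M"
abbreviation const_fun where "const_fun \<equiv> const_functor A M"

lemma const_simps:
  "x \<in> Obj A \<Longrightarrow> on_obj (const c) x = c" "v \<in> Arr A \<Longrightarrow> on_arr (const c) v = Ide M c"
  "on_obj const_fun c = const c" "x \<in> Obj A \<Longrightarrow> component (on_arr const_fun h) x = h"
  by (simp_all add: const_diagram_def const_functor_def)

lemma const_B:
  assumes c: "c \<in> Obj M" shows "const c \<in> Obj B"
proof -
  have "is_functor A M (const c)"
    by (rule functorI[OF A.category_axioms M.category_axioms])
       (use c in \<open>auto simp: const_simps in_Hom\<close>)
  moreover have "is_iso M (on_arr (const c) s)" if "s \<in> S" for s
    using that S_Arr c M.is_isoI[of "Ide M c" c c "Ide M c"] by (auto simp: const_simps in_Hom)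
  ultimately show ?thesis by (simp add: Obj_B Obj_fun_cat const_diagram_def)
qed

lemma const_fun_Hom:
  assumes h: "h \<in> Hom M c d" shows "on_arr const_fun h \<in> Hom B (const c) (const d)"
proof -
  note O = M.Hom_Obj[OF h]
  have "mk_nat A (const c) (const d) (\<lambda>_. h) \<in> Hom B (const c) (const d)"
    by (rule Hom_BI[OF const_B[OF O(1)] const_B[OF O(2)]]) (use h in \<open>auto simp: const_simps in_Hom\<close>)
  then show ?thesis using h by (simp add: const_functor_def in_Hom)
qed

lemma const_functor: "is_functor M B const_fun"
proof (rule functorI[OF M.category_axioms category_B])
  interpret B: category B by (rule category_B)
  show "on_obj const_fun c \<in> Obj B" if "c \<in> Obj M" for c using const_B[OF that] by (simp add: const_simps)
  show H: "on_arr const_fun h \<in> Hom B (on_obj const_fun c) (on_obj const_fun d)" if "h \<in> Hom M c d" for h c d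
    using const_fun_Hom[OF that] by (simp add: const_simps)
  show "on_arr const_fun (Ide M c) = Ide B (on_obj const_fun c)" if c: "c \<in> Obj M" for c
    by (rule B_eqI[OF H[OF M.Ide_Hom[OF c]] B.Ide_Hom]) (use const_B[OF c] in \<open>simp_all add: const_simps B_simps\<close>)
  show "on_arr const_fun (k \<cdot>\<^bsub>M\<^esub> h) = on_arr const_fun k \<cdot>\<^bsub>B\<^esub> on_arr const_fun h"
    if h: "h \<in> Hom M c d" and k: "k \<in> Hom M d e" for h k c d e
    by (rule B_eqI[OF H[OF M.Comp_Hom[OF h k]] B.Comp_Hom[OF H[OF h] H[OF k]]]) (simp add: const_simps B_simps)
qed

lemma cocone_component:
  assumes e: "e \<in> Hom B F (const c)" and c: "c \<in> Obj M"
  shows "is_cocone A M F c (component e)"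
  unfolding is_cocone_def
proof (intro conjI ballI c)
  note eD = Hom_BD[OF e]
  show "component e x \<in> Hom M (on_obj F x) c" if "x \<in> Obj A" for x
    using eD(5)[OF that] that by (simp add: const_simps)
  fix v assume v: "v \<in> Arr A"
  have "component e (Dom A v) \<in> Hom M (on_obj F (Dom A v)) c"
    using eD(5)[of "Dom A v"] v by (simp add: const_simps)
  then show "component e (Cod A v) \<cdot>\<^bsub>M\<^esub> on_arr F v = component e (Dom A v)"
    using eD(6)[of v "Dom A v" "Cod A v"] v by (simp add: in_Hom const_simps)
qed

lemma cocone_Hom:
  assumes F: "F \<in> Obj B" and k: "is_cocone A M F c \<kappa>"
  shows "mk_nat A F (const c) \<kappa> \<in> Hom B F (const c)"
proof -
  have c: "c \<in> Obj M" and kH: "\<And>x. x \<in> Obj A \<Longrightarrow> \<kappa> x \<in> Hom M (on_obj F x) c"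
    and kn: "\<And>v. v \<in> Arr A \<Longrightarrow> \<kappa> (Cod A v) \<cdot>\<^bsub>M\<^esub> on_arr F v = \<kappa> (Dom A v)"
    using k by (auto simp: is_cocone_def)
  show ?thesis
  proof (rule Hom_BI[OF F const_B[OF c]])
    show "\<kappa> x \<in> Hom M (on_obj F x) (on_obj (const c) x)" if "x \<in> Obj A" for x
      using kH[OF that] that by (simp add: const_simps)
    show "\<kappa> y \<cdot>\<^bsub>M\<^esub> on_arr F v = on_arr (const c) v \<cdot>\<^bsub>M\<^esub> \<kappa> x" if v: "v \<in> Hom A x y" for v x y
      using kn[of v] M.Comp_Ide_left[OF kH[OF A.Hom_Obj(1)[OF v]]] v by (simp add: in_Hom const_simps)
  qed
qed

text \<open>A cocone with vertex \<open>d\<close> is the same as a transformation to the constant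
  diagram at \<open>d\<close>. Under this identification colimiting cocones are universal
  arrows.\<close>

lemma is_colimit_iff_universal:
  assumes e: "e \<in> Hom B F (const c)" and c: "c \<in> Obj M"
  shows "is_colimit A M F c (component e) \<longleftrightarrow>
    (\<forall>d \<in> Obj M. \<forall>g \<in> Hom B F (const d). \<exists>!h. h \<in> Hom M c d \<and> on_arr const_fun h \<cdot>\<^bsub>B\<^esub> e = g)"
proof -
  interpret B: category B by (rule category_B)
  have F: "F \<in> Obj B" using Hom_BD(3)[OF e] .
  have eq: "on_arr const_fun h \<cdot>\<^bsub>B\<^esub> e = g \<longleftrightarrow> (\<forall>x \<in> Obj A. h \<cdot>\<^bsub>M\<^esub> component e x = component g x)"
    if h: "h \<in> Hom M c d" and g: "g \<in> Hom B F (const d)" for h d g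
  proof
    assume "on_arr const_fun h \<cdot>\<^bsub>B\<^esub> e = g"
    from arg_cong[OF this, of component]
    show "\<forall>x \<in> Obj A. h \<cdot>\<^bsub>M\<^esub> component e x = component g x"
      by (metis B_simps(4) const_simps(4))
  next
    assume "\<forall>x \<in> Obj A. h \<cdot>\<^bsub>M\<^esub> component e x = component g x"
    then show "on_arr const_fun h \<cdot>\<^bsub>B\<^esub> e = g"
      by (intro B_eqI[OF B.Comp_Hom[OF e const_fun_Hom[OF h]] g]) (simp add: B_simps const_simps)
  qed
  show ?thesis
  proof
    assume L: "is_colimit A M F c (component e)"
    show "\<forall>d \<in> Obj M. \<forall>g \<in> Hom B F (const d). \<exists>!h. h \<in> Hom M c d \<and> on_arr const_fun h \<cdot>\<^bsub>B\<^esub> e = g"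
    proof (intro ballI)
      fix d g assume d: "d \<in> Obj M" and g: "g \<in> Hom B F (const d)"
      have "\<exists>!h. h \<in> Hom M c d \<and> (\<forall>x \<in> Obj A. h \<cdot>\<^bsub>M\<^esub> component e x = component g x)"
        using L cocone_component[OF g d] unfolding is_colimit_def by blast
      then show "\<exists>!h. h \<in> Hom M c d \<and> on_arr const_fun h \<cdot>\<^bsub>B\<^esub> e = g"
        using eq[OF _ g] by (metis (no_types, lifting))
    qed
  next
    assume U: "\<forall>d \<in> Obj M. \<forall>g \<in> Hom B F (const d). \<exists>!h. h \<in> Hom M c d \<and> on_arr const_fun h \<cdot>\<^bsub>B\<^esub> e = g"
    show "is_colimit A M F c (component e)"
      unfolding is_colimit_def
    proof (intro conjI allI impI cocone_component[OF e c])
      fix d \<kappa> assume k: "is_cocone A M F d \<kappa>"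
      have d: "d \<in> Obj M" using k by (simp add: is_cocone_def)
      let ?g = "mk_nat A F (const d) \<kappa>"
      note g = cocone_Hom[OF F k]
      have "\<exists>!h. h \<in> Hom M c d \<and> on_arr const_fun h \<cdot>\<^bsub>B\<^esub> e = ?g" using U d g by blast
      then have "\<exists>!h. h \<in> Hom M c d \<and> (\<forall>x \<in> Obj A. h \<cdot>\<^bsub>M\<^esub> component e x = component ?g x)"
        using eq[OF _ g] by (metis (no_types, lifting))
      then show "\<exists>!h. h \<in> Hom M c d \<and> (\<forall>x \<in> Obj A. h \<cdot>\<^bsub>M\<^esub> component e x = \<kappa> x)" by simp
    qed
  qed
qed

text \<open>The colimiting cocones form the unit, and the compatibility demanded of a colimit
  functor is the naturality of that unit.\<close>

lemma colimit_functor_left_adjoint: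
  assumes "is_colimit_functor A M B Q"
  shows "is_left_adjoint B M Q const_fun"
proof -
  interpret B: category B by (rule category_B)
  from assms obtain \<iota> where Q: "is_functor B M Q"
    and \<iota>: "\<And>F. F \<in> Obj B \<Longrightarrow> is_colimit A M F (on_obj Q F) (\<iota> F)"
    and nat: "\<And>t x. t \<in> Arr B \<Longrightarrow> x \<in> Obj A \<Longrightarrow> on_arr Q t \<cdot>\<^bsub>M\<^esub> \<iota> (Src t) x = \<iota> (Tgt t) x \<cdot>\<^bsub>M\<^esub> component t x"
    unfolding is_colimit_functor_def by blast
  note QD = functor_D[OF Q]
  define \<eta> where "\<eta> F = mk_nat A F (const (on_obj Q F)) (\<iota> F)" for F
  have \<eta>: "\<eta> F \<in> Hom B F (const (on_obj Q F))" if "F \<in> Obj B" for F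
    unfolding \<eta>_def by (rule cocone_Hom[OF that]) (use \<iota>[OF that] in \<open>simp add: is_colimit_def\<close>)
  have \<eta>_comp: "component (\<eta> F) x = \<iota> F x" if "x \<in> Obj A" for F x using that by (simp add: \<eta>_def)
  have cocone_cong: "is_colimit A M F c \<kappa> \<longleftrightarrow> is_colimit A M F c \<kappa>'"
    if "\<And>x. x \<in> Obj A \<Longrightarrow> \<kappa> x = \<kappa>' x" for F c \<kappa> \<kappa>'
    using that by (simp add: is_colimit_def is_cocone_def)
  show ?thesis
    unfolding is_left_adjoint_def
  proof (intro conjI exI[of _ \<eta>])
    show "\<forall>F \<in> Obj B. \<eta> F \<in> Hom B F (on_obj const_fun (on_obj Q F))" using \<eta> by (simp add: const_simps)
    show "\<forall>t \<in> Arr B. \<eta> (Cod B t) \<cdot>\<^bsub>B\<^esub> t = on_arr const_fun (on_arr Q t) \<cdot>\<^bsub>B\<^esub> \<eta> (Dom B t)"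
    proof
      fix t assume t: "t \<in> Arr B"
      then have t': "t \<in> Hom B (Dom B t) (Cod B t)" by (simp add: in_Hom)
      note O = B.Hom_Obj[OF t']
      show "\<eta> (Cod B t) \<cdot>\<^bsub>B\<^esub> t = on_arr const_fun (on_arr Q t) \<cdot>\<^bsub>B\<^esub> \<eta> (Dom B t)"
        by (rule B_eqI[OF B.Comp_Hom[OF t' \<eta>[OF O(2)]] B.Comp_Hom[OF \<eta>[OF O(1)] const_fun_Hom[OF QD(9)[OF t']]]])
           (use nat[OF t] in \<open>simp add: B_simps const_simps \<eta>_comp\<close>)
    qed
    show "\<forall>F \<in> Obj B. \<forall>y \<in> Obj M. \<forall>g \<in> Hom B F (on_obj const_fun y).
        \<exists>!h. h \<in> Hom M (on_obj Q F) y \<and> on_arr const_fun h \<cdot>\<^bsub>B\<^esub> \<eta> F = g"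
    proof
      fix F assume F: "F \<in> Obj B"
      have "is_colimit A M F (on_obj Q F) (component (\<eta> F))"
        using \<iota>[OF F] cocone_cong[of "\<iota> F" "component (\<eta> F)"] \<eta>_comp by simp
      then show "\<forall>y \<in> Obj M. \<forall>g \<in> Hom B F (on_obj const_fun y).
          \<exists>!h. h \<in> Hom M (on_obj Q F) y \<and> on_arr const_fun h \<cdot>\<^bsub>B\<^esub> \<eta> F = g"
        unfolding const_simps is_colimit_iff_universal[OF \<eta>[OF F] QD(3)[OF F]] .
    qed
  qed (fact Q const_functor)+
qed

end

context small_inverting
begin

text \<open>Colimits of single diagrams are universal arrows to the constant diagram functor and
  assemble into a left adjoint. Read backwards, the components of the unit of such an adjoint are
  colimiting cocones.\<close>

lemma colimit_functor_exists: "\<exists>Q. is_colimit_functor A M B Q"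
proof -
  interpret B: category B by (rule category_B)
  have "\<exists>Q. is_left_adjoint B M Q const_fun"
  proof (rule left_adjoint_exists[OF const_functor])
    fix F assume F: "F \<in> Obj B"
    have "has_small_colimits M TYPE('u)" using colimits by (simp add: has_small_colimits_def)
    then obtain c \<iota> where L: "is_colimit A M F c \<iota>"
      using small_colimit[OF B_functor[OF F] _ small_A] by blast
    then have k: "is_cocone A M F c \<iota>" and c: "c \<in> Obj M" by (simp_all add: is_colimit_def is_cocone_def)
    note e = cocone_Hom[OF F k]
    have "is_colimit A M F c (component (mk_nat A F (const c) \<iota>))"
      using L by (simp add: is_colimit_def is_cocone_def)
    then show "\<exists>c e. c \<in> Obj M \<and> e \<in> Hom B F (on_obj const_fun c) \<and>
      (\<forall>y \<in> Obj M. \<forall>g \<in> Hom B F (on_obj const_fun y). \<exists>!h. h \<in> Hom M c y \<and> on_arr const_fun h \<cdot>\<^bsub>B\<^esub> e = g)"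
      unfolding const_simps is_colimit_iff_universal[OF e c] using c e by blast
  qed
  then obtain Q \<eta> where "left_adjoint B M Q const_fun \<eta>" using left_adjointE by metis
  then interpret Q: left_adjoint B M Q const_fun \<eta> .
  have "is_colimit_functor A M B Q"
    unfolding is_colimit_functor_def
  proof (intro conjI exI[of _ "\<lambda>F. component (\<eta> F)"] ballI Q.F)
    fix F assume F: "F \<in> Obj B"
    show "is_colimit A M F (on_obj Q F) (component (\<eta> F))"
      using is_colimit_iff_universal[of "\<eta> F" F "on_obj Q F"] Q.\<eta>[OF F] Q.FD(3)[OF F] Q.universal[OF F]
      by (simp add: const_simps)
  next
    fix t x assume t: "t \<in> Arr B" and x: "x \<in> Obj A"
    show "on_arr Q t \<cdot>\<^bsub>M\<^esub> component (\<eta> (Src t)) x = component (\<eta> (Tgt t)) x \<cdot>\<^bsub>M\<^esub> component t x"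
      using arg_cong[OF Q.\<eta>_nat[OF t], of "\<lambda>t. component t x"] x by (simp add: B_simps const_simps)
  qed
  then show ?thesis by blast
qed

end

section \<open>Restriction and left Kan extension\<close>

lemma left_adjoint_full_subcategory:
  assumes "is_left_adjoint A B F R"
    and pq: "\<And>x. x \<in> Obj A \<Longrightarrow> p x \<Longrightarrow> q (on_obj F x)" and qp: "\<And>y. y \<in> Obj B \<Longrightarrow> q y \<Longrightarrow> p (on_obj R y)"
  shows "is_left_adjoint (full_subcategory A p) (full_subcategory B q) F R"
proof -
  obtain \<eta> where "left_adjoint A B F R \<eta>" using left_adjointE[OF assms(1)] .
  then interpret left_adjoint A B F R \<eta> .
  let ?A = "full_subcategory A p" and ?B = "full_subcategory B q"
  have A: "category ?A" and B: "category ?B"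
    using category_full_subcategory A.category_axioms B.category_axioms by blast+
  have 1: "is_functor ?A ?B F"
    by (rule functorI[OF A B])
       (use pq FD(3,7,8) FD(9) in \<open>auto simp: in_Hom_full_subcategory A.Hom_Obj in_Hom FD\<close>)
  have 2: "is_functor ?B ?A R"
    by (rule functorI[OF B A])
       (use qp RD(3,7,8) RD(9) in \<open>auto simp: in_Hom_full_subcategory B.Hom_Obj in_Hom RD\<close>)
  show ?thesis
    unfolding is_left_adjoint_def
    using 1 2 \<eta> \<eta>_nat universal pq qp FD(3) RD(3)
    by (intro conjI exI[of _ \<eta>]) (simp_all add: in_Hom_full_subcategory)
qed

lemma precomposition_functor:
  assumes P: "is_functor L K P" and M: "category M"
  shows "is_functor (fun_cat K M) (fun_cat L M) (precomposition L P)"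
proof -
  note PD = functor_D[OF P]
  interpret L: category L by (rule PD(1))
  interpret K: category K by (rule PD(2))
  interpret M: category M by (rule M)
  interpret FL: category "fun_cat L M" by (rule category_fun_cat[OF PD(1) M])
  let ?R = "precomposition L P"
  have R_obj: "on_obj (on_obj ?R F) x = on_obj F (on_obj P x)" if "x \<in> Obj L" for F x
    using that by (simp add: precomposition_def)
  have R_arr: "on_arr (on_obj ?R F) v = on_arr F (on_arr P v)" if "v \<in> Arr L" for F v
    using that by (simp add: precomposition_def)
  have R_comp: "component (on_arr ?R t) x = component t (on_obj P x)" if "x \<in> Obj L" for t x
    using that by (simp add: precomposition_def)
  have obj: "on_obj ?R F \<in> Obj (fun_cat L M)" if "F \<in> Obj (fun_cat K M)" for F
  proof -
    have F: "is_functor K M F" using that by (simp add: Obj_fun_cat)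
    note FD = functor_D[OF F]
    have "is_functor L M (on_obj ?R F)"
      by (rule functorI[OF PD(1) M]) (auto simp: R_obj R_arr in_Hom PD FD)
    then show ?thesis by (simp add: Obj_fun_cat precomposition_def)
  qed
  have hom: "on_arr ?R t \<in> Hom (fun_cat L M) (on_obj ?R F) (on_obj ?R G)" if t: "t \<in> Hom (fun_cat K M) F G" for t F G
  proof -
    note tD = Hom_fun_catD[OF t]
    have "mk_nat L (on_obj ?R F) (on_obj ?R G) (\<lambda>x. component t (on_obj P x)) \<in> Hom (fun_cat L M) (on_obj ?R F) (on_obj ?R G)"
    proof (rule Hom_fun_catI[OF obj[OF tD(3)] obj[OF tD(4)]])
      show "component t (on_obj P x) \<in> Hom M (on_obj (on_obj ?R F) x) (on_obj (on_obj ?R G) x)" if "x \<in> Obj L" for x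
        using tD(5)[OF PD(3)[OF that]] that by (simp add: R_obj)
      show "component t (on_obj P y) \<cdot>\<^bsub>M\<^esub> on_arr (on_obj ?R F) v = on_arr (on_obj ?R G) v \<cdot>\<^bsub>M\<^esub> component t (on_obj P x)"
        if v: "v \<in> Hom L x y" for v x y
        using tD(6)[OF PD(9)[OF v]] v by (simp add: R_arr in_Hom)
    qed
    then show ?thesis using tD(1,2) by (simp add: precomposition_def mk_nat_def)
  qed
  show ?thesis
  proof (rule functorI[OF category_fun_cat[OF PD(2) M] category_fun_cat[OF PD(1) M] obj hom])
    show "on_arr ?R (Ide (fun_cat K M) F) = Ide (fun_cat L M) (on_obj ?R F)" if F: "F \<in> Obj (fun_cat K M)" for F
      by (rule fun_cat_eqI[OF hom[OF category.Ide_Hom[OF category_fun_cat[OF PD(2) M] F]] FL.Ide_Hom[OF obj[OF F]]])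
         (simp add: R_comp fun_cat_simps R_obj PD(3))
    show "on_arr ?R (u \<cdot>\<^bsub>fun_cat K M\<^esub> t) = on_arr ?R u \<cdot>\<^bsub>fun_cat L M\<^esub> on_arr ?R t"
      if t: "t \<in> Hom (fun_cat K M) F G" and u: "u \<in> Hom (fun_cat K M) G H" for t u F G H
      by (rule fun_cat_eqI[OF hom[OF category.Comp_Hom[OF category_fun_cat[OF PD(2) M] t u]] FL.Comp_Hom[OF hom[OF t] hom[OF u]]])
         (simp add: R_comp fun_cat_simps PD(3))
  qed
qed

text \<open>The left Kan extension of \<open>F\<close> along \<open>P\<close> at \<open>y\<close> is the colimit of the \<open>F x\<close> over all arrows
  \<open>P x \<rightarrow> y\<close>. Besides its universal property we record that the arrows \<open>G \<alpha> \<cdot> \<eta> x\<close> into \<open>G y\<close>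
  are jointly epic.\<close>

lemma Kan_extension_exists:
  fixes L :: "('c, 'd, 'y) cat_scheme" and K :: "('o, 'a, 'x) cat_scheme" and M :: "('p, 'b, 'z) cat_scheme"
  assumes P: "is_functor L K P" and M: "category M" and colim: "has_small_colimits M TYPE('u)"
    and inf: "infinite (UNIV :: 'u set)"
    and L_small: "|Arr L| \<le>o |UNIV :: 'u set|" and K_small: "|Arr K| \<le>o |UNIV :: 'u set|"
    and F: "F \<in> Obj (fun_cat L M)"
  shows "\<exists>G \<eta>. G \<in> Obj (fun_cat K M) \<and> \<eta> \<in> Hom (fun_cat L M) F (on_obj (precomposition L P) G) \<and>
    (\<forall>D \<in> Obj (fun_cat K M). \<forall>t \<in> Hom (fun_cat L M) F (on_obj (precomposition L P) D).
      \<exists>!h. h \<in> Hom (fun_cat K M) G D \<and> on_arr (precomposition L P) h \<cdot>\<^bsub>fun_cat L M\<^esub> \<eta> = t) \<and>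
    (\<forall>y \<in> Obj K. \<forall>d. \<forall>g \<in> Hom M (on_obj G y) d. \<forall>h \<in> Hom M (on_obj G y) d.
      (\<forall>x \<in> Obj L. \<forall>\<alpha> \<in> Hom K (on_obj P x) y.
         g \<cdot>\<^bsub>M\<^esub> (on_arr G \<alpha> \<cdot>\<^bsub>M\<^esub> component \<eta> x) = h \<cdot>\<^bsub>M\<^esub> (on_arr G \<alpha> \<cdot>\<^bsub>M\<^esub> component \<eta> x)) \<longrightarrow> g = h)"
proof -
  note PD = functor_D[OF P]
  interpret L: category L by (rule PD(1))
  interpret K: category K by (rule PD(2))
  interpret M: category M by (rule M)
  interpret FL: category "fun_cat L M" by (rule category_fun_cat[OF PD(1) M])
  let ?R = "precomposition L P"
  note RD = functor_D[OF precomposition_functor[OF P M]]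
  have R_obj: "on_obj (on_obj ?R F) x = on_obj F (on_obj P x)" if "x \<in> Obj L" for F x
    using that by (simp add: precomposition_def)
  have R_arr: "on_arr (on_obj ?R F) v = on_arr F (on_arr P v)" if "v \<in> Arr L" for F v
    using that by (simp add: precomposition_def)
  have R_comp: "component (on_arr ?R t) x = component t (on_obj P x)" if "x \<in> Obj L" for t x
    using that by (simp add: precomposition_def)
  have F': "is_functor L M F" using F by (simp add: Obj_fun_cat)
  note FD = functor_D[OF F']
  \<comment> \<open>The objects of the comma category of \<open>P\<close> over
    \<open>y\<close>.\<close>
  define I where "I y = {(x, \<alpha>). x \<in> Obj L \<and> \<alpha> \<in> Hom K (on_obj P x) y}" for y
  define X where "X = (\<lambda>(y :: 'o) (x, \<alpha> :: 'a). on_obj F x)"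
  \<comment> \<open>One relation per arrow of the comma category: \<open>u\<close> leads from its
    source with \<open>\<alpha> P u\<close> to its target with \<alpha>.\<close>
  define R where "R y = (\<lambda>(u, \<alpha>). ((Cod L u, \<alpha>), on_arr F u, (Dom L u, \<alpha> \<cdot>\<^bsub>K\<^esub> on_arr P u), Ide M (on_obj F (Dom L u)))) `
      {(u, \<alpha>). u \<in> Arr L \<and> \<alpha> \<in> Hom K (on_obj P (Cod L u)) y}" for y
  have X: "X y (x, \<alpha>) = on_obj F x" for y x \<alpha> by (simp add: X_def)
  have relE: thesis if "r \<in> R y" "\<And>u x x' \<alpha>. u \<in> Hom L x x' \<Longrightarrow> \<alpha> \<in> Hom K (on_obj P x') y \<Longrightarrow>
      r = ((x', \<alpha>), on_arr F u, (x, \<alpha> \<cdot>\<^bsub>K\<^esub> on_arr P u), Ide M (on_obj F x)) \<Longrightarrow> thesis" for r y thesis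
    using that by (fastforce simp: R_def in_Hom)
  have Pu: "\<alpha> \<cdot>\<^bsub>K\<^esub> on_arr P u \<in> Hom K (on_obj P x) y" if "u \<in> Hom L x x'" "\<alpha> \<in> Hom K (on_obj P x') y" for u x x' \<alpha> y
    using K.Comp_Hom[OF PD(9)[OF that(1)] that(2)] .
  have pres: "presentation M (I y) (X y) (R y)" if y: "y \<in> Obj K" for y
    unfolding presentation_def
  proof (intro conjI ballI)
    show "X y i \<in> Obj M" if "i \<in> I y" for i using that FD(3) by (auto simp: I_def X)
    fix r assume "r \<in> R y"
    then show "case r of (i, f, j, g) \<Rightarrow> i \<in> I y \<and> j \<in> I y \<and> f \<in> Hom M (Dom M f) (X y i) \<and> g \<in> Hom M (Dom M f) (X y j)"
    proof (rule relE)
      fix u x x' \<alpha> assume u: "u \<in> Hom L x x'" and \<alpha>: "\<alpha> \<in> Hom K (on_obj P x') y"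
        and r: "r = ((x', \<alpha>), on_arr F u, (x, \<alpha> \<cdot>\<^bsub>K\<^esub> on_arr P u), Ide M (on_obj F x))"
      note O = L.Hom_Obj[OF u]
      show ?thesis
        using FD(9)[OF u] \<alpha> Pu[OF u \<alpha>] O M.Ide_Hom[OF FD(3)[OF O(1)]] by (simp add: r I_def X in_Hom)
    qed
  qed
  have cocone: "pcocone M (I y) (X y) (R y) d b \<longleftrightarrow> d \<in> Obj M \<and>
      (\<forall>x \<in> Obj L. \<forall>\<alpha> \<in> Hom K (on_obj P x) y. b (x, \<alpha>) \<in> Hom M (on_obj F x) d) \<and>
      (\<forall>x x' \<alpha> u. u \<in> Hom L x x' \<longrightarrow> \<alpha> \<in> Hom K (on_obj P x') y \<longrightarrow> b (x', \<alpha>) \<cdot>\<^bsub>M\<^esub> on_arr F u = b (x, \<alpha> \<cdot>\<^bsub>K\<^esub> on_arr P u))"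
    (is "_ \<longleftrightarrow> _ \<and> ?H \<and> ?N") for y d b
  proof -
    have 1: "(\<forall>i \<in> I y. b i \<in> Hom M (X y i) d) \<longleftrightarrow> ?H" by (auto simp: I_def X)
    have 2: "(\<forall>(i, f, j, g) \<in> R y. b i \<cdot>\<^bsub>M\<^esub> f = b j \<cdot>\<^bsub>M\<^esub> g) \<longleftrightarrow>
        (\<forall>x x' \<alpha> u. u \<in> Hom L x x' \<longrightarrow> \<alpha> \<in> Hom K (on_obj P x') y \<longrightarrow>
          b (x', \<alpha>) \<cdot>\<^bsub>M\<^esub> on_arr F u = b (x, \<alpha> \<cdot>\<^bsub>K\<^esub> on_arr P u) \<cdot>\<^bsub>M\<^esub> Ide M (on_obj F x))"
      unfolding R_def ball_simps(9) by (auto simp: in_Hom)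
    have "b (x, \<alpha> \<cdot>\<^bsub>K\<^esub> on_arr P u) \<cdot>\<^bsub>M\<^esub> Ide M (on_obj F x) = b (x, \<alpha> \<cdot>\<^bsub>K\<^esub> on_arr P u)"
      if ?H "u \<in> Hom L x x'" "\<alpha> \<in> Hom K (on_obj P x') y" for x x' \<alpha> u
      using that(1) Pu[OF that(2,3)] L.Hom_Obj(1)[OF that(2)] M.Comp_Ide_right by blast
    then have 3: "(\<forall>x x' \<alpha> u. u \<in> Hom L x x' \<longrightarrow> \<alpha> \<in> Hom K (on_obj P x') y \<longrightarrow>
          b (x', \<alpha>) \<cdot>\<^bsub>M\<^esub> on_arr F u = b (x, \<alpha> \<cdot>\<^bsub>K\<^esub> on_arr P u) \<cdot>\<^bsub>M\<^esub> Ide M (on_obj F x)) \<longleftrightarrow> ?N" if ?H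
      using that by auto
    show ?thesis
    proof (cases ?H)
      case True
      then show ?thesis unfolding pcocone_def 1 2 3[OF True] by simp
    next
      case False
      then show ?thesis unfolding pcocone_def 1 by (simp only: simp_thms)
    qed
  qed
  have Obj_L_small: "|Obj L| \<le>o |UNIV :: 'u set|"
  proof (rule card_of_ordLeq_subset[OF _ card_of_ordLeq_image[OF L_small, of "Dom L"]])
    show "Obj L \<subseteq> Dom L ` Arr L"
    proof
      fix x assume "x \<in> Obj L"
      then show "x \<in> Dom L ` Arr L" by (intro image_eqI[of _ _ "Ide L x"]) simp_all
    qed
  qed
  have col: "\<exists>c \<kappa>. pcolimit M (I y) (X y) (R y) c \<kappa>" if y: "y \<in> Obj K" for y
  proof -
    have "|I y| \<le>o |UNIV :: 'u set|"
      by (rule card_of_ordLeq_subset[OF _ card_of_ordLeq_Times[OF inf Obj_L_small K_small]])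
         (auto simp: I_def in_Hom)
    moreover have "|R y| \<le>o |UNIV :: 'u set|"
      unfolding R_def
      by (rule card_of_ordLeq_image, rule card_of_ordLeq_subset[OF _ card_of_ordLeq_Times[OF inf L_small K_small]])
         (auto simp: in_Hom)
    ultimately show ?thesis using M.pcolimit_exists[OF pres[OF y] colim inf] by blast
  qed
  \<comment> \<open>An arrow of \<open>K\<close> acts on the comma categories by composition and
    leaves the values \<open>F x\<close> as they are.\<close>
  define \<phi> where "\<phi> = (\<lambda>v (x :: 'c, \<alpha>). (x, v \<cdot>\<^bsub>K\<^esub> \<alpha>))"
  define \<xi> where "\<xi> = (\<lambda>(v :: 'a) (x, \<alpha> :: 'a). Ide M (on_obj F x))"
  have s: "\<phi> v (x, \<alpha>) = (x, v \<cdot>\<^bsub>K\<^esub> \<alpha>)" "\<xi> v (x, \<alpha>) = Ide M (on_obj F x)" for v x \<alpha>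
    by (simp_all add: \<phi>_def \<xi>_def)
  have "\<exists>G \<kappa>. is_functor K M G \<and> on_obj G \<in> extensional (Obj K) \<and> on_arr G \<in> extensional (Arr K) \<and>
    (\<forall>y \<in> Obj K. pcolimit M (I y) (X y) (R y) (on_obj G y) (\<kappa> y)) \<and>
    (\<forall>x y v i. v \<in> Hom K x y \<longrightarrow> i \<in> I x \<longrightarrow>
        on_arr G v \<cdot>\<^bsub>M\<^esub> \<kappa> x i = \<kappa> y (\<phi> v i) \<cdot>\<^bsub>M\<^esub> \<xi> v i)"
  proof (rule pcolimit_functor[OF PD(2) M pres col])
    fix v y z i assume v: "v \<in> Hom K y z" and "i \<in> I y"
    then obtain x \<alpha> where i: "i = (x, \<alpha>)" "x \<in> Obj L" "\<alpha> \<in> Hom K (on_obj P x) y" by (auto simp: I_def)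
    show "\<phi> v i \<in> I z" "\<xi> v i \<in> Hom M (X y i) (X z (\<phi> v i))"
      using i K.Comp_Hom[OF i(3) v] M.Ide_Hom[OF FD(3)[OF i(2)]] by (simp_all add: s I_def X)
  next
    fix v y z d b assume v: "v \<in> Hom K y z" and b: "pcocone M (I z) (X z) (R z) d b"
    note b = b[unfolded cocone]
    have bI: "b (x, v \<cdot>\<^bsub>K\<^esub> \<alpha>) \<cdot>\<^bsub>M\<^esub> Ide M (on_obj F x) = b (x, v \<cdot>\<^bsub>K\<^esub> \<alpha>)" "b (x, v \<cdot>\<^bsub>K\<^esub> \<alpha>) \<in> Hom M (on_obj F x) d"
      if "x \<in> Obj L" "\<alpha> \<in> Hom K (on_obj P x) y" for x \<alpha>
    proof -
      show "b (x, v \<cdot>\<^bsub>K\<^esub> \<alpha>) \<in> Hom M (on_obj F x) d" using b that K.Comp_Hom[OF that(2) v] by blast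
      then show "b (x, v \<cdot>\<^bsub>K\<^esub> \<alpha>) \<cdot>\<^bsub>M\<^esub> Ide M (on_obj F x) = b (x, v \<cdot>\<^bsub>K\<^esub> \<alpha>)" by (rule M.Comp_Ide_right)
    qed
    show "pcocone M (I y) (X y) (R y) d (\<lambda>i. b (\<phi> v i) \<cdot>\<^bsub>M\<^esub> \<xi> v i)"
      unfolding cocone s
    proof (intro conjI ballI allI impI)
      show "d \<in> Obj M" using b by blast
      show "b (x, v \<cdot>\<^bsub>K\<^esub> \<alpha>) \<cdot>\<^bsub>M\<^esub> Ide M (on_obj F x) \<in> Hom M (on_obj F x) d"
        if "x \<in> Obj L" "\<alpha> \<in> Hom K (on_obj P x) y" for x \<alpha> using bI[OF that] by simp
      fix x x' \<alpha> u assume u: "u \<in> Hom L x x'" and \<alpha>: "\<alpha> \<in> Hom K (on_obj P x') y"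
      note O = L.Hom_Obj[OF u]
      have "b (x', v \<cdot>\<^bsub>K\<^esub> \<alpha>) \<cdot>\<^bsub>M\<^esub> on_arr F u = b (x, (v \<cdot>\<^bsub>K\<^esub> \<alpha>) \<cdot>\<^bsub>K\<^esub> on_arr P u)"
        using b u K.Comp_Hom[OF \<alpha> v] by blast
      then show "(b (x', v \<cdot>\<^bsub>K\<^esub> \<alpha>) \<cdot>\<^bsub>M\<^esub> Ide M (on_obj F x')) \<cdot>\<^bsub>M\<^esub> on_arr F u =
          b (x, v \<cdot>\<^bsub>K\<^esub> (\<alpha> \<cdot>\<^bsub>K\<^esub> on_arr P u)) \<cdot>\<^bsub>M\<^esub> Ide M (on_obj F x)"
        unfolding bI(1)[OF O(2) \<alpha>] bI(1)[OF O(1) Pu[OF u \<alpha>]] unfolding K.Comp_assoc[OF PD(9)[OF u] \<alpha> v] .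
    qed
  next
    fix y i assume y: "y \<in> Obj K" and "i \<in> I y"
    then obtain x \<alpha> where i: "i = (x, \<alpha>)" "x \<in> Obj L" "\<alpha> \<in> Hom K (on_obj P x) y" by (auto simp: I_def)
    show "\<phi> (Ide K y) i = i" "\<xi> (Ide K y) i = Ide M (X y i)"
      using K.Comp_Ide_left[OF i(3)] by (simp_all add: i(1) s X)
  next
    fix v w y z z' i assume v: "v \<in> Hom K y z" and w: "w \<in> Hom K z z'" and "i \<in> I y"
    then obtain x \<alpha> where i: "i = (x, \<alpha>)" "x \<in> Obj L" "\<alpha> \<in> Hom K (on_obj P x) y" by (auto simp: I_def)
    show "\<phi> (w \<cdot>\<^bsub>K\<^esub> v) i = \<phi> w (\<phi> v i)" "\<xi> (w \<cdot>\<^bsub>K\<^esub> v) i = \<xi> w (\<phi> v i) \<cdot>\<^bsub>M\<^esub> \<xi> v i"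
      using K.Comp_assoc[OF i(3) v w] FD(3)[OF i(2)] by (simp_all add: i(1) s)
  qed
  then obtain G \<kappa> where G: "is_functor K M G" "on_obj G \<in> extensional (Obj K)" "on_arr G \<in> extensional (Arr K)"
    and \<kappa>: "\<And>y. y \<in> Obj K \<Longrightarrow> pcolimit M (I y) (X y) (R y) (on_obj G y) (\<kappa> y)"
    and \<kappa>nat: "\<And>x y v i. v \<in> Hom K x y \<Longrightarrow> i \<in> I x \<Longrightarrow>
        on_arr G v \<cdot>\<^bsub>M\<^esub> \<kappa> x i = \<kappa> y (\<phi> v i) \<cdot>\<^bsub>M\<^esub> \<xi> v i" by blast
  note GD = functor_D[OF G(1)]
  have G': "G \<in> Obj (fun_cat K M)" using G by (simp add: Obj_fun_cat)
  note cc = pcolimitD(1)[OF \<kappa>, unfolded cocone]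
  have \<kappa>H: "\<kappa> y (x, \<alpha>) \<in> Hom M (on_obj F x) (on_obj G y)" if "x \<in> Obj L" "\<alpha> \<in> Hom K (on_obj P x) y" for x y \<alpha>
    using cc[OF K.Hom_Obj(2)[OF that(2)]] that by blast
  have \<kappa>rel: "\<kappa> y (x', \<alpha>) \<cdot>\<^bsub>M\<^esub> on_arr F u = \<kappa> y (x, \<alpha> \<cdot>\<^bsub>K\<^esub> on_arr P u)"
    if "u \<in> Hom L x x'" "\<alpha> \<in> Hom K (on_obj P x') y" for x x' u \<alpha> y
    using cc[OF K.Hom_Obj(2)[OF that(2)]] that by blast
  have \<kappa>G: "on_arr G v \<cdot>\<^bsub>M\<^esub> \<kappa> y (x, \<alpha>) = \<kappa> z (x, v \<cdot>\<^bsub>K\<^esub> \<alpha>)"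
    if "v \<in> Hom K y z" "x \<in> Obj L" "\<alpha> \<in> Hom K (on_obj P x) y" for v y z x \<alpha>
    using \<kappa>nat[OF that(1), of "(x, \<alpha>)"] that(2,3) M.Comp_Ide_right[OF \<kappa>H[OF that(2) K.Comp_Hom[OF that(3,1)]]]
    by (simp add: I_def s)
  have eqI: "g = h" if "y \<in> Obj K" "g \<in> Hom M (on_obj G y) d" "h \<in> Hom M (on_obj G y) d"
    "\<And>x \<alpha>. x \<in> Obj L \<Longrightarrow> \<alpha> \<in> Hom K (on_obj P x) y \<Longrightarrow> g \<cdot>\<^bsub>M\<^esub> \<kappa> y (x, \<alpha>) = h \<cdot>\<^bsub>M\<^esub> \<kappa> y (x, \<alpha>)" for y g h d
    by (rule M.pcolimit_eqI[OF pres[OF that(1)] \<kappa>[OF that(1)] that(2,3)])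
       (use that(4) in \<open>auto simp: I_def\<close>)
  \<comment> \<open>The unit at \<open>x\<close> is the leg at the identity of \<open>P x\<close>.
    Every other leg is \<open>G \<alpha>\<close> after it, which is why these composites are jointly
    epic.\<close>
  define e where "e x = \<kappa> (on_obj P x) (x, Ide K (on_obj P x))" for x
  have e: "e x \<in> Hom M (on_obj F x) (on_obj G (on_obj P x))" if "x \<in> Obj L" for x
    unfolding e_def using \<kappa>H[OF that K.Ide_Hom[OF PD(3)[OF that]]] .
  have Ge: "on_arr G \<alpha> \<cdot>\<^bsub>M\<^esub> e x = \<kappa> y (x, \<alpha>)" if "x \<in> Obj L" "\<alpha> \<in> Hom K (on_obj P x) y" for x y \<alpha>
    unfolding e_def using \<kappa>G[OF that(2,1) K.Ide_Hom[OF PD(3)[OF that(1)]]] K.Comp_Ide_right[OF that(2)] by simp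
  define \<eta> where "\<eta> = mk_nat L F (on_obj ?R G) e"
  have \<eta>: "\<eta> \<in> Hom (fun_cat L M) F (on_obj ?R G)"
    unfolding \<eta>_def
  proof (rule Hom_fun_catI[OF F RD(3)[OF G']])
    show "e x \<in> Hom M (on_obj F x) (on_obj (on_obj ?R G) x)" if "x \<in> Obj L" for x
      using e[OF that] that by (simp add: R_obj)
    fix u x x' assume u: "u \<in> Hom L x x'"
    note O = L.Hom_Obj[OF u]
    have "e x' \<cdot>\<^bsub>M\<^esub> on_arr F u = \<kappa> (on_obj P x') (x, on_arr P u)"
      unfolding e_def using \<kappa>rel[OF u K.Ide_Hom[OF PD(3)[OF O(2)]]] K.Comp_Ide_left[OF PD(9)[OF u]] by simp
    also have "\<dots> = on_arr G (on_arr P u) \<cdot>\<^bsub>M\<^esub> e x" using Ge[OF O(1) PD(9)[OF u]] by simp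
    finally show "e x' \<cdot>\<^bsub>M\<^esub> on_arr F u = on_arr (on_obj ?R G) u \<cdot>\<^bsub>M\<^esub> e x" using u by (simp add: R_arr in_Hom)
  qed
  have \<eta>_comp: "component \<eta> x = e x" if "x \<in> Obj L" for x using that by (simp add: \<eta>_def)
  have universal: "\<exists>!h. h \<in> Hom (fun_cat K M) G D \<and> on_arr ?R h \<cdot>\<^bsub>fun_cat L M\<^esub> \<eta> = t"
    if D: "D \<in> Obj (fun_cat K M)" and t: "t \<in> Hom (fun_cat L M) F (on_obj ?R D)" for D t
  proof -
    note tD = Hom_fun_catD[OF t]
    have D': "is_functor K M D" using D by (simp add: Obj_fun_cat)
    note DD = functor_D[OF D']
    have tx: "component t x \<in> Hom M (on_obj F x) (on_obj D (on_obj P x))" if "x \<in> Obj L" for x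
      using tD(5)[OF that] that by (simp add: R_obj)
    have "\<exists>h. h \<in> Hom M (on_obj G y) (on_obj D y) \<and> (\<forall>x \<in> Obj L. \<forall>\<alpha> \<in> Hom K (on_obj P x) y.
        h \<cdot>\<^bsub>M\<^esub> \<kappa> y (x, \<alpha>) = on_arr D \<alpha> \<cdot>\<^bsub>M\<^esub> component t x)" if y: "y \<in> Obj K" for y
    proof -
      \<comment> \<open>Naturality in \<open>y\<close> forces the map at
        \<open>(x, \<alpha>)\<close> to be \<open>D \<alpha>\<close> after \<open>t x\<close>. That
        these form a cocone is the naturality of \<open>t\<close>.\<close>
      have "pcocone M (I y) (X y) (R y) (on_obj D y) (\<lambda>(x, \<alpha>). on_arr D \<alpha> \<cdot>\<^bsub>M\<^esub> component t x)"
        unfolding cocone split_conv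
      proof (intro conjI ballI allI impI)
        show "on_obj D y \<in> Obj M" using DD(3)[OF y] .
        show "on_arr D \<alpha> \<cdot>\<^bsub>M\<^esub> component t x \<in> Hom M (on_obj F x) (on_obj D y)"
          if "x \<in> Obj L" "\<alpha> \<in> Hom K (on_obj P x) y" for x \<alpha>
          using M.Comp_Hom[OF tx[OF that(1)] DD(9)[OF that(2)]] .
        fix x x' \<alpha> u assume u: "u \<in> Hom L x x'" and \<alpha>: "\<alpha> \<in> Hom K (on_obj P x') y"
        note O = L.Hom_Obj[OF u]
        have "(on_arr D \<alpha> \<cdot>\<^bsub>M\<^esub> component t x') \<cdot>\<^bsub>M\<^esub> on_arr F u = on_arr D \<alpha> \<cdot>\<^bsub>M\<^esub> (component t x' \<cdot>\<^bsub>M\<^esub> on_arr F u)"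
          by (rule M.Comp_assoc[OF FD(9)[OF u] tx[OF O(2)] DD(9)[OF \<alpha>], symmetric])
        also have "component t x' \<cdot>\<^bsub>M\<^esub> on_arr F u = on_arr D (on_arr P u) \<cdot>\<^bsub>M\<^esub> component t x"
          using tD(6)[OF u] u by (simp add: R_arr in_Hom)
        also have "on_arr D \<alpha> \<cdot>\<^bsub>M\<^esub> (on_arr D (on_arr P u) \<cdot>\<^bsub>M\<^esub> component t x) =
            (on_arr D \<alpha> \<cdot>\<^bsub>M\<^esub> on_arr D (on_arr P u)) \<cdot>\<^bsub>M\<^esub> component t x"
          by (rule M.Comp_assoc[OF tx[OF O(1)] DD(9)[OF PD(9)[OF u]] DD(9)[OF \<alpha>]])
        also have "on_arr D \<alpha> \<cdot>\<^bsub>M\<^esub> on_arr D (on_arr P u) = on_arr D (\<alpha> \<cdot>\<^bsub>K\<^esub> on_arr P u)"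
          using DD(8)[of "on_arr P u" \<alpha>] PD(9)[OF u] \<alpha> by (simp add: in_Hom)
        finally show "(on_arr D \<alpha> \<cdot>\<^bsub>M\<^esub> component t x') \<cdot>\<^bsub>M\<^esub> on_arr F u = on_arr D (\<alpha> \<cdot>\<^bsub>K\<^esub> on_arr P u) \<cdot>\<^bsub>M\<^esub> component t x" .
      qed
      from pcolimit_induced[OF \<kappa>[OF y] this] show ?thesis by (auto simp: I_def)
    qed
    then obtain h where h: "\<And>y. y \<in> Obj K \<Longrightarrow> h y \<in> Hom M (on_obj G y) (on_obj D y)"
      "\<And>y x \<alpha>. y \<in> Obj K \<Longrightarrow> x \<in> Obj L \<Longrightarrow> \<alpha> \<in> Hom K (on_obj P x) y \<Longrightarrow>
        h y \<cdot>\<^bsub>M\<^esub> \<kappa> y (x, \<alpha>) = on_arr D \<alpha> \<cdot>\<^bsub>M\<^esub> component t x"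
      by metis
    have H: "mk_nat K G D h \<in> Hom (fun_cat K M) G D"
    proof (rule Hom_fun_catI[OF G' D h(1)])
      fix v y z assume v: "v \<in> Hom K y z"
      note O = K.Hom_Obj[OF v]
      show "h z \<cdot>\<^bsub>M\<^esub> on_arr G v = on_arr D v \<cdot>\<^bsub>M\<^esub> h y"
      proof (rule eqI[OF O(1) M.Comp_Hom[OF GD(9)[OF v] h(1)[OF O(2)]] M.Comp_Hom[OF h(1)[OF O(1)] DD(9)[OF v]]])
        fix x \<alpha> assume x: "x \<in> Obj L" and \<alpha>: "\<alpha> \<in> Hom K (on_obj P x) y"
        have "(h z \<cdot>\<^bsub>M\<^esub> on_arr G v) \<cdot>\<^bsub>M\<^esub> \<kappa> y (x, \<alpha>) = h z \<cdot>\<^bsub>M\<^esub> \<kappa> z (x, v \<cdot>\<^bsub>K\<^esub> \<alpha>)"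
          unfolding \<kappa>G[OF v x \<alpha>, symmetric]
          by (rule M.Comp_assoc[OF \<kappa>H[OF x \<alpha>] GD(9)[OF v] h(1)[OF O(2)], symmetric])
        also have "\<dots> = on_arr D (v \<cdot>\<^bsub>K\<^esub> \<alpha>) \<cdot>\<^bsub>M\<^esub> component t x" by (rule h(2)[OF O(2) x K.Comp_Hom[OF \<alpha> v]])
        also have "on_arr D (v \<cdot>\<^bsub>K\<^esub> \<alpha>) = on_arr D v \<cdot>\<^bsub>M\<^esub> on_arr D \<alpha>"
          using DD(8)[of \<alpha> v] \<alpha> v by (simp add: in_Hom)
        also have "(on_arr D v \<cdot>\<^bsub>M\<^esub> on_arr D \<alpha>) \<cdot>\<^bsub>M\<^esub> component t x = on_arr D v \<cdot>\<^bsub>M\<^esub> (on_arr D \<alpha> \<cdot>\<^bsub>M\<^esub> component t x)"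
          by (rule M.Comp_assoc[OF tx[OF x] DD(9)[OF \<alpha>] DD(9)[OF v], symmetric])
        also have "\<dots> = (on_arr D v \<cdot>\<^bsub>M\<^esub> h y) \<cdot>\<^bsub>M\<^esub> \<kappa> y (x, \<alpha>)"
          unfolding h(2)[OF O(1) x \<alpha>, symmetric]
          by (rule M.Comp_assoc[OF \<kappa>H[OF x \<alpha>] h(1)[OF O(1)] DD(9)[OF v]])
        finally show "(h z \<cdot>\<^bsub>M\<^esub> on_arr G v) \<cdot>\<^bsub>M\<^esub> \<kappa> y (x, \<alpha>) = (on_arr D v \<cdot>\<^bsub>M\<^esub> h y) \<cdot>\<^bsub>M\<^esub> \<kappa> y (x, \<alpha>)" .
      qed
    qed
    have Ht: "on_arr ?R (mk_nat K G D h) \<cdot>\<^bsub>fun_cat L M\<^esub> \<eta> = t"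
    proof (rule fun_cat_eqI[OF FL.Comp_Hom[OF \<eta> RD(9)[OF H]] t])
      fix x assume x: "x \<in> Obj L"
      have "h (on_obj P x) \<cdot>\<^bsub>M\<^esub> e x = component t x"
        unfolding e_def using h(2)[OF PD(3)[OF x] x K.Ide_Hom[OF PD(3)[OF x]]] DD(7)[OF PD(3)[OF x]]
          M.Comp_Ide_left[OF tx[OF x]] by simp
      then show "component (on_arr ?R (mk_nat K G D h) \<cdot>\<^bsub>fun_cat L M\<^esub> \<eta>) x = component t x"
        using x PD(3)[OF x] by (simp add: fun_cat_simps R_comp \<eta>_comp)
    qed
    show ?thesis
    proof (rule ex1I[of _ "mk_nat K G D h"], intro conjI H Ht)
      fix g assume "g \<in> Hom (fun_cat K M) G D \<and> on_arr ?R g \<cdot>\<^bsub>fun_cat L M\<^esub> \<eta> = t"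
      then have g: "g \<in> Hom (fun_cat K M) G D" and gt: "on_arr ?R g \<cdot>\<^bsub>fun_cat L M\<^esub> \<eta> = t" by simp_all
      note gD = Hom_fun_catD[OF g]
      show "g = mk_nat K G D h"
      proof (rule fun_cat_eqI[OF g H])
        fix y assume y: "y \<in> Obj K"
        have "component g y = h y"
        proof (rule eqI[OF y gD(5)[OF y] h(1)[OF y]])
          fix x \<alpha> assume x: "x \<in> Obj L" and \<alpha>: "\<alpha> \<in> Hom K (on_obj P x) y"
          note Px = PD(3)[OF x]
          have ge: "component g (on_obj P x) \<cdot>\<^bsub>M\<^esub> e x = component t x"
            using arg_cong[OF gt, of "\<lambda>t. component t x"] x by (simp add: fun_cat_simps R_comp \<eta>_comp)
          have "component g y \<cdot>\<^bsub>M\<^esub> \<kappa> y (x, \<alpha>) = (component g y \<cdot>\<^bsub>M\<^esub> on_arr G \<alpha>) \<cdot>\<^bsub>M\<^esub> e x"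
            unfolding Ge[OF x \<alpha>, symmetric] by (rule M.Comp_assoc[OF e[OF x] GD(9)[OF \<alpha>] gD(5)[OF y]])
          also have "\<dots> = on_arr D \<alpha> \<cdot>\<^bsub>M\<^esub> (component g (on_obj P x) \<cdot>\<^bsub>M\<^esub> e x)"
            unfolding gD(6)[OF \<alpha>] by (rule M.Comp_assoc[OF e[OF x] gD(5)[OF Px] DD(9)[OF \<alpha>], symmetric])
          finally show "component g y \<cdot>\<^bsub>M\<^esub> \<kappa> y (x, \<alpha>) = h y \<cdot>\<^bsub>M\<^esub> \<kappa> y (x, \<alpha>)"
            using ge h(2)[OF y x \<alpha>] by simp
        qed
        then show "component g y = component (mk_nat K G D h) y" using y by simp
      qed
    qed
  qed
  have epic: "g = h" if "y \<in> Obj K" "g \<in> Hom M (on_obj G y) d" "h \<in> Hom M (on_obj G y) d"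
    "\<forall>x \<in> Obj L. \<forall>\<alpha> \<in> Hom K (on_obj P x) y.
         g \<cdot>\<^bsub>M\<^esub> (on_arr G \<alpha> \<cdot>\<^bsub>M\<^esub> component \<eta> x) = h \<cdot>\<^bsub>M\<^esub> (on_arr G \<alpha> \<cdot>\<^bsub>M\<^esub> component \<eta> x)" for y d g h
    by (rule eqI[OF that(1-3)]) (use that(4) in \<open>simp add: \<eta>_comp Ge\<close>)
  show ?thesis
    by (rule exI[of _ G], rule exI[of _ \<eta>]) (use G' \<eta> universal epic in blast)
qed

lemma Kan_extension_functor_exists:
  fixes L :: "('c, 'd, 'y) cat_scheme" and K :: "('o, 'a, 'x) cat_scheme" and M :: "('p, 'b, 'z) cat_scheme"
  assumes P: "is_functor L K P" and M: "category M" and colim: "has_small_colimits M TYPE('u)"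
    and inf: "infinite (UNIV :: 'u set)"
    and L_small: "|Arr L| \<le>o |UNIV :: 'u set|" and K_small: "|Arr K| \<le>o |UNIV :: 'u set|"
  shows "\<exists>E. is_left_adjoint (fun_cat L M) (fun_cat K M) E (precomposition L P)"
proof (rule left_adjoint_exists[OF precomposition_functor[OF P M]])
  fix F :: "('c, 'd, 'p, 'b) func" assume "F \<in> Obj (fun_cat L M)"
  from Kan_extension_exists[OF assms this] obtain G \<eta> where "G \<in> Obj (fun_cat K M)"
    "\<eta> \<in> Hom (fun_cat L M) F (on_obj (precomposition L P) G)"
    "\<forall>D \<in> Obj (fun_cat K M). \<forall>t \<in> Hom (fun_cat L M) F (on_obj (precomposition L P) D).
      \<exists>!h. h \<in> Hom (fun_cat K M) G D \<and> on_arr (precomposition L P) h \<cdot>\<^bsub>fun_cat L M\<^esub> \<eta> = t"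
    by (elim exE conjE)
  then show "\<exists>G \<eta>. G \<in> Obj (fun_cat K M) \<and> \<eta> \<in> Hom (fun_cat L M) F (on_obj (precomposition L P) G) \<and>
    (\<forall>D \<in> Obj (fun_cat K M). \<forall>t \<in> Hom (fun_cat L M) F (on_obj (precomposition L P) D).
      \<exists>!h. h \<in> Hom (fun_cat K M) G D \<and> on_arr (precomposition L P) h \<cdot>\<^bsub>fun_cat L M\<^esub> \<eta> = t)"
    by (intro exI conjI)
qed

locale inverting_functor = L: small_inverting L M SL U + K: small_inverting K M SK U
  for L :: "('c, 'd, 'y) cat_scheme" and K :: "('o, 'a, 'x) cat_scheme" and M :: "('p, 'b, 'z) cat_scheme"
    and SL SK and U :: "'u itself" +
  fixes P :: "('c, 'd, 'o, 'a) func"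
  assumes P: "is_functor L K P" and P_S: "s \<in> SL \<Longrightarrow> on_arr P s \<in> SK"
begin

text \<open>The left Kan extension of a diagram that inverts \<open>SL\<close> does not distinguish adjacent arrows.\<close>

definition adjacent :: "'c \<Rightarrow> 'o \<Rightarrow> 'a \<Rightarrow> 'a \<Rightarrow> bool" where
  "adjacent x y \<alpha> \<beta> \<longleftrightarrow> (\<exists>s \<in> SL. \<exists>d \<in> Hom L x (Dom L s). \<exists>d' \<in> Hom L x (Dom L s).
     \<exists>\<gamma> \<in> Hom K (on_obj P (Dom L s)) y. Cod L s = x \<and> s \<cdot>\<^bsub>L\<^esub> d = Ide L x \<and> s \<cdot>\<^bsub>L\<^esub> d' = Ide L x \<and>
       \<alpha> = \<gamma> \<cdot>\<^bsub>K\<^esub> on_arr P d \<and> \<beta> = \<gamma> \<cdot>\<^bsub>K\<^esub> on_arr P d')"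

abbreviation restriction where "restriction \<equiv> precomposition L P"

text \<open>For the pointwise construction \<open>G\<close>, joint epicness reduces the equation for
  \<open>G (d s)\<close> to composites with \<open>G \<alpha>\<close> and the unit, and a chain of
  adjacent arrows makes those equal. The given \<open>E F\<close> is isomorphic to \<open>G\<close>
  and therefore satisfies the same equation.\<close>

lemma Kan_extension_inverts:
  assumes homotopy: "\<And>s. s \<in> SK \<Longrightarrow> \<exists>d \<in> Hom K (Cod K s) (Dom K s). s \<cdot>\<^bsub>K\<^esub> d = Ide K (Cod K s) \<and>
      (\<forall>x \<in> Obj L. \<forall>\<alpha> \<in> Hom K (on_obj P x) (Dom K s). (adjacent x (Dom K s))\<^sup>*\<^sup>* \<alpha> ((d \<cdot>\<^bsub>K\<^esub> s) \<cdot>\<^bsub>K\<^esub> \<alpha>))"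
    and E: "is_left_adjoint (fun_cat L M) (fun_cat K M) E restriction"
    and F: "F \<in> Obj L.B"
  shows "on_obj E F \<in> Obj K.B"
proof -
  note PD = functor_D[OF P]
  have F': "F \<in> Obj (fun_cat L M)" using F by (simp add: L.Obj_B)
  have "has_small_colimits M TYPE('u)" using L.colimits by (simp add: has_small_colimits_def)
  from Kan_extension_exists[OF P L.M.category_axioms this L.infinite L.small_A K.small_A F']
  obtain G \<eta> where G: "G \<in> Obj (fun_cat K M)" and \<eta>: "\<eta> \<in> Hom (fun_cat L M) F (on_obj restriction G)"
    and univ': "\<forall>D \<in> Obj (fun_cat K M). \<forall>t \<in> Hom (fun_cat L M) F (on_obj restriction D).
      \<exists>!h. h \<in> Hom (fun_cat K M) G D \<and> on_arr restriction h \<cdot>\<^bsub>fun_cat L M\<^esub> \<eta> = t"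
    and epic': "\<forall>y \<in> Obj K. \<forall>d. \<forall>g \<in> Hom M (on_obj G y) d. \<forall>h \<in> Hom M (on_obj G y) d.
      (\<forall>x \<in> Obj L. \<forall>\<alpha> \<in> Hom K (on_obj P x) y.
         g \<cdot>\<^bsub>M\<^esub> (on_arr G \<alpha> \<cdot>\<^bsub>M\<^esub> component \<eta> x) = h \<cdot>\<^bsub>M\<^esub> (on_arr G \<alpha> \<cdot>\<^bsub>M\<^esub> component \<eta> x)) \<longrightarrow> g = h"
    by (elim exE conjE)
  note univ = univ'[rule_format] and epic = epic'[rule_format]
  have G': "is_functor K M G" "on_obj G \<in> extensional (Obj K)" "on_arr G \<in> extensional (Arr K)"
    using G by (simp_all add: Obj_fun_cat)
  note GD = functor_D[OF G'(1)]
  note FD = L.BD[OF F]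
  have e: "component \<eta> x \<in> Hom M (on_obj F x) (on_obj G (on_obj P x))" if "x \<in> Obj L" for x
    using Hom_fun_catD(5)[OF \<eta> that] that by (simp add: precomposition_def)
  have e_nat: "component \<eta> x' \<cdot>\<^bsub>M\<^esub> on_arr F u = on_arr G (on_arr P u) \<cdot>\<^bsub>M\<^esub> component \<eta> x" if "u \<in> Hom L x x'" for u x x'
    using Hom_fun_catD(6)[OF \<eta> that] that by (simp add: precomposition_def in_Hom)
  \<comment> \<open>Naturality of the unit moves the two sections inside \<open>F\<close>, and
    \<open>F\<close> takes the same value on both because it inverts \<open>s\<close>.\<close>
  have adj: "on_arr G \<alpha> \<cdot>\<^bsub>M\<^esub> component \<eta> x = on_arr G \<beta> \<cdot>\<^bsub>M\<^esub> component \<eta> x" if a: "adjacent x y \<alpha> \<beta>" for x y \<alpha> \<beta>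
  proof -
    obtain s d d' \<gamma> where s: "s \<in> SL" "Cod L s = x" and d: "d \<in> Hom L x (Dom L s)" "s \<cdot>\<^bsub>L\<^esub> d = Ide L x"
      and d': "d' \<in> Hom L x (Dom L s)" "s \<cdot>\<^bsub>L\<^esub> d' = Ide L x"
      and \<gamma>: "\<gamma> \<in> Hom K (on_obj P (Dom L s)) y" and eq: "\<alpha> = \<gamma> \<cdot>\<^bsub>K\<^esub> on_arr P d" "\<beta> = \<gamma> \<cdot>\<^bsub>K\<^esub> on_arr P d'"
      using a unfolding adjacent_def by blast
    have key: "on_arr G (\<gamma> \<cdot>\<^bsub>K\<^esub> on_arr P d) \<cdot>\<^bsub>M\<^esub> component \<eta> x = on_arr G \<gamma> \<cdot>\<^bsub>M\<^esub> (component \<eta> (Dom L s) \<cdot>\<^bsub>M\<^esub> on_arr F d)"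
      if d: "d \<in> Hom L x (Dom L s)" for d
    proof -
      note O = L.A.Hom_Obj[OF d]
      have "on_arr G (\<gamma> \<cdot>\<^bsub>K\<^esub> on_arr P d) = on_arr G \<gamma> \<cdot>\<^bsub>M\<^esub> on_arr G (on_arr P d)"
        using GD(8)[of "on_arr P d" \<gamma>] PD(9)[OF d] \<gamma> by (simp add: in_Hom)
      then show ?thesis
        unfolding e_nat[OF d] using L.M.Comp_assoc[OF e[OF O(1)] GD(9)[OF PD(9)[OF d]] GD(9)[OF \<gamma>]] by simp
    qed
    have "on_arr F d = on_arr F d'"
      by (rule L.sections_eq[OF F s(1)]) (use s d d' in simp_all)
    then show ?thesis unfolding eq key[OF d(1)] key[OF d'(1)] by simp
  qed
  have GB: "G \<in> Obj K.B"
  proof (rule K.Obj_BI[OF G'])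
    fix s assume s: "s \<in> SK"
    then obtain d where d: "d \<in> Hom K (Cod K s) (Dom K s)" "s \<cdot>\<^bsub>K\<^esub> d = Ide K (Cod K s)"
      and path: "\<And>x \<alpha>. x \<in> Obj L \<Longrightarrow> \<alpha> \<in> Hom K (on_obj P x) (Dom K s) \<Longrightarrow> (adjacent x (Dom K s))\<^sup>*\<^sup>* \<alpha> ((d \<cdot>\<^bsub>K\<^esub> s) \<cdot>\<^bsub>K\<^esub> \<alpha>)"
      using homotopy by blast
    have ds: "d \<cdot>\<^bsub>K\<^esub> s \<in> Hom K (Dom K s) (Dom K s)" and y: "Dom K s \<in> Obj K"
      using d s K.S_Arr by (auto simp: in_Hom)
    have "on_arr G (d \<cdot>\<^bsub>K\<^esub> s) = Ide M (on_obj G (Dom K s))"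
    proof (rule epic[OF y GD(9)[OF ds] L.M.Ide_Hom[OF GD(3)[OF y]]])
      fix x \<alpha> assume x: "x \<in> Obj L" and \<alpha>: "\<alpha> \<in> Hom K (on_obj P x) (Dom K s)"
      have "on_arr G \<alpha> \<cdot>\<^bsub>M\<^esub> component \<eta> x = on_arr G ((d \<cdot>\<^bsub>K\<^esub> s) \<cdot>\<^bsub>K\<^esub> \<alpha>) \<cdot>\<^bsub>M\<^esub> component \<eta> x"
        using path[OF x \<alpha>] by (induction rule: rtranclp_induct) (simp_all add: adj)
      also have "on_arr G ((d \<cdot>\<^bsub>K\<^esub> s) \<cdot>\<^bsub>K\<^esub> \<alpha>) = on_arr G (d \<cdot>\<^bsub>K\<^esub> s) \<cdot>\<^bsub>M\<^esub> on_arr G \<alpha>"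
        using GD(8)[of \<alpha> "d \<cdot>\<^bsub>K\<^esub> s"] \<alpha> ds by (simp add: in_Hom)
      also have "(on_arr G (d \<cdot>\<^bsub>K\<^esub> s) \<cdot>\<^bsub>M\<^esub> on_arr G \<alpha>) \<cdot>\<^bsub>M\<^esub> component \<eta> x =
          on_arr G (d \<cdot>\<^bsub>K\<^esub> s) \<cdot>\<^bsub>M\<^esub> (on_arr G \<alpha> \<cdot>\<^bsub>M\<^esub> component \<eta> x)"
        by (rule L.M.Comp_assoc[OF e[OF x] GD(9)[OF \<alpha>] GD(9)[OF ds], symmetric])
      finally show "on_arr G (d \<cdot>\<^bsub>K\<^esub> s) \<cdot>\<^bsub>M\<^esub> (on_arr G \<alpha> \<cdot>\<^bsub>M\<^esub> component \<eta> x) =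
          Ide M (on_obj G (Dom K s)) \<cdot>\<^bsub>M\<^esub> (on_arr G \<alpha> \<cdot>\<^bsub>M\<^esub> component \<eta> x)"
        using L.M.Comp_Ide_left[OF L.M.Comp_Hom[OF e[OF x] GD(9)[OF \<alpha>]]] by simp
    qed
    then show "\<exists>d \<in> Hom K (Cod K s) (Dom K s). s \<cdot>\<^bsub>K\<^esub> d = Ide K (Cod K s) \<and>
        on_arr G (d \<cdot>\<^bsub>K\<^esub> s) = Ide M (on_obj G (Dom K s))" using d by blast
  qed
  obtain \<epsilon> where "left_adjoint (fun_cat L M) (fun_cat K M) E restriction \<epsilon>" using left_adjointE[OF E] .
  then interpret E: left_adjoint "fun_cat L M" "fun_cat K M" E restriction \<epsilon> .
  have EF: "on_obj E F \<in> Obj (fun_cat K M)" using E.FD(3)[OF F'] .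
  obtain k where k: "k \<in> Hom (fun_cat K M) G (on_obj E F)" "is_iso (fun_cat K M) k"
    using E.unique_up_to_iso[OF F' G \<eta> univ] by blast
  obtain l where l: "l \<in> Hom (fun_cat K M) (on_obj E F) G" "l \<cdot>\<^bsub>fun_cat K M\<^esub> k = Ide (fun_cat K M) G"
    "k \<cdot>\<^bsub>fun_cat K M\<^esub> l = Ide (fun_cat K M) (on_obj E F)"
    using E.B.is_isoE[OF k(2,1)] by blast
  have EF': "is_functor K M (on_obj E F)" "on_obj (on_obj E F) \<in> extensional (Obj K)" "on_arr (on_obj E F) \<in> extensional (Arr K)"
    using EF by (simp_all add: Obj_fun_cat)
  show ?thesis
  proof (rule K.Obj_BI_all_sections[OF EF'])
    fix s d assume s: "s \<in> SK" and d: "d \<in> Hom K (Cod K s) (Dom K s)" "s \<cdot>\<^bsub>K\<^esub> d = Ide K (Cod K s)"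
    have ds: "d \<cdot>\<^bsub>K\<^esub> s \<in> Hom K (Dom K s) (Dom K s)" and y: "Dom K s \<in> Obj K"
      using d s K.S_Arr by (auto simp: in_Hom)
    note EFD = functor_D[OF EF'(1)]
    note ky = Hom_fun_catD(5)[OF k(1) y] and ly = Hom_fun_catD(5)[OF l(1) y]
    have kl: "component k (Dom K s) \<cdot>\<^bsub>M\<^esub> component l (Dom K s) = Ide M (on_obj (on_obj E F) (Dom K s))"
      using arg_cong[OF l(3), of "\<lambda>t. component t (Dom K s)"] y by (simp add: fun_cat_simps)
    \<comment> \<open>Conjugation by the isomorphism with \<open>G\<close>, on which
      \<open>d s\<close> acts as the identity.\<close>
    have "on_arr (on_obj E F) (d \<cdot>\<^bsub>K\<^esub> s) = on_arr (on_obj E F) (d \<cdot>\<^bsub>K\<^esub> s) \<cdot>\<^bsub>M\<^esub> (component k (Dom K s) \<cdot>\<^bsub>M\<^esub> component l (Dom K s))"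
      unfolding kl by (rule L.M.Comp_Ide_right[OF EFD(9)[OF ds], symmetric])
    also have "\<dots> = (on_arr (on_obj E F) (d \<cdot>\<^bsub>K\<^esub> s) \<cdot>\<^bsub>M\<^esub> component k (Dom K s)) \<cdot>\<^bsub>M\<^esub> component l (Dom K s)"
      by (rule L.M.Comp_assoc[OF ly ky EFD(9)[OF ds]])
    also have "\<dots> = (component k (Dom K s) \<cdot>\<^bsub>M\<^esub> Ide M (on_obj G (Dom K s))) \<cdot>\<^bsub>M\<^esub> component l (Dom K s)"
      by (simp only: Hom_fun_catD(6)[OF k(1) ds, symmetric] K.section_inverse[OF GB s d])
    also have "\<dots> = Ide M (on_obj (on_obj E F) (Dom K s))"
      by (simp only: L.M.Comp_Ide_right[OF ky] kl)
    finally show "on_arr (on_obj E F) (d \<cdot>\<^bsub>K\<^esub> s) = Ide M (on_obj (on_obj E F) (Dom K s))" .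
  qed
qed

lemma restriction_inverts:
  assumes G: "G \<in> Obj K.B" shows "on_obj restriction G \<in> Obj L.B"
proof -
  have "on_obj restriction G \<in> Obj (fun_cat L M)"
    using functor_D(3)[OF precomposition_functor[OF P L.M.category_axioms]] G by (simp add: K.Obj_B)
  moreover have "is_iso M (on_arr (on_obj restriction G) s)" if "s \<in> SL" for s
    using that L.S_Arr P_S G by (auto simp: precomposition_def K.Obj_B)
  ultimately show ?thesis by (simp add: L.Obj_B)
qed

lemma restricted_adjunction:
  assumes "is_left_adjoint (fun_cat L M) (fun_cat K M) E restriction"
    and "\<And>F. F \<in> Obj L.B \<Longrightarrow> on_obj E F \<in> Obj K.B"
  shows "is_left_adjoint L.B K.B E restriction"
  unfolding inv_cat_def
  by (rule left_adjoint_full_subcategory[OF assms(1)])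
     (use assms(2) restriction_inverts in \<open>auto simp: L.Obj_B K.Obj_B\<close>)

end

section \<open>The simplex category\<close>

abbreviation ev :: "ord_map \<Rightarrow> nat \<Rightarrow> nat" where "ev \<alpha> \<equiv> snd (snd \<alpha>)"

text \<open>The restriction to \<open>{..m}\<close> produces the extensional representative that
  arrows of \<open>Delta\<close> must be, so that monotone maps can be given by formulas on all
  numbers.\<close>

definition ord :: "nat \<Rightarrow> nat \<Rightarrow> (nat \<Rightarrow> nat) \<Rightarrow> ord_map" where
  "ord m n f = (m, n, restrict f {..m})"

lemma ev_ord [simp]: "j \<le> m \<Longrightarrow> ev (ord m n f) j = f j"
  by (simp add: ord_def)

lemma Hom_Delta: "\<alpha> \<in> Hom Delta m n \<longleftrightarrow> fst \<alpha> = m \<and> fst (snd \<alpha>) = n \<and>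
    ev \<alpha> \<in> {..m} \<rightarrow>\<^sub>E {..n} \<and> mono_on {..m} (ev \<alpha>)"
  by (cases \<alpha>) (auto simp: Hom_def Delta_def)

lemma ord_Hom:
  assumes "\<And>j. j \<le> m \<Longrightarrow> f j \<le> n" "\<And>i j. i \<le> j \<Longrightarrow> j \<le> m \<Longrightarrow> f i \<le> f j"
  shows "ord m n f \<in> Hom Delta m n"
  using assms by (auto simp: Hom_Delta ord_def intro!: mono_onI)

lemma ev_le: "\<alpha> \<in> Hom Delta m n \<Longrightarrow> j \<le> m \<Longrightarrow> ev \<alpha> j \<le> n"
  by (auto simp: Hom_Delta)

lemma ev_mono: "\<alpha> \<in> Hom Delta m n \<Longrightarrow> i \<le> j \<Longrightarrow> j \<le> m \<Longrightarrow> ev \<alpha> i \<le> ev \<alpha> j"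
  by (auto simp: Hom_Delta mono_on_def)

lemma Delta_eqI:
  assumes "\<alpha> \<in> Hom Delta m n" "\<beta> \<in> Hom Delta m n" "\<And>j. j \<le> m \<Longrightarrow> ev \<alpha> j = ev \<beta> j"
  shows "\<alpha> = \<beta>"
proof -
  have "ev \<alpha> = ev \<beta>"
    using assms by (intro extensionalityI[of _ "{..m}"]) (auto simp: Hom_Delta PiE_def)
  then show ?thesis using assms(1,2) by (auto simp: Hom_Delta prod_eq_iff)
qed

lemma Delta_simps:
  "Obj Delta = UNIV" "Dom Delta \<alpha> = fst \<alpha>" "Cod Delta \<alpha> = fst (snd \<alpha>)" "Ide Delta n = ord n n (\<lambda>j. j)"
  by (auto simp: Delta_def ord_def split: prod.splits)

lemma ev_Comp:
  assumes "\<alpha> \<in> Hom Delta m n" "j \<le> m" shows "ev (\<beta> \<cdot>\<^bsub>Delta\<^esub> \<alpha>) j = ev \<beta> (ev \<alpha> j)"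
  using assms by (cases \<alpha>; cases \<beta>) (auto simp: Delta_def Hom_def compose_def)

lemma Delta_Comp_Hom:
  assumes \<alpha>: "\<alpha> \<in> Hom Delta m n" and \<beta>: "\<beta> \<in> Hom Delta n p" shows "\<beta> \<cdot>\<^bsub>Delta\<^esub> \<alpha> \<in> Hom Delta m p"
proof -
  have "\<beta> \<cdot>\<^bsub>Delta\<^esub> \<alpha> = ord m p (\<lambda>j. ev \<beta> (ev \<alpha> j))"
    using assms by (cases \<alpha>; cases \<beta>) (auto simp: Delta_def Hom_def compose_def ord_def)
  moreover have "\<dots> \<in> Hom Delta m p"
    using ev_le[OF \<alpha>] ev_le[OF \<beta>] ev_mono[OF \<alpha>] ev_mono[OF \<beta>] by (intro ord_Hom) blast+
  ultimately show ?thesis by simp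
qed

lemma category_Delta: "category Delta"
proof
  show ide: "Ide Delta n \<in> Hom Delta n n" for n by (simp add: Delta_simps ord_Hom)
  show "\<beta> \<cdot>\<^bsub>Delta\<^esub> \<alpha> \<in> Hom Delta m p" if "\<alpha> \<in> Hom Delta m n" "\<beta> \<in> Hom Delta n p" for \<alpha> \<beta> m n p
    using Delta_Comp_Hom[OF that] .
  show "\<alpha> \<cdot>\<^bsub>Delta\<^esub> Ide Delta m = \<alpha>" if "\<alpha> \<in> Hom Delta m n" for \<alpha> m n
    by (rule Delta_eqI[OF Delta_Comp_Hom[OF ide that] that]) (simp only: ev_Comp[OF ide], simp add: Delta_simps(4))
  show "Ide Delta n \<cdot>\<^bsub>Delta\<^esub> \<alpha> = \<alpha>" if "\<alpha> \<in> Hom Delta m n" for \<alpha> m n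
    by (rule Delta_eqI[OF Delta_Comp_Hom[OF that ide] that]) (simp add: ev_Comp[OF that] Delta_simps(4) ev_le[OF that])
  show "\<gamma> \<cdot>\<^bsub>Delta\<^esub> (\<beta> \<cdot>\<^bsub>Delta\<^esub> \<alpha>) = (\<gamma> \<cdot>\<^bsub>Delta\<^esub> \<beta>) \<cdot>\<^bsub>Delta\<^esub> \<alpha>"
    if a: "\<alpha> \<in> Hom Delta m n" and b: "\<beta> \<in> Hom Delta n p" and c: "\<gamma> \<in> Hom Delta p q" for \<alpha> \<beta> \<gamma> m n p q
    by (rule Delta_eqI[OF Delta_Comp_Hom[OF Delta_Comp_Hom[OF a b] c] Delta_Comp_Hom[OF a Delta_Comp_Hom[OF b c]]])
       (simp add: ev_Comp[OF a] ev_Comp[OF b] ev_Comp[OF Delta_Comp_Hom[OF a b]] ev_le[OF a])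
qed (auto simp: Delta_simps)

interpretation Delta: category Delta by (rule category_Delta)

lemma Delta_Ide: "Ide Delta n \<in> Hom Delta n n"
  by (rule Delta.Ide_Hom) (simp add: Delta_simps)

text \<open>The monotone injection whose image misses \<open>i\<close>.\<close>

definition coface :: "nat \<Rightarrow> nat \<Rightarrow> ord_map" where
  "coface n i = ord n (n + 1) (\<lambda>j. if j < i then j else j + 1)"

lemma coface_Hom: "coface n i \<in> Hom Delta n (n + 1)"
  unfolding coface_def by (rule ord_Hom) auto

lemma codegeneracy_ord: "codegeneracy n i = ord (n + 1) n (\<lambda>j. if j \<le> i then j else j - 1)"
  by (simp add: codegeneracy_def ord_def)

lemma codegeneracy_Hom: "i \<le> n \<Longrightarrow> codegeneracy n i \<in> Hom Delta (n + 1) n"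
  unfolding codegeneracy_ord by (rule ord_Hom) auto

text \<open>Omitting either copy of the repeated value undoes the repetition. A codegeneracy thus
  has two sections, and comparing them is the source of all adjacencies in the prism
  argument.\<close>

lemma codegeneracy_coface:
  assumes "i \<le> n" "k = i \<or> k = i + 1"
  shows "codegeneracy n i \<cdot>\<^bsub>Delta\<^esub> coface n k = Ide Delta n"
proof (rule Delta_eqI[OF Delta_Comp_Hom[OF coface_Hom codegeneracy_Hom[OF assms(1)]] Delta_Ide])
  fix j assume j: "j \<le> n"
  show "ev (codegeneracy n i \<cdot>\<^bsub>Delta\<^esub> coface n k) j = ev (Ide Delta n) j"
    unfolding ev_Comp[OF coface_Hom j]
    using j assms by (auto simp: Delta_simps(4) codegeneracy_ord coface_def)
qed

section \<open>The Yoneda lemma for standard simplices\<close>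

lemma std_map_Hom: "\<alpha> \<in> Hom Delta n m \<Longrightarrow> \<theta> \<in> Hom Delta p n \<Longrightarrow> std_map \<alpha> p \<theta> = \<alpha> \<cdot>\<^bsub>Delta\<^esub> \<theta>"
  by (simp add: std_map_def in_Hom)

lemma std_map_Ide: "\<alpha> \<in> Hom Delta n m \<Longrightarrow> std_map \<alpha> n (Ide Delta n) = \<alpha>"
  using std_map_Hom[OF _ Delta_Ide] Delta.Comp_Ide_right by simp

lemma simplicial_maps_std:
  "\<sigma> \<in> simplicial_maps (std_simplex n) K \<longleftrightarrow> (\<forall>p. \<sigma> p \<in> Hom Delta p n \<rightarrow>\<^sub>E Simp K p) \<and>
     (\<forall>p q. \<forall>\<alpha> \<in> Hom Delta p q. \<forall>\<theta> \<in> Hom Delta q n. \<sigma> p (\<theta> \<cdot>\<^bsub>Delta\<^esub> \<alpha>) = act K \<alpha> (\<sigma> q \<theta>))"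
  by (simp add: simplicial_maps_def std_simplex_def)

text \<open>Every \<theta> is the identity restricted along \<theta>, and \<sigma> commutes with
  restriction.\<close>

lemma Yoneda:
  assumes "\<sigma> \<in> simplicial_maps (std_simplex n) K" "\<theta> \<in> Hom Delta p n"
  shows "\<sigma> p \<theta> = act K \<theta> (\<sigma> n (Ide Delta n))"
  using assms Delta_Ide[of n] Delta.Comp_Ide_left[OF assms(2)] unfolding simplicial_maps_std by metis

lemma Yoneda_eqI:
  assumes "\<sigma> \<in> simplicial_maps (std_simplex n) K" "\<tau> \<in> simplicial_maps (std_simplex n) K"
    "\<sigma> n (Ide Delta n) = \<tau> n (Ide Delta n)"
  shows "\<sigma> = \<tau>"
proof
  fix p show "\<sigma> p = \<tau> p"
  proof (rule extensionalityI[of _ "Hom Delta p n"])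
    show "\<sigma> p \<in> extensional (Hom Delta p n)" "\<tau> p \<in> extensional (Hom Delta p n)"
      using assms(1,2) by (auto simp: simplicial_maps_std PiE_def)
    show "\<sigma> p \<theta> = \<tau> p \<theta>" if "\<theta> \<in> Hom Delta p n" for \<theta>
      using Yoneda[OF assms(1) that] Yoneda[OF assms(2) that] assms(3) by simp
  qed
qed

lemma std_map_simplicial:
  assumes "\<alpha> \<in> Hom Delta n m" shows "std_map \<alpha> \<in> simplicial_maps (std_simplex n) (std_simplex m)"
  unfolding simplicial_maps_std
proof (intro conjI allI ballI)
  show "std_map \<alpha> p \<in> Hom Delta p n \<rightarrow>\<^sub>E Simp (std_simplex m) p" for p
    using assms Delta_Comp_Hom[OF _ assms] by (auto simp: std_map_def std_simplex_def in_Hom)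
  fix p q \<beta> \<theta> assume b: "\<beta> \<in> Hom Delta p q" and t: "\<theta> \<in> Hom Delta q n"
  show "std_map \<alpha> p (\<theta> \<cdot>\<^bsub>Delta\<^esub> \<beta>) = act (std_simplex m) \<beta> (std_map \<alpha> q \<theta>)"
    using std_map_Hom[OF assms t] std_map_Hom[OF assms Delta_Comp_Hom[OF b t]] Delta.Comp_assoc[OF b t assms]
    by (simp add: std_simplex_def)
qed

lemma simplicial_map_std_map:
  assumes "\<phi> \<in> simplicial_maps (std_simplex n) (std_simplex m)"
  shows "\<phi> n (Ide Delta n) \<in> Hom Delta n m" "\<phi> = std_map (\<phi> n (Ide Delta n))"
proof -
  show h: "\<phi> n (Ide Delta n) \<in> Hom Delta n m"
    using assms[unfolded simplicial_maps_std] Delta_Ide[of n] by (auto simp: std_simplex_def)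
  show "\<phi> = std_map (\<phi> n (Ide Delta n))"
    by (rule Yoneda_eqI[OF assms std_map_simplicial[OF h]]) (simp add: std_map_Ide[OF h])
qed

lemma sset_comp_simplicial:
  assumes f: "f \<in> simplicial_maps A K" and g: "g \<in> simplicial_maps (std_simplex n) A"
  shows "sset_comp (std_simplex n) f g \<in> simplicial_maps (std_simplex n) K"
proof -
  have gH: "g p \<theta> \<in> Simp A p" if "\<theta> \<in> Hom Delta p n" for p \<theta>
    using g that by (auto simp: simplicial_maps_std)
  have gn: "g p (\<theta> \<cdot>\<^bsub>Delta\<^esub> \<alpha>) = act A \<alpha> (g q \<theta>)" if "\<alpha> \<in> Hom Delta p q" "\<theta> \<in> Hom Delta q n" for p q \<alpha> \<theta>
    using g that by (auto simp: simplicial_maps_std)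
  have fH: "f p x \<in> Simp K p" if "x \<in> Simp A p" for p x using f that by (auto simp: simplicial_maps_def)
  have fn: "f p (act A \<alpha> x) = act K \<alpha> (f q x)" if "\<alpha> \<in> Hom Delta p q" "x \<in> Simp A q" for p q \<alpha> x
    using f that by (auto simp: simplicial_maps_def)
  show ?thesis
    unfolding simplicial_maps_std
    by (auto simp: sset_comp_def std_simplex_def compose_def Delta_Comp_Hom gH fH gn fn)
qed

lemma sset_comp_apply: "\<theta> \<in> Hom Delta p n \<Longrightarrow> sset_comp (std_simplex n) f g p \<theta> = f p (g p \<theta>)"
  by (simp add: sset_comp_def std_simplex_def compose_def)

text \<open>This is the simplicial operator \<alpha> applied to the simplex \<open>y\<close>, with
  simplices seen as maps from standard simplices.\<close>

definition pullback :: "'u simplex \<Rightarrow> ord_map \<Rightarrow> 'u simplex" where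
  "pullback y \<alpha> = (fst \<alpha>, sset_comp (std_simplex (fst \<alpha>)) (snd y) (std_map \<alpha>))"

text \<open>By the Yoneda lemma an arrow into \<open>y\<close> amounts to a monotone map into the
  vertices of \<open>y\<close>, and its source is then determined. In this form composition of
  arrows is composition in \<open>Delta\<close>.\<close>

definition arr :: "'u simplex \<Rightarrow> ord_map \<Rightarrow> 'u simplex_arr" where
  "arr y \<alpha> = (pullback y \<alpha>, y, std_map \<alpha>)"

lemma in_simplices: "y \<in> simplices K \<longleftrightarrow> snd y \<in> simplicial_maps (std_simplex (fst y)) K"
  by (cases y) (simp add: simplices_def)

lemma fst_pullback: "\<alpha> \<in> Hom Delta n m \<Longrightarrow> fst (pullback y \<alpha>) = n"
  by (simp add: pullback_def Hom_Delta)

lemma pullback_simplices: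
  assumes "y \<in> simplices K" "\<alpha> \<in> Hom Delta n (fst y)" shows "pullback y \<alpha> \<in> simplices K"
proof -
  have "fst \<alpha> = n" using assms(2) by (simp add: Hom_Delta)
  then show ?thesis
    using assms sset_comp_simplicial[OF _ std_map_simplicial[OF assms(2)]] by (simp add: in_simplices pullback_def)
qed

lemma simplex_eqI:
  assumes "x \<in> simplices K" "y \<in> simplices K" "fst x = fst y"
    "snd x (fst x) (Ide Delta (fst x)) = snd y (fst x) (Ide Delta (fst x))"
  shows "x = y"
  using assms Yoneda_eqI[of "snd x" "fst x" K "snd y"] by (simp add: in_simplices prod_eq_iff)

lemma snd_pullback:
  assumes "\<alpha> \<in> Hom Delta n m" "\<theta> \<in> Hom Delta p n"
  shows "snd (pullback y \<alpha>) p \<theta> = snd y p (\<alpha> \<cdot>\<^bsub>Delta\<^esub> \<theta>)"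
proof -
  have "fst \<alpha> = n" using assms(1) by (simp add: Hom_Delta)
  then show ?thesis using assms by (simp add: pullback_def sset_comp_apply std_map_Hom)
qed

lemma pullback_Comp:
  assumes y: "y \<in> simplices K" and \<beta>: "\<beta> \<in> Hom Delta m (fst y)" and \<alpha>: "\<alpha> \<in> Hom Delta n m"
  shows "pullback (pullback y \<beta>) \<alpha> = pullback y (\<beta> \<cdot>\<^bsub>Delta\<^esub> \<alpha>)"
proof -
  note \<beta>\<alpha> = Delta_Comp_Hom[OF \<alpha> \<beta>]
  have \<alpha>': "\<alpha> \<in> Hom Delta n (fst (pullback y \<beta>))" using \<alpha> by (simp add: fst_pullback[OF \<beta>])
  have "snd (pullback (pullback y \<beta>) \<alpha>) n (Ide Delta n) = snd (pullback y (\<beta> \<cdot>\<^bsub>Delta\<^esub> \<alpha>)) n (Ide Delta n)"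
    by (simp add: snd_pullback[OF \<alpha> Delta_Ide] snd_pullback[OF \<beta>\<alpha> Delta_Ide]
        Delta.Comp_Ide_right[OF \<alpha>] Delta.Comp_Ide_right[OF \<beta>\<alpha>] snd_pullback[OF \<beta> \<alpha>])
  then show ?thesis
    by (intro simplex_eqI[OF pullback_simplices[OF pullback_simplices[OF y \<beta>] \<alpha>'] pullback_simplices[OF y \<beta>\<alpha>]])
       (simp_all add: fst_pullback[OF \<alpha>] fst_pullback[OF \<beta>\<alpha>])
qed

lemma pullback_Ide:
  assumes y: "y \<in> simplices K" shows "pullback y (Ide Delta (fst y)) = y"
  by (rule simplex_eqI[OF pullback_simplices[OF y Delta_Ide] y])
     (simp_all add: fst_pullback[OF Delta_Ide] snd_pullback[OF Delta_Ide Delta_Ide] Delta.Comp_Ide_left[OF Delta_Ide])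

lemma simplex_cat_simps:
  "Obj (simplex_cat K) = simplices K" "Dom (simplex_cat K) (x, y, \<phi>) = x" "Cod (simplex_cat K) (x, y, \<phi>) = y"
  by (simp_all add: simplex_cat_def)

lemma Arr_simplex_cat:
  "u \<in> Arr (simplex_cat K) \<longleftrightarrow> (\<exists>y \<alpha> n. y \<in> simplices K \<and> \<alpha> \<in> Hom Delta n (fst y) \<and> u = arr y \<alpha>)"
proof
  assume "u \<in> Arr (simplex_cat K)"
  then obtain n \<sigma> m \<tau> \<phi> where u: "u = ((n, \<sigma>), (m, \<tau>), \<phi>)" "(n, \<sigma>) \<in> simplices K" "(m, \<tau>) \<in> simplices K"
    and \<phi>: "\<phi> \<in> simplicial_maps (std_simplex n) (std_simplex m)" "sset_comp (std_simplex n) \<tau> \<phi> = \<sigma>"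
    by (auto simp: simplex_cat_def)
  define \<alpha> where "\<alpha> = \<phi> n (Ide Delta n)"
  note \<alpha> = simplicial_map_std_map[OF \<phi>(1), folded \<alpha>_def]
  have "u = arr (m, \<tau>) \<alpha>" using \<alpha> \<phi>(2) by (simp add: u arr_def pullback_def Hom_Delta)
  then show "\<exists>y \<alpha> n. y \<in> simplices K \<and> \<alpha> \<in> Hom Delta n (fst y) \<and> u = arr y \<alpha>"
    using u(3) \<alpha>(1) by (intro exI[of _ "(m, \<tau>)"] exI[of _ \<alpha>] exI[of _ n]) simp
next
  assume "\<exists>y \<alpha> n. y \<in> simplices K \<and> \<alpha> \<in> Hom Delta n (fst y) \<and> u = arr y \<alpha>"
  then obtain y \<alpha> n where y: "y \<in> simplices K" and \<alpha>: "\<alpha> \<in> Hom Delta n (fst y)" and u: "u = arr y \<alpha>" by blast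
  have "fst \<alpha> = n" using \<alpha> by (simp add: Hom_Delta)
  then show "u \<in> Arr (simplex_cat K)"
    using pullback_simplices[OF y \<alpha>] y std_map_simplicial[OF \<alpha>]
    by (cases y) (simp add: u arr_def pullback_def simplex_cat_def)
qed

lemma arr_simps: "Dom (simplex_cat K) (arr y \<alpha>) = pullback y \<alpha>" "Cod (simplex_cat K) (arr y \<alpha>) = y"
  by (simp_all add: arr_def simplex_cat_simps)

lemma Hom_simplex_cat:
  "u \<in> Hom (simplex_cat K) x y \<longleftrightarrow> y \<in> simplices K \<and> (\<exists>\<alpha> \<in> Hom Delta (fst x) (fst y). x = pullback y \<alpha> \<and> u = arr y \<alpha>)"
proof
  assume "u \<in> Hom (simplex_cat K) x y"
  then obtain \<alpha> n where "y \<in> simplices K" "\<alpha> \<in> Hom Delta n (fst y)" "x = pullback y \<alpha>" "u = arr y \<alpha>"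
    by (auto simp: in_Hom Arr_simplex_cat arr_simps)
  then show "y \<in> simplices K \<and> (\<exists>\<alpha> \<in> Hom Delta (fst x) (fst y). x = pullback y \<alpha> \<and> u = arr y \<alpha>)"
    by (auto simp: fst_pullback)
next
  assume "y \<in> simplices K \<and> (\<exists>\<alpha> \<in> Hom Delta (fst x) (fst y). x = pullback y \<alpha> \<and> u = arr y \<alpha>)"
  then obtain \<alpha> where "y \<in> simplices K" "\<alpha> \<in> Hom Delta (fst x) (fst y)" "x = pullback y \<alpha>" "u = arr y \<alpha>"
    by blast
  then have "u \<in> Arr (simplex_cat K)" "Dom (simplex_cat K) u = x" "Cod (simplex_cat K) u = y"
    unfolding Arr_simplex_cat by (blast, simp_all add: arr_simps)
  then show "u \<in> Hom (simplex_cat K) x y" by (simp add: in_Hom)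
qed

lemma arr_Hom:
  assumes "y \<in> simplices K" "\<alpha> \<in> Hom Delta n (fst y)" shows "arr y \<alpha> \<in> Hom (simplex_cat K) (pullback y \<alpha>) y"
  unfolding Hom_simplex_cat fst_pullback[OF assms(2)] using assms by blast

lemma arr_Comp:
  assumes z: "z \<in> simplices K" and \<beta>: "\<beta> \<in> Hom Delta m (fst z)" and \<alpha>: "\<alpha> \<in> Hom Delta n m"
  shows "arr z \<beta> \<cdot>\<^bsub>simplex_cat K\<^esub> arr (pullback z \<beta>) \<alpha> = arr z (\<beta> \<cdot>\<^bsub>Delta\<^esub> \<alpha>)"
proof -
  note \<beta>\<alpha> = Delta_Comp_Hom[OF \<alpha> \<beta>]
  have "sset_comp (std_simplex n) (std_map \<beta>) (std_map \<alpha>) = std_map (\<beta> \<cdot>\<^bsub>Delta\<^esub> \<alpha>)"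
    by (rule Yoneda_eqI[OF sset_comp_simplicial[OF std_map_simplicial[OF \<beta>] std_map_simplicial[OF \<alpha>]]
          std_map_simplicial[OF \<beta>\<alpha>]])
       (simp add: sset_comp_apply[OF Delta_Ide] std_map_Ide[OF \<alpha>] std_map_Ide[OF \<beta>\<alpha>] std_map_Hom[OF \<beta> \<alpha>])
  then show ?thesis
    using pullback_Comp[OF z \<beta> \<alpha>] fst_pullback[OF \<alpha>, of "pullback z \<beta>"] by (simp add: arr_def simplex_cat_def)
qed

lemma arr_Ide: "y \<in> simplices K \<Longrightarrow> Ide (simplex_cat K) y = arr y (Ide Delta (fst y))"
  using pullback_Ide[of y K] by (cases y) (simp add: simplex_cat_def arr_def)

lemma category_simplex_cat: "category (simplex_cat K)"
proof
  let ?C = "simplex_cat K"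
  show "Dom ?C u \<in> Obj ?C" "Cod ?C u \<in> Obj ?C" if "u \<in> Arr ?C" for u
    using that pullback_simplices by (auto simp: Arr_simplex_cat arr_simps simplex_cat_simps)
  show "Ide ?C y \<in> Hom ?C y y" if "y \<in> Obj ?C" for y
  proof -
    have y: "y \<in> simplices K" using that by (simp add: simplex_cat_simps)
    from arr_Hom[OF y Delta_Ide] show ?thesis by (simp add: arr_Ide[OF y] pullback_Ide[OF y])
  qed
  show "v \<cdot>\<^bsub>?C\<^esub> u \<in> Hom ?C x z" if u: "u \<in> Hom ?C x y" and v: "v \<in> Hom ?C y z" for u v x y z
  proof -
    obtain \<alpha> where \<alpha>: "\<alpha> \<in> Hom Delta (fst x) (fst y)" "x = pullback y \<alpha>" "u = arr y \<alpha>"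
      using u unfolding Hom_simplex_cat by blast
    obtain \<beta> where z: "z \<in> simplices K" and \<beta>: "\<beta> \<in> Hom Delta (fst y) (fst z)" "y = pullback z \<beta>" "v = arr z \<beta>"
      using v unfolding Hom_simplex_cat by blast
    have "v \<cdot>\<^bsub>?C\<^esub> u = arr z (\<beta> \<cdot>\<^bsub>Delta\<^esub> \<alpha>)" "x = pullback z (\<beta> \<cdot>\<^bsub>Delta\<^esub> \<alpha>)"
      using arr_Comp[OF z \<beta>(1) \<alpha>(1)] pullback_Comp[OF z \<beta>(1) \<alpha>(1)] by (simp_all only: \<alpha>(2,3) \<beta>(2,3))
    then show ?thesis using arr_Hom[OF z Delta_Comp_Hom[OF \<alpha>(1) \<beta>(1)]] by simp
  qed
  show "u \<cdot>\<^bsub>?C\<^esub> Ide ?C x = u" if u: "u \<in> Hom ?C x y" for u x y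
  proof -
    obtain \<alpha> where y: "y \<in> simplices K" and \<alpha>: "\<alpha> \<in> Hom Delta (fst x) (fst y)" "x = pullback y \<alpha>" "u = arr y \<alpha>"
      using u unfolding Hom_simplex_cat by blast
    have "Ide ?C x = arr (pullback y \<alpha>) (Ide Delta (fst x))"
      using arr_Ide[OF pullback_simplices[OF y \<alpha>(1)]] \<alpha>(2) by simp
    then show ?thesis using arr_Comp[OF y \<alpha>(1) Delta_Ide] Delta.Comp_Ide_right[OF \<alpha>(1)] \<alpha>(3) by simp
  qed
  show "Ide ?C y \<cdot>\<^bsub>?C\<^esub> u = u" if u: "u \<in> Hom ?C x y" for u x y
  proof -
    obtain \<alpha> where y: "y \<in> simplices K" and \<alpha>: "\<alpha> \<in> Hom Delta (fst x) (fst y)" "x = pullback y \<alpha>" "u = arr y \<alpha>"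
      using u unfolding Hom_simplex_cat by blast
    show ?thesis using arr_Comp[OF y Delta_Ide \<alpha>(1)] Delta.Comp_Ide_left[OF \<alpha>(1)] \<alpha>(3)
      by (simp add: arr_Ide[OF y] pullback_Ide[OF y])
  qed
  show "w \<cdot>\<^bsub>?C\<^esub> (v \<cdot>\<^bsub>?C\<^esub> u) = (w \<cdot>\<^bsub>?C\<^esub> v) \<cdot>\<^bsub>?C\<^esub> u"
    if u: "u \<in> Hom ?C a b" and v: "v \<in> Hom ?C b c" and w: "w \<in> Hom ?C c d" for u v w a b c d
  proof -
    obtain \<gamma> where d: "d \<in> simplices K" and \<gamma>: "\<gamma> \<in> Hom Delta (fst c) (fst d)" "c = pullback d \<gamma>" "w = arr d \<gamma>"
      using w unfolding Hom_simplex_cat by blast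
    obtain \<beta> where c: "c \<in> simplices K" and \<beta>: "\<beta> \<in> Hom Delta (fst b) (fst c)" "b = pullback c \<beta>" "v = arr c \<beta>"
      using v unfolding Hom_simplex_cat by blast
    obtain \<alpha> where b: "b \<in> simplices K" and \<alpha>: "\<alpha> \<in> Hom Delta (fst a) (fst b)" "a = pullback b \<alpha>" "u = arr b \<alpha>"
      using u unfolding Hom_simplex_cat by blast
    have vu: "v \<cdot>\<^bsub>?C\<^esub> u = arr c (\<beta> \<cdot>\<^bsub>Delta\<^esub> \<alpha>)" using arr_Comp[OF c \<beta>(1) \<alpha>(1)] \<alpha> \<beta> by simp
    have wv: "w \<cdot>\<^bsub>?C\<^esub> v = arr d (\<gamma> \<cdot>\<^bsub>Delta\<^esub> \<beta>)" using arr_Comp[OF d \<gamma>(1) \<beta>(1)] \<gamma> \<beta> by simp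
    have b': "b = pullback d (\<gamma> \<cdot>\<^bsub>Delta\<^esub> \<beta>)" using pullback_Comp[OF d \<gamma>(1) \<beta>(1)] \<beta>(2) \<gamma>(2) by simp
    have "w \<cdot>\<^bsub>?C\<^esub> (v \<cdot>\<^bsub>?C\<^esub> u) = arr d (\<gamma> \<cdot>\<^bsub>Delta\<^esub> (\<beta> \<cdot>\<^bsub>Delta\<^esub> \<alpha>))"
      using arr_Comp[OF d \<gamma>(1) Delta_Comp_Hom[OF \<alpha>(1) \<beta>(1)]] by (simp add: vu \<gamma>(3) \<gamma>(2)[symmetric])
    moreover have "(w \<cdot>\<^bsub>?C\<^esub> v) \<cdot>\<^bsub>?C\<^esub> u = arr d ((\<gamma> \<cdot>\<^bsub>Delta\<^esub> \<beta>) \<cdot>\<^bsub>Delta\<^esub> \<alpha>)"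
      using arr_Comp[OF d Delta_Comp_Hom[OF \<beta>(1) \<gamma>(1)] \<alpha>(1)] by (simp add: wv \<alpha>(3) b'[symmetric])
    ultimately show ?thesis using Delta.Comp_assoc[OF \<alpha>(1) \<beta>(1) \<gamma>(1)] by simp
  qed
qed

text \<open>An arrow is determined by its target, which is an element of \<open>'u\<close> together
  with a dimension, and by finitely many numbers: the dimension of the source and the values of the
  monotone map. An infinite \<open>'u\<close> absorbs this countable information.\<close>

lemma simplex_cat_small:
  assumes inf: "infinite (UNIV :: 'u set)"
  shows "|Arr (simplex_cat (K :: 'u sset))| \<le>o |UNIV :: 'u set|"
proof -
  define code :: "'u simplex_arr \<Rightarrow> ((nat \<times> nat) \<times> nat list) \<times> 'u" where
    "code = (\<lambda>(x, y, \<phi>). (((fst x, fst y), map (ev (\<phi> (fst x) (Ide Delta (fst x)))) [0..<Suc (fst x)]),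
       snd y (fst y) (Ide Delta (fst y))))"
  have "inj_on code (Arr (simplex_cat K))"
  proof (rule inj_onI)
    fix u v assume "u \<in> Arr (simplex_cat K)" "v \<in> Arr (simplex_cat K)" and eq: "code u = code v"
    then obtain y \<alpha> n z \<beta> m where y: "y \<in> simplices K" "\<alpha> \<in> Hom Delta n (fst y)" "u = arr y \<alpha>"
      and z: "z \<in> simplices K" "\<beta> \<in> Hom Delta m (fst z)" "v = arr z \<beta>"
      by (auto simp: Arr_simplex_cat)
    have c: "code (arr y \<alpha>) = (((n, fst y), map (ev \<alpha>) [0..<Suc n]), snd y (fst y) (Ide Delta (fst y)))"
      if "\<alpha> \<in> Hom Delta n (fst y)" for y \<alpha> n
      by (simp add: code_def arr_def fst_pullback[OF that] std_map_Ide[OF that] del: upt_Suc)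
    have e: "n = m" "fst y = fst z" "map (ev \<alpha>) [0..<Suc n] = map (ev \<beta>) [0..<Suc m]"
      "snd y (fst y) (Ide Delta (fst y)) = snd z (fst z) (Ide Delta (fst z))"
      using eq unfolding y(3) z(3) c[OF y(2)] c[OF z(2)] prod.inject by blast+
    have yz: "y = z" using simplex_eqI[OF y(1) z(1) e(2)] e(2,4) by simp
    have "ev \<alpha> j = ev \<beta> j" if "j \<le> n" for j
      using e(1,3) that by (auto simp: map_eq_conv simp del: upt_Suc)
    then have "\<alpha> = \<beta>" using Delta_eqI[of \<alpha> n "fst y" \<beta>] y(2) z(2) e(1,2) by simp
    then show "u = v" using yz y(3) z(3) by simp
  qed
  then have "|Arr (simplex_cat K)| \<le>o |(UNIV :: ((nat \<times> nat) \<times> nat list) set) \<times> (UNIV :: 'u set)|"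
    by (rule card_of_ordLeqI) auto
  also have "|(UNIV :: ((nat \<times> nat) \<times> nat list) set) \<times> (UNIV :: 'u set)| \<le>o |UNIV :: 'u set|"
    by (rule card_of_ordLeq_Times[OF inf card_of_ordLeq_countable[OF inf] card_of_mono1[OF subset_UNIV]])
  finally show ?thesis .
qed

section \<open>Degenerate and nondegenerate simplices\<close>

definition degeneracies :: "'u sset \<Rightarrow> 'u simplex_arr set" where
  "degeneracies K = {degeneracy_arr y i | y i. y \<in> simplices K \<and> i \<le> fst y}"

lemma degeneracy_arr: "degeneracy_arr y i = arr y (codegeneracy (fst y) i)"
  by (cases y) (simp add: degeneracy_arr_def arr_def pullback_def codegeneracy_def Let_def)

lemma bounded_iff: "bounded K C F \<longleftrightarrow> (\<forall>s \<in> degeneracies K. is_iso C (on_arr F s))"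
  unfolding bounded_def degeneracies_def by fastforce

lemma bounded_cat_eq: "bounded_cat K C = inv_cat (simplex_cat K) (degeneracies K) C"
  unfolding bounded_cat_def inv_cat_def by (rule arg_cong[of _ _ "full_subcategory _"]) (simp add: fun_eq_iff bounded_iff)

lemma degeneraciesE:
  assumes "s \<in> degeneracies K"
  obtains y i where "y \<in> simplices K" "i \<le> fst y" "s = arr y (codegeneracy (fst y) i)"
  using assms by (auto simp: degeneracies_def degeneracy_arr)

lemma degeneracy_section:
  assumes y: "y \<in> simplices K" and i: "i \<le> fst y" and k: "k = i \<or> k = i + 1"
  defines "s \<equiv> arr y (codegeneracy (fst y) i)" and "d \<equiv> arr (pullback y (codegeneracy (fst y) i)) (coface (fst y) k)"
  shows "d \<in> Hom (simplex_cat K) y (Dom (simplex_cat K) s)" "s \<cdot>\<^bsub>simplex_cat K\<^esub> d = Ide (simplex_cat K) y"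
proof -
  note c = codegeneracy_Hom[OF i] and sc = codegeneracy_coface[OF i k]
  have f: "coface (fst y) k \<in> Hom Delta (fst y) (fst (pullback y (codegeneracy (fst y) i)))"
    unfolding fst_pullback[OF c] by (rule coface_Hom)
  show "s \<cdot>\<^bsub>simplex_cat K\<^esub> d = Ide (simplex_cat K) y"
    unfolding s_def d_def arr_Comp[OF y c coface_Hom] sc arr_Ide[OF y] ..
  show "d \<in> Hom (simplex_cat K) y (Dom (simplex_cat K) s)"
    using arr_Hom[OF pullback_simplices[OF y c] f] pullback_Comp[OF y c coface_Hom] pullback_Ide[OF y]
    by (simp add: s_def d_def arr_simps sc)
qed

text \<open>A monotone map that is not injective takes equal values at two neighbours, so it factors
  through a codegeneracy and its source is degenerate. Hence \<alpha> is strictly increasing, and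
  between equal dimensions only the identity is.\<close>

lemma nondegenerate_injective:
  assumes u: "u \<in> Hom (simplex_cat K) x y" and x: "\<forall>s \<in> degeneracies K. Dom (simplex_cat K) s \<noteq> x"
  shows "fst x < fst y \<or> x = y \<and> u = Ide (simplex_cat K) x"
proof -
  obtain \<alpha> where y: "y \<in> simplices K" and \<alpha>: "\<alpha> \<in> Hom Delta (fst x) (fst y)" "x = pullback y \<alpha>" "u = arr y \<alpha>"
    using u unfolding Hom_simplex_cat by blast
  have step: "ev \<alpha> j < ev \<alpha> (Suc j)" if j: "j < fst x" for j
  proof (rule ccontr)
    assume "\<not> ev \<alpha> j < ev \<alpha> (Suc j)"
    then have eq: "ev \<alpha> j = ev \<alpha> (Suc j)" using ev_mono[OF \<alpha>(1), of j "Suc j"] j by simp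
    obtain n where n: "fst x = n + 1" using j by (cases "fst x") auto
    have jn: "j \<le> n" using j n by simp
    have \<alpha>n: "\<alpha> \<in> Hom Delta (n + 1) (fst y)" using \<alpha>(1) n by simp
    \<comment> \<open>Of two neighbours with the same value the second is omitted. This loses
      nothing, since \<alpha> is recovered by repeating the value at \<open>j\<close>.\<close>
    let ?\<beta> = "\<alpha> \<cdot>\<^bsub>Delta\<^esub> coface n (j + 1)"
    have \<beta>: "?\<beta> \<in> Hom Delta n (fst y)" using Delta_Comp_Hom[OF coface_Hom \<alpha>n] .
    note c = codegeneracy_Hom[OF jn]
    have "?\<beta> \<cdot>\<^bsub>Delta\<^esub> codegeneracy n j = \<alpha>"
    proof (rule Delta_eqI[OF Delta_Comp_Hom[OF c \<beta>] \<alpha>n])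
      fix k assume k: "k \<le> n + 1"
      have "ev (codegeneracy n j) k \<le> n" using ev_le[OF c k] .
      then have "ev (?\<beta> \<cdot>\<^bsub>Delta\<^esub> codegeneracy n j) k = ev \<alpha> (ev (coface n (j + 1)) (ev (codegeneracy n j) k))"
        using ev_Comp[OF c k] ev_Comp[OF coface_Hom] by simp
      also have "\<dots> = ev \<alpha> k"
      proof (cases "k = Suc j")
        case True
        then show ?thesis using jn eq by (simp add: codegeneracy_ord coface_def)
      next
        case False
        then show ?thesis using k jn by (auto simp: codegeneracy_ord coface_def)
      qed
      finally show "ev (?\<beta> \<cdot>\<^bsub>Delta\<^esub> codegeneracy n j) k = ev \<alpha> k" .
    qed
    then have x': "x = pullback (pullback y ?\<beta>) (codegeneracy n j)"
      using pullback_Comp[OF y \<beta> c] \<alpha>(2) by simp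
    have z: "pullback y ?\<beta> \<in> simplices K" "fst (pullback y ?\<beta>) = n"
      using pullback_simplices[OF y \<beta>] fst_pullback[OF \<beta>] by simp_all
    have "degeneracy_arr (pullback y ?\<beta>) j \<in> degeneracies K"
      unfolding degeneracies_def by (rule CollectI, intro exI conjI, rule refl) (use z jn in simp_all)
    moreover have "Dom (simplex_cat K) (degeneracy_arr (pullback y ?\<beta>) j) = x"
      unfolding degeneracy_arr arr_simps z(2) by (rule x'[symmetric])
    ultimately show False using x by blast
  qed
  \<comment> \<open>Counting steps from the left bounds a strictly increasing map from below;
    counting from the right, in \<open>down\<close>, bounds it from above. In equal dimensions the
    two bounds meet.\<close>
  have up: "j \<le> ev \<alpha> j" if "j \<le> fst x" for j
    using that
  proof (induction j)
    case (Suc j) then show ?case using step[of j] by simp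
  qed simp
  have down: "ev \<alpha> (fst x - k) + k \<le> fst y" if "k \<le> fst x" for k
    using that
  proof (induction k)
    case 0 then show ?case using ev_le[OF \<alpha>(1)] by simp
  next
    case (Suc k)
    then have "Suc (fst x - Suc k) = fst x - k" by simp
    then show ?case using step[of "fst x - Suc k"] Suc by simp
  qed
  show ?thesis
  proof (cases "fst x < fst y")
    case False
    then have n: "fst x = fst y" using up[of "fst x"] ev_le[OF \<alpha>(1), of "fst x"] by simp
    have "\<alpha> = Ide Delta (fst y)"
    proof (rule Delta_eqI[of _ "fst x" "fst y"])
      show "\<alpha> \<in> Hom Delta (fst x) (fst y)" "Ide Delta (fst y) \<in> Hom Delta (fst x) (fst y)"
        using \<alpha>(1) Delta_Ide n by simp_all
      fix j assume j: "j \<le> fst x"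
      have "ev \<alpha> j = j" using up[OF j] down[of "fst x - j"] j n by simp
      then show "ev \<alpha> j = ev (Ide Delta (fst y)) j" using j n by (simp add: Delta_simps(4))
    qed
    then show ?thesis using \<alpha>(2,3) pullback_Ide[OF y] arr_Ide[OF y] by simp
  qed simp
qed

lemma simplex_cat_direct_inverting:
  assumes inf: "infinite (UNIV :: 'u set)" and M: "category M"
    and lim: "has_small_limits M TYPE('u)" and colim: "has_small_colimits M TYPE('u)"
  shows "direct_inverting (simplex_cat (K :: 'u sset)) M (degeneracies K) TYPE('u) fst"
proof -
  let ?C = "simplex_cat K"
  interpret C: category ?C by (rule category_simplex_cat)
  interpret M: category M by (rule M)
  show ?thesis
  proof
    show "degeneracies K \<subseteq> Arr ?C"
    proof
      fix s assume "s \<in> degeneracies K"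
      then obtain y i where y: "y \<in> simplices K" and i: "i \<le> fst y" and s: "s = arr y (codegeneracy (fst y) i)"
        by (rule degeneraciesE)
      show "s \<in> Arr ?C" using arr_Hom[OF y codegeneracy_Hom[OF i]] by (simp add: s in_Hom)
    qed
    show "\<exists>d \<in> Hom ?C (Cod ?C s) (Dom ?C s). s \<cdot>\<^bsub>?C\<^esub> d = Ide ?C (Cod ?C s)" if "s \<in> degeneracies K" for s
      using that
    proof (rule degeneraciesE)
      fix y i assume y: "y \<in> simplices K" and i: "i \<le> fst y" and s: "s = arr y (codegeneracy (fst y) i)"
      have "Cod ?C s = y" by (simp add: s arr_simps)
      then show ?thesis using degeneracy_section[OF y i disjI1[OF refl]] by (auto simp: s)
    qed
    show "fst (Cod ?C s) < fst (Dom ?C s)" if "s \<in> degeneracies K" for s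
      using that
    proof (rule degeneraciesE)
      fix y i assume "i \<le> fst y" and s: "s = arr y (codegeneracy (fst y) i)"
      then show ?thesis by (simp add: arr_simps fst_pullback[OF codegeneracy_Hom])
    qed
    show "|Arr ?C| \<le>o |UNIV :: 'u set|" by (rule simplex_cat_small[OF inf])
    show "fst x < fst y \<or> x = y \<and> u = Ide ?C x"
      if "u \<in> Hom ?C x y" "\<forall>s \<in> degeneracies K. Dom ?C s \<noteq> x" for u x y
      using nondegenerate_injective[OF that] .
  qed (fact inf lim colim)+
qed

section \<open>The functor induced by a simplicial map\<close>

lemma simplex_functor_simps:
  "fst (on_obj (simplex_functor L f) x) = fst x"
  "on_arr (simplex_functor L f) (arr y \<alpha>) = (on_obj (simplex_functor L f) (pullback y \<alpha>), on_obj (simplex_functor L f) y, std_map \<alpha>)"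
  by (simp_all add: simplex_functor_def arr_def Let_def split: prod.splits)

lemma simplex_functor_simplices:
  assumes f: "f \<in> simplicial_maps L K" and x: "x \<in> simplices L"
  shows "on_obj (simplex_functor L f) x \<in> simplices K"
  using x sset_comp_simplicial[OF f] by (cases x) (simp add: in_simplices simplex_functor_def Let_def)

lemma simplex_functor_pullback:
  assumes f: "f \<in> simplicial_maps L K" and y: "y \<in> simplices L" and \<alpha>: "\<alpha> \<in> Hom Delta n (fst y)"
  shows "on_obj (simplex_functor L f) (pullback y \<alpha>) = pullback (on_obj (simplex_functor L f) y) \<alpha>"
proof (rule simplex_eqI)
  let ?P = "on_obj (simplex_functor L f)"
  have \<alpha>': "\<alpha> \<in> Hom Delta n (fst (?P y))" using \<alpha> by (simp add: simplex_functor_simps)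
  have P_apply: "snd (?P x) p \<theta> = f p (snd x p \<theta>)" if "\<theta> \<in> Hom Delta p (fst x)" for x p \<theta>
    using that by (cases x) (simp add: simplex_functor_def sset_comp_apply Let_def)
  show "?P (pullback y \<alpha>) \<in> simplices K" "pullback (?P y) \<alpha> \<in> simplices K"
    using simplex_functor_simplices[OF f] pullback_simplices y \<alpha> \<alpha>' by blast+
  show "fst (?P (pullback y \<alpha>)) = fst (pullback (?P y) \<alpha>)"
    by (simp add: simplex_functor_simps fst_pullback[OF \<alpha>] fst_pullback[OF \<alpha>'])
  have "fst (pullback y \<alpha>) = n" by (rule fst_pullback[OF \<alpha>])
  then show "snd (?P (pullback y \<alpha>)) (fst (?P (pullback y \<alpha>))) (Ide Delta (fst (?P (pullback y \<alpha>)))) =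
      snd (pullback (?P y) \<alpha>) (fst (?P (pullback y \<alpha>))) (Ide Delta (fst (?P (pullback y \<alpha>))))"
    using P_apply[of "Ide Delta n" n "pullback y \<alpha>"] P_apply[of \<alpha> n y] Delta_Ide[of n] \<alpha>
    by (simp add: simplex_functor_simps snd_pullback[OF \<alpha> Delta_Ide] snd_pullback[OF \<alpha>' Delta_Ide] Delta.Comp_Ide_right[OF \<alpha>])
qed

lemma simplex_functor_arr:
  assumes "f \<in> simplicial_maps L K" "y \<in> simplices L" "\<alpha> \<in> Hom Delta n (fst y)"
  shows "on_arr (simplex_functor L f) (arr y \<alpha>) = arr (on_obj (simplex_functor L f) y) \<alpha>"
  using simplex_functor_pullback[OF assms] by (simp add: simplex_functor_simps(2)) (simp add: arr_def)

lemma simplex_functor: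
  assumes f: "f \<in> simplicial_maps L K"
  shows "is_functor (simplex_cat L) (simplex_cat K) (simplex_functor L f)"
proof (rule functorI[OF category_simplex_cat category_simplex_cat])
  let ?P = "simplex_functor L f"
  note obj = simplex_functor_simplices[OF f] and arr = simplex_functor_arr[OF f] and pb = simplex_functor_pullback[OF f]
  show "on_obj ?P x \<in> Obj (simplex_cat K)" if "x \<in> Obj (simplex_cat L)" for x
    using obj that by (simp add: simplex_cat_simps)
  show "on_arr ?P u \<in> Hom (simplex_cat K) (on_obj ?P x) (on_obj ?P y)" if u: "u \<in> Hom (simplex_cat L) x y" for u x y
  proof -
    obtain \<alpha> where y: "y \<in> simplices L" and \<alpha>: "\<alpha> \<in> Hom Delta (fst x) (fst y)" "x = pullback y \<alpha>" "u = arr y \<alpha>"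
      using u unfolding Hom_simplex_cat by blast
    have "\<alpha> \<in> Hom Delta (fst x) (fst (on_obj ?P y))" using \<alpha>(1) by (simp add: simplex_functor_simps)
    from arr_Hom[OF obj[OF y] this] show ?thesis using pb[OF y \<alpha>(1)] arr[OF y \<alpha>(1)] \<alpha> by simp
  qed
  show "on_arr ?P (Ide (simplex_cat L) x) = Ide (simplex_cat K) (on_obj ?P x)" if "x \<in> Obj (simplex_cat L)" for x
  proof -
    have x: "x \<in> simplices L" using that by (simp add: simplex_cat_simps)
    show ?thesis using arr[OF x Delta_Ide] arr_Ide[OF x] arr_Ide[OF obj[OF x]] by (simp add: simplex_functor_simps)
  qed
  show "on_arr ?P (v \<cdot>\<^bsub>simplex_cat L\<^esub> u) = on_arr ?P v \<cdot>\<^bsub>simplex_cat K\<^esub> on_arr ?P u"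
    if u: "u \<in> Hom (simplex_cat L) x y" and v: "v \<in> Hom (simplex_cat L) y z" for u v x y z
  proof -
    obtain \<beta> where z: "z \<in> simplices L" and \<beta>: "\<beta> \<in> Hom Delta (fst y) (fst z)" "y = pullback z \<beta>" "v = arr z \<beta>"
      using v unfolding Hom_simplex_cat by blast
    obtain \<alpha> where y: "y \<in> simplices L" and \<alpha>: "\<alpha> \<in> Hom Delta (fst x) (fst y)" "x = pullback y \<alpha>" "u = arr y \<alpha>"
      using u unfolding Hom_simplex_cat by blast
    have \<beta>': "\<beta> \<in> Hom Delta (fst y) (fst (on_obj ?P z))" using \<beta>(1) by (simp add: simplex_functor_simps)
    have 1: "v \<cdot>\<^bsub>simplex_cat L\<^esub> u = arr z (\<beta> \<cdot>\<^bsub>Delta\<^esub> \<alpha>)" using arr_Comp[OF z \<beta>(1) \<alpha>(1)] \<alpha>(3) \<beta>(2,3) by simp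
    have 2: "on_obj ?P y = pullback (on_obj ?P z) \<beta>" using pb[OF z \<beta>(1)] \<beta>(2) by simp
    show ?thesis
      unfolding 1 unfolding arr[OF z Delta_Comp_Hom[OF \<alpha>(1) \<beta>(1)]] \<alpha>(3) \<beta>(3) arr[OF z \<beta>(1)] arr[OF y \<alpha>(1)] 2
        arr_Comp[OF obj[OF z] \<beta>' \<alpha>(1)] ..
  qed
qed

lemma simplex_inverting_functor:
  assumes "infinite (UNIV :: 'u set)" and "category M"
    and "has_small_limits M TYPE('u)" and "has_small_colimits M TYPE('u)"
    and f: "f \<in> simplicial_maps L (K :: 'u sset)"
  shows "inverting_functor (simplex_cat (L :: 'u sset)) (simplex_cat K) M (degeneracies L) (degeneracies K)
    TYPE('u) (simplex_functor L f)"
proof -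
  interpret L: direct_inverting "simplex_cat L" M "degeneracies L" "TYPE('u)" fst
    by (rule simplex_cat_direct_inverting[OF assms(1-4)])
  interpret K: direct_inverting "simplex_cat K" M "degeneracies K" "TYPE('u)" fst
    by (rule simplex_cat_direct_inverting[OF assms(1-4)])
  show ?thesis
  proof
    show "is_functor (simplex_cat L) (simplex_cat K) (simplex_functor L f)" by (rule simplex_functor[OF f])
    show "on_arr (simplex_functor L f) s \<in> degeneracies K" if "s \<in> degeneracies L" for s
      using that
    proof (rule degeneraciesE)
      fix y i assume y: "y \<in> simplices L" and i: "i \<le> fst y" and s: "s = arr y (codegeneracy (fst y) i)"
      let ?Py = "on_obj (simplex_functor L f) y"
      have "on_arr (simplex_functor L f) s = degeneracy_arr ?Py i"
        unfolding s degeneracy_arr simplex_functor_simps(1) by (rule simplex_functor_arr[OF f y codegeneracy_Hom[OF i]])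
      moreover have "?Py \<in> simplices K" "i \<le> fst ?Py"
        using simplex_functor_simplices[OF f y] i by (simp_all add: simplex_functor_simps)
      ultimately show ?thesis unfolding degeneracies_def by (intro CollectI exI conjI)
    qed
  qed
qed

text \<open>The prism argument: \<open>\<delta> \<sigma> \<alpha>\<close>, where \<open>\<sigma>\<close> is the codegeneracy at \<open>i\<close> and \<open>\<delta>\<close> the section that
  omits \<open>i + 1\<close>, arises from \<open>\<alpha>\<close> by lowering its values one vertex at a time, and each such step is an adjacency.\<close>

lemma degeneracy_homotopy:
  assumes inf: "infinite (UNIV :: 'u set)" and M: "category M"
    and lim: "has_small_limits M TYPE('u)" and colim: "has_small_colimits M TYPE('u)"
    and f: "f \<in> simplicial_maps (L :: 'u sset) (K :: 'u sset)" and s: "s \<in> degeneracies K"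
  defines "P \<equiv> simplex_functor L f"
  shows "\<exists>d \<in> Hom (simplex_cat K) (Cod (simplex_cat K) s) (Dom (simplex_cat K) s).
    s \<cdot>\<^bsub>simplex_cat K\<^esub> d = Ide (simplex_cat K) (Cod (simplex_cat K) s) \<and>
    (\<forall>x \<in> Obj (simplex_cat L). \<forall>a \<in> Hom (simplex_cat K) (on_obj P x) (Dom (simplex_cat K) s).
      (inverting_functor.adjacent (simplex_cat L) (simplex_cat K) (degeneracies L) P x (Dom (simplex_cat K) s))\<^sup>*\<^sup>*
        a ((d \<cdot>\<^bsub>simplex_cat K\<^esub> s) \<cdot>\<^bsub>simplex_cat K\<^esub> a))"
  using s
proof (rule degeneraciesE)
  let ?K = "simplex_cat K" and ?L = "simplex_cat L"
  interpret inverting_functor ?L ?K M "degeneracies L" "degeneracies K" "TYPE('u)" P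
    unfolding P_def by (rule simplex_inverting_functor[OF inf M lim colim f])
  fix y i assume y: "y \<in> simplices K" and i: "i \<le> fst y" and s: "s = arr y (codegeneracy (fst y) i)"
  define n where "n = fst y"
  define \<sigma> where "\<sigma> = codegeneracy n i"
  \<comment> \<open>Of the two sections the one missing \<open>i + 1\<close> is taken, so that
    \<open>r\<close> below lowers values: it sends \<open>i + 1\<close> to \<open>i\<close> and
    fixes everything else.\<close>
  define \<delta> where "\<delta> = coface n (i + 1)"
  define y' where "y' = pullback y \<sigma>"
  define r where "r = \<delta> \<cdot>\<^bsub>Delta\<^esub> \<sigma>"
  have \<sigma>: "\<sigma> \<in> Hom Delta (n + 1) (fst y)" and \<delta>: "\<delta> \<in> Hom Delta n (n + 1)" and \<sigma>\<delta>: "\<sigma> \<cdot>\<^bsub>Delta\<^esub> \<delta> = Ide Delta n"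
    using codegeneracy_Hom[OF i] coface_Hom codegeneracy_coface[of i n "i + 1"] i by (simp_all add: \<sigma>_def \<delta>_def n_def)
  have s': "s = arr y \<sigma>" "Cod ?K s = y" "Dom ?K s = y'" by (simp_all add: s \<sigma>_def n_def y'_def arr_simps)
  have y'K: "y' \<in> simplices K" and y'n: "fst y' = n + 1"
    using pullback_simplices[OF y \<sigma>] fst_pullback[OF \<sigma>] by (simp_all add: y'_def)
  define d where "d = arr y' \<delta>"
  have d: "d \<in> Hom ?K y y'" "s \<cdot>\<^bsub>?K\<^esub> d = Ide ?K y"
    using degeneracy_section[OF y i disjI2[OF refl]] by (simp_all add: s d_def y'_def \<sigma>_def \<delta>_def n_def arr_simps)
  have yd: "y = pullback y' \<delta>" using d(1) by (simp add: d_def in_Hom arr_simps)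
  have rH: "r \<in> Hom Delta (n + 1) (n + 1)"
    unfolding r_def using \<sigma> \<delta> Delta_Comp_Hom[of \<sigma> "n + 1" n \<delta> "n + 1"] by (simp add: n_def)
  have \<delta>': "\<delta> \<in> Hom Delta n (fst y')" and \<sigma>': "\<sigma> \<in> Hom Delta (n + 1) n" using \<delta> \<sigma> by (simp_all add: y'n n_def)
  have ds: "d \<cdot>\<^bsub>?K\<^esub> s = arr y' r"
    using arr_Comp[OF y'K \<delta>' \<sigma>'] yd by (simp add: d_def s'(1) r_def)
  have r_le: "ev r j \<le> j" and \<sigma>r: "ev \<sigma> (ev r j) = ev \<sigma> j" if j: "j \<le> n + 1" for j
  proof -
    have "ev r j = (if j \<le> i then j else if j = i + 1 then i else j)"
      unfolding r_def ev_Comp[OF \<sigma>' j] using j i by (auto simp: \<sigma>_def \<delta>_def codegeneracy_ord coface_def n_def)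
    then show "ev r j \<le> j" "ev \<sigma> (ev r j) = ev \<sigma> j" using j by (auto simp: \<sigma>_def codegeneracy_ord)
  qed
  have "(adjacent x y')\<^sup>*\<^sup>* a ((d \<cdot>\<^bsub>?K\<^esub> s) \<cdot>\<^bsub>?K\<^esub> a)" if x: "x \<in> Obj ?L" and a: "a \<in> Hom ?K (on_obj P x) y'" for x a
  proof -
    define m where "m = fst x"
    have xL: "x \<in> simplices L" using x by (simp add: simplex_cat_simps)
    have Px: "fst (on_obj P x) = m" by (simp add: P_def simplex_functor_simps m_def)
    obtain \<alpha> where \<alpha>: "\<alpha> \<in> Hom Delta m (n + 1)" "on_obj P x = pullback y' \<alpha>" "a = arr y' \<alpha>"
      using a unfolding Hom_simplex_cat Px y'n by blast
    have \<alpha>_le: "ev \<alpha> j \<le> n + 1" if "j \<le> m" for j using ev_le[OF \<alpha>(1) that] .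
    have r\<alpha>_mono: "ev r (ev \<alpha> j) \<le> ev r (ev \<alpha> k)" if "j \<le> k" "k \<le> m" for j k
      using ev_mono[OF rH ev_mono[OF \<alpha>(1) that] \<alpha>_le[OF that(2)]] .
    have r\<alpha>_le: "ev r (ev \<alpha> j) \<le> ev \<alpha> j" if "j \<le> m" for j using r_le[OF \<alpha>_le[OF that]] .
    have r\<alpha>_le': "ev r (ev \<alpha> j) \<le> ev \<alpha> k" if "j \<le> k" "k \<le> m" for j k
      using r\<alpha>_le[of j] ev_mono[OF \<alpha>(1) that] that by simp
    \<comment> \<open>Interpolation between \<alpha> and \<open>r \<alpha>\<close>, with the first
      \<open>k\<close> vertices already lowered. It is monotone because the lowered vertices come
      first and \<open>r\<close> never raises a value.\<close>
    define A where "A k = ord m (n + 1) (\<lambda>j. if j < k then ev r (ev \<alpha> j) else ev \<alpha> j)" for k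
    have A: "A k \<in> Hom Delta m (n + 1)" for k
      unfolding A_def
    proof (rule ord_Hom)
      show "(if j < k then ev r (ev \<alpha> j) else ev \<alpha> j) \<le> n + 1" if "j \<le> m" for j
        using \<alpha>_le[OF that] r\<alpha>_le[OF that] by auto
      show "(if j < k then ev r (ev \<alpha> j) else ev \<alpha> j) \<le> (if j' < k then ev r (ev \<alpha> j') else ev \<alpha> j')"
        if "j \<le> j'" "j' \<le> m" for j j'
        using that r\<alpha>_mono[OF that] r\<alpha>_le'[OF that] ev_mono[OF \<alpha>(1) that] by auto
    qed
    have A_step: "adjacent x y' (arr y' (A k)) (arr y' (A (Suc k)))" if k: "k \<le> m" for k
    proof -
      define t where "t = codegeneracy m k"
      define x' where "x' = pullback x t"
      \<comment> \<open>One layer of the prism: vertex \<open>k\<close> occurs twice, first lowered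
        and then in its old place. Omitting the first copy gives \<open>A k\<close>, omitting the
        second gives \<open>A (Suc k)\<close>.\<close>
      define g where "g = ord (m + 1) (n + 1) (\<lambda>j. if j \<le> k then ev r (ev \<alpha> j) else ev \<alpha> (j - 1))"
      have t: "t \<in> Hom Delta (m + 1) m" using codegeneracy_Hom[OF k] by (simp add: t_def)
      have t': "t \<in> Hom Delta (m + 1) (fst x)" using t by (simp add: m_def)
      have g: "g \<in> Hom Delta (m + 1) (n + 1)"
        unfolding g_def
      proof (rule ord_Hom)
        show "(if j \<le> k then ev r (ev \<alpha> j) else ev \<alpha> (j - 1)) \<le> n + 1" if "j \<le> m + 1" for j
          using \<alpha>_le[of j] r\<alpha>_le[of j] \<alpha>_le[of "j - 1"] that k by auto
        show "(if j \<le> k then ev r (ev \<alpha> j) else ev \<alpha> (j - 1)) \<le> (if j' \<le> k then ev r (ev \<alpha> j') else ev \<alpha> (j' - 1))"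
          if "j \<le> j'" "j' \<le> m + 1" for j j'
          using that k r\<alpha>_mono[of j j'] r\<alpha>_le'[of j "j' - 1"] ev_mono[OF \<alpha>(1), of "j - 1" "j' - 1"] by auto
      qed
      have g': "g \<in> Hom Delta (m + 1) (fst y')" using g by (simp add: y'n)
      \<comment> \<open>After \<sigma> both copies of vertex \<open>k\<close> coincide, so
        \<open>g\<close> agrees there with the degenerate map \<open>\<alpha> t\<close>. As
        \<open>y'\<close> is itself pulled back along \<sigma>, restricting it along
        \<open>g\<close> gives the degeneracy of \<open>P x\<close>, which is the image of a
        degeneracy in \<open>L\<close>.\<close>
      have "\<sigma> \<cdot>\<^bsub>Delta\<^esub> g = (\<sigma> \<cdot>\<^bsub>Delta\<^esub> \<alpha>) \<cdot>\<^bsub>Delta\<^esub> t"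
      proof (rule Delta_eqI[OF Delta_Comp_Hom[OF g \<sigma>'] Delta_Comp_Hom[OF t Delta_Comp_Hom[OF \<alpha>(1) \<sigma>']]])
        fix j assume j: "j \<le> m + 1"
        have "ev t j \<le> m" using ev_le[OF t j] .
        then show "ev (\<sigma> \<cdot>\<^bsub>Delta\<^esub> g) j = ev ((\<sigma> \<cdot>\<^bsub>Delta\<^esub> \<alpha>) \<cdot>\<^bsub>Delta\<^esub> t) j"
          unfolding ev_Comp[OF g j] ev_Comp[OF t j] ev_Comp[OF \<alpha>(1) \<open>ev t j \<le> m\<close>]
          using j k \<sigma>r[OF \<alpha>_le[of j]] by (auto simp: g_def t_def codegeneracy_ord)
      qed
      then have eq: "\<sigma> \<cdot>\<^bsub>Delta\<^esub> g = \<sigma> \<cdot>\<^bsub>Delta\<^esub> (\<alpha> \<cdot>\<^bsub>Delta\<^esub> t)" using Delta.Comp_assoc[OF t \<alpha>(1) \<sigma>'] by simp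
      have \<alpha>': "\<alpha> \<in> Hom Delta m (fst y')" using \<alpha>(1) by (simp add: y'n)
      have Px': "on_obj P x' = pullback y' g"
      proof -
        have "on_obj P x' = pullback (pullback y' \<alpha>) t"
          unfolding x'_def \<alpha>(2)[symmetric] unfolding P_def by (rule simplex_functor_pullback[OF f xL t'])
        also have "\<dots> = pullback (pullback y \<sigma>) (\<alpha> \<cdot>\<^bsub>Delta\<^esub> t)"
          using pullback_Comp[OF y'K \<alpha>' t] by (simp add: y'_def)
        also have "\<dots> = pullback (pullback y \<sigma>) g"
          unfolding pullback_Comp[OF y \<sigma> Delta_Comp_Hom[OF t \<alpha>(1)]] pullback_Comp[OF y \<sigma> g] eq ..
        finally show ?thesis by (simp add: y'_def)
      qed
      have \<gamma>: "arr y' g \<in> Hom ?K (on_obj P x') y'" unfolding Px' by (rule arr_Hom[OF y'K g'])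
      have x'L: "x' \<in> simplices L" and x'm: "fst x' = m + 1"
        using pullback_simplices[OF xL t'] fst_pullback[OF t] by (simp_all add: x'_def)
      have sec: "arr x' (coface m l) \<in> Hom ?L x (Dom ?L (arr x t))" "arr x t \<cdot>\<^bsub>?L\<^esub> arr x' (coface m l) = Ide ?L x"
        if "l = k \<or> l = k + 1" for l
        using degeneracy_section[OF xL k[unfolded m_def] that] by (simp_all add: t_def x'_def m_def)
      have comp: "arr y' g \<cdot>\<^bsub>?K\<^esub> on_arr P (arr x' (coface m l)) = arr y' (A l)" if l: "l = k \<or> l = k + 1" for l
      proof -
        have cf: "coface m l \<in> Hom Delta m (fst x')" using coface_Hom by (simp add: x'm)
        have "on_arr P (arr x' (coface m l)) = arr (pullback y' g) (coface m l)"
          using simplex_functor_arr[OF f x'L cf] Px' by (simp add: P_def)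
        then have "arr y' g \<cdot>\<^bsub>?K\<^esub> on_arr P (arr x' (coface m l)) = arr y' (g \<cdot>\<^bsub>Delta\<^esub> coface m l)"
          using arr_Comp[OF y'K g' coface_Hom] by simp
        also have "g \<cdot>\<^bsub>Delta\<^esub> coface m l = A l"
        proof (rule Delta_eqI[OF Delta_Comp_Hom[OF coface_Hom g] A])
          fix j assume j: "j \<le> m"
          show "ev (g \<cdot>\<^bsub>Delta\<^esub> coface m l) j = ev (A l) j"
            unfolding ev_Comp[OF coface_Hom j] using j k l by (auto simp: g_def A_def coface_def)
        qed
        finally show ?thesis .
      qed
      have "arr x t \<in> degeneracies L"
        unfolding t_def m_def degeneracy_arr[symmetric] degeneracies_def
        by (rule CollectI, intro exI conjI, rule refl) (use xL k m_def in simp_all)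
      moreover have "Dom ?L (arr x t) = x'" "Cod ?L (arr x t) = x" by (simp_all add: arr_simps x'_def)
      ultimately show ?thesis
        unfolding adjacent_def using sec[of k] sec[of "k + 1"] comp[of k] comp[of "k + 1"] \<gamma>
        by (intro bexI[of _ "arr x t"] bexI[of _ "arr x' (coface m k)"] bexI[of _ "arr x' (coface m (k + 1))"]
            bexI[of _ "arr y' g"] conjI) simp_all
    qed
    \<comment> \<open>There are \<open>m + 1\<close> vertices to lower, so the chain runs up to
      \<open>A (Suc m)\<close>, in which every vertex has been treated.\<close>
    have "(adjacent x y')\<^sup>*\<^sup>* (arr y' (A 0)) (arr y' (A k))" if "k \<le> Suc m" for k
      using that
    proof (induction k)
      case (Suc k)
      then show ?case using A_step[of k] by (simp add: rtranclp.rtrancl_into_rtrancl)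
    qed simp
    from this[of "Suc m"] have "(adjacent x y')\<^sup>*\<^sup>* (arr y' (A 0)) (arr y' (A (Suc m)))" by simp
    moreover have "A 0 = \<alpha>"
      by (rule Delta_eqI[OF A \<alpha>(1)]) (simp add: A_def)
    moreover have "A (Suc m) = r \<cdot>\<^bsub>Delta\<^esub> \<alpha>"
      by (rule Delta_eqI[OF A Delta_Comp_Hom[OF \<alpha>(1) rH]]) (simp add: A_def ev_Comp[OF \<alpha>(1)])
    moreover have "(d \<cdot>\<^bsub>?K\<^esub> s) \<cdot>\<^bsub>?K\<^esub> a = arr y' (r \<cdot>\<^bsub>Delta\<^esub> \<alpha>)"
    proof -
      have r': "r \<in> Hom Delta (n + 1) (fst y')" using rH by (simp add: y'n)
      have "pullback y' r = pullback (pullback y' \<delta>) \<sigma>"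
        unfolding r_def by (rule pullback_Comp[OF y'K \<delta>' \<sigma>', symmetric])
      also have "\<dots> = y'" unfolding yd[symmetric] by (rule y'_def[symmetric])
      finally show ?thesis using arr_Comp[OF y'K r' \<alpha>(1)] by (simp add: ds \<alpha>(3))
    qed
    ultimately show ?thesis by (simp add: \<alpha>(3))
  qed
  then show ?thesis unfolding s'(2,3) using d by blast
qed

section \<open>The statements for bounded diagrams\<close>

lemma extend_left_adjoint:
  "is_left_adjoint (cat.extend C (model_cat.fields W Fi Co)) D F R = is_left_adjoint C D F R"
  "is_left_adjoint D (cat.extend C (model_cat.fields W Fi Co)) F' R' = is_left_adjoint D C F' R'"
  for C :: "('o, 'a) cat" and W Fi Co :: "'a set"
  by (simp_all add: is_left_adjoint_def extend_defs)

lemma bounded_model_exists: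
  assumes inf: "infinite (UNIV :: 'u set)" and M: "model_category M TYPE('u)"
  shows "\<exists>CK. model_category (bounded_model (K :: 'u sset) M CK) TYPE('u)"
proof -
  interpret M: model_category M "TYPE('u)" by (rule M)
  have "direct_inverting (simplex_cat K) M (degeneracies K) TYPE('u) fst"
    by (rule simplex_cat_direct_inverting[OF inf M.category_axioms M.MC1])
  from model_structure[OF M this] show ?thesis
    unfolding bounded_model_def bounded_cat_eq simplex_cat_simps by blast
qed

text \<open>The right adjoint is the constant diagram functor. Every component of the transformation
  it assigns to an arrow is that arrow, so it preserves fibrations and weak equivalences.\<close>

lemma bounded_colimit:
  assumes inf: "infinite (UNIV :: 'u set)" and M: "model_category M TYPE('u)"
    and N: "model_category (bounded_model (K :: 'u sset) M CK) TYPE('u)"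
    and Q: "is_colimit_functor (simplex_cat K) M (bounded_cat K M) Q"
  shows "homotopy_meaningful_on_cofibrant (bounded_model K M CK) M Q \<and>
    preserves_cofibrations (bounded_model K M CK) M Q \<and>
    preserves_acyclic_cofibrations (bounded_model K M CK) M Q \<and>
    preserves_cofibrant_objects (bounded_model K M CK) M Q"
proof -
  interpret M: model_category M "TYPE('u)" by (rule M)
  interpret K: direct_inverting "simplex_cat K" M "degeneracies K" "TYPE('u)" fst
    by (rule simplex_cat_direct_inverting[OF inf M.category_axioms M.MC1])
  have "is_left_adjoint (bounded_cat K M) M Q (const_functor (simplex_cat K) M)"
    using K.colimit_functor_left_adjoint Q unfolding bounded_cat_eq by blast
  then have adj: "is_left_adjoint (bounded_model K M CK) M Q (const_functor (simplex_cat K) M)"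
    by (simp add: bounded_model_def extend_left_adjoint)
  have const: "on_arr (const_functor (simplex_cat K) M) p \<in> Arr (bounded_cat K M)" if "p \<in> Arr M" for p
    using K.const_fun_Hom[of p "Dom M p" "Cod M p"] that by (simp add: bounded_cat_eq in_Hom)
  show ?thesis
  proof (rule left_Quillen[OF N M inf adj])
    show "on_arr (const_functor (simplex_cat K) M) p \<in> Fib (bounded_model K M CK)" if "p \<in> Fib M" for p
      using that const M.Fib_Arr by (auto simp: bounded_model_def simplex_cat_simps K.const_simps)
    show "on_arr (const_functor (simplex_cat K) M) p \<in> Weq (bounded_model K M CK)" if "p \<in> Weq M" for p
      using that const M.Weq_Arr by (auto simp: bounded_model_def simplex_cat_simps K.const_simps)
  qed
qed

text \<open>The functor \<open>E\<close> is given as an adjoint on all diagrams. It and restriction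
  keep bounded diagrams bounded, so the adjunction descends to them. The components of a restricted
  map are among those of the original one, which makes restriction preserve both objectwise
  classes.\<close>

lemma bounded_Kan_extension:
  assumes inf: "infinite (UNIV :: 'u set)" and M: "model_category M TYPE('u)"
    and f: "f \<in> simplicial_maps L (K :: 'u sset)"
    and NK: "model_category (bounded_model K M CK) TYPE('u)"
    and NL: "model_category (bounded_model (L :: 'u sset) M CL) TYPE('u)"
    and E: "is_left_Kan_extension_functor L K f M E"
  shows "is_functor (bounded_cat L M) (bounded_cat K M) E \<and>
    homotopy_meaningful_on_cofibrant (bounded_model L M CL) (bounded_model K M CK) E \<and>
    preserves_cofibrations (bounded_model L M CL) (bounded_model K M CK) E \<and>
    preserves_acyclic_cofibrations (bounded_model L M CL) (bounded_model K M CK) E \<and>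
    preserves_cofibrant_objects (bounded_model L M CL) (bounded_model K M CK) E"
proof -
  interpret M: model_category M "TYPE('u)" by (rule M)
  let ?P = "simplex_functor L f" and ?R = "precomposition (simplex_cat L) (simplex_functor L f)"
  interpret P: inverting_functor "simplex_cat L" "simplex_cat K" M "degeneracies L" "degeneracies K" "TYPE('u)" ?P
    by (rule simplex_inverting_functor[OF inf M.category_axioms M.MC1 f])
  have E': "is_left_adjoint (fun_cat (simplex_cat L) M) (fun_cat (simplex_cat K) M) E ?R"
    using E by (simp add: is_left_Kan_extension_functor_def)
  have "is_left_adjoint P.L.B P.K.B E ?R"
    by (rule P.restricted_adjunction[OF E' P.Kan_extension_inverts[OF _ E']])
       (rule degeneracy_homotopy[OF inf M.category_axioms M.MC1 f])
  then have adj: "is_left_adjoint (bounded_cat L M) (bounded_cat K M) E ?R" by (simp add: bounded_cat_eq)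
  then have F: "is_functor (bounded_cat L M) (bounded_cat K M) E" and R: "is_functor (bounded_cat K M) (bounded_cat L M) ?R"
    by (simp_all add: is_left_adjoint_def)
  from adj have adj': "is_left_adjoint (bounded_model L M CL) (bounded_model K M CK) E ?R"
    by (simp add: bounded_model_def extend_left_adjoint)
  have R_comp: "component (on_arr ?R t) x = component t (on_obj ?P x)" if "x \<in> simplices L" for t x
    using that by (simp add: precomposition_def simplex_cat_simps)
  have R_Arr: "on_arr ?R p \<in> Arr (bounded_cat L M)" if "p \<in> Arr (bounded_cat K M)" for p
    using functor_D(4)[OF R that] .
  have "homotopy_meaningful_on_cofibrant (bounded_model L M CL) (bounded_model K M CK) E \<and>
    preserves_cofibrations (bounded_model L M CL) (bounded_model K M CK) E \<and>
    preserves_acyclic_cofibrations (bounded_model L M CL) (bounded_model K M CK) E \<and>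
    preserves_cofibrant_objects (bounded_model L M CL) (bounded_model K M CK) E"
  proof (rule left_Quillen[OF NL NK inf adj'])
    show "on_arr ?R p \<in> Fib (bounded_model L M CL)" if "p \<in> Fib (bounded_model K M CK)" for p
      using that R_Arr simplex_functor_simplices[OF f] by (simp add: bounded_model_def R_comp)
    show "on_arr ?R p \<in> Weq (bounded_model L M CL)" if "p \<in> Weq (bounded_model K M CK)" for p
      using that R_Arr simplex_functor_simplices[OF f] by (simp add: bounded_model_def R_comp)
  qed
  then show ?thesis using F by blast
qed

text \<open>The last two parts hold for every class of cofibrations that completes the objectwise
  classes to a model structure, because the adjunction arguments meet that class only through the
  axioms.\<close>

theorem theorem11p2:
  fixes K L :: "'u sset"
    and f :: "nat \<Rightarrow> 'u \<Rightarrow> 'u"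
    and M :: "('o, 'a) model_cat"
  assumes "infinite (UNIV :: 'u set)"
    and "simplicial_set K"
    and "simplicial_set L"
    and "f \<in> simplicial_maps L K"
    and "model_category M TYPE('u)"
  shows
    "(\<exists>CK. model_category (bounded_model K M CK) TYPE('u)) \<and>
     (\<forall>CK. model_category (bounded_model K M CK) TYPE('u) \<longrightarrow>
        (\<exists>Q. is_colimit_functor (simplex_cat K) M (bounded_cat K M) Q) \<and>
        (\<forall>Q. is_colimit_functor (simplex_cat K) M (bounded_cat K M) Q \<longrightarrow>
           homotopy_meaningful_on_cofibrant (bounded_model K M CK) M Q \<and>
           preserves_cofibrations (bounded_model K M CK) M Q \<and>
           preserves_acyclic_cofibrations (bounded_model K M CK) M Q \<and>
           preserves_cofibrant_objects (bounded_model K M CK) M Q)) \<and>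
     (\<forall>CK CL. model_category (bounded_model K M CK) TYPE('u) \<and>
              model_category (bounded_model L M CL) TYPE('u) \<longrightarrow>
        (\<exists>E. is_left_Kan_extension_functor L K f M E) \<and>
        (\<forall>E. is_left_Kan_extension_functor L K f M E \<longrightarrow>
           is_functor (bounded_cat L M) (bounded_cat K M) E \<and>
           homotopy_meaningful_on_cofibrant (bounded_model L M CL) (bounded_model K M CK) E \<and>
           preserves_cofibrations (bounded_model L M CL) (bounded_model K M CK) E \<and>
           preserves_acyclic_cofibrations (bounded_model L M CL) (bounded_model K M CK) E \<and>
           preserves_cofibrant_objects (bounded_model L M CL) (bounded_model K M CK) E))"
proof -
  note inf = assms(1) and f = assms(4) and M = assms(5)
  interpret M: model_category M "TYPE('u)" by (rule M)
  interpret K: direct_inverting "simplex_cat K" M "degeneracies K" "TYPE('u)" fst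
    by (rule simplex_cat_direct_inverting[OF inf M.category_axioms M.MC1])
  have Q: "\<exists>Q. is_colimit_functor (simplex_cat K) M (bounded_cat K M) Q"
    using K.colimit_functor_exists by (simp add: bounded_cat_eq)
  have E: "\<exists>E. is_left_Kan_extension_functor L K f M E"
    unfolding is_left_Kan_extension_functor_def
    by (rule Kan_extension_functor_exists[OF simplex_functor[OF f] M.category_axioms M.MC1(2) inf
          simplex_cat_small[OF inf] simplex_cat_small[OF inf]])
  show ?thesis
    by (rule conjI[OF bounded_model_exists[OF inf M] conjI];
        intro allI impI; rule conjI[OF Q] conjI[OF E]; intro allI impI; (elim conjE)?;
        rule bounded_colimit[OF inf M] bounded_Kan_extension[OF inf M f]; assumption)
qed

end
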